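(* (I) Let $t\ge 1$ and let $F=\mathbb{Q}(\sqrt{\Delta})$ with $\Delta=-p_1\cdots p_t$, where $p_1,\dots,p_t$ are distinct primes such that $p_i\equiv 1\pmod 4$ for $i=1,\dots,t-1$ and $p_t\equiv 3\pmod 4$. Let $V_0$ be the $\mathbb{F}_2$-vector space defined in the context and let $Q_{\mathfrak{B}}$ be the quadratic form on $V_0$ defined by $Q_{\mathfrak{B}}(D)=\xi\left(\left(\frac{\Delta/D}{D}\right)_4\right)$. Let $r_8$ be the $8$-rank of the class group of $F$. Then $$r_8\in\mathcal{N}(Q_{\mathfrak{B}}).$$ (II) Let $Q$ be a quadratic form on an $r$-dimensional vector space over $\mathbb{F}_2$ with isotropy index $\rho$. Then $\mathcal{N}(Q)=S(\rho,r)$, where $S(\rho,r)$ (which also depends on whether $Q\cong X$) is the set of integers $a$ satisfying all of the following: - $0\le a\le\rho$; - $a\equiv r\pmod 2$ if $\rho=r$; - $a=1$ if $r=2$ and $Q\cong X$. Here $X$ is the quadratic form on $\mathbb{F}_2^2$ defined by $X(x_1e_1+x_2e_2)=x_1x_2$ for the standard basis $\{e_1,e_2\}$ of $\mathbb{F}_2^2$. In particular, for the quadratic form $Q_{\mathfrak{B}}$ in (I), $\mathcal{N}(Q_{\mathfrak{B}})=S(\rho,r_4)$ with $\rho$ the isotropy index of $Q_{\mathfrak{B}}$, where $r_4=\dim_{\mathbb{F}_2}V_0$ is the $4$-rank of the class group of $F$.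
   Context: Let $\mathcal{C}$ be the ideal class group of $F$, written additively, so $2^k\mathcal{C}$ is the subgroup of $2^k$-th powers of ideal classes and $\mathcal{C}[2]$ the subgroup of classes killed by $2$. The $2^k$-rank of $\mathcal{C}$ is $r_{2^k}=\dim_{\mathbb{F}_2}2^{k-1}\mathcal{C}/2^k\mathcal{C}$ for $k\ge1$; in particular $r_4=\dim_{\mathbb{F}_2}2\mathcal{C}/4\mathcal{C}$ and $r_8=\dim_{\mathbb{F}_2}4\mathcal{C}/8\mathcal{C}$. Let $\xi\colon\{\pm1\}\to\mathbb{F}_2$ be the group isomorphism with $\xi(1)=0$, $\xi(-1)=1$. For $i=1,\dots,t$ let $\mathfrak{p}_i$ be the prime ideal of $F$ with $\mathfrak{p}_i^2=(p_i)$. Let $V'$ be the set of positive divisors of $p_1\cdots p_{t-1}$, an $\mathbb{F}_2$-vector space with addition $q_1\cdot q_2=q_1q_2/\gcd(q_1,q_2)^2$. The map $p_i\mapsto$ class of $\mathfrak{p}_i$ ($1\le i\le t-1$) extends to an isomorphism of $\mathbb{F}_2$-vector spaces $V'\to\mathcal{C}[2]$, sending $D$ to the class of $\prod_{p_i\mid D}\mathfrak{p}_i$. Let $V_0\subset V'$ be the subspace of those $D$ for which the class of $\prod_{p_i\mid D}\mathfrak{p}_i$ lies in $2\mathcal{C}$; it is identified with $\mathcal{C}[2]\cap 2\mathcal{C}$. Quartic symbol: for a prime $p\equiv1\pmod 4$ and an integer $a$ coprime to $p$ that is a quadratic residue mod $p$, $\left(\frac{a}{p}\right)_4=\pm1$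 is defined by $\left(\frac{a}{p}\right)_4\equiv a^{(p-1)/4}\pmod p$. For $D$ a product of distinct primes $q_1,\dots,q_s\equiv1\pmod 4$ and $a\in\mathbb{Z}$ coprime to $D$ and a quadratic residue mod every $q_i$, $\left(\frac{a}{D}\right)_4=\prod_{i=1}^s\left(\frac{a}{q_i}\right)_4$ (equal to $1$ if $D=1$). For $D\in V_0$, the integer $\Delta/D$ is a quadratic residue modulo every prime dividing $D$, so $Q_{\mathfrak{B}}$ is well defined. Quadratic forms: for a vector space $W$ over a field $k$, a map $Q\colon W\to k$ is a quadratic form if there is a (not necessarily symmetric) bilinear form $B\colon W\times W\to k$ with $Q=Q_B$, where $Q_B(x)=B(x,x)$. Two quadratic forms are isomorphic ($\cong$) if they correspond under a linear isomorphism of the underlying spaces. The isotropy index $\rho(Q)$ is the maximal dimension of a subspace $W'\subset W$ with $Q|_{W'}=0$. For a quadratic form $Q$ on a finite-dimensional $W$, $$\mathcal{N}(Q)=\{\operatorname{null}(B) : B\colon W\times W\to k\text{ is a bilinear form with }Q_B=Q\},$$ where $\operatorname{null}(B)=\dim W-\operatorname{rank}(B)$. *)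

theory Defs
  imports
    "HOL-Library.Z2"
    "HOL-Number_Theory.Cong"
    "HOL-Algebra.Ideal_Product"
    "Jordan_Normal_Form.VS_Connect"
begin

section \<open>Quadratic forms\<close>

definition bilinear_form ::
    "('k, 'm) ring_scheme \<Rightarrow> ('k, 'v, 'n) module_scheme \<Rightarrow> ('v \<Rightarrow> 'v \<Rightarrow> 'k) \<Rightarrow> bool" where
  "bilinear_form K W B \<longleftrightarrow>
     (\<forall>x\<in>carrier W. \<forall>y\<in>carrier W. B x y \<in> carrier K) \<and>
     (\<forall>x\<in>carrier W. \<forall>y\<in>carrier W. \<forall>z\<in>carrier W.
        B (x \<oplus>\<^bsub>W\<^esub> y) z = B x z \<oplus>\<^bsub>K\<^esub> B y z \<and>
        B z (x \<oplus>\<^bsub>W\<^esub> y) = B z x \<oplus>\<^bsub>K\<^esub> B z y) \<and>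
     (\<forall>c\<in>carrier K. \<forall>x\<in>carrier W. \<forall>y\<in>carrier W.
        B (c \<odot>\<^bsub>W\<^esub> x) y = c \<otimes>\<^bsub>K\<^esub> B x y \<and>
        B x (c \<odot>\<^bsub>W\<^esub> y) = c \<otimes>\<^bsub>K\<^esub> B x y)"

text \<open>The rank of \<open>B\<close> is the dimension of the image of the linear map \<open>x \<mapsto> B(x, -)\<close>, whose
  values are regarded as elements of the space of all functions from \<open>W\<close> to the field.\<close>

definition bilinear_rank ::
    "('k, 'm) ring_scheme \<Rightarrow> ('k, 'v, 'n) module_scheme \<Rightarrow> ('v \<Rightarrow> 'v \<Rightarrow> 'k) \<Rightarrow> nat" where
  "bilinear_rank K W B =
     vectorspace.dim K
       ((ring.func_space K (carrier W))
          \<lparr>carrier := (\<lambda>x. restrict (B x) (carrier W)) ` carrier W\<rparr>)"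

text \<open>The subtraction does not truncate: the rank is at most the dimension.\<close>

definition bilinear_null ::
    "('k, 'm) ring_scheme \<Rightarrow> ('k, 'v, 'n) module_scheme \<Rightarrow> ('v \<Rightarrow> 'v \<Rightarrow> 'k) \<Rightarrow> nat" where
  "bilinear_null K W B = vectorspace.dim K W - bilinear_rank K W B"

definition quadratic_form ::
    "('k, 'm) ring_scheme \<Rightarrow> ('k, 'v, 'n) module_scheme \<Rightarrow> ('v \<Rightarrow> 'k) \<Rightarrow> bool" where
  "quadratic_form K W Q \<longleftrightarrow> (\<exists>B. bilinear_form K W B \<and> (\<forall>x\<in>carrier W. Q x = B x x))"

definition form_nullities ::
    "('k, 'm) ring_scheme \<Rightarrow> ('k, 'v, 'n) module_scheme \<Rightarrow> ('v \<Rightarrow> 'k) \<Rightarrow> nat set" where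
  "form_nullities K W Q =
     {bilinear_null K W B | B. bilinear_form K W B \<and> (\<forall>x\<in>carrier W. Q x = B x x)}"

definition quadratic_form_iso ::
    "('k, 'm) ring_scheme \<Rightarrow> ('k, 'v, 'n) module_scheme \<Rightarrow> ('v \<Rightarrow> 'k) \<Rightarrow>
     ('k, 'w, 'l) module_scheme \<Rightarrow> ('w \<Rightarrow> 'k) \<Rightarrow> bool" where
  "quadratic_form_iso K W Q W' Q' \<longleftrightarrow>
     (\<exists>T. linear_map K W W' T \<and> bij_betw T (carrier W) (carrier W') \<and>
          (\<forall>x\<in>carrier W. Q' (T x) = Q x))"

definition isotropy_index ::
    "('k, 'm) ring_scheme \<Rightarrow> ('k, 'v, 'n) module_scheme \<Rightarrow> ('v \<Rightarrow> 'k) \<Rightarrow> nat" where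
  "isotropy_index K W Q =
     Max {vectorspace.dim K (W\<lparr>carrier := U\<rparr>) | U. subspace K U W \<and> (\<forall>x\<in>U. Q x = \<zero>\<^bsub>K\<^esub>)}"

abbreviation F2 :: "bit ring" where
  "F2 \<equiv> class_ring"

definition X_form :: "bit vec \<Rightarrow> bit" where
  "X_form x = x $ 0 * x $ 1"

definition S_set :: "(bit, 'v, 'n) module_scheme \<Rightarrow> ('v \<Rightarrow> bit) \<Rightarrow> nat \<Rightarrow> nat \<Rightarrow> nat set" where
  "S_set W Q \<rho> r =
     {a. 0 \<le> a \<and> a \<le> \<rho> \<and>
         (\<rho> = r \<longrightarrow> [a = r] (mod 2)) \<and>
         (r = 2 \<and> quadratic_form_iso F2 W Q (module_vec TYPE(bit) 2) X_form \<longrightarrow> a = 1)}"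


section \<open>Elementary abelian 2-groups and 2-power ranks\<close>

text \<open>A commutative group of exponent dividing 2 as a vector space over \<open>F2\<close>. The ring
  multiplication fields of the record play no role.\<close>

definition F2_module :: "('a, 'm) monoid_scheme \<Rightarrow> (bit, 'a) module" where
  "F2_module G =
     \<lparr>carrier = carrier G, mult = undefined, one = undefined, zero = \<one>\<^bsub>G\<^esub>, add = (\<otimes>\<^bsub>G\<^esub>),
      smult = (\<lambda>c x. if c = 0 then \<one>\<^bsub>G\<^esub> else x)\<rparr>"

definition powers :: "('a, 'm) monoid_scheme \<Rightarrow> nat \<Rightarrow> 'a set" where
  "powers G n = (\<lambda>x. x [^]\<^bsub>G\<^esub> n) ` carrier G"

text \<open>The \<open>2\<^sup>k\<close>-rank, for \<open>k \<ge> 1\<close>, of a commutative group written multiplicatively.\<close>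

definition two_power_rank :: "('a, 'm) monoid_scheme \<Rightarrow> nat \<Rightarrow> nat" where
  "two_power_rank G k =
     vectorspace.dim F2
       (F2_module ((G\<lparr>carrier := powers G (2 ^ (k - 1))\<rparr>) Mod (powers G (2 ^ k))))"


section \<open>Ideal class groups of quadratic fields\<close>

definition quadratic_field :: "int \<Rightarrow> complex ring" where
  "quadratic_field \<Delta> =
     class_ring\<lparr>carrier := {a + b * csqrt (of_int \<Delta>) | a b. a \<in> \<rat> \<and> b \<in> \<rat>}\<rparr>"

definition ring_of_integers :: "complex ring \<Rightarrow> complex ring" where
  "ring_of_integers F = F\<lparr>carrier := {x \<in> carrier F. algebraic_int x}\<rparr>"

definition fractional_ideals :: "complex ring \<Rightarrow> complex set set" where
  "fractional_ideals F =
     {(\<lambda>x. x / d) ` J | J d. ideal J (ring_of_integers F) \<and> J \<noteq> {0} \<and>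
                              d \<in> carrier (ring_of_integers F) \<and> d \<noteq> 0}"

text \<open>\<open>ideal_prod F I J\<close> consists of the finite sums of products of elements of \<open>I\<close> and \<open>J\<close>.\<close>

definition ideal_group :: "complex ring \<Rightarrow> complex set monoid" where
  "ideal_group F =
     \<lparr>carrier = fractional_ideals F, mult = ideal_prod F, one = carrier (ring_of_integers F)\<rparr>"

definition principal_ideals :: "complex ring \<Rightarrow> complex set set" where
  "principal_ideals F =
     {(\<lambda>x. a * x) ` carrier (ring_of_integers F) | a. a \<in> carrier F \<and> a \<noteq> 0}"

definition class_group :: "complex ring \<Rightarrow> complex set set monoid" where
  "class_group F = ideal_group F Mod principal_ideals F"

definition ideal_class :: "complex ring \<Rightarrow> complex set \<Rightarrow> complex set set" where
  "ideal_class F I = principal_ideals F #>\<^bsub>ideal_group F\<^esub> I"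

definition ramified_prime :: "complex ring \<Rightarrow> nat \<Rightarrow> complex set" where
  "ramified_prime F p =
     (THE P. primeideal P (ring_of_integers F) \<and>
             ideal_prod (ring_of_integers F) P P = PIdl\<^bsub>ring_of_integers F\<^esub> (of_nat p))"


section \<open>The space \<open>V\<^sub>0\<close> and its quadratic form\<close>

definition divisor_group :: "nat \<Rightarrow> nat monoid" where
  "divisor_group n =
     \<lparr>carrier = {d. d dvd n}, mult = (\<lambda>a b. a * b div (gcd a b)\<^sup>2), one = 1\<rparr>"

text \<open>In the intended use \<open>n\<close> is the product of the primes dividing \<open>\<Delta>\<close> other than the one
  congruent to 3 modulo 4.\<close>

definition V0_space :: "int \<Rightarrow> nat \<Rightarrow> (bit, nat) module" where
  "V0_space \<Delta> n =
     (let F = quadratic_field \<Delta>; V' = F2_module (divisor_group n)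
      in V'\<lparr>carrier :=
           {D \<in> carrier V'.
              ideal_class F (finprod (ideal_group F) (ramified_prime F) (prime_factors D))
                \<in> powers (class_group F) 2}\<rparr>)"

text \<open>Meaningful only if \<open>p \<equiv> 1 (mod 4)\<close> is prime and \<open>a\<close> is a nonzero square modulo \<open>p\<close>.\<close>

definition quartic_symbol_prime :: "int \<Rightarrow> nat \<Rightarrow> int" where
  "quartic_symbol_prime a p =
     (THE e. e \<in> {1, -1} \<and> [e = a ^ ((p - 1) div 4)] (mod int p))"

definition quartic_symbol :: "int \<Rightarrow> nat \<Rightarrow> int" where
  "quartic_symbol a D = (\<Prod>q\<in>prime_factors D. quartic_symbol_prime a q)"

definition xi :: "int \<Rightarrow> bit" where
  "xi e = (if e = -1 then 1 else 0)"

definition Q_form :: "int \<Rightarrow> nat \<Rightarrow> bit" where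
  "Q_form \<Delta> D = xi (quartic_symbol (\<Delta> div int D) D)"

end

theory Submission
  imports Defs "HOL-Number_Theory.Quadratic_Reciprocity" "HOL-Computational_Algebra.Squarefree" "HOL-Library.Discrete_Functions"
begin

text \<open>The statement about the set of nullities is linear algebra over the field of two elements. Let
  \<open>B\<close> have diagonal \<open>Q\<close>. Its left kernel is isotropic for \<open>Q\<close>, so the nullity is at most the
  isotropy index. If \<open>Q = 0\<close> then \<open>B\<close> is alternating and its rank is even. If \<open>Q\<close> is the
  hyperbolic plane \<open>X\<close> then \<open>B(e,f) + B(f,e) = 1\<close>, so exactly one of the two off-diagonal entries
  vanishes and the nullity is 1. Conversely, every remaining value is reached: choose an isotropic
  subspace \<open>U\<close> of the required dimension and a complement, pair the complement with \<open>U\<close> by the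
  polar form, and put on the complement a form whose kernel does no harm (\<open>isotropic_glue\<close>). When
  \<open>Q\<close> is nonzero on the complement and is not \<open>X\<close> there, a nondegenerate form exists
  (\<open>nondegenerate_form_exists\<close>); otherwise one lets the kernel be a line that \<open>U\<close> detects, after a
  change of \<open>U\<close> if necessary. The outcome is \<open>nullity_spectrum\<close>.

  The statement about the class group rests on a pairing between divisors \<open>D\<close> of
  \<open>n = p\<^sub>1 \<dots> p\<^bsub>t-1\<^esub>\<close> and ideal classes. A prime \<open>q\<close> dividing \<open>\<Delta>\<close> gives a genus character \<open>\<chi>\<^sub>q\<close>, the
  Legendre symbol modulo \<open>q\<close> of the norm of an integral representative prime to \<open>q\<close>; put
  \<open>X(D,c) = \<Prod>\<^bsub>q|D\<^esub> \<chi>\<^sub>q(c)\<close>. By the principal genus theorem (\<open>principal_genus\<close>) the classes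
  orthogonal to all \<open>D\<close> are the squares. Its proof is elementary: if all characters are trivial,
  the norm of a suitable representative is the norm of a field element by the pigeonhole principle
  (\<open>norm_equation_pigeonhole\<close>), so that the class contains an ideal of norm 1, and such an ideal is
  a square up to a principal factor (\<open>norm_one_is_square\<close>, Hilbert's Theorem 90 for ideals).

  Sending \<open>D\<close> to the class \<open>\<iota>(D)\<close> of the ramified ideal over \<open>D\<close> is injective
  (\<open>ram_principal\<close>), and counting with the pairing shows that its image is all of \<open>C[2]\<close>. For \<open>D\<close>
  and \<open>D'\<close> in \<open>V\<^sub>0\<close> choose \<open>y\<close> with \<open>2y = \<iota>(D)\<close> and set \<open>B(D,D') = X(D',y)\<close>. Quadratic reciprocity makes
  \<open>X(D,\<iota>(D'))\<close> symmetric, hence \<open>B\<close> does not depend on \<open>y\<close>. A second count identifies the left kernel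
  of \<open>B\<close> with \<open>C[2] \<inter> 4C\<close>, whose dimension is the 8-rank (\<open>card_left_kernel\<close>).

  It remains to see that \<open>B\<close> has diagonal \<open>Q\<close> (\<open>X_half_quartic\<close>). If \<open>J\<close> is an integral ideal of norm
  \<open>a\<close> in the class of \<open>-y\<close>, then \<open>J\<^sup>2\<close> times the ramified ideal over \<open>D\<close> is principal, and the norm of a
  generator yields \<open>D u\<^sup>2 + |\<Delta>/D| v\<^sup>2 = 4 a\<^sup>2\<close>. Modulo a prime dividing \<open>D\<close> this expresses the quartic
  symbol of \<open>\<Delta>/D\<close> through the Legendre symbols of \<open>a\<close> and \<open>v\<close>, because \<open>-4\<close> is a fourth power; and
  reciprocity shows that the contribution of \<open>v\<close> multiplies to 1 (\<open>quartic_symbol_eq_jac\<close>).\<close>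

section \<open>Finite elementary abelian 2-groups\<close>

text \<open>A class of abelian groups on which scalars from the field of two elements act without being named:
  there subspaces are the subgroups and linear maps the additive maps.\<close>
class two_torsion = ab_group_add +
  assumes add_self [simp]: "x + x = 0"
begin
lemma add_self_left [simp]: "x + (x + y) = y"
  by (simp add: add.assoc [symmetric])
lemma minus_two_torsion [simp]: "- x = x"
  using add_self minus_unique by blast
lemma diff_two_torsion [simp]: "x - y = x + y"
  using diff_conv_add_uminus minus_two_torsion by simp
lemma add_eq_0_iff_eq: "x + y = 0 \<longleftrightarrow> x = y"
  by (metis add_eq_0_iff minus_two_torsion)
end

instance bit :: two_torsion
  by standard simp

declare Z2.add_bit_eq_xor [simp del] Z2.mult_bit_eq_and [simp del]

instance poly :: ("{two_torsion, comm_ring}") two_torsion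
  by standard (simp add: poly_eq_iff)

definition gsub :: "'a::two_torsion set \<Rightarrow> bool" where
  "gsub V \<longleftrightarrow> 0 \<in> V \<and> (\<forall>x\<in>V. \<forall>y\<in>V. x + y \<in> V)"

lemma gsub0 [simp]: "gsub V \<Longrightarrow> 0 \<in> V" and gsub_add [simp]: "gsub V \<Longrightarrow> x \<in> V \<Longrightarrow> y \<in> V \<Longrightarrow> x + y \<in> V"
  by (auto simp: gsub_def)

lemma gsubI: "0 \<in> V \<Longrightarrow> (\<And>x y. x \<in> V \<Longrightarrow> y \<in> V \<Longrightarrow> x + y \<in> V) \<Longrightarrow> gsub V"
  unfolding gsub_def by blast

definition additive_on :: "'a::two_torsion set \<Rightarrow> ('a \<Rightarrow> 'b::two_torsion) \<Rightarrow> bool" where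
  "additive_on V f \<longleftrightarrow> (\<forall>x\<in>V. \<forall>y\<in>V. f (x + y) = f x + f y)"

lemma additive_onD: "additive_on V f \<Longrightarrow> x \<in> V \<Longrightarrow> y \<in> V \<Longrightarrow> f (x + y) = f x + f y"
  by (auto simp: additive_on_def)

lemma additive_on_0: "additive_on V f \<Longrightarrow> gsub V \<Longrightarrow> f 0 = 0"
  by (metis add_self additive_onD gsub0)

lemma additive_on_subset: "additive_on V f \<Longrightarrow> U \<subseteq> V \<Longrightarrow> additive_on U f"
  by (auto simp: additive_on_def)

lemma gsub_image: "gsub V \<Longrightarrow> additive_on V f \<Longrightarrow> gsub (f ` V)"
  by (rule gsubI) (auto simp: image_iff additive_onD[of V f, symmetric] intro: gsub_add, metis additive_on_0 gsub0)

lemma gsub_kernel: "gsub V \<Longrightarrow> additive_on V f \<Longrightarrow> gsub {x\<in>V. f x = 0}"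
  using additive_on_0[of V f] by (intro gsubI) (auto simp: additive_onD[of V f])

text \<open>The fibres are the cosets of \<open>K\<close>. The map need not be additive, so that the lemma also applies to
  maps into types without addition.\<close>
lemma card_image_fibres:
  assumes "gsub V" "finite V" "K \<subseteq> V" and f: "\<And>x y. x \<in> V \<Longrightarrow> y \<in> V \<Longrightarrow> f x = f y \<longleftrightarrow> x + y \<in> K"
  shows "card V = card (f ` V) * card K"
proof -
  have "card V = (\<Sum>y\<in>f ` V. card {x\<in>V. f x = y})"
    using card_eq_sum sum.image_gen[of V "\<lambda>_. 1::nat" f] assms(2) by auto
  also have "\<dots> = (\<Sum>y\<in>f ` V. card K)"
  proof (rule sum.cong[OF refl])
    fix y assume "y \<in> f ` V"
    then obtain a where a: "a \<in> V" "y = f a" by auto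
    have "bij_betw (\<lambda>x. a + x) K {x\<in>V. f x = y}"
      by (rule bij_betw_byWitness[where f' = "\<lambda>x. a + x"])
         (use a assms in \<open>auto simp: ac_simps subset_iff\<close>)
    then show "card {x\<in>V. f x = y} = card K"
      by (rule bij_betw_same_card[symmetric])
  qed
  finally show ?thesis by simp
qed

lemma card_image_kernel:
  assumes "gsub V" "finite V" "additive_on V f"
  shows "card V = card (f ` V) * card {x\<in>V. f x = 0}"
  by (rule card_image_fibres) (use assms in \<open>auto simp: additive_onD[of V f] add_eq_0_iff_eq\<close>)

text \<open>Linear projections of \<open>V\<close> along \<open>U\<close>; the image is a complement of \<open>U\<close>.\<close>
definition projects :: "'a::two_torsion set \<Rightarrow> 'a set \<Rightarrow> ('a \<Rightarrow> 'a) \<Rightarrow> bool" where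
  "projects V U \<pi> \<longleftrightarrow> additive_on V \<pi> \<and> \<pi> ` V \<subseteq> V \<and> (\<forall>x\<in>V. \<pi> (\<pi> x) = \<pi> x) \<and> (\<forall>x\<in>V. \<pi> x = 0 \<longleftrightarrow> x \<in> U)"

text \<open>A maximal subgroup meeting \<open>U\<close> trivially is a complement: a vector \<open>x\<close> outside \<open>U + W\<close> would let \<open>W\<close>
  grow to \<open>W \<union> (x + W)\<close>.\<close>
lemma complement_exists:
  assumes V: "gsub V" "finite V" and U: "gsub U" "U \<subseteq> V"
  obtains W where "gsub W" "W \<subseteq> V" "U \<inter> W = {0}" "\<And>x. x \<in> V \<Longrightarrow> \<exists>w\<in>W. x + w \<in> U"
proof -
  define P where "P W \<longleftrightarrow> gsub W \<and> W \<subseteq> V \<and> U \<inter> W = {0}" for W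
  have "P {0}" using V U by (auto simp: P_def intro!: gsubI)
  moreover have "\<forall>W. P W \<longrightarrow> card W < Suc (card V)" using V by (auto simp: P_def card_mono le_imp_less_Suc)
  ultimately obtain W where W: "P W" and mx: "\<And>W'. P W' \<Longrightarrow> card W' \<le> card W"
    using ex_has_greatest_nat[of P "{0}" card "Suc (card V)"] by metis
  have gW: "gsub W" "W \<subseteq> V" "U \<inter> W = {0}" using W by (auto simp: P_def)
  have "\<exists>w\<in>W. x + w \<in> U" if x: "x \<in> V" for x
  proof (rule ccontr)
    assume no: "\<not> (\<exists>w\<in>W. x + w \<in> U)"
    let ?W = "W \<union> (\<lambda>w. x + w) ` W"
    have "gsub ?W"
    proof (rule gsubI)
      show "0 \<in> ?W" using gW by simp
      fix a b assume "a \<in> ?W" "b \<in> ?W"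
      then obtain w c where "w \<in> W" "c \<in> W" "a = w \<or> a = x + w" "b = c \<or> b = x + c" by auto
      then have wc: "w + c \<in> W" and ab: "a + b = w + c \<or> a + b = x + (w + c)"
        using gW by (auto simp: ac_simps)
      then show "a + b \<in> ?W" by (elim disjE) simp_all
    qed
    moreover have "?W \<subseteq> V" using gW x V by auto
    moreover have "U \<inter> ?W = {0}" using gW no U by auto
    ultimately have "P ?W" by (simp add: P_def)
    then have "card ?W \<le> card W" by (rule mx)
    moreover have "finite ?W" using gW V by (meson \<open>?W \<subseteq> V\<close> finite_subset)
    ultimately have "?W = W" using card_seteq[of ?W W] by blast
    then have "x + 0 \<in> W" using gW(1) gsub0 by blast
    then have "x \<in> W" by simp
    then show False using no U by (metis add_self gsub0)
  qed
  with gW show thesis using that by blast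
qed

lemma projection_exists:
  assumes V: "gsub V" "finite V" and U: "gsub U" "U \<subseteq> V"
  obtains \<pi> where "projects V U \<pi>"
proof -
  obtain W where W: "gsub W" "W \<subseteq> V" "U \<inter> W = {0}" "\<And>x. x \<in> V \<Longrightarrow> \<exists>w\<in>W. x + w \<in> U"
    using complement_exists[OF assms] by blast
  define \<pi> where "\<pi> x = (SOME w. w \<in> W \<and> x + w \<in> U)" for x
  have p: "\<pi> x \<in> W \<and> x + \<pi> x \<in> U" if "x \<in> V" for x
    unfolding \<pi>_def by (rule someI_ex) (use W(4)[OF that] in blast)
  have uniq: "\<pi> x = w" if "x \<in> V" "w \<in> W" "x + w \<in> U" for x w
  proof -
    have "(x + \<pi> x) + (x + w) \<in> U" by (rule gsub_add[OF U(1) conjunct2[OF p[OF that(1)]] that(3)])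
    then have "\<pi> x + w \<in> U" by (simp add: ac_simps)
    moreover have "\<pi> x + w \<in> W" using p that W by auto
    ultimately have "\<pi> x + w = 0" using W(3) by blast
    then show ?thesis by (simp add: add_eq_0_iff_eq)
  qed
  have "projects V U \<pi>"
    unfolding projects_def
  proof (intro conjI ballI)
    show "additive_on V \<pi>" unfolding additive_on_def
    proof (intro ballI uniq)
      fix x y assume xy: "x \<in> V" "y \<in> V"
      show "x + y \<in> V" "\<pi> x + \<pi> y \<in> W" using xy V W p by auto
      have "(x + \<pi> x) + (y + \<pi> y) \<in> U"
        by (rule gsub_add[OF U(1) conjunct2[OF p[OF xy(1)]] conjunct2[OF p[OF xy(2)]]])
      then show "x + y + (\<pi> x + \<pi> y) \<in> U" by (simp add: ac_simps)
    qed
    show "\<pi> ` V \<subseteq> V" using p W by auto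
    show "\<pi> (\<pi> x) = \<pi> x" if "x \<in> V" for x using p[OF that] W U by (intro uniq) auto
    show "\<pi> x = 0 \<longleftrightarrow> x \<in> U" if "x \<in> V" for x
      using p[OF that] uniq[OF that, of 0] gsub0[OF W(1)] by auto
  qed
  then show thesis by (rule that)
qed

lemma projectsD:
  assumes "projects V U \<pi>" "gsub V" "x \<in> V"
  shows "\<pi> x \<in> V" "\<pi> (\<pi> x) = \<pi> x" "\<pi> x = 0 \<longleftrightarrow> x \<in> U" "x + \<pi> x \<in> U"
proof -
  show 1: "\<pi> x \<in> V" "\<pi> (\<pi> x) = \<pi> x" "\<pi> x = 0 \<longleftrightarrow> x \<in> U" using assms by (auto simp: projects_def)
  have "\<pi> (x + \<pi> x) = 0" using assms 1 by (simp add: projects_def additive_onD[of V \<pi>])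
  moreover have "x + \<pi> x \<in> V" using 1 assms by simp
  ultimately show "x + \<pi> x \<in> U" using assms(1) by (auto simp: projects_def)
qed

lemma projects_additive: "projects V U \<pi> \<Longrightarrow> additive_on V \<pi>"
  by (simp add: projects_def)

lemma projects_card:
  assumes "projects V U \<pi>" "gsub V" "finite V" "U \<subseteq> V"
  shows "card V = card (\<pi> ` V) * card U"
proof -
  have "{x\<in>V. \<pi> x = 0} = U" using assms by (auto simp: projects_def)
  then show ?thesis using card_image_kernel[of V \<pi>] assms by (simp add: projects_additive)
qed

lemma extend_functional:
  fixes f :: "'a::two_torsion \<Rightarrow> 'b::two_torsion"
  assumes V: "gsub V" "finite V" and U: "gsub U" "U \<subseteq> V" and f: "additive_on U f"
  obtains g where "additive_on V g" "\<And>x. x \<in> U \<Longrightarrow> g x = f x"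
proof -
  obtain \<pi> where p: "projects V U \<pi>" using projection_exists[OF V U] .
  show thesis
  proof
    show "additive_on V (\<lambda>x. f (x + \<pi> x))"
      unfolding additive_on_def
    proof (intro ballI)
      fix x y assume xy: "x \<in> V" "y \<in> V"
      have e: "x + y + \<pi> (x + y) = (x + \<pi> x) + (y + \<pi> y)"
        using xy p by (simp add: additive_onD[OF projects_additive, of V U \<pi>] ac_simps)
      show "f (x + y + \<pi> (x + y)) = f (x + \<pi> x) + f (y + \<pi> y)"
        unfolding e using xy projectsD(4)[OF p V(1)] by (intro additive_onD[OF f])
    qed
    show "f (x + \<pi> x) = f x" if "x \<in> U" for x
      using that p V U by (metis add.right_neutral projectsD(3) subsetD)
  qed
qed

text \<open>Two nonzero vectors are either equal or linearly independent, so a functional may take any pair of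
  values on them that does not contradict their equality.\<close>
lemma functional_values2:
  assumes V: "gsub V" "finite V" and x: "x \<in> V" "x \<noteq> 0" and y: "y \<in> V" "y \<noteq> 0" and xy: "x = y \<Longrightarrow> a = b"
  obtains f :: "'a::two_torsion \<Rightarrow> bit" where "additive_on V f" "f x = a" "f y = b"
proof (cases "x = y")
  case True
  have s: "gsub {0,x}" "{0,x} \<subseteq> V" using V x by (auto intro!: gsubI)
  have ad: "additive_on {0,x} (\<lambda>z. if z = 0 then 0 else a)" using x by (auto simp: additive_on_def)
  obtain g where "additive_on V g" "\<And>z. z \<in> {0,x} \<Longrightarrow> g z = (if z = 0 then 0 else a)"
    using extend_functional[OF V s ad] by blast
  then show thesis using that[of g] True x xy by auto
next
  case False
  have s: "gsub {0,x,y,x+y}" "{0,x,y,x+y} \<subseteq> V" using V x y by (auto intro!: gsubI simp: ac_simps)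
  have n: "x + y \<noteq> 0" "x + y \<noteq> x" "x + y \<noteq> y" using False x y by (auto simp: add_eq_0_iff_eq)
  define f where "f z = (if z = 0 then 0 else if z = x then a else if z = y then b else a + b)" for z
  have fv: "f 0 = 0" "f x = a" "f y = b" "f (x + y) = a + b" using False x y n by (auto simp: f_def)
  have ad: "additive_on {0,x,y,x+y} f" using fv
    by (auto simp: additive_on_def ac_simps)
  obtain g where "additive_on V g" "\<And>z. z \<in> {0,x,y,x+y} \<Longrightarrow> g z = f z"
    using extend_functional[OF V s ad] by blast
  then show thesis using that[of g] fv by auto
qed

lemma functional_value:
  assumes V: "gsub V" "finite V" and x: "x \<in> V" "x \<noteq> 0"
  obtains f :: "'a::two_torsion \<Rightarrow> bit" where "additive_on V f" "f x = 1"
  using functional_values2[OF V x x, of 1 1] by metis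

lemma card_hyperplane:
  fixes f :: "'a::two_torsion \<Rightarrow> bit"
  assumes "gsub V" "finite V" "additive_on V f" "w \<in> V" "f w = 1"
  shows "card V = 2 * card {x\<in>V. f x = 0}"
proof -
  have "f ` V = {0, 1}"
  proof -
    have "f 0 = 0" using assms additive_on_0 by blast
    then show ?thesis using assms by (auto intro: rev_image_eqI)
  qed
  then show ?thesis using card_image_kernel[of V f] assms by simp
qed

text \<open>Split off hyperplanes, which have half the size.\<close>
lemma card_gsub_power:
  assumes "gsub V" "finite V"
  obtains k where "card V = 2 ^ k"
  using assms
proof (induction "card V" arbitrary: V thesis rule: less_induct)
  case less
  show thesis
  proof (cases "V = {0}")
    case True then show thesis using less(2)[of 0] by simp
  next
    case False
    then obtain w where w: "w \<in> V" "w \<noteq> 0" using less.prems gsub0 by blast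
    obtain f :: "'a \<Rightarrow> bit" where f: "additive_on V f" "f w = 1" using functional_value less.prems w by metis
    let ?H = "{x\<in>V. f x = 0}"
    have c: "card V = 2 * card ?H" using card_hyperplane less.prems f w by blast
    have g: "gsub ?H" "finite ?H" using less.prems f gsub_kernel by auto
    then have "card ?H > 0" using card_gt_0_iff gsub0 by blast
    then obtain k where "card ?H = 2 ^ k" using less(1)[of ?H] c g by auto
    then show thesis using less(2)[of "Suc k"] c by simp
  qed
qed

lemma gsub_of_card:
  assumes "gsub V" "finite V" "card V = 2 ^ k" "a \<le> k"
  obtains U where "gsub U" "U \<subseteq> V" "card U = 2 ^ a"
  using assms
proof (induction k arbitrary: V thesis)
  case 0 then show ?case by auto
next
  case (Suc k)
  show ?case
  proof (cases "a = Suc k")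
    case True then show ?thesis using Suc by blast
  next
    case False
    have "V \<noteq> {0}" using Suc.prems by (metis card_1_singleton_iff is_singletonI is_singleton_altdef one_less_numeral_iff one_less_power semiring_norm(76) zero_less_Suc less_irrefl)
    then obtain w where w: "w \<in> V" "w \<noteq> 0" using Suc.prems gsub0 by blast
    obtain f :: "'a \<Rightarrow> bit" where f: "additive_on V f" "f w = 1" using functional_value Suc.prems w by metis
    let ?H = "{x\<in>V. f x = 0}"
    have c: "card V = 2 * card ?H" using card_hyperplane Suc.prems f w by blast
    have g: "gsub ?H" "finite ?H" using Suc.prems f gsub_kernel by auto
    have "card ?H = 2 ^ k" using c Suc.prems by simp
    then obtain U where "gsub U" "U \<subseteq> ?H" "card U = 2 ^ a" using Suc.IH[OF _ g] False Suc.prems by auto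
    then show ?thesis using Suc.prems(1) by blast
  qed
qed

section \<open>Bilinear forms with a prescribed diagonal\<close>
definition biadditive_on :: "'a::two_torsion set \<Rightarrow> ('a \<Rightarrow> 'a \<Rightarrow> bit) \<Rightarrow> bool" where
  "biadditive_on V B \<longleftrightarrow> (\<forall>x\<in>V. additive_on V (B x) \<and> additive_on V (\<lambda>z. B z x))"

text \<open>The left kernel suffices throughout: left and right kernel of a bilinear form have equal size.\<close>
definition lker :: "'a::two_torsion set \<Rightarrow> ('a \<Rightarrow> 'a \<Rightarrow> bit) \<Rightarrow> 'a set" where
  "lker V B = {x\<in>V. \<forall>y\<in>V. B x y = 0}"

definition quad :: "'a::two_torsion set \<Rightarrow> ('a \<Rightarrow> bit) \<Rightarrow> ('a \<Rightarrow> 'a \<Rightarrow> bit) \<Rightarrow> bool" where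
  "quad V Q B \<longleftrightarrow> biadditive_on V B \<and> (\<forall>x\<in>V. Q x = B x x)"

definition polar :: "('a::two_torsion \<Rightarrow> bit) \<Rightarrow> 'a \<Rightarrow> 'a \<Rightarrow> bit" where
  "polar Q x y = Q (x + y) + Q x + Q y"

lemma biadd_l: "biadditive_on V B \<Longrightarrow> x \<in> V \<Longrightarrow> y \<in> V \<Longrightarrow> z \<in> V \<Longrightarrow> B (x + y) z = B x z + B y z"
  and biadd_r: "biadditive_on V B \<Longrightarrow> x \<in> V \<Longrightarrow> y \<in> V \<Longrightarrow> z \<in> V \<Longrightarrow> B z (x + y) = B z x + B z y"
  by (simp_all add: biadditive_on_def additive_on_def)

lemma biadd_add_l: "biadditive_on V B \<Longrightarrow> z \<in> V \<Longrightarrow> additive_on V (\<lambda>x. B x z)"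
  and biadd_add_r: "biadditive_on V B \<Longrightarrow> z \<in> V \<Longrightarrow> additive_on V (B z)"
  by (simp_all add: biadditive_on_def)

lemma biadd_0l: "biadditive_on V B \<Longrightarrow> gsub V \<Longrightarrow> z \<in> V \<Longrightarrow> B 0 z = 0"
  and biadd_0r: "biadditive_on V B \<Longrightarrow> gsub V \<Longrightarrow> z \<in> V \<Longrightarrow> B z 0 = 0"
  using additive_on_0[of V "B z"] additive_on_0[of V "\<lambda>x. B x z"] by (simp_all add: biadditive_on_def)

lemma biadditive_onI:
  assumes "\<And>x y z. x \<in> V \<Longrightarrow> y \<in> V \<Longrightarrow> z \<in> V \<Longrightarrow> B (x + y) z = B x z + B y z"
    "\<And>x y z. x \<in> V \<Longrightarrow> y \<in> V \<Longrightarrow> z \<in> V \<Longrightarrow> B z (x + y) = B z x + B z y"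
  shows "biadditive_on V B"
  using assms by (simp add: biadditive_on_def additive_on_def)

lemma biadditive_sum:
  "biadditive_on V A \<Longrightarrow> biadditive_on V B \<Longrightarrow> biadditive_on V (\<lambda>x y. A x y + B x y)"
  by (simp add: biadditive_on_def additive_on_def ac_simps)

lemma biadditive_prod:
  "additive_on V f \<Longrightarrow> additive_on V g \<Longrightarrow> biadditive_on V (\<lambda>x y. f x * g y)"
  by (simp add: biadditive_on_def additive_on_def algebra_simps)

lemma biadditive_comp:
  assumes "biadditive_on W B" "additive_on V f" "f ` V \<subseteq> W" "additive_on V g" "g ` V \<subseteq> W"
  shows "biadditive_on V (\<lambda>x y. B (f x) (g y))"
  using assms unfolding biadditive_on_def additive_on_def by (simp add: image_subset_iff)

lemma biadditive_on_subset: "biadditive_on V B \<Longrightarrow> U \<subseteq> V \<Longrightarrow> biadditive_on U B"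
  by (auto simp: biadditive_on_def intro: additive_on_subset)

lemma quadD: "quad V Q B \<Longrightarrow> biadditive_on V B" "quad V Q B \<Longrightarrow> x \<in> V \<Longrightarrow> Q x = B x x"
  by (auto simp: quad_def)

lemma quad_subset: "quad V Q B \<Longrightarrow> U \<subseteq> V \<Longrightarrow> quad U Q B"
  by (auto simp: quad_def intro: biadditive_on_subset)

lemma quad_polar: "quad V Q B \<Longrightarrow> gsub V \<Longrightarrow> x \<in> V \<Longrightarrow> y \<in> V \<Longrightarrow> polar Q x y = B x y + B y x"
  by (simp add: polar_def quadD(2)[of V Q B] biadd_l[OF quadD(1)] biadd_r[OF quadD(1)] ac_simps)

lemma quad_add: "quad V Q B \<Longrightarrow> gsub V \<Longrightarrow> x \<in> V \<Longrightarrow> y \<in> V \<Longrightarrow> Q (x + y) = Q x + Q y + polar Q x y"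
  by (simp add: polar_def ac_simps)

lemma biadditive_polar:
  assumes "quad V Q B" "gsub V" shows "biadditive_on V (polar Q)"
proof -
  have "biadditive_on V (\<lambda>x y. B x y + B y x)"
    using quadD(1)[OF assms(1)] by (intro biadditive_sum) (auto simp: biadditive_on_def)
  then show ?thesis using assms by (simp add: biadditive_on_def additive_on_def quad_polar)
qed

lemma quad_0:
  assumes "quad V Q B" "gsub V" shows "Q 0 = 0"
  using assms biadd_0l quadD gsub0 by metis

lemma gsub_lker: "gsub V \<Longrightarrow> biadditive_on V B \<Longrightarrow> gsub (lker V B)"
  by (rule gsubI) (auto simp: lker_def biadd_l biadd_0l)

lemma quad_alternating:
  assumes "quad V (\<lambda>_. 0) A" "gsub V" "x \<in> V" "y \<in> V" shows "A x y = A y x"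
proof -
  have "A x y + A y x = 0" using quad_polar[OF assms] by (simp add: polar_def)
  then show ?thesis by (simp add: add_eq_0_iff_eq)
qed

lemma quad_cong: "(\<And>x. x \<in> V \<Longrightarrow> Q x = Q' x) \<Longrightarrow> quad V Q B \<longleftrightarrow> quad V Q' B"
  by (auto simp: quad_def)

text \<open>Scalar multiplication by an element of the two-element field.\<close>
definition sel :: "bit \<Rightarrow> 'a::two_torsion \<Rightarrow> 'a" where "sel c w = (if c = 0 then 0 else w)"

lemma sel_simps [simp]: "sel 0 w = 0" "sel 1 w = w" by (auto simp: sel_def)
lemma sel_add: "sel (a + b) w = sel a w + sel b w" by (cases a; cases b) auto

text \<open>The decomposition \<open>V = H \<oplus> \<langle>w\<rangle>\<close> with \<open>H\<close> the kernel of a functional \<open>l\<close>, together with the projection \<open>\<pi>\<close>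
  to \<open>H\<close> along \<open>w\<close>.\<close>
locale line_split =
  fixes V :: "'a::two_torsion set" and l :: "'a \<Rightarrow> bit" and w :: 'a
  assumes V: "gsub V" "finite V" and l: "additive_on V l" and w: "w \<in> V" "l w = 1"
begin

definition "H = {x\<in>V. l x = 0}"
definition "\<pi> x = x + sel (l x) w"

lemma H: "gsub H" "finite H" "H \<subseteq> V"
  using gsub_kernel V l by (auto simp: H_def)
lemma card_V: "card V = 2 * card H"
  unfolding H_def using card_hyperplane V l w by blast
lemma sel_V: "sel c w \<in> V" using V w by (auto simp: sel_def)
lemma l_sel: "l (sel c w) = c" using additive_on_0[OF l V(1)] w by (auto simp: sel_def)
lemma pi_V: "x \<in> V \<Longrightarrow> \<pi> x \<in> V" using V sel_V by (simp add: \<pi>_def)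
lemma pi_H: "x \<in> V \<Longrightarrow> \<pi> x \<in> H"
  using pi_V additive_onD[OF l _ sel_V] by (simp add: H_def \<pi>_def l_sel)
lemma pi_id [simp]: "x \<in> H \<Longrightarrow> \<pi> x = x" by (simp add: H_def \<pi>_def)
lemma l_H [simp]: "x \<in> H \<Longrightarrow> l x = 0" by (simp add: H_def)
lemma pi_w [simp]: "\<pi> w = 0" using w by (simp add: \<pi>_def)
lemma pi_additive: "additive_on V \<pi>"
  using additive_onD[OF l] by (simp add: additive_on_def \<pi>_def sel_add ac_simps)
lemma decomp: "x = \<pi> x + sel (l x) w" by (simp add: \<pi>_def ac_simps)
lemma pi_image: "\<pi> ` V \<subseteq> H" using pi_H by auto
lemma comp_pi: "additive_on H f \<Longrightarrow> additive_on V (\<lambda>x. f (\<pi> x))"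
  using pi_H additive_onD[OF pi_additive] by (simp add: additive_on_def)

lemma comp_pi2: "biadditive_on H B \<Longrightarrow> biadditive_on V (\<lambda>x y. B (\<pi> x) (\<pi> y))"
  by (rule biadditive_comp[OF _ pi_additive pi_image pi_additive pi_image])

text \<open>The form \<open>B\<close> extends \<open>BH\<close> by \<open>B(w,w) = 1\<close>, \<open>B(h,w) = d(h)\<close> and \<open>B(w,h) = c(h)\<close>, where the diagonal only
  prescribes \<open>c + d\<close>. Eliminating the entry at \<open>w\<close> leaves the Schur complement \<open>BH(h,k) - d(h) c(k)\<close>, which
  is what the last hypothesis asks to be nondegenerate. The freedom in the choice of \<open>d\<close> repairs a
  form \<open>BH\<close> whose kernel is a line.\<close>
lemma nondegenerate_step:
  assumes Q: "quad V Q B0" "Q w = 1" and BH: "quad H Q BH"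
    and c: "additive_on H c" and d: "additive_on H d"
    and cd: "\<And>h. h \<in> H \<Longrightarrow> c h + d h = polar Q w h"
    and nd: "\<And>h. h \<in> H \<Longrightarrow> (\<And>k. k \<in> H \<Longrightarrow> BH h k = d h * c k) \<Longrightarrow> h = 0"
  shows "\<exists>B. quad V Q B \<and> lker V B = {0}"
proof -
  define B where "B x y = l x * l y + d (\<pi> x) * l y + l x * c (\<pi> y) + BH (\<pi> x) (\<pi> y)" for x y
  have bi: "biadditive_on V B"
    unfolding B_def
    by (intro biadditive_sum biadditive_prod[OF l l] biadditive_prod[OF comp_pi[OF d] l]
        biadditive_prod[OF l comp_pi[OF c]] comp_pi2 quadD(1)[OF BH])
  have "Q x = B x x" if x: "x \<in> V" for x
  proof -
    have "Q x = Q (\<pi> x + sel (l x) w)" using decomp by simp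
    also have "\<dots> = l x + l x * polar Q w (\<pi> x) + Q (\<pi> x)"
      using quad_0[OF Q(1) V(1)] Q(2) by (cases "l x") (auto simp: polar_def ac_simps)
    also have "\<dots> = B x x"
      using x cd[OF pi_H[OF x], symmetric] quadD(2)[OF BH pi_H[OF x]]
      by (cases "l x") (simp_all add: B_def algebra_simps)
    finally show ?thesis .
  qed
  then have q: "quad V Q B" using bi by (simp add: quad_def)
  have "x = 0" if x: "x \<in> lker V B" for x
  proof -
    have xV: "x \<in> V" and x0: "\<And>y. y \<in> V \<Longrightarrow> B x y = 0" using x by (auto simp: lker_def)
    have "B x w = 0" using x0 w by blast
    then have lx: "l x = d (\<pi> x)"
      using w additive_on_0[OF c H(1)] biadd_0r[OF quadD(1)[OF BH] H(1) pi_H[OF xV]]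
      by (simp add: B_def add_eq_0_iff_eq)
    have "\<pi> x = 0"
    proof (rule nd[OF pi_H[OF xV]])
      fix k assume k: "k \<in> H"
      then have "B x k = 0" using x0 H by blast
      then show "BH (\<pi> x) k = d (\<pi> x) * c k" using k lx by (simp add: B_def add_eq_0_iff_eq)
    qed
    moreover from this have "l x = 0" using lx additive_on_0[OF d H(1)] by simp
    ultimately show "x = 0" using decomp[of x] by simp
  qed
  moreover have "0 \<in> lker V B" using gsub_lker[OF V(1) bi] by simp
  ultimately show ?thesis using q by blast
qed

end

lemma line_splitI:
  assumes "gsub V" "finite V" "w \<in> V" "w \<noteq> 0"
  obtains l where "line_split V l w"
  using functional_value[OF assms] assms unfolding line_split_def by metis

text \<open>Both cases go by adding a vector to a space one dimension smaller. From even to odd dimension, pull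
  a nondegenerate form back along the projection that kills the chosen vector \<open>h\<close>; from odd to even
  dimension, pair the new vector with the line that is the kernel so far.\<close>
lemma alternating_exists:
  assumes "gsub V" "finite V" "card V = 2 ^ k"
  shows "(even k \<longrightarrow> (\<exists>A. quad V (\<lambda>_. 0) A \<and> lker V A = {0})) \<and>
         (odd k \<longrightarrow> (\<forall>h\<in>V. h \<noteq> 0 \<longrightarrow> (\<exists>A. quad V (\<lambda>_. 0) A \<and> lker V A = {0, h})))"
  using assms
proof (induction k arbitrary: V)
  case 0
  then have "V = {0}" by (metis card_1_singletonE gsub0 power_0 singletonD)
  then have "quad V (\<lambda>_. 0) (\<lambda>_ _. 0)" "lker V (\<lambda>_ _. 0) = {0}"
    by (auto simp: quad_def biadditive_on_def additive_on_def lker_def)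
  then show ?case by auto
next
  case (Suc k)
  note V = Suc.prems(1,2)
  show ?case
  proof (cases "even k")
    case True
    have "\<exists>A. quad V (\<lambda>_. 0) A \<and> lker V A = {0, h}" if h: "h \<in> V" "h \<noteq> 0" for h
    proof -
      obtain l where "line_split V l h" using line_splitI V h by metis
      then interpret line_split V l h .
      have "card H = 2 ^ k" using card_V Suc.prems(3) by simp
      then obtain A where A: "quad H (\<lambda>_. 0) A" "lker H A = {0}" using Suc.IH H True by blast
      let ?A = "\<lambda>x y. A (\<pi> x) (\<pi> y)"
      have "biadditive_on V ?A"
        by (rule comp_pi2[OF quadD(1)[OF A(1)]])
      then have q: "quad V (\<lambda>_. 0) ?A" using quadD(2)[OF A(1)] pi_H by (simp add: quad_def)
      have "x \<in> lker V ?A \<longleftrightarrow> x \<in> {0, h}" if x: "x \<in> V" for x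
      proof -
        have "(\<forall>y\<in>V. A (\<pi> x) (\<pi> y) = 0) \<longleftrightarrow> (\<forall>y\<in>H. A (\<pi> x) y = 0)"
          using pi_H H by (metis pi_id subsetD)
        then have "x \<in> lker V ?A \<longleftrightarrow> \<pi> x \<in> lker H A" using pi_H x by (simp add: lker_def)
        also have "\<dots> \<longleftrightarrow> \<pi> x = 0" using A by simp
        also have "\<dots> \<longleftrightarrow> x \<in> {0, h}"
          using w additive_on_0[OF l V(1)] by (cases "l x") (auto simp: \<pi>_def add_eq_0_iff_eq)
        finally show ?thesis .
      qed
      moreover have "lker V ?A \<subseteq> V" by (auto simp: lker_def)
      moreover have "{0, h} \<subseteq> V" using V h gsub0 by blast
      ultimately have "lker V ?A = {0, h}" by blast
      with q show ?thesis by blast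
    qed
    with True show ?thesis by simp
  next
    case False
    have "V \<noteq> {0}" using Suc.prems(3) by auto
    then obtain w where w: "w \<in> V" "w \<noteq> 0" using V gsub0 by blast
    obtain l where "line_split V l w" using line_splitI V w by metis
    then interpret line_split V l w .
    have cH: "card H = 2 ^ k" using card_V Suc.prems(3) by simp
    then have "H \<noteq> {0}" using False by (auto elim!: oddE)
    then obtain h where h: "h \<in> H" "h \<noteq> 0" using H gsub0 by blast
    obtain A where A: "quad H (\<lambda>_. 0) A" "lker H A = {0, h}" using Suc.IH H cH False h by blast
    obtain d :: "'a \<Rightarrow> bit" where d: "additive_on H d" "d h = 1" using functional_value H h by metis
    let ?A = "\<lambda>x y. A (\<pi> x) (\<pi> y) + (d (\<pi> x) * l y + l x * d (\<pi> y))"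
    have bi: "biadditive_on V ?A"
      by (intro biadditive_sum biadditive_prod[OF comp_pi[OF d(1)] l] biadditive_prod[OF l comp_pi[OF d(1)]]
          comp_pi2 quadD(1)[OF A(1)])
    then have q: "quad V (\<lambda>_. 0) ?A" using quadD(2)[OF A(1)] pi_H by (auto simp: quad_def mult.commute)
    have "x = 0" if x: "x \<in> lker V ?A" for x
    proof -
      have xV: "x \<in> V" and x0: "\<And>y. y \<in> V \<Longrightarrow> ?A x y = 0" using x by (auto simp: lker_def)
      have Ah: "A (\<pi> x) h = 0"
        using quad_alternating[OF A(1) H(1) pi_H[OF xV] h(1)] A(2) pi_H[OF xV] by (auto simp: lker_def)
      have lx: "l x = 0" using x0[of h] h H(3) Ah d by auto
      have "A (\<pi> x) 0 = 0" "d 0 = 0"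
        using biadd_0r[OF quadD(1)[OF A(1)] H(1) pi_H[OF xV]] additive_on_0[OF d(1) H(1)] by auto
      then have dx: "d (\<pi> x) = 0" using x0[OF w(1)] lx \<open>line_split V l w\<close> by (simp add: line_split_def)
      have "A (\<pi> x) y = 0" if "y \<in> H" for y
        using x0[of y] lx dx that H(3) by auto
      then have "\<pi> x \<in> lker H A" using pi_H[OF xV] by (simp add: lker_def)
      then have "\<pi> x = 0" using A(2) dx d by auto
      then show ?thesis using decomp[of x] lx by simp
    qed
    moreover have "0 \<in> lker V ?A" using gsub_lker[OF V(1) bi] by simp
    ultimately have "lker V ?A = {0}" by blast
    with q have "\<exists>A. quad V (\<lambda>_. 0) A \<and> lker V A = {0}" by (intro exI[of _ ?A] conjI)
    then show ?thesis using False by simp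
  qed
qed

definition hyperbolic_plane :: "'a::two_torsion set \<Rightarrow> ('a \<Rightarrow> bit) \<Rightarrow> 'a \<Rightarrow> 'a \<Rightarrow> bool" where
  "hyperbolic_plane V Q e f \<longleftrightarrow> e \<noteq> 0 \<and> f \<noteq> 0 \<and> e \<noteq> f \<and> V = {0, e, f, e + f} \<and> Q e = 0 \<and> Q f = 0 \<and> Q (e + f) = 1"

lemma hyperbolic_plane_commute: "hyperbolic_plane V Q e f \<Longrightarrow> hyperbolic_plane V Q f e"
  by (auto simp: hyperbolic_plane_def ac_simps)

text \<open>On the plane with \<open>Q(xe + yf) = xy\<close> take the form that multiplies the first coordinate of one vector with
  the second coordinate of the other.\<close>
lemma hyperbolic_plane_form:
  assumes "hyperbolic_plane V Q e f" "gsub V" "finite V" "Q 0 = 0"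
  obtains B where "quad V Q B" "lker V B = {0, f}" "\<And>h. h \<in> V \<Longrightarrow> B h e = 0" "\<And>h. h \<in> V \<Longrightarrow> B h f = 0 \<Longrightarrow> h \<in> {0, f}"
proof -
  have X: "e \<noteq> 0" "f \<noteq> 0" "e \<noteq> f" "V = {0, e, f, e + f}" "Q e = 0" "Q f = 0" "Q (e + f) = 1"
    using assms by (auto simp: hyperbolic_plane_def)
  have ef: "e \<in> V" "f \<in> V" using X by auto
  obtain m :: "'a \<Rightarrow> bit" where m: "additive_on V m" "m e = 1" "m f = 0"
    using functional_values2[OF assms(2,3) ef(1) X(1) ef(2) X(2)] X(3) by metis
  obtain n :: "'a \<Rightarrow> bit" where n: "additive_on V n" "n e = 0" "n f = 1"
    using functional_values2[OF assms(2,3) ef(1) X(1) ef(2) X(2)] X(3) by metis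
  have m0: "m 0 = 0" "n 0 = 0" "m (e + f) = 1" "n (e + f) = 1"
    using additive_on_0[OF m(1) assms(2)] additive_on_0[OF n(1) assms(2)]
      additive_onD[OF m(1) ef] additive_onD[OF n(1) ef] m n by auto
  show thesis
  proof
    show "quad V Q (\<lambda>x y. m x * n y)"
      unfolding quad_def using biadditive_prod[OF m(1) n(1)] X m n m0 assms(4) by auto
    show "lker V (\<lambda>x y. m x * n y) = {0, f}"
      unfolding lker_def using X m n m0 by auto
    show "m h * n e = 0" for h using n by simp
    show "h \<in> {0, f}" if "h \<in> V" "m h * n f = 0" for h using that X m n m0 by auto
  qed
qed

text \<open>Induction on the size of the space: split off a vector \<open>w\<close> with \<open>Q(w) = 1\<close>. If the complement \<open>H\<close> carries
  a nondegenerate form, the extension with \<open>d = 0\<close> is nondegenerate. The exceptions are that \<open>H\<close> is a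
  hyperbolic plane or that \<open>Q\<close> vanishes on \<open>H\<close> and \<open>H\<close> has odd dimension; then a form on \<open>H\<close> with a line as
  kernel is corrected by a suitable \<open>d\<close>.\<close>
lemma nondegenerate_form_exists:
  assumes "gsub V" "finite V" "quad V Q B0" "\<exists>w\<in>V. Q w = 1" "\<nexists>e f. hyperbolic_plane V Q e f"
  shows "\<exists>B. quad V Q B \<and> lker V B = {0}"
  using assms
proof (induction "card V" arbitrary: V rule: less_induct)
  case less
  note V = less.prems(1,2) and Q = less.prems(3)
  note Q0 = quad_0[OF Q V(1)]
  obtain w where ww: "w \<in> V" "Q w = 1" using less.prems by blast
  then have "w \<noteq> 0" using Q0 by auto
  then obtain l where "line_split V l w" using line_splitI V ww(1) by metis
  then interpret line_split V l w .
  note QH = quad_subset[OF Q H(3)]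
  have pw: "additive_on H (polar Q w)"
    using biadd_add_r[OF biadditive_polar[OF Q V(1)] w(1)] H(3) by (rule additive_on_subset)
  have Hpos: "card H > 0" using H gsub0 card_gt_0_iff by blast
  have simple: ?case if "quad H Q BH" "lker H BH = {0}" for BH
  proof (rule nondegenerate_step[OF Q ww(2) that(1) pw])
    show "additive_on H (\<lambda>_. 0)" by (simp add: additive_on_def)
    show "h = 0" if "h \<in> H" "\<And>k. k \<in> H \<Longrightarrow> BH h k = 0 * polar Q w k" for h
      using that \<open>lker H BH = {0}\<close> by (auto simp: lker_def)
  qed simp
  have twist: "additive_on H (\<lambda>x. polar Q w x + d x)" if "additive_on H d" for d
    using that pw by (simp add: additive_on_def ac_simps)
  show ?case
  proof (cases "\<exists>h\<in>H. Q h = 1")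
    case True
    show ?thesis
    proof (cases "\<exists>e f. hyperbolic_plane H Q e f")
      case False
      then obtain B where "quad H Q B" "lker H B = {0}"
        using less.hyps[of H] H QH True card_V Hpos by auto
      then show ?thesis by (rule simple)
    next
      case X: True
      then obtain e f where ef: "hyperbolic_plane H Q e f" by blast
      obtain B where B: "quad H Q B" "\<And>h. h \<in> H \<Longrightarrow> B h e = 0" "\<And>h. h \<in> H \<Longrightarrow> B h f = 0 \<Longrightarrow> h \<in> {0, f}"
        using hyperbolic_plane_form[OF ef H(1,2) Q0] by metis
      have efH: "e \<in> H" "f \<in> H" "e \<noteq> 0" "f \<noteq> 0" "e \<noteq> f" using ef by (auto simp: hyperbolic_plane_def)
      \<comment> \<open>The values of \<open>d\<close> make \<open>c(e) = 1\<close> and \<open>d(f) = 1\<close>, so that the rank-one term detects the kernel \<open>{0, f}\<close>.\<close>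
      obtain d :: "'a \<Rightarrow> bit" where d: "additive_on H d" "d e = 1 + polar Q w e" "d f = 1"
        using functional_values2[OF H(1,2) efH(1,3) efH(2,4)] efH(5) by metis
      show ?thesis
      proof (rule nondegenerate_step[OF Q ww(2) B(1) twist[OF d(1)] d(1)])
        show "h = 0" if h: "h \<in> H" "\<And>k. k \<in> H \<Longrightarrow> B h k = d h * (polar Q w k + d k)" for h
        proof -
          have "d h = 0" using h(2)[OF efH(1)] B(2)[OF h(1)] d(2) by (cases "polar Q w e") auto
          moreover from this have "B h f = 0" using h(2)[OF efH(2)] by simp
          ultimately show "h = 0" using B(3)[OF h(1)] d(3) by auto
        qed
      qed (simp add: add.assoc)
    qed
  next
    case False
    then have QH0: "Q h = 0" if "h \<in> H" for h using that by (cases "Q h") auto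
    obtain k where k: "card H = 2 ^ k" using card_gsub_power H by blast
    show ?thesis
    proof (cases "even k")
      case True
      then obtain A where "quad H (\<lambda>_. 0) A" "lker H A = {0}" using alternating_exists[OF H(1,2) k] by blast
      then show ?thesis using simple[of A] QH0 quad_cong[of H Q "\<lambda>_. 0"] by blast
    next
      case odd: False
      \<comment> \<open>Otherwise \<open>H\<close> would be a line on which \<open>Q\<close> vanishes and \<open>V\<close> would be a hyperbolic plane.\<close>
      have "\<exists>h\<in>H. h \<noteq> 0 \<and> polar Q w h = 0"
      proof (rule ccontr)
        assume "\<not> (\<exists>h\<in>H. h \<noteq> 0 \<and> polar Q w h = 0)"
        then have p1: "polar Q w h = 1" if "h \<in> H" "h \<noteq> 0" for h using that by (cases "polar Q w h") auto
        have "H \<noteq> {0}" using k odd by (auto elim!: oddE)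
        then obtain h where h: "h \<in> H" "h \<noteq> 0" using H gsub0 by blast
        have "g \<in> {0, h}" if g: "g \<in> H" for g
        proof (rule ccontr)
          assume n: "g \<notin> {0, h}"
          then have "g + h \<in> H" "g + h \<noteq> 0" using g h H by (auto simp: add_eq_0_iff_eq)
          then have "polar Q w (g + h) = 1" by (rule p1)
          then show False using additive_onD[OF pw g h(1)] p1 g h n by auto
        qed
        then have Hh: "H = {0, h}" using H h gsub0 by blast
        have hV: "h \<in> V" using h H by blast
        have "V = {0, h, w + h, h + (w + h)}"
        proof -
          have "x \<in> {0, h, w, w + h}" if "x \<in> V" for x
          proof -
            have "\<pi> x + sel (l x) w \<in> {0, h, w, w + h}"
              using pi_H[OF that] Hh by (cases "l x") (auto simp: ac_simps)
            then show ?thesis by (simp only: decomp[symmetric])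
          qed
          then show ?thesis using V ww hV by (auto simp: ac_simps)
        qed
        moreover have "Q (w + h) = 0"
          using quad_add[OF Q V(1) ww(1) hV] ww(2) p1[OF h] QH0[OF h(1)] by simp
        moreover have "Q (h + (w + h)) = 1" using ww by (simp add: ac_simps)
        moreover have "h \<noteq> w" using QH0[OF h(1)] ww by auto
        ultimately have "hyperbolic_plane V Q h (w + h)"
          using h QH0 \<open>w \<noteq> 0\<close> unfolding hyperbolic_plane_def by (auto simp: add_eq_0_iff_eq)
        then show False using less.prems by blast
      qed
      then obtain h where h: "h \<in> H" "h \<noteq> 0" "polar Q w h = 0" by blast
      obtain A where A: "quad H (\<lambda>_. 0) A" "lker H A = {0, h}"
        using alternating_exists[OF H(1,2) k] odd h by blast
      have A': "quad H Q A" using A(1) QH0 quad_cong[of H Q "\<lambda>_. 0"] by blast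
      obtain d :: "'a \<Rightarrow> bit" where d: "additive_on H d" "d h = 1" using functional_value H h by metis
      show ?thesis
      proof (rule nondegenerate_step[OF Q ww(2) A' twist[OF d(1)] d(1)])
        show "g = 0" if g: "g \<in> H" "\<And>k. k \<in> H \<Longrightarrow> A g k = d g * (polar Q w k + d k)" for g
        proof -
          have "A g h = A h g" using quad_alternating[OF A(1) H(1) g(1) h(1)] .
          also have "\<dots> = 0" using A(2) g(1) by (auto simp: lker_def)
          finally have "d g = 0" using g(2)[OF h(1)] h d by simp
          then have "g \<in> lker H A" using g by (simp add: lker_def)
          then show "g = 0" using A(2) d \<open>d g = 0\<close> by auto
        qed
      qed (simp add: add.assoc)
    qed
  qed
qed

section \<open>Bilinear forms with a prescribed kernel\<close>

text \<open>With \<open>y = \<pi> y + u\<close>, \<open>u\<close> in \<open>U\<close>, the form pairs \<open>\<pi> x\<close> with \<open>u\<close> by the polar form of \<open>Q\<close> and \<open>\<pi> x\<close> with \<open>\<pi> y\<close>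
  by \<open>B'\<close>. Its diagonal is \<open>Q\<close> because \<open>Q\<close> vanishes on \<open>U\<close>. Vectors of \<open>U\<close> are in the left kernel, and no
  others as soon as nothing in the left kernel of \<open>B'\<close> is orthogonal to \<open>U\<close>.\<close>
lemma isotropic_glue:
  assumes V: "gsub V" "finite V" and Q: "quad V Q B0" and U: "gsub U" "U \<subseteq> V" "\<And>u. u \<in> U \<Longrightarrow> Q u = 0"
    and p: "projects V U \<pi>" and B': "quad (\<pi> ` V) Q B'"
    and nd: "\<And>h. h \<in> lker (\<pi> ` V) B' \<Longrightarrow> (\<And>u. u \<in> U \<Longrightarrow> polar Q h u = 0) \<Longrightarrow> h = 0"
  shows "\<exists>B. quad V Q B \<and> lker V B = U"
proof -
  define B where "B x y = polar Q (\<pi> x) (y + \<pi> y) + B' (\<pi> x) (\<pi> y)" for x y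
  note P = projectsD[OF p V(1)] and pa = projects_additive[OF p]
  have bp: "biadditive_on V (polar Q)" by (rule biadditive_polar[OF Q V(1)])
  have a1: "additive_on V (\<lambda>y. y + \<pi> y)" using additive_onD[OF pa] by (simp add: additive_on_def ac_simps)
  have "biadditive_on V (\<lambda>x y. polar Q (\<pi> x) (y + \<pi> y))"
    by (rule biadditive_comp[OF bp pa _ a1]) (use P(1) V(1) in auto)
  moreover have "biadditive_on V (\<lambda>x y. B' (\<pi> x) (\<pi> y))"
    by (rule biadditive_comp[OF quadD(1)[OF B'] pa _ pa]) auto
  ultimately have bi: "biadditive_on V B" unfolding B_def by (rule biadditive_sum)
  have "Q x = B x x" if x: "x \<in> V" for x
  proof -
    have xp: "x + \<pi> x \<in> V" using P(1)[OF x] x V by simp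
    have "Q x = Q (\<pi> x + (x + \<pi> x))" by (simp add: ac_simps)
    also have "\<dots> = Q (\<pi> x) + Q (x + \<pi> x) + polar Q (\<pi> x) (x + \<pi> x)"
      by (rule quad_add[OF Q V(1) P(1)[OF x] xp])
    also have "\<dots> = B x x" using U(3)[OF P(4)[OF x]] quadD(2)[OF B', of "\<pi> x"] x by (simp add: B_def ac_simps)
    finally show ?thesis .
  qed
  then have q: "quad V Q B" using bi by (simp add: quad_def)
  have "x \<in> U" if x: "x \<in> lker V B" for x
  proof -
    have xV: "x \<in> V" and x0: "\<And>y. y \<in> V \<Longrightarrow> B x y = 0" using x by (auto simp: lker_def)
    have pu: "polar Q (\<pi> x) u = 0" if u: "u \<in> U" for u
    proof -
      have "\<pi> u = 0" "u \<in> V" using P(3)[of u] u U by auto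
      moreover have "B' (\<pi> x) 0 = 0"
        using biadd_0r[OF quadD(1)[OF B'] gsub_image[OF V(1) pa]] xV by blast
      ultimately show ?thesis using x0[of u] by (simp add: B_def)
    qed
    have "B' (\<pi> x) (\<pi> y) = 0" if "y \<in> V" for y
      using x0[OF that] pu[OF P(4)[OF that]] by (simp add: B_def)
    then have "\<pi> x \<in> lker (\<pi> ` V) B'" using xV by (auto simp: lker_def)
    then have "\<pi> x = 0" using nd pu by blast
    then show "x \<in> U" using P(3)[OF xV] by blast
  qed
  moreover have "x \<in> lker V B" if "x \<in> U" for x
  proof -
    have x: "x \<in> V" "\<pi> x = 0" using that U P(3) by auto
    have "B x y = 0" if y: "y \<in> V" for y
    proof -
      have "y + \<pi> y \<in> V" using y P(1)[OF y] V by simp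
      moreover have "B' 0 (\<pi> y) = 0" using biadd_0l[OF quadD(1)[OF B'] gsub_image[OF V(1) pa]] y by blast
      ultimately show ?thesis using biadd_0l[OF bp V(1)] x by (simp add: B_def)
    qed
    then show ?thesis using x by (simp add: lker_def)
  qed
  ultimately have "lker V B = U" by blast
  with q show ?thesis by blast
qed

text \<open>If \<open>U\<close> is not orthogonal to everything, there is room for \<open>B'\<close> to have a line as kernel, provided that \<open>U\<close>
  detects this line. Such forms always exist: nondegenerate ones in general, the product form on a
  hyperbolic plane, and alternating ones where \<open>Q\<close> vanishes.\<close>
lemma kernel_outside_polar_radical:
  assumes V: "gsub V" "finite V" and Q: "quad V Q B0" and U: "gsub U" "U \<subseteq> V" "\<And>u. u \<in> U \<Longrightarrow> Q u = 0"
    and v: "v \<in> V" "u0 \<in> U" "polar Q v u0 = 1"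
  shows "\<exists>B. quad V Q B \<and> lker V B = U"
proof -
  obtain \<pi> where p: "projects V U \<pi>" using projection_exists V U by metis
  let ?W = "\<pi> ` V"
  note P = projectsD[OF p V(1)] and pa = projects_additive[OF p]
  have W: "gsub ?W" "finite ?W" "?W \<subseteq> V" using gsub_image[OF V(1) pa] V P(1) by auto
  note QW = quad_subset[OF Q W(3)]
  have bp: "biadditive_on V (polar Q)" by (rule biadditive_polar[OF Q V(1)])
  have u0V: "u0 \<in> V" using v U by auto
  have e: "\<pi> v + (v + \<pi> v) = v" by (simp add: ac_simps)
  have "polar Q v u0 = polar Q (\<pi> v) u0 + polar Q (v + \<pi> v) u0"
    using biadd_l[OF bp P(1)[OF v(1)] _ u0V, of "v + \<pi> v", unfolded e] V v P(1)[OF v(1)] by simp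
  moreover have "polar Q (v + \<pi> v) u0 = 0"
    using U gsub_add[OF U(1) P(4)[OF v(1)] v(2)] P(4)[OF v(1)] v(2) by (simp add: polar_def)
  ultimately have g: "\<pi> v \<in> ?W" "polar Q (\<pi> v) u0 = 1" using v by auto
  have g0: "\<pi> v \<noteq> 0" using g(2) biadd_0l[OF bp V(1) u0V] by auto
  have line: ?thesis if B': "quad ?W Q B'" "lker ?W B' \<subseteq> {0, h}" and u: "u \<in> U" "polar Q h u = 1" for B' h u
  proof (rule isotropic_glue[OF V Q U p B'(1)])
    fix g assume g: "g \<in> lker ?W B'" "\<And>u. u \<in> U \<Longrightarrow> polar Q g u = 0"
    then have "g \<noteq> h" using g(2)[OF u(1)] u(2) by auto
    then show "g = 0" using g(1) B'(2) by blast
  qed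
  show ?thesis
  proof (cases "\<exists>w\<in>?W. Q w = 1")
    case True
    show ?thesis
    proof (cases "\<exists>e f. hyperbolic_plane ?W Q e f")
      case False
      then obtain B' where "quad ?W Q B'" "lker ?W B' = {0}"
        using nondegenerate_form_exists[OF W(1,2) QW] True by blast
      then show ?thesis using line[of B' "\<pi> v" u0] g v by blast
    next
      case X: True
      \<comment> \<open>Were both basis vectors orthogonal to \<open>U\<close>, the vector \<open>\<pi> v\<close> would be too.\<close>
      have "\<exists>e f u. hyperbolic_plane ?W Q e f \<and> u \<in> U \<and> polar Q f u = 1"
      proof (rule ccontr)
        assume no: "\<not> ?thesis"
        obtain e f where ef: "hyperbolic_plane ?W Q e f" using X by blast
        have pe: "polar Q f u0 = 0" "polar Q e u0 = 0"
          using no v(2) ef hyperbolic_plane_commute[OF ef] by (metis bit_not_one_iff)+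
        have mem: "e \<in> ?W" "f \<in> ?W" and cs: "\<pi> v \<in> {0, e, f, e + f}"
          using ef g(1) by (auto simp: hyperbolic_plane_def)
        have "e \<in> V" "f \<in> V" using mem W by auto
        then have "polar Q (e + f) u0 = 0" using biadd_l[OF bp _ _ u0V] pe by simp
        then show False using cs pe g(2) g0 by auto
      qed
      then obtain e f u where ef: "hyperbolic_plane ?W Q e f" "u \<in> U" "polar Q f u = 1" by blast
      obtain B' where "quad ?W Q B'" "lker ?W B' = {0, f}"
        using hyperbolic_plane_form[OF ef(1) W(1,2) quad_0[OF Q V(1)]] by metis
      then show ?thesis using line[of B' f u] ef by blast
    qed
  next
    case False
    then have "Q h = 0" if "h \<in> ?W" for h using that by (cases "Q h") auto
    then have qc: "quad ?W Q A \<longleftrightarrow> quad ?W (\<lambda>_. 0) A" for A by (rule quad_cong)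
    obtain k where k: "card ?W = 2 ^ k" using card_gsub_power W by blast
    have "\<exists>A. quad ?W (\<lambda>_. 0) A \<and> lker ?W A \<subseteq> {0, \<pi> v}"
      using alternating_exists[OF W(1,2) k] g(1) g0 by (cases "even k") blast+
    then show ?thesis using line[of _ "\<pi> v" u0] g v qc by blast
  qed
qed

text \<open>Every \<open>a\<close> that is not excluded occurs. The one delicate case is that \<open>U\<close> lies in the radical of the
  polar form and the complement is a hyperbolic plane with basis \<open>e\<close>, \<open>f\<close>: then \<open>U\<close> is replaced by a
  hyperplane of \<open>U\<close> together with \<open>e\<close>, which is again isotropic and no longer in the radical.\<close>
lemma form_with_kernel_dim:
  assumes V: "gsub V" "finite V" "card V = 2 ^ r" and Q: "quad V Q B0"
    and U0: "gsub U0" "U0 \<subseteq> V" "card U0 = 2 ^ \<rho>" "\<And>u. u \<in> U0 \<Longrightarrow> Q u = 0"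
    and mx: "\<And>U. gsub U \<Longrightarrow> U \<subseteq> V \<Longrightarrow> (\<And>u. u \<in> U \<Longrightarrow> Q u = 0) \<Longrightarrow> card U \<le> 2 ^ \<rho>"
    and a: "a \<le> \<rho>" "\<rho> = r \<Longrightarrow> even (a + r)" "\<And>e f. hyperbolic_plane V Q e f \<Longrightarrow> a = 1"
  shows "\<exists>B. quad V Q B \<and> card (lker V B) = 2 ^ a"
proof -
  have fU0: "finite U0" using U0 V by (meson finite_subset)
  obtain U where U: "gsub U" "U \<subseteq> U0" "card U = 2 ^ a" using gsub_of_card[OF U0(1) fU0 U0(3) a(1)] .
  then have UV: "U \<subseteq> V" and QU: "\<And>u. u \<in> U \<Longrightarrow> Q u = 0" using U0 by auto
  have goal: ?thesis if "\<exists>B. quad V Q B \<and> lker V B = U'" "card U' = 2 ^ a" for U' using that by auto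
  obtain \<pi> where p: "projects V U \<pi>" using projection_exists V U UV by metis
  let ?W = "\<pi> ` V"
  note P = projectsD[OF p V(1)] and pa = projects_additive[OF p]
  have W: "gsub ?W" "finite ?W" "?W \<subseteq> V" using gsub_image[OF V(1) pa] V P(1) by auto
  note QW = quad_subset[OF Q W(3)]
  have nice: ?thesis if "quad ?W Q B'" "lker ?W B' = {0}" for B'
    using isotropic_glue[OF V(1,2) Q U(1) UV QU p that(1)] that(2) goal[OF _ U(3)] by blast
  show ?thesis
  proof (cases "\<exists>w\<in>V. Q w = 1")
    case False
    then have Q0: "Q h = 0" if "h \<in> V" for h using that by (cases "Q h") auto
    have "card V \<le> 2 ^ \<rho>" using mx[OF V(1)] Q0 by simp
    moreover have "card U0 \<le> card V" using U0 V card_mono by blast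
    ultimately have "\<rho> = r" using U0 V by simp
    obtain k where k: "card ?W = 2 ^ k" using card_gsub_power W by blast
    have "(2::nat) ^ r = 2 ^ (k + a)"
      using projects_card[OF p V(1,2) UV] V(3) k U(3) by (simp add: power_add)
    then have "r = k + a" by (simp add: power_inject_exp)
    then have "even k" using a(2)[OF \<open>\<rho> = r\<close>] by presburger
    then obtain A where A: "quad ?W (\<lambda>_. 0) A" "lker ?W A = {0}"
      using alternating_exists[OF W(1,2) k] by blast
    have "quad ?W Q A \<longleftrightarrow> quad ?W (\<lambda>_. 0) A" using Q0 W(3) by (intro quad_cong) blast
    then show ?thesis using nice A by blast
  next
    case True
    show ?thesis
    proof (cases "\<exists>v\<in>V. \<exists>u\<in>U. polar Q v u = 1")
      case True
      then show ?thesis using kernel_outside_polar_radical[OF V(1,2) Q U(1) UV QU] goal[OF _ U(3)] by blast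
    next
      case False
      then have rad: "polar Q v u = 0" if "v \<in> V" "u \<in> U" for v u
        using that by (cases "polar Q v u") auto
      have QP: "Q (\<pi> v) = Q v" if v: "v \<in> V" for v
      proof -
        have "Q (v + (v + \<pi> v)) = Q v + Q (v + \<pi> v) + polar Q v (v + \<pi> v)"
          by (rule quad_add[OF Q V(1) v]) (use v V P(1)[OF v] in auto)
        then show ?thesis using QU[OF P(4)[OF v]] rad[OF v P(4)[OF v]] by simp
      qed
      have ex: "\<exists>w\<in>?W. Q w = 1" using True QP by auto
      show ?thesis
      proof (cases "\<exists>e f. hyperbolic_plane ?W Q e f")
        case False
        then show ?thesis using nondegenerate_form_exists[OF W(1,2) QW ex] nice by blast
      next
        case X: True
        then obtain e f where ef: "hyperbolic_plane ?W Q e f" by blast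
        show ?thesis
        proof (cases a)
          case 0
          then have "U = {0}" using U by (metis card_1_singletonE gsub0 power_0 singletonD)
          then have "\<pi> v = v" if "v \<in> V" for v using P(4)[OF that] by (simp add: add_eq_0_iff_eq)
          then have "?W = V" by force
          then have "hyperbolic_plane V Q e f" using ef by simp
          then have "a = 1" by (rule a(3))
          then show ?thesis using 0 by simp
        next
          case (Suc b)
          have mem: "e \<in> ?W" "f \<in> ?W" "e \<noteq> 0" and Qe: "Q e = 0" "Q f = 0" "Q (e + f) = 1"
            using ef by (auto simp: hyperbolic_plane_def)
          have eV: "e \<in> V" "f \<in> V" "\<pi> e = e" using mem W P(2) by auto
          have eU: "e \<notin> U" using P(3)[OF eV(1)] eV(3) mem(3) by auto
          obtain U1 where U1: "gsub U1" "U1 \<subseteq> U" "card U1 = 2 ^ b"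
            using gsub_of_card[OF U(1) finite_subset[OF UV V(2)] U(3), of b] Suc by auto
          let ?U = "U1 \<union> (\<lambda>u. e + u) ` U1"
          have gU: "gsub ?U"
          proof (rule gsubI)
            show "0 \<in> ?U" using U1 by simp
            fix x y assume "x \<in> ?U" "y \<in> ?U"
            then obtain s t where "s \<in> U1" "t \<in> U1" "x = s \<or> x = e + s" "y = t \<or> y = e + t" by auto
            then have "s + t \<in> U1" "x + y = s + t \<or> x + y = e + (s + t)" using U1 by (auto simp: ac_simps)
            then show "x + y \<in> ?U" by (elim disjE) simp_all
          qed
          have UV': "?U \<subseteq> V" using U1 UV eV V by auto
          have "U1 \<inter> (\<lambda>u. e + u) ` U1 = {}"
          proof -
            have False if "s \<in> U1" "e + s \<in> U1" for s
            proof -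
              have "s + (e + s) \<in> U1" using that U1 gsub_add by blast
              then show False using eU U1 by (auto simp: ac_simps)
            qed
            then show ?thesis by auto
          qed
          then have "card ?U = card U1 + card U1"
            using card_image[of "\<lambda>u. e + u" U1] finite_subset[OF subset_trans[OF U1(2) UV] V(2)]
            by (subst card_Un_disjoint) (auto simp: inj_on_def)
          then have cU: "card ?U = 2 ^ a" using U1 Suc by simp
          have Q0: "Q u = 0" if "u \<in> ?U" for u
          proof -
            have "Q (e + s) = 0" if s: "s \<in> U1" for s
            proof -
              have sU: "s \<in> U" "s \<in> V" using s U1 UV by auto
              then show ?thesis using quad_add[OF Q V(1) eV(1) sU(2)] QU[OF sU(1)] rad[OF eV(1) sU(1)] Qe by simp
            qed
            then show ?thesis using that U1 QU by auto
          qed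
          have "e \<in> ?U" using U1 gsub0 by (metis UnCI add.right_neutral image_eqI)
          moreover have "polar Q f e = 1" using Qe by (simp add: polar_def ac_simps)
          ultimately show ?thesis
            using kernel_outside_polar_radical[OF V(1,2) Q gU UV' Q0 eV(2)] goal[OF _ cU] by blast
        qed
      qed
    qed
  qed
qed

text \<open>Splitting off a hyperbolic pair \<open>e\<close>, \<open>f\<close> with \<open>A(e,f) = 1\<close> lowers the dimension by two and keeps the kernel.\<close>
lemma alternating_nullity_parity:
  assumes "gsub V" "finite V" "quad V (\<lambda>_. 0) A" "card V = 2 ^ r" "card (lker V A) = 2 ^ a"
  shows "even (a + r)"
  using assms
proof (induction r arbitrary: V rule: less_induct)
  case (less r)
  note V = less.prems(1,2) and A = less.prems(3)
  note bi = quadD(1)[OF A]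
  show ?case
  proof (cases "\<exists>e\<in>V. \<exists>f\<in>V. A e f = 1")
    case False
    then have "A x y = 0" if "x \<in> V" "y \<in> V" for x y using that by (cases "A x y") auto
    then have "lker V A = V" by (auto simp: lker_def)
    then show ?thesis using less.prems by simp
  next
    case True
    then obtain e f where ef: "e \<in> V" "f \<in> V" "A e f = 1" by blast
    have fe: "A f e = 1" using quad_alternating[OF A V(1)] ef by metis
    have ee: "A e e = 0" "A f f = 0" using quadD(2)[OF A] ef by metis+
    let ?V1 = "{x\<in>V. A x e = 0}"
    let ?V2 = "{x\<in>?V1. A x f = 0}"
    have c1: "card V = 2 * card ?V1" "gsub ?V1"
      using card_hyperplane[OF V biadd_add_l[OF bi ef(1)] ef(2) fe] gsub_kernel[OF V(1) biadd_add_l[OF bi ef(1)]] by auto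
    have ad: "additive_on ?V1 (\<lambda>x. A x f)" by (rule additive_on_subset[OF biadd_add_l[OF bi ef(2)]]) auto
    have c2: "card ?V1 = 2 * card ?V2" "gsub ?V2"
      using card_hyperplane[OF c1(2) _ ad, of e] gsub_kernel[OF c1(2) ad] V ef ee by auto
    have sub: "?V2 \<subseteq> V" by auto
    have lk: "lker ?V2 A = lker V A"
    proof (intro equalityI subsetI)
      fix x assume "x \<in> lker V A"
      then show "x \<in> lker ?V2 A" using ef by (auto simp: lker_def)
    next
      fix x assume x: "x \<in> lker ?V2 A"
      then have xV: "x \<in> V" and x0: "\<And>y. y \<in> ?V2 \<Longrightarrow> A x y = 0" and xe: "A x e = 0" "A x f = 0"
        by (auto simp: lker_def)
      have "A x y = 0" if y: "y \<in> V" for y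
      proof -
        \<comment> \<open>The component of \<open>y\<close> in the span of \<open>e\<close> and \<open>f\<close>.\<close>
        define z where "z = sel (A y f) e + sel (A y e) f"
        have zV: "sel c e \<in> V" "sel c f \<in> V" for c using ef V by (auto simp: sel_def)
        have s: "A (sel c e) g = c * A e g" "A (sel c f) g = c * A f g" "A x (sel c e) = 0" "A x (sel c f) = 0"
          if "g \<in> V" for c g
          using biadd_0l[OF bi V(1) that] biadd_0r[OF bi V(1) xV] xe by (auto simp: sel_def)
        have zz: "z \<in> V" using zV V by (simp add: z_def)
        have "A (y + z) e = 0" "A (y + z) f = 0"
          using y zz zV ef s fe ee by (simp_all add: biadd_l[OF bi] z_def V)
        then have "A x (y + z) = 0" using x0[of "y + z"] y zz V by simp
        moreover have "A x z = 0" using s[OF xV] zV xV by (simp add: z_def biadd_r[OF bi])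
        ultimately show ?thesis using biadd_r[OF bi y zz xV] by simp
      qed
      then show "x \<in> lker V A" using xV by (simp add: lker_def)
    qed
    have "(2::nat) ^ r = 4 * card ?V2" using c1 c2 less.prems(4) by simp
    moreover have "r \<noteq> 0" using calculation by (intro notI) simp
    moreover have "r \<noteq> 1" using calculation by (intro notI) simp
    ultimately have s: "r = Suc (Suc (r - 2))" by arith
    define s where "s = r - 2"
    have s: "r = Suc (Suc s)" using s by (simp add: s_def)
    have "card ?V2 = 2 ^ s" using \<open>(2::nat) ^ r = 4 * card ?V2\<close> by (simp add: s)
    note s = s this
    have "even (a + s)"
      using less.IH[of s ?V2] s c2(2) V(2) quad_subset[OF A sub] less.prems(5) lk by auto
    then show ?thesis using s by simp
  qed
qed

text \<open>The upper bound, the parity condition and the value on a hyperbolic plane are all visible on the left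
  kernel, which is isotropic; the converse is \<open>form_with_kernel_dim\<close>.\<close>
theorem nullity_spectrum:
  assumes V: "gsub V" "finite V" "card V = 2 ^ r" and Q: "quad V Q B0"
    and U0: "gsub U0" "U0 \<subseteq> V" "card U0 = 2 ^ \<rho>" "\<And>u. u \<in> U0 \<Longrightarrow> Q u = 0"
    and mx: "\<And>U. gsub U \<Longrightarrow> U \<subseteq> V \<Longrightarrow> (\<And>u. u \<in> U \<Longrightarrow> Q u = 0) \<Longrightarrow> card U \<le> 2 ^ \<rho>"
  shows "(\<exists>B. quad V Q B \<and> card (lker V B) = 2 ^ a) \<longleftrightarrow>
    a \<le> \<rho> \<and> (\<rho> = r \<longrightarrow> even (a + r)) \<and> ((\<exists>e f. hyperbolic_plane V Q e f) \<longrightarrow> a = 1)"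
proof
  assume "\<exists>B. quad V Q B \<and> card (lker V B) = 2 ^ a"
  then obtain B where B: "quad V Q B" "card (lker V B) = 2 ^ a" by blast
  have "Q u = 0" if "u \<in> lker V B" for u using that quadD(2)[OF B(1)] by (simp add: lker_def)
  then have "(2::nat) ^ a \<le> 2 ^ \<rho>"
    using mx[OF gsub_lker[OF V(1) quadD(1)[OF B(1)]]] B(2) by (simp add: lker_def)
  then have "a \<le> \<rho>" by (simp add: power_increasing_iff)
  moreover have "even (a + r)" if "\<rho> = r"
  proof -
    have "U0 = V" using card_subset_eq[OF V(2) U0(2)] U0 V that by simp
    then have "quad V (\<lambda>_. 0) B" using B(1) quad_cong[of V Q "\<lambda>_. 0"] U0(4) by blast
    then show ?thesis using alternating_nullity_parity[OF V(1,2) _ V(3) B(2)] by blast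
  qed
  moreover have "a = 1" if ef: "hyperbolic_plane V Q e f" for e f
  proof -
    have X: "e \<noteq> 0" "f \<noteq> 0" "e \<noteq> f" "V = {0, e, f, e + f}" "Q e = 0" "Q f = 0" "Q (e + f) = 1"
      using ef by (auto simp: hyperbolic_plane_def)
    note bi = quadD(1)[OF B(1)]
    have ef: "e \<in> V" "f \<in> V" using X by auto
    have d: "B e e = 0" "B f f = 0" using X quadD(2)[OF B(1)] ef by metis+
    have "polar Q e f = B e f + B f e" by (rule quad_polar[OF B(1) V(1) ef])
    then have s: "B e f + B f e = 1" using X by (simp add: polar_def)
    note v = biadd_l[OF bi ef] biadd_r[OF bi ef] biadd_0l[OF bi V(1)] biadd_0r[OF bi V(1)]
    have ne: "e + f \<noteq> 0" using X by (simp add: add_eq_0_iff_eq)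
    have "card (lker V B) = 2"
    proof (cases "B e f")
      case zero
      then have "lker V B = {0, e}"
        using s d ef v gsub0[OF V(1)] X(1-3) ne by (auto simp: lker_def X(4))
      then show ?thesis using X by simp
    next
      case one
      then have "lker V B = {0, f}"
        using s d ef v gsub0[OF V(1)] X(1-3) ne by (auto simp: lker_def X(4))
      then show ?thesis using X by simp
    qed
    then show ?thesis using B(2) by (metis power_one_right power_inject_exp one_less_numeral_iff semiring_norm(76))
  qed
  ultimately show "a \<le> \<rho> \<and> (\<rho> = r \<longrightarrow> even (a + r)) \<and> ((\<exists>e f. hyperbolic_plane V Q e f) \<longrightarrow> a = 1)" by blast
next
  assume "a \<le> \<rho> \<and> (\<rho> = r \<longrightarrow> even (a + r)) \<and> ((\<exists>e f. hyperbolic_plane V Q e f) \<longrightarrow> a = 1)"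
  then show "\<exists>B. quad V Q B \<and> card (lker V B) = 2 ^ a"
    using form_with_kernel_dim[OF V Q U0 mx] by blast
qed

section \<open>Coordinates over the field of two elements\<close>
lemma F2_field: "field F2"
  by (rule class_field)

lemma F2_simps [simp]: "carrier F2 = UNIV" "\<zero>\<^bsub>F2\<^esub> = 0" "\<one>\<^bsub>F2\<^esub> = 1" "x \<oplus>\<^bsub>F2\<^esub> y = x + y" "x \<otimes>\<^bsub>F2\<^esub> y = x * y"
  by (simp_all add: class_ring_simps)

text \<open>An axiomatisation of vector spaces over the two-element field without scalars: the laws for the
  scalar action reduce to \<open>x + x = 0\<close>.\<close>
definition F2_axioms :: "(bit, 'v, 'n) module_scheme \<Rightarrow> bool" where
  "F2_axioms W \<longleftrightarrow> \<zero>\<^bsub>W\<^esub> \<in> carrier W \<and>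
     (\<forall>x\<in>carrier W. \<forall>y\<in>carrier W. x \<oplus>\<^bsub>W\<^esub> y \<in> carrier W \<and> x \<oplus>\<^bsub>W\<^esub> y = y \<oplus>\<^bsub>W\<^esub> x) \<and>
     (\<forall>x\<in>carrier W. \<forall>y\<in>carrier W. \<forall>z\<in>carrier W. (x \<oplus>\<^bsub>W\<^esub> y) \<oplus>\<^bsub>W\<^esub> z = x \<oplus>\<^bsub>W\<^esub> (y \<oplus>\<^bsub>W\<^esub> z)) \<and>
     (\<forall>x\<in>carrier W. x \<oplus>\<^bsub>W\<^esub> \<zero>\<^bsub>W\<^esub> = x \<and> x \<oplus>\<^bsub>W\<^esub> x = \<zero>\<^bsub>W\<^esub> \<and> 0 \<odot>\<^bsub>W\<^esub> x = \<zero>\<^bsub>W\<^esub> \<and> 1 \<odot>\<^bsub>W\<^esub> x = x)"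

lemma vectorspace_F2_iff: "vectorspace F2 W \<longleftrightarrow> F2_axioms W"
proof
  assume "vectorspace F2 W"
  then interpret vectorspace F2 W .
  have "x \<oplus>\<^bsub>W\<^esub> x = \<zero>\<^bsub>W\<^esub>" if x: "x \<in> carrier W" for x
  proof -
    have "(1 + 1::bit) \<odot>\<^bsub>W\<^esub> x = 1 \<odot>\<^bsub>W\<^esub> x \<oplus>\<^bsub>W\<^esub> 1 \<odot>\<^bsub>W\<^esub> x"
      using smult_l_distr[of 1 1 x] x by simp
    then show ?thesis using smult_one[OF x] smult_l_null[OF x] by simp
  qed
  then show "F2_axioms W"
    using smult_one smult_l_null by (auto simp: F2_axioms_def M.a_ac)
next
  assume W: "F2_axioms W"
  have c: "c = 0 \<or> c = 1" for c :: bit by (cases c) auto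
  show "vectorspace F2 W"
  proof (rule vs_criteria[OF F2_field])
    show "\<forall>v\<in>carrier W. \<exists>neg_v\<in>carrier W. v \<oplus>\<^bsub>W\<^esub> neg_v = \<zero>\<^bsub>W\<^esub>" using W by (auto simp: F2_axioms_def)
    have "c \<odot>\<^bsub>W\<^esub> v = (if c = 0 then \<zero>\<^bsub>W\<^esub> else v)" if "v \<in> carrier W" for c v
      using W c[of c] that by (auto simp: F2_axioms_def)
    moreover have "\<zero>\<^bsub>W\<^esub> \<oplus>\<^bsub>W\<^esub> v = v" if "v \<in> carrier W" for v using W that by (metis F2_axioms_def)
    ultimately show "\<forall>a b v. a \<in> carrier F2 \<and> b \<in> carrier F2 \<and> v \<in> carrier W \<longrightarrow> (a \<otimes>\<^bsub>F2\<^esub> b) \<odot>\<^bsub>W\<^esub> v = a \<odot>\<^bsub>W\<^esub> (b \<odot>\<^bsub>W\<^esub> v)"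
      "\<forall>a b v. a \<in> carrier F2 \<and> b \<in> carrier F2 \<and> v \<in> carrier W \<longrightarrow> (a \<oplus>\<^bsub>F2\<^esub> b) \<odot>\<^bsub>W\<^esub> v = a \<odot>\<^bsub>W\<^esub> v \<oplus>\<^bsub>W\<^esub> b \<odot>\<^bsub>W\<^esub> v"
      "\<forall>a v w. a \<in> carrier F2 \<and> v \<in> carrier W \<and> w \<in> carrier W \<longrightarrow> a \<odot>\<^bsub>W\<^esub> (v \<oplus>\<^bsub>W\<^esub> w) = a \<odot>\<^bsub>W\<^esub> v \<oplus>\<^bsub>W\<^esub> a \<odot>\<^bsub>W\<^esub> w"
      "\<forall>c v. c \<in> carrier F2 \<and> v \<in> carrier W \<longrightarrow> c \<odot>\<^bsub>W\<^esub> v \<in> carrier W"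
      using W by (auto simp: F2_axioms_def add_eq_0_iff_eq)
  qed (use W in \<open>auto simp: F2_axioms_def\<close>)
qed

lemma F2_subspace_iff:
  assumes W: "vectorspace F2 W"
  shows "VectorSpace.subspace F2 U W \<longleftrightarrow> U \<subseteq> carrier W \<and> \<zero>\<^bsub>W\<^esub> \<in> U \<and> (\<forall>x\<in>U. \<forall>y\<in>U. x \<oplus>\<^bsub>W\<^esub> y \<in> U)"
proof -
  interpret vectorspace F2 W by fact
  have c: "c = 0 \<or> c = 1" for c :: bit by (cases c) auto
  show ?thesis
  proof
    assume "VectorSpace.subspace F2 U W"
    then have s: "submodule F2 U W" by (simp add: VectorSpace.subspace_def)
    then show "U \<subseteq> carrier W \<and> \<zero>\<^bsub>W\<^esub> \<in> U \<and> (\<forall>x\<in>U. \<forall>y\<in>U. x \<oplus>\<^bsub>W\<^esub> y \<in> U)"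
      by (auto simp: submodule_def)
  next
    assume U: "U \<subseteq> carrier W \<and> \<zero>\<^bsub>W\<^esub> \<in> U \<and> (\<forall>x\<in>U. \<forall>y\<in>U. x \<oplus>\<^bsub>W\<^esub> y \<in> U)"
    have "c \<odot>\<^bsub>W\<^esub> x \<in> U" if "x \<in> U" for c x
      using c[of c] U that W[unfolded vectorspace_F2_iff] by (auto simp: F2_axioms_def)
    then have "submodule F2 U W"
      unfolding submodule_def using U module_axioms by auto
    then show "VectorSpace.subspace F2 U W" using W by (simp add: VectorSpace.subspace_def)
  qed
qed

lemma F2_subspace_vectorspace: "vectorspace F2 W \<Longrightarrow> VectorSpace.subspace F2 U W \<Longrightarrow> vectorspace F2 (W\<lparr>carrier := U\<rparr>)"
  by (auto simp: vectorspace_F2_iff F2_subspace_iff F2_axioms_def subset_iff)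

text \<open>Polynomials over the two-element field serve as an ambient group that contains spaces of every finite
  dimension; the coordinates with respect to a basis become coefficients.\<close>
lemma F2_coordinates:
  assumes W: "vectorspace F2 W" "vectorspace.fin_dim F2 W"
  obtains T :: "'v \<Rightarrow> bit poly" where "inj_on T (carrier (W :: (bit,'v,'n) module_scheme))"
    "\<And>x y. x \<in> carrier W \<Longrightarrow> y \<in> carrier W \<Longrightarrow> T (x \<oplus>\<^bsub>W\<^esub> y) = T x + T y"
    "finite (carrier W)" "card (carrier W) = 2 ^ vectorspace.dim F2 W"
proof -
  interpret vectorspace F2 W by fact
  obtain A where A: "finite A" "basis A" using finite_basis_exists[OF W(2)] by blast
  have AW: "A \<subseteq> carrier W" using A by (simp add: basis_def)
  have ex1: "\<exists>!a. a \<in> A \<rightarrow>\<^sub>E UNIV \<and> lincomb a A = v" if "v \<in> carrier W" for v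
    using A AW basis_criterion[OF A(1) AW] that by simp
  define co where "co v = (THE a. a \<in> A \<rightarrow>\<^sub>E UNIV \<and> lincomb a A = v)" for v
  have co: "co v \<in> A \<rightarrow>\<^sub>E UNIV" "lincomb (co v) A = v" if "v \<in> carrier W" for v
    using theI'[OF ex1[OF that]] by (auto simp: co_def)
  have co_eq: "co v = a" if "v \<in> carrier W" "a \<in> A \<rightarrow>\<^sub>E UNIV" "lincomb a A = v" for v a
    using ex1[OF that(1)] co[OF that(1)] that by blast
  have co_add: "co (x \<oplus>\<^bsub>W\<^esub> y) a = co x a + co y a" if "x \<in> carrier W" "y \<in> carrier W" "a \<in> A" for x y a
  proof -
    have "lincomb (restrict (\<lambda>a. co x a + co y a) A) A = lincomb (\<lambda>a. co x a \<oplus>\<^bsub>F2\<^esub> co y a) A"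
      by (rule lincomb_cong[OF refl AW]) auto
    also have "\<dots> = lincomb (co x) A \<oplus>\<^bsub>W\<^esub> lincomb (co y) A"
      by (rule lincomb_sum[OF A(1) AW]) auto
    also have "\<dots> = x \<oplus>\<^bsub>W\<^esub> y" using co that by simp
    finally have "co (x \<oplus>\<^bsub>W\<^esub> y) = restrict (\<lambda>a. co x a + co y a) A"
      using that by (intro co_eq) auto
    then show ?thesis using that by simp
  qed
  obtain i where i: "inj_on (i :: 'v \<Rightarrow> nat) A" using finite_imp_inj_to_nat_seg[OF A(1)] by blast
  define T :: "'v \<Rightarrow> bit poly" where "T v = (\<Sum>a\<in>A. Polynomial.monom (co v a) (i a))" for v
  have coT: "Polynomial.coeff (T v) (i a) = co v a" if "a \<in> A" for v a
  proof -
    have "Polynomial.coeff (T v) (i a) = (\<Sum>b\<in>A. if b = a then co v b else 0)"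
      unfolding T_def Polynomial.coeff_sum using i that by (intro sum.cong) (auto simp: inj_on_def)
    then show ?thesis using A(1) that by (simp add: sum.delta')
  qed
  show thesis
  proof
    show "inj_on T (carrier W)"
    proof (rule inj_onI)
      fix x y assume xy: "x \<in> carrier W" "y \<in> carrier W" "T x = T y"
      then have "co x a = co y a" if "a \<in> A" for a using coT[OF that] by metis
      then have "co x = co y" by (rule PiE_ext[OF co(1)[OF xy(1)] co(1)[OF xy(2)]])
      then show "x = y" using co xy by metis
    qed
    show "T (x \<oplus>\<^bsub>W\<^esub> y) = T x + T y" if "x \<in> carrier W" "y \<in> carrier W" for x y
      using that by (simp add: T_def co_add sum.distrib Polynomial.add_monom [symmetric])
    have bij: "bij_betw co (carrier W) (A \<rightarrow>\<^sub>E UNIV)"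
    proof (rule bij_betwI[where g = "\<lambda>a. lincomb a A"])
      show "co \<in> carrier W \<rightarrow> A \<rightarrow>\<^sub>E UNIV" using co by auto
      show "(\<lambda>a. lincomb a A) \<in> (A \<rightarrow>\<^sub>E UNIV) \<rightarrow> carrier W" using AW by (auto intro!: lincomb_closed)
      show "lincomb (co x) A = x" if "x \<in> carrier W" for x using co that by simp
      show "co (lincomb a A) = a" if "a \<in> A \<rightarrow>\<^sub>E UNIV" for a
        using that AW by (intro co_eq lincomb_closed) auto
    qed
    have "c \<in> {0, 1}" for c :: bit by (cases c) auto
    then have ub: "(UNIV :: bit set) = {0, 1}" by blast
    have f: "finite (A \<rightarrow>\<^sub>E (UNIV::bit set))" using A(1) by (intro finite_PiE) (auto simp: ub)
    then show "finite (carrier W)" using bij_betw_finite[OF bij] by simp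
    have "card (UNIV :: bit set) = 2" by (simp add: ub)
    then show "card (carrier W) = 2 ^ vectorspace.dim F2 W"
      using bij_betw_same_card[OF bij] dim_basis[OF A] A(1) by (simp add: card_PiE)
  qed
qed

lemma F2_fin_dim: "vectorspace F2 W \<Longrightarrow> finite (carrier W) \<Longrightarrow> vectorspace.fin_dim F2 W"
proof -
  assume W: "vectorspace F2 W" "finite (carrier W)"
  interpret vectorspace F2 W by fact
  have "span (carrier W) = carrier W"
    using span_is_subset2[of "carrier W"] in_own_span[of "carrier W"] by blast
  then show ?thesis unfolding fin_dim_def using W by blast
qed

lemma F2_card_dim:
  assumes "vectorspace F2 W" "finite (carrier W)"
  shows "card (carrier W) = 2 ^ vectorspace.dim F2 W"
  using F2_coordinates[OF assms(1) F2_fin_dim[OF assms]] by metis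

lemma F2_dim_eq: "vectorspace F2 W \<Longrightarrow> finite (carrier W) \<Longrightarrow> card (carrier W) = 2 ^ k \<Longrightarrow> vectorspace.dim F2 W = k"
  using F2_card_dim[of W] by simp

text \<open>Transport of a finite space to a subgroup \<open>V\<close> of the polynomials, with inverse \<open>S\<close>.\<close>
locale F2_coords =
  fixes W :: "(bit,'v,'n) module_scheme" and T :: "'v \<Rightarrow> bit poly"
  assumes W: "vectorspace F2 W" "finite (carrier W)" and T: "inj_on T (carrier W)"
    "\<And>x y. x \<in> carrier W \<Longrightarrow> y \<in> carrier W \<Longrightarrow> T (x \<oplus>\<^bsub>W\<^esub> y) = T x + T y"
begin

definition "V = T ` carrier W"
definition "S = the_inv_into (carrier W) T"

lemma ax: "F2_axioms W" using W vectorspace_F2_iff by blast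
lemma zero_W [simp]: "\<zero>\<^bsub>W\<^esub> \<in> carrier W" using ax by (simp add: F2_axioms_def)
lemma add_W [simp]: "x \<in> carrier W \<Longrightarrow> y \<in> carrier W \<Longrightarrow> x \<oplus>\<^bsub>W\<^esub> y \<in> carrier W" using ax by (simp add: F2_axioms_def)
lemma T_zero [simp]: "T \<zero>\<^bsub>W\<^esub> = 0"
  using T(2)[OF zero_W zero_W] ax by (simp add: F2_axioms_def)
lemma S_T [simp]: "x \<in> carrier W \<Longrightarrow> S (T x) = x" using T by (simp add: S_def the_inv_into_f_f)
lemma T_S [simp]: "v \<in> V \<Longrightarrow> T (S v) = v" by (auto simp: V_def)
lemma S_W [simp]: "v \<in> V \<Longrightarrow> S v \<in> carrier W" by (auto simp: V_def)
lemma T_V [simp]: "x \<in> carrier W \<Longrightarrow> T x \<in> V" by (auto simp: V_def)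
lemma T_eq [simp]: "x \<in> carrier W \<Longrightarrow> y \<in> carrier W \<Longrightarrow> T x = T y \<longleftrightarrow> x = y" using T inj_on_eq_iff by metis
lemma gsub_T: "U \<subseteq> carrier W \<Longrightarrow> \<zero>\<^bsub>W\<^esub> \<in> U \<Longrightarrow> (\<forall>x\<in>U. \<forall>y\<in>U. x \<oplus>\<^bsub>W\<^esub> y \<in> U) \<Longrightarrow> gsub (T ` U)"
proof (rule gsubI)
  assume U: "U \<subseteq> carrier W" "\<zero>\<^bsub>W\<^esub> \<in> U" "\<forall>x\<in>U. \<forall>y\<in>U. x \<oplus>\<^bsub>W\<^esub> y \<in> U"
  then show "0 \<in> T ` U" by (metis T_zero image_eqI)
  show "a + b \<in> T ` U" if ab: "a \<in> T ` U" "b \<in> T ` U" for a b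
  proof -
    obtain x y where "x \<in> U" "y \<in> U" "a = T x" "b = T y" using ab by auto
    then show ?thesis using U T(2)[of x y] by (metis image_eqI subsetD)
  qed
qed
lemma V: "gsub V" "finite V" "card V = 2 ^ vectorspace.dim F2 W"
  using gsub_T[of "carrier W"] W card_image[OF T(1)] F2_card_dim by (auto simp: V_def)
lemma S_add [simp]: "u \<in> V \<Longrightarrow> v \<in> V \<Longrightarrow> S (u + v) = S u \<oplus>\<^bsub>W\<^esub> S v"
  using T(2)[of "S u" "S v"] S_T[of "S u \<oplus>\<^bsub>W\<^esub> S v"] by simp
lemma S_zero [simp]: "S 0 = \<zero>\<^bsub>W\<^esub>" using S_T[OF zero_W] by simp

lemma bilinear_form_iff: "bilinear_form F2 W B \<longleftrightarrow> biadditive_on V (\<lambda>u v. B (S u) (S v))"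
proof
  assume "bilinear_form F2 W B"
  then show "biadditive_on V (\<lambda>u v. B (S u) (S v))"
    by (intro biadditive_onI) (simp_all add: bilinear_form_def)
next
  assume b: "biadditive_on V (\<lambda>u v. B (S u) (S v))"
  have l: "B (x \<oplus>\<^bsub>W\<^esub> y) z = B x z + B y z" "B z (x \<oplus>\<^bsub>W\<^esub> y) = B z x + B z y"
    if "x \<in> carrier W" "y \<in> carrier W" "z \<in> carrier W" for x y z
    using biadd_l[OF b, of "T x" "T y" "T z"] biadd_r[OF b, of "T x" "T y" "T z"] that T_V by simp_all
  have z: "B \<zero>\<^bsub>W\<^esub> z = 0" "B z \<zero>\<^bsub>W\<^esub> = 0" if "z \<in> carrier W" for z
    using biadd_0l[OF b V(1), of "T z"] biadd_0r[OF b V(1), of "T z"] that by simp_all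
  have sm: "c \<odot>\<^bsub>W\<^esub> x = (if c = 0 then \<zero>\<^bsub>W\<^esub> else x)" if "x \<in> carrier W" for c x
    using ax that by (cases c) (auto simp: F2_axioms_def)
  show "bilinear_form F2 W B"
    unfolding bilinear_form_def using l z sm by auto
qed

text \<open>The map \<open>x \<mapsto> B(x, -)\<close> has the left kernel as kernel and a space of dimension equal to the rank as image.\<close>
lemma bilinear_null_eq:
  assumes B: "bilinear_form F2 W B" and a: "card (lker V (\<lambda>u v. B (S u) (S v))) = 2 ^ a"
  shows "bilinear_null F2 W B = a"
proof -
  let ?f = "\<lambda>x. restrict (B x) (carrier W)"
  let ?I = "ring.func_space F2 (carrier W)\<lparr>carrier := ?f ` carrier W\<rparr>"
  note bi = B[unfolded bilinear_form_iff]
  have R: "ring F2" using F2_field by (simp add: field_def domain_def cring_def)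
  have f: "vectorspace F2 ?I"
  proof -
    interpret VS: vectorspace F2 W by (rule W(1))
    let ?M = "ring.func_space F2 (carrier W)"
    have z: "\<zero>\<^bsub>?M\<^esub> = ?f \<zero>\<^bsub>W\<^esub>"
    proof -
      have "B \<zero>\<^bsub>W\<^esub> y = 0" if "y \<in> carrier W" for y
        using biadd_0l[OF bi V(1) T_V[OF that]] that by simp
      then show ?thesis unfolding ring.func_space_def[OF R] by (auto intro!: restrict_ext)
    qed
    have a: "?f x \<oplus>\<^bsub>?M\<^esub> ?f y = ?f (x \<oplus>\<^bsub>W\<^esub> y)" if "x \<in> carrier W" "y \<in> carrier W" for x y
      unfolding ring.func_space_def[OF R] using B that by (auto simp: bilinear_form_def intro!: restrict_ext)
    have sm: "1 \<odot>\<^bsub>?M\<^esub> ?f x = ?f x" "0 \<odot>\<^bsub>?M\<^esub> ?f x = \<zero>\<^bsub>?M\<^esub>" for x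
      unfolding ring.func_space_def[OF R] by (auto intro!: restrict_ext)
    have c: "carrier ?I = ?f ` carrier W" by simp
    show ?thesis
      unfolding vectorspace_F2_iff F2_axioms_def c
      using ax[unfolded F2_axioms_def] by (simp add: z a sm imageI VS.M.a_ac del: restrict_apply)
  qed
  let ?L = "lker V (\<lambda>u v. B (S u) (S v))"
  have "card V = card ((\<lambda>u. ?f (S u)) ` V) * card ?L"
  proof (rule card_image_fibres[OF V(1,2)])
    show "?L \<subseteq> V" by (auto simp: lker_def)
    show "?f (S u) = ?f (S v) \<longleftrightarrow> u + v \<in> ?L" if uv: "u \<in> V" "v \<in> V" for u v
    proof -
      have "?f (S u) = ?f (S v) \<longleftrightarrow> (\<forall>w\<in>V. B (S u) (S w) = B (S v) (S w))"
      proof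
        assume "?f (S u) = ?f (S v)"
        then have "?f (S u) (S w) = ?f (S v) (S w)" for w by simp
        then show "\<forall>w\<in>V. B (S u) (S w) = B (S v) (S w)" by (metis S_W restrict_apply')
      next
        assume a: "\<forall>w\<in>V. B (S u) (S w) = B (S v) (S w)"
        have "B (S u) y = B (S v) y" if "y \<in> carrier W" for y using a T_V[OF that] S_T[OF that] by metis
        then show "?f (S u) = ?f (S v)" by (intro restrict_ext)
      qed
      also have "\<dots> \<longleftrightarrow> (\<forall>w\<in>V. B (S (u + v)) (S w) = 0)"
        using biadd_l[OF bi uv] by (simp add: add_eq_0_iff_eq)
      finally show ?thesis using uv V by (simp add: lker_def del: S_add)
    qed
  qed
  moreover have "(\<lambda>u. ?f (S u)) ` V = carrier ?I" by (force simp: V_def)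
  ultimately have "card V = card (carrier ?I) * 2 ^ a" using a by simp
  moreover have "card (carrier ?I) = 2 ^ vectorspace.dim F2 ?I"
    by (rule F2_card_dim[OF f]) (use W in simp)
  ultimately have "(2::nat) ^ vectorspace.dim F2 W = 2 ^ (vectorspace.dim F2 ?I + a)"
    using V(3) by (simp add: power_add)
  then have "vectorspace.dim F2 W = vectorspace.dim F2 ?I + a" by (simp add: power_inject_exp)
  then show ?thesis by (simp add: bilinear_null_def bilinear_rank_def)
qed

lemma form_nullities_iff:
  "a \<in> form_nullities F2 W Q \<longleftrightarrow> (\<exists>B. quad V (\<lambda>v. Q (S v)) B \<and> card (lker V B) = 2 ^ a)"
proof
  assume "a \<in> form_nullities F2 W Q"
  then obtain B where B: "bilinear_form F2 W B" "\<forall>x\<in>carrier W. Q x = B x x" "a = bilinear_null F2 W B"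
    by (auto simp: form_nullities_def)
  let ?B = "\<lambda>u v. B (S u) (S v)"
  have bi: "biadditive_on V ?B" using B bilinear_form_iff by blast
  obtain k where k: "card (lker V ?B) = 2 ^ k"
    using card_gsub_power[OF gsub_lker[OF V(1) bi]] finite_subset[OF _ V(2), of "lker V ?B"]
    by (auto simp: lker_def)
  then have "a = k" using bilinear_null_eq[OF B(1)] B(3) by simp
  then show "\<exists>B. quad V (\<lambda>v. Q (S v)) B \<and> card (lker V B) = 2 ^ a"
    using k bi B(2) by (intro exI[of _ ?B]) (simp add: quad_def)
next
  assume "\<exists>B. quad V (\<lambda>v. Q (S v)) B \<and> card (lker V B) = 2 ^ a"
  then obtain B where B: "quad V (\<lambda>v. Q (S v)) B" "card (lker V B) = 2 ^ a" by blast
  let ?B = "\<lambda>x y. B (T x) (T y)"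
  have "biadditive_on V (\<lambda>u v. ?B (S u) (S v))"
    using quadD(1)[OF B(1)] V(1) by (simp add: biadditive_on_def additive_on_def del: S_add)
  then have b: "bilinear_form F2 W ?B" using bilinear_form_iff by blast
  have "lker V (\<lambda>u v. ?B (S u) (S v)) = lker V B" by (auto simp: lker_def)
  then have "bilinear_null F2 W ?B = a" using bilinear_null_eq[OF b] B(2) by simp
  moreover have "\<forall>x\<in>carrier W. Q x = ?B x x" using quadD(2)[OF B(1) T_V] by simp
  ultimately show "a \<in> form_nullities F2 W Q" using b by (auto simp: form_nullities_def)
qed

end

section \<open>Nullities of a quadratic form\<close>
context F2_coords
begin

text \<open>The vectors \<open>e\<close> and \<open>f\<close> correspond to the two unit vectors.\<close>
lemma hyperbolic_plane_iff:
  assumes Q0: "Q \<zero>\<^bsub>W\<^esub> = 0"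
  shows "quadratic_form_iso F2 W Q (module_vec TYPE(bit) 2) X_form \<longleftrightarrow>
    (\<exists>e f. hyperbolic_plane V (\<lambda>v. Q (S v)) e f)"
proof
  assume "quadratic_form_iso F2 W Q (module_vec TYPE(bit) 2) X_form"
  then obtain g where g: "linear_map F2 W (module_vec TYPE(bit) 2) g"
    and bij: "bij_betw g (carrier W) (carrier_vec 2)" and Xg: "\<And>x. x \<in> carrier W \<Longrightarrow> X_form (g x) = Q x"
    by (auto simp: quadratic_form_iso_def module_vec_simps)
  interpret g: linear_map F2 W "module_vec TYPE(bit) 2" g by fact
  have ga: "g (x \<oplus>\<^bsub>W\<^esub> y) = g x + g y" if "x \<in> carrier W" "y \<in> carrier W" for x y
    using g.T_add[OF that] by (simp add: module_vec_simps)
  obtain e where e: "e \<in> carrier W" "g e = unit_vec 2 0" using bij unit_vec_carrier by (metis bij_betw_imp_surj_on imageE)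
  obtain f where f: "f \<in> carrier W" "g f = unit_vec 2 1" using bij unit_vec_carrier by (metis bij_betw_imp_surj_on imageE)
  have inj: "x = y" if "x \<in> carrier W" "y \<in> carrier W" "g x = g y" for x y
    using bij that by (meson bij_betw_imp_inj_on inj_onD)
  have v2: "v = w \<longleftrightarrow> v $ 0 = w $ 0 \<and> v $ 1 = w $ 1" if "v \<in> carrier_vec 2" "w \<in> carrier_vec 2" for v w :: "bit vec"
  proof
    assume a: "v $ 0 = w $ 0 \<and> v $ 1 = w $ 1"
    show "v = w"
    proof (rule eq_vecI)
      fix i assume "i < dim_vec w"
      then have "i = 0 \<or> i = 1" using that(2) less_2_cases by auto
      then show "v $ i = w $ i" using a by auto
    qed (use that in auto)
  qed simp
  have gc: "g x \<in> carrier_vec 2" if "x \<in> carrier W" for x using bij that by (metis bij_betwE)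
  have g0: "g \<zero>\<^bsub>W\<^esub> = 0\<^sub>v 2" using g.T0_is_0 by (simp add: module_vec_simps)
  have u: "unit_vec 2 0 $ 0 = (1::bit)" "unit_vec 2 0 $ 1 = (0::bit)" "unit_vec 2 1 $ 0 = (0::bit)" "unit_vec 2 1 $ 1 = (1::bit)"
    by auto
  have gef: "g (e \<oplus>\<^bsub>W\<^esub> f) = unit_vec 2 0 + unit_vec 2 1" by (simp only: ga[OF e(1) f(1)] e(2) f(2))
  have c: "(c::bit) = 0 \<or> c = 1" for c by (cases c) auto
  have "x \<in> {\<zero>\<^bsub>W\<^esub>, e, f, e \<oplus>\<^bsub>W\<^esub> f}" if x: "x \<in> carrier W" for x
  proof -
    have "g x \<in> {0\<^sub>v 2, unit_vec 2 0, unit_vec 2 1, unit_vec 2 0 + unit_vec 2 1}"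
      using c[of "g x $ 0"] c[of "g x $ 1"] gc[OF x] by (auto simp: v2 u)
    then have "g x \<in> {g \<zero>\<^bsub>W\<^esub>, g e, g f, g (e \<oplus>\<^bsub>W\<^esub> f)}" using g0 e f gef by simp
    then show ?thesis using inj[OF x] e f by auto
  qed
  then have cW: "carrier W = {\<zero>\<^bsub>W\<^esub>, e, f, e \<oplus>\<^bsub>W\<^esub> f}" using e f by auto
  have "V = T ` {\<zero>\<^bsub>W\<^esub>, e, f, e \<oplus>\<^bsub>W\<^esub> f}" unfolding V_def by (simp only: cW[symmetric])
  then have "V = {0, T e, T f, T e + T f}" using T(2)[OF e(1) f(1)] by simp
  moreover have "Q e = 0" "Q f = 0" "Q (e \<oplus>\<^bsub>W\<^esub> f) = 1"
    using Xg[OF e(1)] Xg[OF f(1)] Xg[OF add_W[OF e(1) f(1)]] e f gef by (auto simp: X_form_def module_vec_simps)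
  moreover have "e \<noteq> \<zero>\<^bsub>W\<^esub>" "f \<noteq> \<zero>\<^bsub>W\<^esub>" "e \<noteq> f" using e f g0 u by (metis index_zero_vec(1) pos2 one_less_numeral_iff semiring_norm(76) zero_neq_one)+
  ultimately have "hyperbolic_plane V (\<lambda>v. Q (S v)) (T e) (T f)"
    using e f T_zero T_eq[OF e(1) zero_W] T_eq[OF f(1) zero_W] by (simp add: hyperbolic_plane_def)
  then show "\<exists>e f. hyperbolic_plane V (\<lambda>v. Q (S v)) e f" by blast
next
  assume "\<exists>e f. hyperbolic_plane V (\<lambda>v. Q (S v)) e f"
  then obtain e f where "hyperbolic_plane V (\<lambda>v. Q (S v)) e f" by blast
  then have X: "e \<noteq> 0" "f \<noteq> 0" "e \<noteq> f" "V = {0, e, f, e + f}" "Q (S e) = 0" "Q (S f) = 0" "Q (S (e + f)) = 1"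
    by (auto simp: hyperbolic_plane_def)
  have ef: "e \<in> V" "f \<in> V" using X by auto
  obtain m :: "bit poly \<Rightarrow> bit" where m: "additive_on V m" "m e = 1" "m f = 0"
    using functional_values2[OF V(1,2) ef(1) X(1) ef(2) X(2)] X(3) by metis
  obtain n :: "bit poly \<Rightarrow> bit" where n: "additive_on V n" "n e = 0" "n f = 1"
    using functional_values2[OF V(1,2) ef(1) X(1) ef(2) X(2)] X(3) by metis
  have m0: "m 0 = 0" "n 0 = 0" "m (e + f) = 1" "n (e + f) = 1"
    using additive_on_0[OF m(1) V(1)] additive_on_0[OF n(1) V(1)]
      additive_onD[OF m(1) ef] additive_onD[OF n(1) ef] m n by auto
  define g where "g x = vec 2 (\<lambda>i. if i = 0 then m (T x) else n (T x))" for x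
  have gi: "g x $ 0 = m (T x)" "g x $ 1 = n (T x)" "dim_vec (g x) = 2" for x by (simp_all add: g_def)
  have i2: "i < 2 \<longleftrightarrow> i = 0 \<or> i = 1" for i :: nat by auto
  have gadd: "g (x \<oplus>\<^bsub>W\<^esub> y) = g x + g y" if "x \<in> carrier W" "y \<in> carrier W" for x y
    by (rule eq_vecI) (use that in \<open>auto simp: g_def T(2) additive_onD[OF m(1)] additive_onD[OF n(1)]\<close>)
  have g0: "g \<zero>\<^bsub>W\<^esub> = 0\<^sub>v 2" by (rule eq_vecI) (auto simp: g_def m0)
  have gsm: "g (c \<odot>\<^bsub>W\<^esub> x) = c \<cdot>\<^sub>v g x" if "x \<in> carrier W" for c x
  proof (cases c)
    case zero
    have "0 \<cdot>\<^sub>v g x = 0\<^sub>v 2" by (rule eq_vecI) (auto simp: gi)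
    moreover have "0 \<odot>\<^bsub>W\<^esub> x = \<zero>\<^bsub>W\<^esub>" using ax that by (simp add: F2_axioms_def)
    ultimately show ?thesis using g0 zero by simp
  next
    case one then show ?thesis using ax that by (simp add: F2_axioms_def)
  qed
  have lin: "linear_map F2 W (module_vec TYPE(bit) 2) g"
  proof -
    have "g \<in> LinearCombinations.module_hom F2 W (module_vec TYPE(bit) 2)"
      unfolding LinearCombinations.module_hom_def using gadd gsm by (auto simp: module_vec_simps g_def)
    then show ?thesis
      unfolding linear_map_def mod_hom_def mod_hom_axioms_def
      using W(1) vectorspace.axioms(1)[OF W(1)] vec_vs vec_module by blast
  qed
  have memV: "T x = 0 \<or> T x = e \<or> T x = f \<or> T x = e + f" if "x \<in> carrier W" for x
    using T_V[OF that] X(4) by blast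
  have "bij_betw g (carrier W) (carrier_vec 2)"
    unfolding bij_betw_def
  proof
    show "inj_on g (carrier W)"
    proof (rule inj_onI)
      fix x y assume xy: "x \<in> carrier W" "y \<in> carrier W" "g x = g y"
      then have "m (T x) = m (T y)" "n (T x) = n (T y)" using gi by metis+
      then have "T x = T y" using memV[OF xy(1)] memV[OF xy(2)] m n m0 by auto
      then show "x = y" using xy by simp
    qed
    show "g ` carrier W = carrier_vec 2"
    proof (intro equalityI subsetI)
      fix v :: "bit vec" assume v: "v \<in> carrier_vec 2"
      have c: "(c::bit) = 0 \<or> c = 1" for c by (cases c) auto
      have "\<exists>u\<in>V. m u = v $ 0 \<and> n u = v $ 1"
        using c[of "v $ 0"] c[of "v $ 1"] X(4) m n m0 by auto
      then obtain u where u: "u \<in> V" "m u = v $ 0" "n u = v $ 1" by blast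
      have "g (S u) = v" by (rule eq_vecI) (use u v i2 in \<open>auto simp: g_def\<close>)
      then show "v \<in> g ` carrier W" using u by force
    qed (auto simp: g_def)
  qed
  moreover have "X_form (g x) = Q x" if x: "x \<in> carrier W" for x
  proof -
    have "Q (S (T x)) = m (T x) * n (T x)" using memV[OF x] X m n m0 Q0 by auto
    then show ?thesis using x by (simp add: X_form_def gi del: One_nat_def)
  qed
  ultimately show "quadratic_form_iso F2 W Q (module_vec TYPE(bit) 2) X_form"
    unfolding quadratic_form_iso_def using lin by (intro exI[of _ g]) (auto simp: module_vec_simps)
qed

text \<open>The maximum that defines the isotropy index is attained, and is a maximum over the isotropic subgroups
  of \<open>V\<close>, so that \<open>nullity_spectrum\<close> applies in coordinates.\<close>
theorem form_nullities_eq_S_set: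
  assumes q: "quadratic_form F2 W Q"
  shows "form_nullities F2 W Q = S_set W Q (isotropy_index F2 W Q) (vectorspace.dim F2 W)"
proof -
  obtain B0 where B0: "bilinear_form F2 W B0" "\<forall>x\<in>carrier W. Q x = B0 x x" using q by (auto simp: quadratic_form_def)
  have qd: "quad V (\<lambda>v. Q (S v)) (\<lambda>u v. B0 (S u) (S v))"
    using B0 bilinear_form_iff by (simp add: quad_def)
  have Q0: "Q \<zero>\<^bsub>W\<^esub> = 0" using quad_0[OF qd V(1)] by simp
  define D where "D = {vectorspace.dim F2 (W\<lparr>carrier := U\<rparr>) | U. VectorSpace.subspace F2 U W \<and> (\<forall>x\<in>U. Q x = \<zero>\<^bsub>F2\<^esub>)}"
  have sub: "gsub (T ` U) \<and> T ` U \<subseteq> V \<and> card (T ` U) = 2 ^ vectorspace.dim F2 (W\<lparr>carrier := U\<rparr>)"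
    if U: "VectorSpace.subspace F2 U W" for U
  proof -
    have U': "U \<subseteq> carrier W" "\<zero>\<^bsub>W\<^esub> \<in> U" "\<forall>x\<in>U. \<forall>y\<in>U. x \<oplus>\<^bsub>W\<^esub> y \<in> U" using U F2_subspace_iff[OF W(1)] by auto
    have "card (T ` U) = card U" using card_image inj_on_subset[OF T(1) U'(1)] by blast
    moreover have "card U = 2 ^ vectorspace.dim F2 (W\<lparr>carrier := U\<rparr>)"
      using F2_card_dim[OF F2_subspace_vectorspace[OF W(1) U]] finite_subset[OF U'(1) W(2)] by simp
    ultimately show ?thesis using gsub_T[OF U'] U'(1) by (auto simp: V_def)
  qed
  have "D \<subseteq> {.. vectorspace.dim F2 W}"
  proof
    fix d assume "d \<in> D"
    then obtain U where U: "VectorSpace.subspace F2 U W" "d = vectorspace.dim F2 (W\<lparr>carrier := U\<rparr>)" by (auto simp: D_def)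
    then have "(2::nat) ^ d \<le> 2 ^ vectorspace.dim F2 W" using sub[OF U(1)] V card_mono[OF V(2)] by metis
    then show "d \<in> {.. vectorspace.dim F2 W}" by (simp add: power_increasing_iff)
  qed
  then have fD: "finite D" by (rule finite_subset) simp
  have "VectorSpace.subspace F2 {\<zero>\<^bsub>W\<^esub>} W" using F2_subspace_iff[OF W(1)] ax by (simp add: F2_axioms_def)
  then have "D \<noteq> {}" unfolding D_def using Q0 by fastforce
  then have "Max D \<in> D" using fD by (rule Max_in[rotated])
  define \<rho> where "\<rho> = isotropy_index F2 W Q"
  have \<rho>: "\<rho> = Max D" by (simp add: \<rho>_def isotropy_index_def D_def)
  then obtain U where U: "VectorSpace.subspace F2 U W" "\<forall>x\<in>U. Q x = 0" "\<rho> = vectorspace.dim F2 (W\<lparr>carrier := U\<rparr>)"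
    using \<open>Max D \<in> D\<close> by (auto simp: D_def)
  have UW: "U \<subseteq> carrier W" using U F2_subspace_iff[OF W(1)] by auto
  have U1: "gsub (T ` U)" "T ` U \<subseteq> V" "card (T ` U) = 2 ^ \<rho>" using sub[OF U(1)] U(3) by auto
  have U2: "Q (S u) = 0" if "u \<in> T ` U" for u using that U(2) UW by auto
  have mx: "card G \<le> 2 ^ \<rho>" if G: "gsub G" "G \<subseteq> V" "\<And>u. u \<in> G \<Longrightarrow> Q (S u) = 0" for G
  proof -
    have SG: "VectorSpace.subspace F2 (S ` G) W"
      unfolding F2_subspace_iff[OF W(1)]
    proof (intro conjI ballI)
      show "S ` G \<subseteq> carrier W" using G by auto
      show "\<zero>\<^bsub>W\<^esub> \<in> S ` G" using gsub0[OF G(1)] S_zero by (metis image_eqI)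
      fix x y assume "x \<in> S ` G" "y \<in> S ` G"
      then obtain u v where uv: "u \<in> G" "v \<in> G" "x = S u" "y = S v" by auto
      then have "S (u + v) = x \<oplus>\<^bsub>W\<^esub> y" using G(2) by (intro trans[OF S_add]) auto
      then show "x \<oplus>\<^bsub>W\<^esub> y \<in> S ` G" using gsub_add[OF G(1) uv(1,2)] by (metis image_eqI)
    qed
    have "T ` S ` G = G" using G(2) by (force simp: image_iff)
    then have "card G = 2 ^ vectorspace.dim F2 (W\<lparr>carrier := S ` G\<rparr>)" using sub[OF SG] by simp
    moreover have "vectorspace.dim F2 (W\<lparr>carrier := S ` G\<rparr>) \<in> D" using SG G(3) by (auto simp: D_def)
    ultimately show ?thesis using fD \<rho> by (simp add: power_increasing_iff)
  qed
  have r2: "vectorspace.dim F2 W = 2" if "hyperbolic_plane V (\<lambda>v. Q (S v)) e f" for e f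
  proof -
    have "card V = 4" "e + f \<noteq> 0" using that by (auto simp: hyperbolic_plane_def add_eq_0_iff_eq)
    then have "(2::nat) ^ vectorspace.dim F2 W = 2 ^ 2" using V(3) by simp
    then show ?thesis by (simp only: power_inject_exp)
  qed
  have "a \<in> form_nullities F2 W Q \<longleftrightarrow> a \<in> S_set W Q \<rho> (vectorspace.dim F2 W)" for a
  proof -
    have "a \<in> form_nullities F2 W Q \<longleftrightarrow> a \<le> \<rho> \<and> (\<rho> = vectorspace.dim F2 W \<longrightarrow> even (a + vectorspace.dim F2 W)) \<and>
        ((\<exists>e f. hyperbolic_plane V (\<lambda>v. Q (S v)) e f) \<longrightarrow> a = 1)"
      unfolding form_nullities_iff by (rule nullity_spectrum[OF V qd U1 U2 mx])
    moreover have "even (a + d) \<longleftrightarrow> [a = d] (mod 2)" for d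
      unfolding cong_def by presburger
    ultimately show ?thesis
      using r2 hyperbolic_plane_iff[of Q, OF Q0] by (simp add: S_set_def) blast
  qed
  then show ?thesis unfolding \<rho>_def by blast
qed

end

theorem nullities_of_quadratic_form:
  assumes "vectorspace F2 W" "finite (carrier W)" "quadratic_form F2 W Q"
  shows "form_nullities F2 W Q = S_set W Q (isotropy_index F2 W Q) (vectorspace.dim F2 W)"
proof -
  obtain T :: "'a \<Rightarrow> bit poly" where T: "inj_on T (carrier W)"
    "\<And>x y. x \<in> carrier W \<Longrightarrow> y \<in> carrier W \<Longrightarrow> T (x \<oplus>\<^bsub>W\<^esub> y) = T x + T y"
    using F2_coordinates[OF assms(1) F2_fin_dim[OF assms(1,2)]] by metis
  have "F2_coords W T" unfolding F2_coords_def using assms(1,2) T by blast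
  then interpret F2_coords W T .
  show ?thesis by (rule form_nullities_eq_S_set[OF assms(3)])
qed

lemma nullity_in_form_nullities:
  assumes "vectorspace F2 W" "finite (carrier W)" "bilinear_form F2 W B" "\<And>x. x \<in> carrier W \<Longrightarrow> Q x = B x x"
    and c: "card {x \<in> carrier W. \<forall>y\<in>carrier W. B x y = 0} = 2 ^ a"
  shows "a \<in> form_nullities F2 W Q"
proof -
  obtain T :: "'a \<Rightarrow> bit poly" where T: "inj_on T (carrier W)"
    "\<And>x y. x \<in> carrier W \<Longrightarrow> y \<in> carrier W \<Longrightarrow> T (x \<oplus>\<^bsub>W\<^esub> y) = T x + T y"
    using F2_coordinates[OF assms(1) F2_fin_dim[OF assms(1,2)]] by metis
  have "F2_coords W T" unfolding F2_coords_def using assms(1,2) T by blast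
  then interpret F2_coords W T .
  have "lker V (\<lambda>u v. B (S u) (S v)) = T ` {x \<in> carrier W. \<forall>y\<in>carrier W. B x y = 0}"
    by (force simp: lker_def V_def)
  then have "card (lker V (\<lambda>u v. B (S u) (S v))) = 2 ^ a"
    using c card_image inj_on_subset[OF T(1)] by (metis (no_types, lifting) mem_Collect_eq subsetI)
  then have "bilinear_null F2 W B = a" using bilinear_null_eq assms(3) by blast
  then show ?thesis using assms by (auto simp: form_nullities_def)
qed

section \<open>Legendre symbols and the quartic symbol\<close>

text \<open>Collects facts on the Legendre symbol modulo one odd prime.\<close>
locale odd_prime =
  fixes p :: nat
  assumes p: "prime p" "2 < p"
begin

lemma pint: "prime (int p)" using p by simp

lemma Legendre_values: "Legendre a p \<in> {-1, 0, 1}"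
  by (auto simp: Legendre_def)

lemma Legendre_eqI:
  assumes "[Legendre a p = e] (mod int p)" "e \<in> {-1, 0, 1}" shows "Legendre a p = e"
proof (rule ccontr)
  assume ne: "Legendre a p \<noteq> e"
  have "int p dvd Legendre a p - e" using assms(1) by (simp add: cong_iff_dvd_diff)
  then have "int p \<le> \<bar>Legendre a p - e\<bar>" using ne dvd_imp_le_int[of "Legendre a p - e" "int p"] by simp
  moreover have "\<bar>Legendre a p - e\<bar> \<le> 2" using Legendre_values[of a] assms(2) by auto
  ultimately show False using p by simp
qed

lemma Legendre_mult: "Legendre (a * b) p = Legendre a p * Legendre b p"
proof (rule Legendre_eqI)
  have "[Legendre (a * b) p = (a * b) ^ ((p - 1) div 2)] (mod int p)" by (rule euler_criterion[OF p])
  moreover have "[Legendre a p * Legendre b p = a ^ ((p - 1) div 2) * b ^ ((p - 1) div 2)] (mod int p)"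
    by (intro cong_mult euler_criterion[OF p])
  ultimately show "[Legendre (a * b) p = Legendre a p * Legendre b p] (mod int p)"
    by (metis cong_sym cong_trans power_mult_distrib)
  show "Legendre a p * Legendre b p \<in> {-1, 0, 1}" using Legendre_values[of a] Legendre_values[of b] by auto
qed

lemma Legendre_cong:
  assumes "[a = b] (mod int p)" shows "Legendre a p = Legendre b p"
proof -
  have "[a = 0] (mod int p) \<longleftrightarrow> [b = 0] (mod int p)" "\<And>c. [c = a] (mod int p) \<longleftrightarrow> [c = b] (mod int p)"
    using assms by (simp_all add: cong_def)
  then show ?thesis by (simp add: Legendre_def QuadRes_def)
qed

lemma Legendre_0_iff: "Legendre a p = 0 \<longleftrightarrow> int p dvd a"
  by (auto simp: Legendre_def cong_0_iff)

lemma Legendre_1_iff: "Legendre a p = 1 \<longleftrightarrow> \<not> int p dvd a \<and> (\<exists>y. [y\<^sup>2 = a] (mod int p))"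
  by (auto simp: Legendre_def QuadRes_def cong_0_iff)

lemma Legendre_square: "\<not> int p dvd a \<Longrightarrow> Legendre (a\<^sup>2) p = 1"
  unfolding Legendre_1_iff using pint by (auto simp: prime_dvd_power_iff intro!: exI[of _ a])

lemma Legendre_self_square: "\<not> int p dvd a \<Longrightarrow> Legendre a p * Legendre a p = 1"
  using Legendre_square[of a] by (simp add: power2_eq_square Legendre_mult)

lemma Legendre_one [simp]: "Legendre 1 p = 1"
  using Legendre_square[of 1] p by simp

lemma Legendre_unit_cases: "\<not> int p dvd a \<Longrightarrow> Legendre a p = 1 \<or> Legendre a p = -1"
  using Legendre_values[of a] Legendre_0_iff[of a] by auto

lemma Legendre_cancel_square: "\<not> int p dvd b \<Longrightarrow> Legendre (a * b\<^sup>2) p = Legendre a p"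
  by (simp add: Legendre_mult Legendre_square)

lemma Legendre_minus_one: "Legendre (-1) p = (-1) ^ ((p - 1) div 2)"
proof (rule Legendre_eqI)
  show "[Legendre (-1) p = (-1) ^ ((p - 1) div 2)] (mod int p)" using euler_criterion[OF p, of "-1"] by simp
  show "(-1::int) ^ ((p - 1) div 2) \<in> {-1, 0, 1}" by (cases "even ((p - 1) div 2)") auto
qed

lemma Legendre_minus_one_1: "[p = 1] (mod 4) \<Longrightarrow> Legendre (-1) p = 1"
proof -
  assume "[p = 1] (mod 4)"
  then have "even ((p - 1) div 2)" unfolding cong_def by presburger
  then show ?thesis by (simp add: Legendre_minus_one)
qed

lemma sqrt_minus_one:
  assumes "[p = 1] (mod 4)"
  obtains i where "[i\<^sup>2 = -1] (mod int p)"
  using Legendre_minus_one_1[OF assms] Legendre_1_iff by auto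

lemma fermat: "\<not> int p dvd a \<Longrightarrow> [a ^ (p - 1) = 1] (mod int p)"
proof -
  assume a: "\<not> int p dvd a"
  have "[a ^ ((p - 1) div 2) = Legendre a p] (mod int p)" using euler_criterion[OF p] cong_sym by blast
  then have "[(a ^ ((p - 1) div 2))\<^sup>2 = (Legendre a p)\<^sup>2] (mod int p)" by (rule cong_pow)
  moreover have "(a ^ ((p - 1) div 2))\<^sup>2 = a ^ (p - 1)"
    using prime_odd_nat[OF p(1)] p(2) by (simp add: power_mult[symmetric])
  moreover have "(Legendre a p)\<^sup>2 = 1" using Legendre_unit_cases[OF a] by auto
  ultimately show ?thesis by simp
qed

text \<open>With a square root \<open>i\<close> of \<open>-1\<close>, the numbers \<open>2\<close> and \<open>-4\<close> are a unit times a square and a fourth power: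
  \<open>(1 + i)\<^sup>2 = 2i\<close> and \<open>(1 + i)\<^sup>4 = -4\<close>.\<close>
lemma two_via_i:
  assumes i: "[i\<^sup>2 = -1] (mod int p)"
  shows "[2 = - i * (1 + i)\<^sup>2] (mod int p)" "[-4 = (1 + i) ^ 4] (mod int p)" "\<not> int p dvd 1 + i"
proof -
  obtain k where k: "i\<^sup>2 = -1 + int p * k" 
  proof -
    have "int p dvd i\<^sup>2 + 1" using i by (simp add: cong_iff_dvd_diff)
    then obtain k where "i\<^sup>2 + 1 = int p * k" by (auto elim: dvdE)
    then show thesis using that[of k] by (simp add: algebra_simps)
  qed
  have "2 - (- i * (1 + i)\<^sup>2) = 2 + i + 2 * i\<^sup>2 + i * i\<^sup>2" by (simp add: power2_eq_square algebra_simps)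
  also have "\<dots> = int p * (k * (2 + i))" unfolding k by (simp add: algebra_simps)
  finally show "[2 = - i * (1 + i)\<^sup>2] (mod int p)" by (simp add: cong_iff_dvd_diff)
  have "-4 - (1 + i) ^ 4 = -4 - (1 + 2 * i + i\<^sup>2)\<^sup>2" by (simp add: power2_eq_square power4_eq_xxxx algebra_simps)
  also have "\<dots> = -4 - (int p * k + 2 * i)\<^sup>2" unfolding k by (simp add: add.commute)
  also have "\<dots> = -4 - 4 * i\<^sup>2 - int p * (k * (4 * i + int p * k))" by (simp add: power2_eq_square algebra_simps)
  also have "\<dots> = int p * (- 4 * k - k * (4 * i + int p * k))" unfolding k by (simp add: algebra_simps)
  finally show 4: "[-4 = (1 + i) ^ 4] (mod int p)" by (simp add: cong_iff_dvd_diff)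
  show "\<not> int p dvd 1 + i"
  proof
    assume "int p dvd 1 + i"
    then have "int p dvd (1 + i) ^ 4" using dvd_trans[OF _ dvd_power[of 4 "1 + i"]] by simp
    then have "int p dvd - 4" using 4 cong_dvd_iff by blast
    then have "int p dvd 2 ^ 2" by simp
    then have "int p dvd 2" using pint prime_dvd_power by blast
    then show False using p(2) zdvd_imp_le[of "int p" 2] by simp
  qed
qed

text \<open>By \<open>2 = -i (1 + i)\<^sup>2\<close> the symbol of \<open>2\<close> is that of \<open>-i\<close>, which Euler's criterion evaluates.\<close>
lemma Legendre_two:
  assumes "[p = 1] (mod 4)"
  shows "Legendre 2 p = (if p mod 8 = 1 then 1 else -1)"
proof -
  obtain i where i: "[i\<^sup>2 = -1] (mod int p)" using sqrt_minus_one[OF assms] .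
  have "Legendre 2 p = Legendre (- i) p"
    using Legendre_cong[OF two_via_i(1)[OF i]] Legendre_cancel_square[OF two_via_i(3)[OF i], of "- i"] by (simp only:)
  also have "\<dots> = (if p mod 8 = 1 then 1 else -1)"
  proof (rule Legendre_eqI)
    have k: "\<exists>k. (p - 1) div 2 = 2 * k" using assms unfolding cong_def by presburger
    then obtain k where k: "(p - 1) div 2 = 2 * k" by blast
    have A: "[Legendre (- i) p = (- i) ^ (2 * k)] (mod int p)" using euler_criterion[OF p, of "- i"] k by simp
    have B: "(- i) ^ (2 * k) = (i\<^sup>2) ^ k" by (simp add: power_mult)
    have C: "[(i\<^sup>2) ^ k = (-1) ^ k] (mod int p)" by (rule cong_pow[OF i])
    have D: "(-1 :: int) ^ k = (if p mod 8 = 1 then 1 else -1)"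
    proof -
      have "even k \<longleftrightarrow> p mod 8 = 1" using k assms p(2) unfolding cong_def by presburger
      then show ?thesis by simp
    qed
    show "[Legendre (- i) p = (if p mod 8 = 1 then 1 else -1)] (mod int p)"
      using cong_trans[OF A[unfolded B] C] unfolding D .
  qed simp
  finally show ?thesis .
qed

text \<open>Raise the congruence to the power \<open>(p - 1)/4\<close>. Squares turn into Legendre symbols by Euler's criterion,
  and \<open>-4\<close> disappears since it is a fourth power modulo \<open>p\<close>.\<close>
lemma quartic_symbol_prime_eq:
  assumes p4: "[p = 1] (mod 4)" and e: "[m * v\<^sup>2 = - 4 * a\<^sup>2] (mod int p)" and na: "\<not> int p dvd a"
  shows "quartic_symbol_prime m p = Legendre a p * Legendre v p"
proof -
  have "4 dvd p - 1" using p4 p(2) unfolding cong_def by presburger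
  then obtain k where k: "p - 1 = 4 * k" by blast
  obtain i where i: "[i\<^sup>2 = -1] (mod int p)" using sqrt_minus_one[OF p4] .
  have "\<not> int p dvd v"
  proof
    assume "int p dvd v"
    then have "int p dvd m * v\<^sup>2" by (simp add: dvd_power dvd_mult power2_eq_square)
    then have d: "int p dvd -4 * a\<^sup>2" using e cong_dvd_iff by blast
    have "[-4 * a\<^sup>2 = (1 + i) ^ 4 * a\<^sup>2] (mod int p)" using two_via_i(2)[OF i] by (intro cong_mult) auto
    then have "int p dvd (1 + i) ^ 4 * a\<^sup>2" using d cong_dvd_iff by blast
    then show False using pint two_via_i(3)[OF i] na by (metis prime_dvd_mult_iff prime_dvd_power_iff zero_less_numeral)
  qed
  then have v1: "Legendre v p * Legendre v p = 1" "Legendre v p = 1 \<or> Legendre v p = -1"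
    using Legendre_self_square Legendre_unit_cases by auto
  have v: "[(v\<^sup>2) ^ k = Legendre v p] (mod int p)" and a: "[(a\<^sup>2) ^ k = Legendre a p] (mod int p)"
    using euler_criterion[OF p, of v] euler_criterion[OF p, of a] k by (auto simp: power_mult[symmetric] cong_sym)
  have "[(-4) ^ k = ((1 + i) ^ 4) ^ k] (mod int p)" by (rule cong_pow[OF two_via_i(2)[OF i]])
  moreover have "((1 + i) ^ 4) ^ k = (1 + i) ^ (p - 1)" by (simp only: k power_mult)
  ultimately have f: "[(-4) ^ k = 1] (mod int p)" using fermat[OF two_via_i(3)[OF i]] by (metis cong_trans)
  have "[(m * v\<^sup>2) ^ k = (-4 * a\<^sup>2) ^ k] (mod int p)" by (rule cong_pow[OF e])
  then have "[m ^ k * (v\<^sup>2) ^ k = (-4) ^ k * (a\<^sup>2) ^ k] (mod int p)" by (simp only: power_mult_distrib)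
  moreover have "[(-4) ^ k * (a\<^sup>2) ^ k = 1 * Legendre a p] (mod int p)" by (intro cong_mult f a)
  moreover have "[m ^ k * (v\<^sup>2) ^ k = m ^ k * Legendre v p] (mod int p)" by (intro cong_mult v) auto
  ultimately have "[m ^ k * Legendre v p = Legendre a p] (mod int p)" by (metis cong_sym cong_trans mult_1)
  then have "[m ^ k * Legendre v p * Legendre v p = Legendre a p * Legendre v p] (mod int p)" by (intro cong_mult) auto
  then have mk: "[Legendre a p * Legendre v p = m ^ k] (mod int p)" using v1(1) by (simp add: mult.assoc cong_sym)
  have kk: "(p - 1) div 4 = k" using k by simp
  show ?thesis
    unfolding quartic_symbol_prime_def kk
  proof (rule the_equality)
    show "Legendre a p * Legendre v p \<in> {1, -1} \<and> [Legendre a p * Legendre v p = m ^ k] (mod int p)"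
      using mk v1(2) Legendre_unit_cases[OF na] by auto
    show "e = Legendre a p * Legendre v p" if "e \<in> {1, -1} \<and> [e = m ^ k] (mod int p)" for e
    proof (rule ccontr)
      assume ne: "e \<noteq> Legendre a p * Legendre v p"
      have "[e = Legendre a p * Legendre v p] (mod int p)" using that mk cong_sym cong_trans by blast
      then have "int p dvd e - Legendre a p * Legendre v p" by (simp add: cong_iff_dvd_diff)
      then have "int p \<le> \<bar>e - Legendre a p * Legendre v p\<bar>" using ne dvd_imp_le_int[of "e - Legendre a p * Legendre v p" "int p"] by simp
      moreover have "\<bar>e - Legendre a p * Legendre v p\<bar> \<le> 2" using v1(2) Legendre_unit_cases[OF na] that by auto
      ultimately show False using p(2) by simp
    qed
  qed
qed

end

lemma Legendre_reciprocity_1: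
  assumes "prime (p::nat)" "2 < p" "prime (q::nat)" "2 < q" "p \<noteq> q" "[q = 1] (mod 4)"
  shows "Legendre p q = Legendre q p"
proof -
  interpret p: odd_prime p by standard fact+
  interpret q: odd_prime q by standard fact+
  have "even ((q - 1) div 2)" using assms(6) unfolding cong_def by presburger
  then have "even ((p - 1) div 2 * ((q - 1) div 2))" by simp
  then have e: "Legendre p q * Legendre q p = 1" using Quadratic_Reciprocity[OF assms(1-5)] by simp
  then show ?thesis using p.Legendre_values[of q] q.Legendre_values[of p] by auto
qed

text \<open>The sign from reciprocity is the Legendre symbol of \<open>-1\<close>.\<close>
lemma Legendre_reciprocity_3:
  assumes "prime (p::nat)" "2 < p" "prime (q::nat)" "2 < q" "p \<noteq> q" "[q = 3] (mod 4)"
  shows "Legendre p q = Legendre (- int q) p"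
proof -
  interpret p: odd_prime p by standard fact+
  interpret q: odd_prime q by standard fact+
  have o: "odd ((q - 1) div 2)" using assms(6) unfolding cong_def by presburger
  have "(-1::int) ^ ((p - 1) div 2 * ((q - 1) div 2)) = (-1) ^ ((p - 1) div 2)"
    using o by (cases "even ((p - 1) div 2)") (auto simp: power_mult)
  also have "\<dots> = Legendre (-1) p" by (simp add: p.Legendre_minus_one)
  finally have e: "Legendre p q * Legendre q p = Legendre (-1) p" using Quadratic_Reciprocity[OF assms(1-5)] by simp
  have "\<not> int p dvd q" using assms by (metis int_dvd_int_iff primes_dvd_imp_eq)
  then have "Legendre q p * Legendre q p = 1" by (rule p.Legendre_self_square)
  then have "Legendre p q = Legendre (-1) p * Legendre q p" using e by (metis mult.assoc mult.right_neutral)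
  also have "\<dots> = Legendre (- int q) p" using p.Legendre_mult[of "-1" q] by simp
  finally show ?thesis .
qed

lemma (in odd_prime) Legendre_prod: "finite A \<Longrightarrow> Legendre (\<Prod>x\<in>A. f x) p = (\<Prod>x\<in>A. Legendre (f x) p)"
  by (induction A rule: finite_induct) (simp_all add: Legendre_mult)

lemma prime_1_mod_4_gt_2: "prime (p::nat) \<Longrightarrow> [p = 1] (mod 4) \<Longrightarrow> 2 < p"
proof -
  assume p: "prime p" "[p = 1] (mod 4)"
  have "p \<noteq> 2" using p(2) by (auto simp: cong_def)
  then show ?thesis using prime_ge_2_nat[OF p(1)] by simp
qed

text \<open>For \<open>S\<close> the set of prime factors of a squarefree number this is the Jacobi symbol.\<close>
definition jac :: "int \<Rightarrow> nat set \<Rightarrow> int" where "jac a S = (\<Prod>q\<in>S. Legendre a q)"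

lemma Legendre_two_prod:
  assumes "finite S" "\<And>q. q \<in> S \<Longrightarrow> prime q \<and> [q = 1] (mod 4)"
  shows "[\<Prod>S = 1] (mod 4)" "jac 2 S = (if \<Prod>S mod 8 = 1 then 1 else -1)"
proof -
  have "[\<Prod>S = 1] (mod 4) \<and> jac 2 S = (if \<Prod>S mod 8 = 1 then 1 else -1)"
    using assms
  proof (induction S rule: finite_induct)
    case empty then show ?case by (simp add: jac_def)
  next
    case (insert q S)
    interpret odd_prime q by standard (use insert prime_1_mod_4_gt_2 in auto)
    have IH: "[\<Prod>S = 1] (mod 4)" "jac 2 S = (if \<Prod>S mod 8 = 1 then 1 else -1)" using insert by auto
    have q: "[q = 1] (mod 4)" using insert by auto
    have l: "Legendre 2 q = (if q mod 8 = 1 then 1 else -1)" by (rule Legendre_two[OF q])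
    have m: "(q * \<Prod>S) mod 8 = ((q mod 8) * (\<Prod>S mod 8)) mod 8" by (simp add: mod_mult_eq)
    have c: "q mod 8 = 1 \<or> q mod 8 = 5" "\<Prod>S mod 8 = 1 \<or> \<Prod>S mod 8 = 5"
      using q IH(1) unfolding cong_def by presburger+
    have "[q * \<Prod>S = 1 * 1] (mod 4)" by (intro cong_mult q IH)
    then show ?case using insert(1,2) l IH(2) c m by (auto simp: jac_def)
  qed
  then show "[\<Prod>S = 1] (mod 4)" "jac 2 S = (if \<Prod>S mod 8 = 1 then 1 else -1)" by auto
qed

locale primes_1_mod_4 =
  fixes S :: "nat set"
  assumes S: "finite S" "\<And>q. q \<in> S \<Longrightarrow> prime q" "\<And>q. q \<in> S \<Longrightarrow> [q = 1] (mod 4)"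
begin

lemma S_odd: "q \<in> S \<Longrightarrow> odd_prime q"
  using S prime_1_mod_4_gt_2 by (simp add: odd_prime_def)

lemma jac_mult: "jac (a * b) S = jac a S * jac b S"
  unfolding jac_def prod.distrib[symmetric] by (rule prod.cong) (auto simp: odd_prime.Legendre_mult[OF S_odd])

lemma jac_one: "jac 1 S = 1"
  unfolding jac_def by (rule prod.neutral) (auto simp: odd_prime.Legendre_one[OF S_odd])

lemma jac_minus: "jac (- a) S = jac a S"
proof -
  have "jac (-1) S = 1" unfolding jac_def
    by (rule prod.neutral) (auto simp: odd_prime.Legendre_minus_one_1[OF S_odd S(3)])
  then show ?thesis using jac_mult[of "-1" a] by simp
qed

lemma jac_odd_prime:
  assumes l: "prime l" "2 < l" "l \<notin> S"
  shows "jac l S = Legendre (\<Prod>q\<in>S. int q) l"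
proof -
  interpret l: odd_prime l by standard fact+
  have "jac l S = (\<Prod>q\<in>S. Legendre q l)" unfolding jac_def
    by (rule prod.cong[OF refl], rule Legendre_reciprocity_1) (use l S(2,3) prime_1_mod_4_gt_2[OF S(2,3)] in auto)
  then show ?thesis using l.Legendre_prod[OF S(1)] by simp
qed

lemma jac_eq_one_of_primes:
  assumes "w > 0" "\<And>l. prime l \<Longrightarrow> l dvd w \<Longrightarrow> l \<notin> S \<and> 2 < l \<and> Legendre (\<Prod>q\<in>S. int q) l = 1"
  shows "jac (int w) S = 1"
  using assms
proof (induction w rule: less_induct)
  case (less w)
  show ?case
  proof (cases "w = 1")
    case True then show ?thesis by (simp add: jac_one)
  next
    case False
    then obtain l where l: "prime l" "l dvd w" using prime_factor_nat by blast
    then obtain v where v: "w = l * v" by (auto elim: dvdE)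
    have "jac (int v) S = 1"
    proof (rule less.IH)
      show "v < w" "v > 0" using v less.prems(1) prime_gt_1_nat[OF l(1)] by auto
    qed (use less.prems(2) v in auto)
    moreover have "jac (int l) S = 1" using less.prems(2)[OF l] jac_odd_prime[OF l(1)] by simp
    ultimately show ?thesis using v by (simp add: jac_mult)
  qed
qed

text \<open>An odd prime \<open>l\<close> dividing \<open>v\<close> makes \<open>D\<close> a square modulo \<open>l\<close>, so that reciprocity gives \<open>l\<close> the symbol 1. The
  equation modulo 32 controls the power of 2 in \<open>v\<close>: its exponent is even or \<open>D \<equiv> 1 (mod 8)\<close>, and in
  either case its symbol is 1 too.\<close>
lemma jac_second_coordinate:
  fixes u v a :: int
  defines "D \<equiv> \<Prod>q\<in>S. int q"
  assumes e: "D * u\<^sup>2 + m * v\<^sup>2 = 4 * a\<^sup>2" and a: "odd a" and m: "[m = 3] (mod 4)" and v0: "v \<noteq> 0"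
    and av: "\<And>l. prime l \<Longrightarrow> 2 < l \<Longrightarrow> int l dvd v \<Longrightarrow> \<not> int l dvd a"
    and aS: "\<And>q. q \<in> S \<Longrightarrow> \<not> int q dvd a"
  shows "jac v S = 1"
proof -
  have Dodd: "[D = 1] (mod 4)" "jac 2 S = (if D mod 8 = 1 then 1 else -1)"
  proof -
    define n where "n = \<Prod>S"
    have D: "D = int n" by (simp add: D_def n_def)
    have "[n = 1] (mod 4)" unfolding n_def by (rule Legendre_two_prod(1)) (use S in auto)
    then show "[D = 1] (mod 4)" unfolding D using cong_int_iff[of n 1 4] by simp
    have "int (n mod 8) = D mod 8" by (simp add: zmod_int D)
    then have "D mod 8 = 1 \<longleftrightarrow> n mod 8 = 1" by linarith
    then show "jac 2 S = (if D mod 8 = 1 then 1 else -1)" using Legendre_two_prod(2)[OF S(1)] S by (simp add: n_def)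
  qed
  define w where "w = nat \<bar>v\<bar>"
  have w0: "w \<noteq> 0" using v0 by (simp add: w_def)
  define k where "k = multiplicity 2 w"
  define z where "z = w div 2 ^ k"
  have kz: "w = 2 ^ k * z" "odd z"
    using multiplicity_dvd[of 2 w] multiplicity_decompose[of w 2] w0 by (simp_all add: k_def z_def)
  have jz: "jac (int z) S = 1"
  proof (rule jac_eq_one_of_primes)
    show "z > 0" using kz by (auto intro: odd_pos)
    fix l assume l: "prime l" "l dvd z"
    interpret l: odd_prime l using l kz(2) prime_ge_2_nat[OF l(1)] by unfold_locales (auto intro: le_neq_implies_less)
    have "l dvd w" using l kz by simp
    then have lv: "int l dvd v" unfolding w_def by (simp add: int_dvd_int_iff[symmetric])
    have la: "\<not> int l dvd a" using av[OF l(1) l.p(2) lv] .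
    have l4: "\<not> int l dvd (2 * a)"
    proof
      assume "int l dvd 2 * a"
      then have "int l dvd 2" using la prime_dvd_mult_iff[OF l.pint] by blast
      then show False using l.p(2) zdvd_imp_le[of "int l" 2] by simp
    qed
    have c: "[D * u\<^sup>2 = (2 * a)\<^sup>2] (mod int l)"
    proof -
      have "(2 * a)\<^sup>2 - D * u\<^sup>2 = m * v\<^sup>2" using e by (simp add: power_mult_distrib)
      moreover have "int l dvd m * v\<^sup>2" using lv by (simp add: dvd_mult power2_eq_square)
      ultimately show ?thesis by (metis cong_iff_dvd_diff cong_sym)
    qed
    have nd: "\<not> int l dvd D * u\<^sup>2" using c l4 by (metis cong_dvd_iff l.pint prime_dvd_power)
    then have lu: "\<not> int l dvd u" by (auto simp: power2_eq_square dvd_mult)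
    have "Legendre D l = Legendre (D * u\<^sup>2) l" by (simp add: l.Legendre_cancel_square[OF lu])
    also have "\<dots> = 1" using l.Legendre_cong[OF c] l.Legendre_square[OF l4] by simp
    finally have "Legendre D l = 1" .
    moreover have "l \<notin> S"
    proof
      assume "l \<in> S"
      then have "int l dvd D" unfolding D_def using S(1) by (simp add: dvd_prodI)
      then show False using nd by (simp add: dvd_mult2)
    qed
    ultimately show "l \<notin> S \<and> 2 < l \<and> Legendre (\<Prod>q\<in>S. int q) l = 1" using l.p by (simp add: D_def)
  qed
  have j2: "jac (2 ^ k) S = jac 2 S ^ k" for k by (induction k) (simp_all add: jac_one jac_mult)
  have "jac 2 S = 1 \<or> even k"
  proof -
    have "\<bar>v\<bar> = int w" by (simp add: w_def)
    then have "\<bar>v\<bar> = 2 ^ k * int z" using kz(1) by simp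
    then have vk: "v = 2 ^ k * int z \<or> v = - (2 ^ k * int z)" by linarith
    then have v2: "v\<^sup>2 = (2 ^ k * int z)\<^sup>2" by auto
    have D1: "D mod 4 = 1" and m3: "m mod 4 = 3" using Dodd m by (auto simp: cong_def)
    \<comment> \<open>Then \<open>u\<close> is twice an odd number, and division by 4 leaves a congruence between odd squares.\<close>
    have D8: "D mod 8 = 1" if k3: "k \<ge> 3"
    proof -
      obtain j where j: "k = j + 3" using k3 by (metis le_Suc_ex add.commute)
      define s where "s = 2 ^ j * int z"
      have "v\<^sup>2 = 64 * s\<^sup>2" unfolding v2 j s_def by (simp add: power_add power_mult_distrib)
      then have e1: "D * u\<^sup>2 + 64 * (m * s\<^sup>2) = 4 * a\<^sup>2" using e by (simp add: mult.left_commute)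
      have "even (D * u\<^sup>2)"
      proof -
        have "D * u\<^sup>2 = 2 * (2 * a\<^sup>2 - 32 * (m * s\<^sup>2))" using e1 by simp
        then show ?thesis by simp
      qed
      moreover have "odd D" using D1 by presburger
      ultimately have "even u" by simp
      then obtain x where x: "u = 2 * x" by blast
      have e2: "D * x\<^sup>2 + 16 * (m * s\<^sup>2) = a\<^sup>2" using e1 x by (simp add: power_mult_distrib)
      have "odd (D * x\<^sup>2)" using e2 a by (metis even_add even_mult_iff even_numeral even_power zero_less_numeral)
      then have ox: "odd x" by simp
      have sq: "y\<^sup>2 mod 8 = 1" if "odd y" for y :: int
      proof -
        obtain r where "y = 2 * r + 1" using \<open>odd y\<close> by (auto elim: oddE)
        then have "y\<^sup>2 = 4 * (r * (r + 1)) + 1" by (simp add: power2_eq_square algebra_simps)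
        moreover have "even (r * (r + 1))" by simp
        then obtain h where "r * (r + 1) = 2 * h" by blast
        ultimately have "y\<^sup>2 = 1 + 8 * h" by simp
        then show ?thesis using mod_mult_self2[of 1 8 h] by simp
      qed
      have "a\<^sup>2 = D * x\<^sup>2 + 8 * (2 * (m * s\<^sup>2))" using e2 by simp
      then have "D * x\<^sup>2 mod 8 = 1" using sq[OF a] mod_mult_self2[of "D * x\<^sup>2" 8 "2 * (m * s\<^sup>2)"] by simp
      then have "(D * (x\<^sup>2 mod 8)) mod 8 = 1" by (simp add: mod_mult_right_eq)
      then show ?thesis using sq[OF ox] by simp
    qed
    \<comment> \<open>Again division by 4 is possible, but now the remaining squares do not fit modulo 4.\<close>
    have k1: "k \<noteq> 1"
    proof
      assume k: "k = 1"
      have "v\<^sup>2 = 4 * (int z)\<^sup>2" unfolding v2 k by (simp add: power_mult_distrib)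
      then have e1: "D * u\<^sup>2 + 4 * (m * (int z)\<^sup>2) = 4 * a\<^sup>2" using e by (simp add: mult.left_commute)
      have "D * u\<^sup>2 = 2 * (2 * a\<^sup>2 - 2 * (m * (int z)\<^sup>2))" using e1 by simp
      then have "even (D * u\<^sup>2)" by simp
      moreover have "odd D" using D1 by presburger
      ultimately have "even u" by simp
      then obtain x where x: "u = 2 * x" by blast
      have e2: "D * x\<^sup>2 + m * (int z)\<^sup>2 = a\<^sup>2" using e1 x by (simp add: power_mult_distrib)
      have sq: "y\<^sup>2 mod 4 = (if even y then 0 else 1)" for y :: int
      proof (cases "even y")
        case True then show ?thesis by (auto simp: power_mult_distrib elim!: evenE)
      next
        case False
        then obtain r where "y = 2 * r + 1" by (auto elim: oddE)
        then have "y\<^sup>2 = 1 + 4 * (r * (r + 1))" by (simp add: power2_eq_square algebra_simps)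
        then have "y\<^sup>2 mod 4 = 1" using mod_mult_self2[of 1 4 "r * (r + 1)"] by simp
        then show ?thesis using False by simp
      qed
      have zz: "(int z)\<^sup>2 mod 4 = 1" using sq[of "int z"] kz(2) by simp
      have "(D * x\<^sup>2) mod 4 = ((D mod 4) * (x\<^sup>2 mod 4)) mod 4" by (simp add: mod_mult_eq)
      then have t1: "(D * x\<^sup>2) mod 4 = 0 \<or> (D * x\<^sup>2) mod 4 = 1" using D1 sq[of x] by (auto split: if_splits)
      have "(m * (int z)\<^sup>2) mod 4 = ((m mod 4) * ((int z)\<^sup>2 mod 4)) mod 4" by (simp add: mod_mult_eq)
      then have t2: "(m * (int z)\<^sup>2) mod 4 = 3" using m3 zz by simp
      have "a\<^sup>2 mod 4 = 1" using sq[of a] a by simp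
      moreover have "a\<^sup>2 mod 4 = ((D * x\<^sup>2) mod 4 + (m * (int z)\<^sup>2) mod 4) mod 4"
        unfolding e2[symmetric] by (simp add: mod_add_eq)
      ultimately show False using t1 t2 by auto
    qed
    show ?thesis
    proof (cases "k \<ge> 3")
      case True then show ?thesis using D8 Dodd by simp
    next
      case False
      then have "k = 0 \<or> k = 2" using k1 by arith
      then show ?thesis by auto
    qed
  qed
  then have "jac (2 ^ k) S = 1"
  proof
    assume "even k"
    moreover have "jac 2 S = 1 \<or> jac 2 S = -1" using Dodd by (simp split: if_splits)
    ultimately show ?thesis unfolding j2 by auto
  qed (simp add: j2)
  then have "jac (int w) S = 1" using kz jz by (simp add: jac_mult)
  then show ?thesis using jac_minus[of v] by (auto simp: w_def abs_if split: if_splits)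
qed

text \<open>Each prime in \<open>S\<close> contributes the Legendre symbols of \<open>a\<close> and of \<open>v\<close>; those of \<open>v\<close> multiply to 1.\<close>
lemma quartic_symbol_eq_jac:
  fixes u v a :: int
  assumes e: "(\<Prod>q\<in>S. int q) * u\<^sup>2 + m * v\<^sup>2 = 4 * a\<^sup>2" and a: "odd a" and m: "[m = 3] (mod 4)"
    and av: "\<And>l. prime l \<Longrightarrow> 2 < l \<Longrightarrow> int l dvd v \<Longrightarrow> \<not> int l dvd a"
    and aS: "\<And>q. q \<in> S \<Longrightarrow> \<not> int q dvd a" and D: "prime_factors D = S"
  shows "quartic_symbol (- m) D = jac a S"
proof (cases "S = {}")
  case True then show ?thesis by (simp add: quartic_symbol_def D jac_def)
next
  case False
  have c: "[- m * v\<^sup>2 = - 4 * a\<^sup>2] (mod int q)" if q: "q \<in> S" for q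
  proof -
    have "int q dvd (\<Prod>q\<in>S. int q) * u\<^sup>2" using S(1) q by (simp add: dvd_mult2 dvd_prodI)
    moreover have "- m * v\<^sup>2 - (- 4 * a\<^sup>2) = (\<Prod>q\<in>S. int q) * u\<^sup>2" using e by simp
    ultimately show ?thesis by (simp add: cong_iff_dvd_diff)
  qed
  have v0: "v \<noteq> 0"
  proof
    assume "v = 0"
    obtain q where q: "q \<in> S" using False by blast
    interpret odd_prime q by (rule S_odd[OF q])
    have "int q dvd 4 * a\<^sup>2" using c[OF q] \<open>v = 0\<close> by (simp add: cong_iff_dvd_diff)
    then have "int q dvd (2 * a)\<^sup>2" by (simp add: power_mult_distrib)
    then have "int q dvd 2 * a" using pint prime_dvd_power by blast
    then have "int q dvd 2 \<or> int q dvd a" using pint prime_dvd_mult_iff by blast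
    then show False using aS[OF q] p(2) zdvd_imp_le[of "int q" 2] by auto
  qed
  have "quartic_symbol (- m) D = (\<Prod>q\<in>S. Legendre a q * Legendre v q)"
    unfolding quartic_symbol_def D
    by (rule prod.cong[OF refl], rule odd_prime.quartic_symbol_prime_eq[OF S_odd]) (use c S(3) aS in auto)
  also have "\<dots> = jac a S * jac v S" by (simp add: jac_def prod.distrib)
  also have "jac v S = 1" by (rule jac_second_coordinate[OF e a m v0 av aS])
  finally show ?thesis by simp
qed

end

text \<open>A prime \<open>l\<close> at which \<open>D\<close> is a square satisfies the formula by reciprocity, and both sides are
  multiplicative. In terms of the field of discriminant \<open>D\<close>: the product of all genus characters is trivial.\<close>
lemma genus_product_formula:
  assumes P: "finite P" "\<And>q. q \<in> P \<Longrightarrow> prime q \<and> [q = 1] (mod 4)" and r: "prime r" "[r = 3] (mod 4)" "r \<notin> P"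
    and D: "D = - (\<Prod>q\<in>insert r P. int q)" and a: "a > 0"
    and al: "\<And>l. prime l \<Longrightarrow> l dvd a \<Longrightarrow> 2 < l \<and> l \<notin> insert r P \<and> Legendre D l = 1"
  shows "jac (int a) P = Legendre (int a) r"
proof -
  have r2: "2 < r"
  proof -
    have "r \<noteq> 2" using r(2) by (auto simp: cong_def)
    then show ?thesis using prime_ge_2_nat[OF r(1)] by simp
  qed
  interpret P: primes_1_mod_4 P by standard (use P in auto)
  interpret r: odd_prime r by standard fact+
  show ?thesis using a al
  proof (induction a rule: less_induct)
    case (less a)
    show ?case
    proof (cases "a = 1")
      case True then show ?thesis by (simp add: P.jac_one)
    next
      case False
      then obtain l where l: "prime l" "l dvd a" using prime_factor_nat by blast
      then obtain v where v: "a = l * v" by (auto elim: dvdE)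
      have IH: "jac (int v) P = Legendre (int v) r"
      proof (rule less.IH)
        show "v < a" "v > 0" using v less.prems(1) prime_gt_1_nat[OF l(1)] by auto
      qed (use less.prems(2) v in auto)
      have l2: "2 < l" "l \<notin> insert r P" "Legendre D l = 1" using less.prems(2)[OF l] by auto
      interpret l: odd_prime l by standard fact+
      have "D = - int r * (\<Prod>q\<in>P. int q)" using D r(3) P(1) by simp
      then have "Legendre (- int r) l * Legendre (\<Prod>q\<in>P. int q) l = 1" using l2(3) by (simp only: l.Legendre_mult)
      moreover have "Legendre (\<Prod>q\<in>P. int q) l = jac l P" using P.jac_odd_prime[OF l(1) l2(1)] l2(2) by simp
      moreover have "Legendre (- int r) l = Legendre l r" using Legendre_reciprocity_3[OF l(1) l2(1) r(1) r2 _ r(2)] l2 by auto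
      ultimately have "Legendre l r * jac l P = 1" by simp
      then have "jac l P = Legendre l r" using r.Legendre_values[of l] by auto
      then show ?thesis using v IH by (simp add: P.jac_mult r.Legendre_mult)
    qed
  qed
qed

section \<open>Solving a norm equation by the pigeonhole principle\<close>

text \<open>Chinese remainder theorem, one prime at a time.\<close>
lemma square_mod_squarefree:
  fixes m :: nat and d :: int
  assumes "squarefree m" "\<And>l. prime l \<Longrightarrow> l dvd m \<Longrightarrow> \<exists>c. [c\<^sup>2 = d] (mod int l)"
  shows "\<exists>c. [c\<^sup>2 = d] (mod int m)"
  using assms
proof (induction m rule: less_induct)
  case (less m)
  have m0: "m \<noteq> 0" using less.prems(1) not_squarefree_0 by metis
  show ?case
  proof (cases "m = 1")
    case True then show ?thesis by (auto simp: cong_def)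
  next
    case False
    then obtain l where l: "prime l" "l dvd m" using prime_factor_nat by blast
    then obtain v where v: "m = l * v" by (auto elim: dvdE)
    have cop: "coprime l v"
    proof (rule prime_imp_coprime[OF l(1)])
      show "\<not> l dvd v"
      proof
        assume "l dvd v"
        then have "l\<^sup>2 dvd m" using v by (simp add: power2_eq_square)
        then have "l dvd 1" using less.prems(1) squarefreeD by blast
        then show False using l(1) by simp
      qed
    qed
    have "v < m" using v m0 prime_gt_1_nat[OF l(1)] n_less_m_mult_n[of v l] by simp
    moreover have "squarefree v" using less.prems(1) v squarefree_mono[of v m] by simp
    ultimately obtain c1 where c1: "[c1\<^sup>2 = d] (mod int v)" using less.IH[of v] less.prems(2) v by auto
    obtain c2 where c2: "[c2\<^sup>2 = d] (mod int l)" using less.prems(2)[OF l] by blast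
    have cop': "coprime (int l) (int v)" using cop by simp
    obtain x where x: "[x = c2] (mod int l)" "[x = c1] (mod int v)"
      using binary_chinese_remainder_int[OF cop'] by blast
    have "[x\<^sup>2 = d] (mod int l)" "[x\<^sup>2 = d] (mod int v)"
      using cong_trans[OF cong_pow[OF x(1), of 2] c2] cong_trans[OF cong_pow[OF x(2), of 2] c1] by auto
    then have "[x\<^sup>2 = d] (mod (int l * int v))" using cop' coprime_cong_mult by blast
    then show ?thesis using v by auto
  qed
qed

text \<open>Two of the triples \<open>(x, y, z)\<close> in the box with sides \<open>\<surd>(ab)\<close>, \<open>\<surd>a\<close>, \<open>\<surd>b\<close> agree in \<open>x - cy\<close> modulo \<open>a\<close> and in
  \<open>x - ez\<close> modulo \<open>b\<close>. For their difference the form \<open>x\<^sup>2 + by\<^sup>2 - az\<^sup>2\<close> is a multiple of \<open>ab\<close>, and by size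
  it is \<open>0\<close> or \<open>ab\<close>. In both cases \<open>a\<close> is a quotient of two values of \<open>x\<^sup>2 + by\<^sup>2\<close>.\<close>
lemma norm_equation_pigeonhole:
  fixes a b :: nat and c e :: int
  assumes ab: "a > 0" "b > 0" "coprime a b" and nsq: "\<And>z. z\<^sup>2 \<noteq> b"
    and c: "[c\<^sup>2 = - int b] (mod int a)" and e: "[e\<^sup>2 = int a] (mod int b)"
  obtains x y z :: int where "(x, y, z) \<noteq> (0, 0, 0)"
    "x\<^sup>2 + int b * y\<^sup>2 = int a * z\<^sup>2 \<or> x\<^sup>2 + int b * y\<^sup>2 = int a * (z\<^sup>2 + int b)"
proof -
  define p q r where "p = floor_sqrt (a * b)" and "q = floor_sqrt a" and "r = floor_sqrt b"
  have le: "p\<^sup>2 \<le> a * b" "q\<^sup>2 \<le> a" "r\<^sup>2 \<le> b" by (auto simp: p_def q_def r_def)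
  have gt: "a * b < (Suc p)\<^sup>2" "a < (Suc q)\<^sup>2" "b < (Suc r)\<^sup>2"
    unfolding p_def q_def r_def by (rule Suc_floor_sqrt_power2_gt)+
  define A where "A = {0..p} \<times> {0..q} \<times> {0..r}"
  define f :: "nat \<times> nat \<times> nat \<Rightarrow> int \<times> int" where
    "f = (\<lambda>(x, y, z). ((int x - c * int y) mod int a, (int x - e * int z) mod int b))"
  have "f ` A \<subseteq> {0..<int a} \<times> {0..<int b}" using ab by (auto simp: f_def)
  then have "card (f ` A) \<le> card ({0..<int a} \<times> {0..<int b})" by (intro card_mono) auto
  then have cf: "card (f ` A) \<le> a * b" by simp
  have "(a * b)\<^sup>2 = (a * b) * (a * b)" by (simp add: power2_eq_square)
  also have "\<dots> < (Suc p)\<^sup>2 * ((Suc q)\<^sup>2 * (Suc r)\<^sup>2)"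
    using gt ab by (intro mult_strict_mono) auto
  also have "\<dots> = (card A)\<^sup>2"
  proof -
    have "card A = Suc p * (Suc q * Suc r)" by (simp add: A_def)
    then show ?thesis by (simp only: power_mult_distrib)
  qed
  finally have "a * b < card A" using power_less_imp_less_base by blast
  then have "\<not> inj_on f A" using cf by (intro pigeonhole) simp
  then obtain s t where st: "s \<in> A" "t \<in> A" "s \<noteq> t" "f s = f t"
    unfolding inj_on_def by blast
  obtain x1 y1 z1 x2 y2 z2 where s: "s = (x1, y1, z1)" and t: "t = (x2, y2, z2)" by (metis prod_cases3)
  define x y z where "x = int x1 - int x2" and "y = int y1 - int y2" and "z = int z1 - int z2"
  have bd: "\<bar>x\<bar> \<le> int p" "\<bar>y\<bar> \<le> int q" "\<bar>z\<bar> \<le> int r"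
    using st by (auto simp: A_def s t x_def y_def z_def)
  have sq: "x\<^sup>2 \<le> int (a * b)" "y\<^sup>2 \<le> int a" "z\<^sup>2 \<le> int b"
  proof -
    have "w\<^sup>2 \<le> int n" if "\<bar>w\<bar> \<le> int k" "k\<^sup>2 \<le> n" for w n k
    proof -
      have "w\<^sup>2 \<le> (int k)\<^sup>2" using that(1) abs_le_square_iff[of w "int k"] by simp
      also have "\<dots> \<le> int n" using that(2) by (metis of_nat_le_iff of_nat_power)
      finally show ?thesis .
    qed
    then show "x\<^sup>2 \<le> int (a * b)" "y\<^sup>2 \<le> int a" "z\<^sup>2 \<le> int b" using bd le by blast+
  qed
  have ne: "(x, y, z) \<noteq> (0, 0, 0)" using st(3) by (auto simp: s t x_def y_def z_def)
  have da: "int a dvd x - c * y"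
  proof -
    have "(int x1 - c * int y1) mod int a = (int x2 - c * int y2) mod int a" using st(4) by (simp add: f_def s t)
    then have "int a dvd (int x1 - c * int y1) - (int x2 - c * int y2)" by (simp add: mod_eq_dvd_iff)
    then show ?thesis by (simp add: x_def y_def algebra_simps)
  qed
  have db: "int b dvd x - e * z"
  proof -
    have "(int x1 - e * int z1) mod int b = (int x2 - e * int z2) mod int b" using st(4) by (simp add: f_def s t)
    then have "int b dvd (int x1 - e * int z1) - (int x2 - e * int z2)" by (simp add: mod_eq_dvd_iff)
    then show ?thesis by (simp add: x_def z_def algebra_simps)
  qed
  define F where "F = x\<^sup>2 + int b * y\<^sup>2 - int a * z\<^sup>2"
  have "int a dvd F"
  proof -
    have "F = (x - c * y) * (x + c * y) + (c\<^sup>2 - (- int b)) * y\<^sup>2 - int a * z\<^sup>2"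
      by (simp add: F_def power2_eq_square algebra_simps)
    moreover have "int a dvd c\<^sup>2 - (- int b)" using c by (simp only: cong_iff_dvd_diff)
    ultimately show ?thesis using da by (metis dvd_add dvd_diff dvd_mult2 dvd_triv_left)
  qed
  moreover have "int b dvd F"
  proof -
    have "F = (x - e * z) * (x + e * z) + (e\<^sup>2 - int a) * z\<^sup>2 + int b * y\<^sup>2"
      by (simp add: F_def power2_eq_square algebra_simps)
    moreover have "int b dvd e\<^sup>2 - int a" using e by (simp only: cong_iff_dvd_diff)
    ultimately show ?thesis using db by (metis dvd_add dvd_mult2 dvd_triv_left)
  qed
  ultimately have "int a * int b dvd F" using ab(3) by (intro divides_mult) auto
  then obtain k where k: "F = int a * int b * k" by blast
  have abp: "int a * int b > 0" using ab by simp
  have y2: "int b * y\<^sup>2 \<le> int a * int b" using sq(2) ab mult_left_mono[of "y\<^sup>2" "int a" "int b"] by (simp add: mult.commute)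
  have z2: "int a * z\<^sup>2 \<le> int a * int b" using sq(3) mult_left_mono[of "z\<^sup>2" "int b" "int a"] by simp
  have y0: "int b * y\<^sup>2 \<ge> 0" "int a * z\<^sup>2 \<ge> 0" "x\<^sup>2 \<ge> 0" by auto
  have x2: "x\<^sup>2 \<le> int a * int b" using sq by simp
  have "int a * int b * (-1) \<le> int a * int b * k" using k y0 z2 unfolding F_def by linarith
  then have k1: "-1 \<le> k" using abp mult_le_cancel_left_pos by blast
  have "int a * int b * k \<le> int a * int b * 2" using k y0 y2 x2 unfolding F_def by linarith
  then have k2: "k \<le> 2" using abp mult_le_cancel_left_pos by blast
  have isq: "w\<^sup>2 \<noteq> int b" for w
  proof
    assume "w\<^sup>2 = int b"
    then have "(nat \<bar>w\<bar>)\<^sup>2 = b" by (metis nat_int nat_power_eq power2_abs abs_ge_zero)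
    then show False using nsq by blast
  qed
  \<comment> \<open>The extreme values of \<open>k\<close> would need equality in the bounds, hence \<open>b\<close> to be a square.\<close>
  have "k \<noteq> -1"
  proof
    assume "k = -1"
    then have "int a * z\<^sup>2 = x\<^sup>2 + int b * y\<^sup>2 + int a * int b" using k unfolding F_def by simp
    then have "int a * z\<^sup>2 = int a * int b" using z2 y0 by linarith
    then show False using ab isq[of z] by simp
  qed
  moreover have "k \<noteq> 2"
  proof
    assume "k = 2"
    then have s: "x\<^sup>2 + int b * y\<^sup>2 = int a * z\<^sup>2 + (int a * int b + int a * int b)" using k unfolding F_def by simp
    then have "x\<^sup>2 = int a * int b" "int b * y\<^sup>2 = int a * int b" using y2 x2 y0 by linarith+
    then have xy: "x\<^sup>2 = y\<^sup>2 * int b" "y\<^sup>2 = int a" using ab by auto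
    then have "y dvd x" by (metis dvd_triv_left pow_divides_pow_iff zero_less_numeral)
    then obtain w where "x = y * w" by blast
    then have "y\<^sup>2 * w\<^sup>2 = y\<^sup>2 * int b" using xy(1) by (simp add: power_mult_distrib)
    then have "w\<^sup>2 = int b" using xy(2) ab by simp
    then show False using isq by blast
  qed
  ultimately have "k = 0 \<or> k = 1" using k1 k2 by linarith
  then have "x\<^sup>2 + int b * y\<^sup>2 = int a * z\<^sup>2 \<or> x\<^sup>2 + int b * y\<^sup>2 = int a * (z\<^sup>2 + int b)"
    using k unfolding F_def by (auto simp: algebra_simps)
  then show thesis using that ne by blast
qed

section \<open>Integers of an imaginary quadratic field\<close>

text \<open>In this locale \<open>K\<close> is the field, \<open>R\<close> its ring of integers and \<open>s\<close> the square root of \<open>d\<close> in the upper half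
  plane. Complex conjugation is the nontrivial automorphism of \<open>K\<close>.\<close>
locale imaginary_quadratic =
  fixes d :: int
  assumes neg: "d < 0" and mod4: "[d = 1] (mod 4)" and sqf: "squarefree d"
begin

definition "\<sigma> = sqrt (real_of_int (- d))"
definition "s = csqrt (of_int d)"
definition "K = carrier (quadratic_field d)"
definition "R = carrier (ring_of_integers (quadratic_field d))"

lemma \<sigma>_pos: "\<sigma> > 0" using neg by (simp add: \<sigma>_def)
lemma \<sigma>_sq: "\<sigma> * \<sigma> = - real_of_int d" using neg by (simp add: \<sigma>_def)
lemma s_eq: "s = \<i> * of_real \<sigma>"
  unfolding s_def \<sigma>_def using neg csqrt_of_real_nonpos[of "real_of_int d"] by simp
lemma s_sq: "s * s = of_int d"
proof -
  have "s * s = of_real (- (\<sigma> * \<sigma>))" by (simp add: s_eq algebra_simps)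
  then show ?thesis by (simp add: \<sigma>_sq)
qed
lemma cnj_s: "cnj s = - s" by (simp add: s_eq)
lemma Re_s [simp]: "Re s = 0" and Im_s [simp]: "Im s = \<sigma>" by (simp_all add: s_eq)
lemma s_neq_0: "s \<noteq> 0" using \<sigma>_pos by (simp add: s_eq)

lemma K_def': "K = {a + b * s | a b. a \<in> \<rat> \<and> b \<in> \<rat>}"
  by (simp add: K_def quadratic_field_def s_def)

lemma K_iff: "x \<in> K \<longleftrightarrow> (\<exists>a b :: real. a \<in> \<rat> \<and> b \<in> \<rat> \<and> x = of_real a + of_real b * s)"
proof -
  have r: "(z :: complex) \<in> \<rat> \<longleftrightarrow> (\<exists>a :: real. a \<in> \<rat> \<and> z = of_real a)" for z
  proof
    assume "z \<in> \<rat>"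
    then obtain p q where "z = of_int p / of_int q" by (auto elim!: Rats_cases')
    then have "(of_int p / of_int q :: real) \<in> \<rat> \<and> z = of_real (of_int p / of_int q)" by simp
    then show "\<exists>a :: real. a \<in> \<rat> \<and> z = of_real a" by blast
  next
    assume "\<exists>a :: real. a \<in> \<rat> \<and> z = of_real a"
    then obtain a :: real where a: "a \<in> \<rat>" "z = of_real a" by blast
    then obtain p q where "a = of_int p / of_int q" by (auto elim!: Rats_cases')
    then show "z \<in> \<rat>" using a by simp
  qed
  show ?thesis unfolding K_def' r by blast
qed

lemma K_I: "a \<in> \<rat> \<Longrightarrow> b \<in> \<rat> \<Longrightarrow> of_real a + of_real b * s \<in> K"
  using K_iff by blast

lemma K_rat: "a \<in> \<rat> \<Longrightarrow> complex_of_real a \<in> K"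
  using K_I[of a 0] by simp
lemma K_of_int [simp]: "of_int n \<in> K" using K_rat[of "of_int n"] by simp
lemma K_0 [simp]: "0 \<in> K" and K_1 [simp]: "1 \<in> K" using K_of_int[of 0] K_of_int[of 1] by auto
lemma K_s [simp]: "s \<in> K" using K_I[of 0 1] by simp

lemma K_add [intro]: "x \<in> K \<Longrightarrow> y \<in> K \<Longrightarrow> x + y \<in> K"
proof -
  assume "x \<in> K" "y \<in> K"
  then obtain a b a' b' where ab: "a \<in> \<rat>" "b \<in> \<rat>" "x = of_real a + of_real b * s"
    "a' \<in> \<rat>" "b' \<in> \<rat>" "y = of_real a' + of_real b' * s" unfolding K_iff by blast
  have "x + y = of_real (a + a') + of_real (b + b') * s" using ab by (simp add: algebra_simps)
  then show ?thesis using K_I[OF Rats_add[OF ab(1,4)] Rats_add[OF ab(2,5)]] by (simp only:)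
qed

lemma K_mult [intro]: "x \<in> K \<Longrightarrow> y \<in> K \<Longrightarrow> x * y \<in> K"
proof -
  assume "x \<in> K" "y \<in> K"
  then obtain a b a' b' where ab: "a \<in> \<rat>" "b \<in> \<rat>" "x = of_real a + of_real b * s"
    "a' \<in> \<rat>" "b' \<in> \<rat>" "y = of_real a' + of_real b' * s" unfolding K_iff by blast
  have "x * y = of_real a * of_real a' + of_real b * of_real b' * (s * s) + (of_real a * of_real b' + of_real b * of_real a') * s"
    using ab by (simp add: algebra_simps)
  also have "\<dots> = of_real (a * a' + b * b' * of_int d) + of_real (a * b' + b * a') * s"
    by (simp add: s_sq)
  finally show ?thesis using ab K_I[of "a * a' + b * b' * of_int d" "a * b' + b * a'"] by simp
qed

lemma K_cnj [intro]: "x \<in> K \<Longrightarrow> cnj x \<in> K"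
proof -
  assume "x \<in> K"
  then obtain a b where ab: "a \<in> \<rat>" "b \<in> \<rat>" "x = of_real a + of_real b * s" unfolding K_iff by blast
  then have "cnj x = of_real a + of_real (- b) * s" by (simp add: cnj_s)
  then show ?thesis using ab K_I[of a "- b"] by simp
qed

lemma K_minus [intro]: "x \<in> K \<Longrightarrow> - x \<in> K"
  using K_mult[of "-1" x] K_of_int[of "-1"] by simp
lemma K_diff [intro]: "x \<in> K \<Longrightarrow> y \<in> K \<Longrightarrow> x - y \<in> K"
  using K_add[of x "- y"] K_minus by simp

lemma K_real: "x \<in> K \<Longrightarrow> x \<in> \<real> \<Longrightarrow> \<exists>r::real. r \<in> \<rat> \<and> x = of_real r"
proof -
  assume "x \<in> K" "x \<in> \<real>"
  then obtain a b where ab: "a \<in> \<rat>" "b \<in> \<rat>" "x = of_real a + of_real b * s" unfolding K_iff by blast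
  have "Im x = 0" using \<open>x \<in> \<real>\<close> complex_is_Real_iff by blast
  then have "b = 0" using \<sigma>_pos ab by simp
  then show ?thesis using ab by auto
qed

lemma K_norm: "x \<in> K \<Longrightarrow> \<exists>r::real. r \<in> \<rat> \<and> x * cnj x = of_real r"
  by (rule K_real) (auto simp: complex_is_Real_iff)
lemma K_inverse [intro]: "x \<in> K \<Longrightarrow> inverse x \<in> K"
proof (cases "x = 0")
  case False
  assume x: "x \<in> K"
  obtain r where r: "r \<in> \<rat>" "x * cnj x = of_real r" using K_norm[OF x] by blast
  have "r \<noteq> 0" using r(2) False by auto
  have "x * (cnj x * of_real (inverse r)) = of_real (r * inverse r)" by (simp add: mult.assoc[symmetric] r(2))
  then have "x * (cnj x * of_real (inverse r)) = 1" using \<open>r \<noteq> 0\<close> by simp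
  then have "inverse x = cnj x * of_real (inverse r)" by (rule inverse_unique)
  moreover have "complex_of_real (inverse r) \<in> K" by (rule K_rat) (use r(1) in simp)
  ultimately show ?thesis using K_mult[OF K_cnj[OF x]] by (simp only:)
qed simp
lemma K_divide [intro]: "x \<in> K \<Longrightarrow> y \<in> K \<Longrightarrow> x / y \<in> K"
  by (simp add: divide_inverse K_mult K_inverse)

lemma R_def': "R = {x \<in> K. algebraic_int x}"
  by (simp add: R_def K_def ring_of_integers_def)

text \<open>The subring generated by \<open>s\<close>. It is smaller than \<open>R\<close>, but every element of \<open>K\<close> has a multiple in it.\<close>
definition "Zs = {of_int u + of_int v * s | u v :: int. True}"

lemma Zs_add: "x \<in> Zs \<Longrightarrow> y \<in> Zs \<Longrightarrow> x + y \<in> Zs"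
proof -
  assume "x \<in> Zs" "y \<in> Zs"
  then obtain a b a' b' where "x = of_int a + of_int b * s" "y = of_int a' + of_int b' * s" unfolding Zs_def by blast
  then have "x + y = of_int (a + a') + of_int (b + b') * s" by (simp add: algebra_simps)
  then show ?thesis unfolding Zs_def by blast
qed
lemma Zs_mult: "x \<in> Zs \<Longrightarrow> y \<in> Zs \<Longrightarrow> x * y \<in> Zs"
proof -
  assume "x \<in> Zs" "y \<in> Zs"
  then obtain a b a' b' where "x = of_int a + of_int b * s" "y = of_int a' + of_int b' * s" unfolding Zs_def by blast
  then have "x * y = of_int a * of_int a' + of_int b * of_int b' * (s * s) + of_int (a * b' + b * a') * s" by (simp add: algebra_simps)
  also have "\<dots> = of_int (a * a' + b * b' * d) + of_int (a * b' + b * a') * s" by (simp add: s_sq)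
  finally show ?thesis unfolding Zs_def by blast
qed
lemma Zs_int: "of_int n \<in> Zs"
  unfolding Zs_def by (rule CollectI, rule exI[of _ n], rule exI[of _ 0]) simp
lemma Zs_power: "x \<in> Zs \<Longrightarrow> x ^ n \<in> Zs"
  by (induction n) (use Zs_int[of 1] Zs_mult in auto)
lemma Zs_sum: "(\<And>i. i \<in> A \<Longrightarrow> f i \<in> Zs) \<Longrightarrow> sum f A \<in> Zs"
  by (induction A rule: infinite_finite_induct) (use Zs_int[of 0] Zs_add in auto)
lemma Zs_norm: "x \<in> Zs \<Longrightarrow> x * cnj x \<in> \<int>"
proof -
  assume "x \<in> Zs"
  then obtain a b where "x = of_int a + of_int b * s" unfolding Zs_def by blast
  then have "x * cnj x = of_int a * of_int a - of_int b * of_int b * (s * s)" by (simp add: cnj_s algebra_simps)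
  also have "\<dots> = of_int (a * a - b * b * d)" by (simp add: s_sq)
  finally show ?thesis by (metis Ints_of_int)
qed

lemma K_denominator:
  assumes "x \<in> K" obtains n :: int where "n > 0" "of_int n * x \<in> Zs"
proof -
  obtain a b where ab: "a \<in> \<rat>" "b \<in> \<rat>" "x = of_real a + of_real b * s" using assms unfolding K_iff by blast
  obtain p q where a: "q > 0" "a = of_int p / of_int q" using ab(1) by (metis Rats_cases')
  obtain p' q' where b: "q' > 0" "b = of_int p' / of_int q'" using ab(2) by (metis Rats_cases')
  have "of_int (q * q') * x = of_int (p * q') + of_int (p' * q) * s"
    using a(1) b(1) unfolding ab(3) a(2) b(2) by (simp add: field_simps)
  then have "of_int (q * q') * x \<in> Zs" unfolding Zs_def by blast
  moreover have "q * q' > 0" using a b by simp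
  ultimately show thesis by (rule that[rotated])
qed

text \<open>A monic equation expresses all powers of \<open>x\<close> by finitely many. Together with the next lemma this shows
  that norm and trace of an algebraic integer are integers.\<close>
lemma powers_bounded_denominator:
  assumes x: "x \<in> K" "algebraic_int x"
  obtains D :: int where "D > 0" "\<And>k. of_int D * x ^ k \<in> Zs"
proof -
  obtain f where f: "lead_coeff f = 1" "\<And>i. Polynomial.coeff f i \<in> \<int>" "poly f x = 0"
    using x(2) by (auto elim: algebraic_int.cases)
  define n where "n = Polynomial.degree f"
  obtain w where w: "w > 0" "of_int w * x \<in> Zs" using K_denominator[OF x(1)] .
  define D where "D = w ^ n"
  have small: "of_int D * x ^ k \<in> Zs" if "k \<le> n" for k
  proof -
    have "w ^ n = w ^ (n - k) * w ^ k" using that by (simp add: power_add[symmetric])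
    then have e: "of_int D * x ^ k = of_int (w ^ (n - k)) * (of_int w * x) ^ k"
      by (simp add: D_def power_mult_distrib)
    show ?thesis unfolding e by (rule Zs_mult[OF Zs_int Zs_power[OF w(2)]])
  qed
  have "of_int D * x ^ k \<in> Zs" for k
  proof (induction k rule: less_induct)
    case (less k)
    show ?case
    proof (cases "k \<le> n")
      case False
      have "0 = (\<Sum>i\<le>n. Polynomial.coeff f i * x ^ i)" using f(3) by (simp add: poly_altdef n_def)
      also have "\<dots> = x ^ n + (\<Sum>i<n. Polynomial.coeff f i * x ^ i)"
        using f(1) by (simp add: lessThan_Suc_atMost[symmetric] n_def)
      finally have "x ^ n = (\<Sum>i<n. - Polynomial.coeff f i * x ^ i)" by (simp add: sum_negf eq_neg_iff_add_eq_0)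
      then have "x ^ (k - n) * x ^ n = (\<Sum>i<n. - Polynomial.coeff f i * x ^ (k - n + i))"
        by (simp add: sum_distrib_left power_add algebra_simps)
      then have "x ^ k = (\<Sum>i<n. - Polynomial.coeff f i * x ^ (k - n + i))" using False by (simp add: power_add[symmetric])
      then have "of_int D * x ^ k = (\<Sum>i<n. - Polynomial.coeff f i * (of_int D * x ^ (k - n + i)))"
        by (simp add: sum_distrib_left algebra_simps)
      also have "\<dots> \<in> Zs"
      proof (rule Zs_sum)
        fix i assume "i \<in> {..<n}"
        then have "of_int D * x ^ (k - n + i) \<in> Zs" using False by (intro less.IH) auto
        moreover obtain c where "Polynomial.coeff f i = of_int c" using f(2)[of i] by (auto elim: Ints_cases)
        ultimately show "- Polynomial.coeff f i * (of_int D * x ^ (k - n + i)) \<in> Zs"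
          using Zs_mult[OF Zs_int[of "- c"]] by simp
      qed
      finally show ?thesis .
    qed (rule small)
  qed
  moreover have "D > 0" using w by (simp add: D_def)
  ultimately show thesis using that by blast
qed

text \<open>A denominator \<open>q > 1\<close> of \<open>r\<close> would give \<open>r\<^sup>k\<close> the denominator \<open>q\<^sup>k\<close>.\<close>
lemma rational_bounded_powers:
  fixes r :: real
  assumes "r \<in> \<rat>" "D > 0" "\<And>k. of_int D * r ^ k \<in> \<int>"
  shows "r \<in> \<int>"
proof -
  obtain p q where pq: "q > 0" "coprime p q" "r = of_int p / of_int q" using assms(1) by (metis Rats_cases')
  have "q ^ k dvd D" for k
  proof -
    obtain m where m: "of_int D * r ^ k = of_int m" using assms(3)[of k] by (auto elim: Ints_cases)
    then have "real_of_int (D * p ^ k) = of_int (m * q ^ k)" using pq by (simp add: field_simps)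
    then have "D * p ^ k = m * q ^ k" by linarith
    then have "q ^ k dvd D * p ^ k" by simp
    moreover have "coprime (q ^ k) (p ^ k)" using pq(2) by (simp add: coprime_commute)
    ultimately show ?thesis using coprime_dvd_mult_left_iff by blast
  qed
  then have le: "q ^ k \<le> D" for k using assms(2) zdvd_imp_le by blast
  have "q = 1"
  proof (rule ccontr)
    assume "q \<noteq> 1"
    then have "2 \<le> q" using pq(1) by simp
    then have "(2::int) ^ nat D \<le> q ^ nat D" by (intro power_mono) auto
    also have "\<dots> \<le> D" by (rule le)
    also have "D = int (nat D)" using assms(2) by simp
    also have "\<dots> < 2 ^ nat D" by (metis less_exp of_nat_less_iff of_nat_numeral of_nat_power)
    finally show False by simp
  qed
  then show ?thesis using pq by simp
qed

text \<open>The norm inherits bounded denominators of powers from \<open>x\<close>. The trace is obtained from the norms of \<open>x\<close>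
  and of \<open>1 + x\<close>.\<close>
lemma algebraic_int_norm_trace:
  assumes x: "x \<in> K" "algebraic_int x"
  shows "x * cnj x \<in> \<int>" "x + cnj x \<in> \<int>"
proof -
  obtain D where D: "D > 0" "\<And>k. of_int D * x ^ k \<in> Zs" using powers_bounded_denominator[OF x] by blast
  have key: "y * cnj y \<in> \<int>" if y: "y \<in> K" and Dy: "\<And>k. of_int D * y ^ k \<in> Zs" for y
  proof -
    obtain r where r: "r \<in> \<rat>" "y * cnj y = of_real r" using K_norm[OF y] by blast
    have "of_int (D * D) * r ^ k \<in> \<int>" for k
    proof -
      have "(of_int D * y ^ k) * cnj (of_int D * y ^ k) = of_int (D * D) * (y * cnj y) ^ k"
        by (simp add: power_mult_distrib algebra_simps)
      also have "\<dots> = of_real (of_int (D * D) * r ^ k)" by (simp add: r)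
      finally have e: "(of_int D * y ^ k) * cnj (of_int D * y ^ k) = of_real (of_int (D * D) * r ^ k)" .
      obtain m where "complex_of_real (of_int (D * D) * r ^ k) = of_int m"
        using Zs_norm[OF Dy[of k]] unfolding e by (rule Ints_cases)
      then have "complex_of_real (of_int (D * D) * r ^ k) = complex_of_real (of_int m)" by simp
      then have "of_int (D * D) * r ^ k = of_int m" unfolding of_real_eq_iff .
      then show ?thesis by simp
    qed
    then have "r \<in> \<int>" using rational_bounded_powers[OF r(1), of "D * D"] D(1) by simp
    then show ?thesis unfolding r by (auto elim: Ints_cases)
  qed
  show n: "x * cnj x \<in> \<int>" by (rule key[OF x(1) D(2)])
  have "(1 + x) * cnj (1 + x) \<in> \<int>"
  proof (rule key)
    show "1 + x \<in> K" using x K_add by auto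
    show "of_int D * (1 + x) ^ k \<in> Zs" for k
    proof -
      have "of_int D * (1 + x) ^ k = (\<Sum>i\<le>k. of_int (int (k choose i)) * (of_int D * x ^ i))"
        using binomial_ring[of x 1 k] by (simp add: add.commute sum_distrib_left algebra_simps)
      also have "\<dots> \<in> Zs" by (intro Zs_sum Zs_mult Zs_int D)
      finally show ?thesis .
    qed
  qed
  then have "(1 + x) * cnj (1 + x) - 1 - x * cnj x \<in> \<int>" using n by (intro Ints_diff) auto
  then show "x + cnj x \<in> \<int>" by (simp add: algebra_simps)
qed

text \<open>For \<open>x = a + bs\<close> the trace shows that \<open>2a\<close> is an integer, and the norm that \<open>(2b)\<^sup>2 d\<close> is one; since \<open>d\<close> is
  squarefree, \<open>2b\<close> is an integer. The parity condition comes from \<open>d \<equiv> 1 (mod 4)\<close>.\<close>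
lemma R_coords: "x \<in> R \<longleftrightarrow> (\<exists>u v :: int. even (u + v) \<and> x = (of_int u + of_int v * s) / 2)"
proof
  assume x: "x \<in> R"
  then have xK: "x \<in> K" by (simp add: R_def')
  note nt = algebraic_int_norm_trace[OF xK] and alg = x[unfolded R_def']
  obtain a b where ab: "a \<in> \<rat>" "b \<in> \<rat>" "x = of_real a + of_real b * s" using xK unfolding K_iff by blast
  obtain t where t: "x + cnj x = of_int t" using nt alg by (auto elim: Ints_cases)
  obtain n where n: "x * cnj x = of_int n" using nt alg by (auto elim: Ints_cases)
  have a: "2 * a = of_int t"
  proof -
    have "x + cnj x = of_real (2 * a)" using ab(3) by (simp add: cnj_s)
    then have "complex_of_real (2 * a) = of_real (of_int t)" using t by simp
    then show ?thesis using of_real_eq_iff by blast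
  qed
  have b: "a * a - b * b * of_int d = of_int n"
  proof -
    have "x * cnj x = of_real a * of_real a - of_real b * of_real b * (s * s)" unfolding ab(3) by (simp add: cnj_s algebra_simps)
    then have "complex_of_real (a * a - b * b * of_int d) = of_real (of_int n)" using n by (simp add: s_sq)
    then show ?thesis using of_real_eq_iff by blast
  qed
  define m where "m = t * t - 4 * n"
  have m: "of_int m = (2 * b) * (2 * b) * real_of_int d"
  proof -
    have "(2 * a) * (2 * a) - (2 * b) * (2 * b) * real_of_int d = 4 * of_int n" using b by (simp add: algebra_simps)
    then show ?thesis unfolding a m_def by simp
  qed
  have "2 * b \<in> \<rat>" using ab(2) by simp
  then obtain p q where pq: "q > 0" "coprime p q" "2 * b = of_int p / of_int q" by (metis Rats_cases')
  have "real_of_int (m * (q * q)) = of_int (p * p * d)" using m pq(1) unfolding pq(3) by (simp add: field_simps)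
  then have mq: "m * (q * q) = p * p * d" by linarith
  have "q\<^sup>2 dvd d"
  proof -
    have "q * q dvd p * p * d" using mq by (metis dvd_triv_right)
    moreover have "coprime (q * q) (p * p)" using pq(2) by (simp add: coprime_commute)
    ultimately show ?thesis by (simp add: coprime_dvd_mult_right_iff power2_eq_square)
  qed
  then have "q dvd 1" using sqf squarefreeD by blast
  then have "q = 1" using pq(1) by simp
  then have bp: "2 * b = of_int p" using pq by simp
  have mp: "t * t - 4 * n = p * p * d" using mq \<open>q = 1\<close> by (simp add: m_def)
  have "odd d" using mod4 unfolding cong_def by presburger
  have "t * t - p * p * d = 2 * (2 * n)" using mp by simp
  then have "even (t * t - p * p * d)" by simp
  then have "even (t + p)" using \<open>odd d\<close> by simp
  moreover have "x = (of_int t + of_int p * s) / 2"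
  proof -
    have "x = (of_real (2 * a) + of_real (2 * b) * s) / 2" using ab(3) by (simp add: field_simps)
    then show ?thesis using a bp by simp
  qed
  ultimately show "\<exists>u v :: int. even (u + v) \<and> x = (of_int u + of_int v * s) / 2" by blast
next
  assume "\<exists>u v :: int. even (u + v) \<and> x = (of_int u + of_int v * s) / 2"
  then obtain u v :: int where uv: "even (u + v)" "x = (of_int u + of_int v * s) / 2" by blast
  have "of_real (of_int u / 2) + of_real (of_int v / 2) * s \<in> K" by (rule K_I) auto
  moreover have "of_real (of_int u / 2) + of_real (of_int v / 2) * s = x" using uv(2) by (simp add: field_simps)
  ultimately have xK: "x \<in> K" by simp
  have "4 dvd u * u - v * v * d"
  proof -
    obtain k where "u + v = 2 * k" using uv(1) by blast
    then have k: "u = 2 * k - v" by simp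
    have "4 dvd d - 1" using mod4 by (simp add: cong_iff_dvd_diff)
    then obtain j where "d - 1 = 4 * j" by blast
    then have j: "d = 4 * j + 1" by simp
    have "u * u - v * v * d = 4 * (k * k - k * v - v * v * j)" unfolding k j by (simp add: algebra_simps)
    then show ?thesis by simp
  qed
  then obtain n where n: "u * u - v * v * d = 4 * n" by blast
  have "x * x - of_int u * x + of_int n = 0"
  proof -
    have x2: "2 * x = of_int u + of_int v * s" unfolding uv(2) by simp
    have "4 * (x * x - of_int u * x + of_int n) = (2 * x) * (2 * x) - 2 * of_int u * (2 * x) + of_int (4 * n)" by (simp add: algebra_simps)
    also have "\<dots> = of_int v * of_int v * (s * s) - of_int u * of_int u + of_int (4 * n)" unfolding x2 by (simp add: algebra_simps)
    also have "\<dots> = of_int (v * v * d - u * u + 4 * n)" by (simp add: s_sq)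
    also have "v * v * d - u * u + 4 * n = 0" using n by simp
    finally have "4 * (x * x - of_int u * x + of_int n) = 0" by (simp only: of_int_0)
    then show ?thesis by (metis mult_eq_0_iff zero_neq_numeral)
  qed
  then have "poly [:of_int n, - of_int u, 1:] x = 0" by (simp add: algebra_simps)
  then have "algebraic_int x"
    by (intro algebraic_int.intros[of "[:of_int n, - of_int u, 1:]"]) (auto simp: coeff_pCons split: nat.splits)
  then show "x \<in> R" using xK by (simp add: R_def')
qed

end

section \<open>Fractional ideals and their norms\<close>
context imaginary_quadratic
begin

lemma R_K: "x \<in> R \<Longrightarrow> x \<in> K" by (simp add: R_def')

lemma R_iff: "x \<in> R \<longleftrightarrow> x \<in> K \<and> x + cnj x \<in> \<int> \<and> x * cnj x \<in> \<int>"
proof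
  assume "x \<in> R"
  then have "x \<in> K" "algebraic_int x" by (auto simp: R_def')
  then show "x \<in> K \<and> x + cnj x \<in> \<int> \<and> x * cnj x \<in> \<int>" using algebraic_int_norm_trace by blast
next
  assume a: "x \<in> K \<and> x + cnj x \<in> \<int> \<and> x * cnj x \<in> \<int>"
  then obtain t n where tn: "x + cnj x = of_int t" "x * cnj x = of_int n" by (auto elim!: Ints_cases)
  have "x * x - (x + cnj x) * x + x * cnj x = 0" by (simp add: algebra_simps)
  then have "poly [:of_int n, - of_int t, 1:] x = 0" unfolding tn by (simp add: algebra_simps)
  then have "algebraic_int x"
    by (intro algebraic_int.intros[of "[:of_int n, - of_int t, 1:]"]) (auto simp: coeff_pCons split: nat.splits)
  then show "x \<in> R" using a by (simp add: R_def')
qed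

definition "w = (1 + s) / 2"

lemma R_basis: "x \<in> R \<longleftrightarrow> (\<exists>a b :: int. x = of_int a + of_int b * w)"
proof
  assume "x \<in> R"
  then obtain u v where uv: "even (u + v)" "x = (of_int u + of_int v * s) / 2" using R_coords by blast
  have "even (u - v)" using uv(1) by simp
  then obtain k where "u - v = 2 * k" by blast
  then have u: "u = v + 2 * k" by simp
  have "x = of_int k + of_int v * w" unfolding uv(2) u w_def by (simp add: field_simps)
  then show "\<exists>a b :: int. x = of_int a + of_int b * w" by blast
next
  assume "\<exists>a b :: int. x = of_int a + of_int b * w"
  then obtain a b :: int where "x = of_int a + of_int b * w" by blast
  then have "x = (of_int (2 * a + b) + of_int b * s) / 2" by (simp add: w_def field_simps)
  moreover have "even (2 * a + b + b)" by simp
  ultimately show "x \<in> R" using R_coords by blast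
qed

lemma w_sq: "\<exists>j :: int. w * w = w + of_int j"
proof -
  have "4 dvd d - 1" using mod4 by (simp add: cong_iff_dvd_diff)
  then obtain j where "d - 1 = 4 * j" by blast
  then have "d = 4 * j + 1" by simp
  then have dd: "(of_int d :: complex) = 4 * of_int j + 1" by (simp only: of_int_add of_int_mult of_int_numeral of_int_1)
  have "4 * (w * w) = 1 + 2 * s + s * s" by (simp add: w_def field_simps)
  also have "\<dots> = 4 * (w + of_int j)" unfolding s_sq dd by (simp add: w_def field_simps)
  finally have "4 * (w * w) = 4 * (w + of_int j)" .
  then have "w * w = w + of_int j" by (simp only: mult_cancel_left) simp
  then show ?thesis by blast
qed

lemma R_add [intro]: "x \<in> R \<Longrightarrow> y \<in> R \<Longrightarrow> x + y \<in> R"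
proof -
  assume "x \<in> R" "y \<in> R"
  then obtain a b a' b' where "x = of_int a + of_int b * w" "y = of_int a' + of_int b' * w" unfolding R_basis by blast
  then have "x + y = of_int (a + a') + of_int (b + b') * w" by (simp add: algebra_simps)
  then show ?thesis unfolding R_basis by blast
qed

lemma R_mult [intro]: "x \<in> R \<Longrightarrow> y \<in> R \<Longrightarrow> x * y \<in> R"
proof -
  assume "x \<in> R" "y \<in> R"
  then obtain a b a' b' where "x = of_int a + of_int b * w" "y = of_int a' + of_int b' * w" unfolding R_basis by blast
  then have "x * y = of_int a * of_int a' + of_int b * of_int b' * (w * w) + of_int (a * b' + b * a') * w" by (simp add: algebra_simps)
  moreover obtain j where "w * w = w + of_int j" using w_sq by blast
  ultimately have "x * y = of_int (a * a' + b * b' * j) + of_int (a * b' + b * a' + b * b') * w" by (simp add: algebra_simps)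
  then show ?thesis unfolding R_basis by blast
qed

lemma R_int [simp]: "of_int n \<in> R"
  unfolding R_basis by (rule exI[of _ n], rule exI[of _ 0]) simp
lemma R_0 [simp]: "0 \<in> R" and R_1 [simp]: "1 \<in> R" using R_int[of 0] R_int[of 1] by auto
lemma R_cnj [intro]: "x \<in> R \<Longrightarrow> cnj x \<in> R"
  unfolding R_iff using K_cnj by (auto simp: add.commute mult.commute)
lemma R_minus [intro]: "x \<in> R \<Longrightarrow> - x \<in> R"
  using R_mult[OF R_int[of "-1"]] by simp
lemma R_s [simp]: "s \<in> R"
  unfolding R_coords by (rule exI[of _ 0], rule exI[of _ 2]) simp

lemma R_real: "x \<in> R \<Longrightarrow> x \<in> \<real> \<Longrightarrow> \<exists>n :: int. x = of_int n"
proof -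
  assume x: "x \<in> R" "x \<in> \<real>"
  obtain u v where uv: "even (u + v)" "x = (of_int u + of_int v * s) / 2" using x(1) R_coords by blast
  have "Im x = 0" using x(2) complex_is_Real_iff by blast
  then have v: "v = 0" using uv(2) \<sigma>_pos by simp
  then obtain k where "u = 2 * k" using uv(1) by auto
  then have "x = of_int k" using uv(2) v by simp
  then show ?thesis by blast
qed

lemma R_norm: "x \<in> R \<Longrightarrow> \<exists>n :: int. x * cnj x = of_int n"
  using R_iff by (auto elim!: Ints_cases)

text \<open>Submodules of the complex numbers over \<open>R\<close>.\<close>
definition "Rmod I \<longleftrightarrow> 0 \<in> I \<and> (\<forall>x\<in>I. \<forall>y\<in>I. x + y \<in> I) \<and> (\<forall>r\<in>R. \<forall>x\<in>I. r * x \<in> I)"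

text \<open>Fractional ideals, characterised by a common denominator, which may be taken in the positive integers.\<close>
definition "fideal I \<longleftrightarrow> Rmod I \<and> I \<noteq> {0} \<and> (\<exists>n :: int. n > 0 \<and> (\<forall>x\<in>I. of_int n * x \<in> R))"
definition "sm a I = (\<lambda>x :: complex. a * x) ` I"
definition "cj I = cnj ` I"
abbreviation "mul \<equiv> ideal_prod (quadratic_field d)"

lemma Rmod_0: "Rmod I \<Longrightarrow> 0 \<in> I" and Rmod_add: "Rmod I \<Longrightarrow> x \<in> I \<Longrightarrow> y \<in> I \<Longrightarrow> x + y \<in> I"
  and Rmod_mult: "Rmod I \<Longrightarrow> r \<in> R \<Longrightarrow> x \<in> I \<Longrightarrow> r * x \<in> I"
  by (auto simp: Rmod_def)

lemma fideal_Rmod: "fideal I \<Longrightarrow> Rmod I" by (simp add: fideal_def)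

lemma fideal_K: "fideal I \<Longrightarrow> x \<in> I \<Longrightarrow> x \<in> K"
proof -
  assume "fideal I" "x \<in> I"
  then obtain n where n: "n > 0" "of_int n * x \<in> R" by (auto simp: fideal_def)
  then have "of_int n * x / of_int n \<in> K" using R_K K_divide by (metis K_of_int)
  then show ?thesis using n(1) by simp
qed

lemma fideal_nonzero: "fideal I \<Longrightarrow> \<exists>x\<in>I. x \<noteq> 0"
  unfolding fideal_def Rmod_def by blast

lemma field_ops: "x \<otimes>\<^bsub>quadratic_field d\<^esub> y = x * y" "x \<oplus>\<^bsub>quadratic_field d\<^esub> y = x + y"
  by (simp_all add: quadratic_field_def class_ring_simps)

lemma mulI: "x \<in> I \<Longrightarrow> y \<in> J \<Longrightarrow> x * y \<in> mul I J"
  using ideal_prod.prod[of x I y J "quadratic_field d"] by (simp add: field_ops)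
lemma mul_add: "x \<in> mul I J \<Longrightarrow> y \<in> mul I J \<Longrightarrow> x + y \<in> mul I J"
  using ideal_prod.sum[of x "quadratic_field d" I J y] by (simp add: field_ops)
lemma mul_induct [consumes 1, case_names prod sum]:
  assumes "z \<in> mul I J" "\<And>x y. x \<in> I \<Longrightarrow> y \<in> J \<Longrightarrow> P (x * y)" "\<And>a b. P a \<Longrightarrow> P b \<Longrightarrow> P (a + b)"
  shows "P z"
  using assms(1) by (induction rule: ideal_prod.induct) (use assms(2,3) in \<open>auto simp: field_ops\<close>)
lemma mul_sub:
  assumes "\<And>x y. x \<in> I \<Longrightarrow> y \<in> J \<Longrightarrow> x * y \<in> L" "\<And>a b. a \<in> L \<Longrightarrow> b \<in> L \<Longrightarrow> a + b \<in> L"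
  shows "mul I J \<subseteq> L"
proof
  fix z assume "z \<in> mul I J" then show "z \<in> L" by (induction rule: mul_induct) (use assms in auto)
qed

lemma mul_commute: "mul I J = mul J I"
proof -
  have "mul I J \<subseteq> mul J I" for I J
    by (rule mul_sub) (metis mulI mult.commute, rule mul_add)
  then show ?thesis by blast
qed

lemma mul_assoc: "mul (mul I J) L = mul I (mul J L)"
proof -
  have le: "mul (mul I J) L \<subseteq> mul I (mul J L)" for I J L
  proof (rule mul_sub)
    fix x y assume x: "x \<in> mul I J" and y: "y \<in> L"
    show "x * y \<in> mul I (mul J L)" using x
    proof (induction rule: mul_induct)
      case (prod a b)
      then have "a * (b * y) \<in> mul I (mul J L)" using y by (intro mulI)
      then show ?case by (simp add: mult.assoc)
    next
      case (sum a b) then show ?case using mul_add by (simp add: distrib_right)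
    qed
  qed (rule mul_add)
  show ?thesis
  proof
    show "mul I (mul J L) \<subseteq> mul (mul I J) L"
      using le[of L J I] by (simp add: mul_commute[of _ L] mul_commute[of _ I] mul_commute[of J])
  qed (rule le)
qed

lemma Rmod_mul: "Rmod I \<Longrightarrow> Rmod J \<Longrightarrow> Rmod (mul I J)"
proof -
  assume I: "Rmod I" and J: "Rmod J"
  have "r * z \<in> mul I J" if r: "r \<in> R" and z: "z \<in> mul I J" for r z
    using z
  proof (induction rule: mul_induct)
    case (prod x y)
    then have "(r * x) * y \<in> mul I J" using Rmod_mult[OF I r] by (intro mulI)
    then show ?case by (simp add: mult.assoc)
  next
    case (sum a b) then show ?case using mul_add by (simp add: distrib_left)
  qed
  moreover have "0 \<in> mul I J" using mulI[OF Rmod_0[OF I] Rmod_0[OF J]] by simp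
  ultimately show ?thesis using mul_add by (auto simp: Rmod_def)
qed

lemma Rmod_R: "Rmod R" by (auto simp: Rmod_def)

lemma mul_R: "Rmod I \<Longrightarrow> mul R I = I"
proof
  assume I: "Rmod I"
  show "mul R I \<subseteq> I" by (rule mul_sub) (use I in \<open>auto simp: Rmod_def\<close>)
  show "I \<subseteq> mul R I" using mulI[OF R_1, of _ I] by auto
qed

lemma mul_mono: "I \<subseteq> I' \<Longrightarrow> J \<subseteq> J' \<Longrightarrow> mul I J \<subseteq> mul I' J'"
  by (rule mul_sub) (auto intro: mulI mul_add)

lemma sm_iff: "x \<in> sm a I \<longleftrightarrow> (\<exists>y\<in>I. x = a * y)" by (auto simp: sm_def)
lemma sm_iff': "a \<noteq> 0 \<Longrightarrow> x \<in> sm a I \<longleftrightarrow> x / a \<in> I"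
  by (auto simp: sm_iff intro!: bexI[of _ "x / a"])
lemma sm_sm [simp]: "sm a (sm b I) = sm (a * b) I" by (auto simp: sm_def image_image mult.assoc)
lemma sm_1 [simp]: "sm 1 I = I" by (simp add: sm_def)
lemma Rmod_sm: "Rmod I \<Longrightarrow> Rmod (sm a I)"
proof -
  assume I: "Rmod I"
  have "0 \<in> sm a I" using Rmod_0[OF I] by (force simp: sm_iff)
  moreover have "x + y \<in> sm a I" if xy: "x \<in> sm a I" "y \<in> sm a I" for x y
  proof -
    obtain x' y' where "x' \<in> I" "y' \<in> I" "x = a * x'" "y = a * y'" using xy by (auto simp: sm_iff)
    then have "x' + y' \<in> I" "x + y = a * (x' + y')" using Rmod_add[OF I] by (auto simp: algebra_simps)
    then show ?thesis unfolding sm_iff by blast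
  qed
  moreover have "r * x \<in> sm a I" if rx: "r \<in> R" "x \<in> sm a I" for r x
  proof -
    obtain x' where "x' \<in> I" "x = a * x'" using rx by (auto simp: sm_iff)
    then have "r * x' \<in> I" "r * x = a * (r * x')" using Rmod_mult[OF I rx(1)] by simp_all
    then show ?thesis unfolding sm_iff by blast
  qed
  ultimately show ?thesis by (simp add: Rmod_def)
qed

lemma mul_sm: "mul (sm a I) J = sm a (mul I J)"
proof
  show "mul (sm a I) J \<subseteq> sm a (mul I J)"
  proof (rule mul_sub)
    fix x y assume "x \<in> sm a I" "y \<in> J"
    then obtain z where "z \<in> I" "x = a * z" by (auto simp: sm_iff)
    then show "x * y \<in> sm a (mul I J)" using mulI[of z I y J] \<open>y \<in> J\<close> by (auto simp: sm_iff mult.assoc)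
  next
    fix x y assume "x \<in> sm a (mul I J)" "y \<in> sm a (mul I J)"
    then obtain x' y' where "x' \<in> mul I J" "x = a * x'" "y' \<in> mul I J" "y = a * y'" by (auto simp: sm_iff)
    then have "x' + y' \<in> mul I J" "x + y = a * (x' + y')" using mul_add by (auto simp: algebra_simps)
    then show "x + y \<in> sm a (mul I J)" unfolding sm_iff by blast
  qed
  have "a * z \<in> mul (sm a I) J" if "z \<in> mul I J" for z using that
  proof (induction rule: mul_induct)
    case (prod x y)
    then have "(a * x) * y \<in> mul (sm a I) J" by (intro mulI) (auto simp: sm_iff)
    then show ?case by (simp add: mult.assoc)
  next
    case (sum x y) then show ?case using mul_add by (simp add: distrib_left)
  qed
  then show "sm a (mul I J) \<subseteq> mul (sm a I) J" by (auto simp: sm_iff)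
qed

lemma mul_sm2: "mul I (sm a J) = sm a (mul I J)"
  using mul_sm[of a J I] by (simp add: mul_commute)

lemma cj_iff: "x \<in> cj I \<longleftrightarrow> cnj x \<in> I"
  unfolding cj_def by (metis complex_cnj_cnj image_iff)
lemma cj_cj [simp]: "cj (cj I) = I" by (auto simp: cj_iff)
lemma cj_R [simp]: "cj R = R" using R_cnj by (metis cj_iff complex_cnj_cnj subsetI subset_antisym)
lemma cj_sm: "cj (sm a I) = sm (cnj a) (cj I)"
  by (auto simp: cj_def sm_def image_image)
lemma Rmod_cj: "Rmod I \<Longrightarrow> Rmod (cj I)"
  unfolding Rmod_def using R_cnj by (auto simp: cj_iff)
lemma cj_mul: "cj (mul I J) = mul (cj I) (cj J)"
proof -
  have le: "mul (cj I) (cj J) \<subseteq> cj (mul I J)" for I J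
    by (rule mul_sub) (auto simp: cj_iff mulI mul_add)
  have "cj (mul I J) \<subseteq> mul (cj I) (cj J)" using le[of "cj I" "cj J"] by (auto simp: cj_iff)
  then show ?thesis using le by blast
qed

lemma fidealI: "Rmod I \<Longrightarrow> x \<in> I \<Longrightarrow> x \<noteq> 0 \<Longrightarrow> n > 0 \<Longrightarrow> (\<And>y. y \<in> I \<Longrightarrow> of_int n * y \<in> R) \<Longrightarrow> fideal I"
  unfolding fideal_def by blast

lemma fideal_R: "fideal R"
  by (rule fidealI[OF Rmod_R R_1, of 1]) auto

lemma fideal_mul: "fideal I \<Longrightarrow> fideal J \<Longrightarrow> fideal (mul I J)"
proof -
  assume I: "fideal I" and J: "fideal J"
  obtain n where n: "n > 0" "\<And>x. x \<in> I \<Longrightarrow> of_int n * x \<in> R" using I by (auto simp: fideal_def)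
  obtain m where m: "m > 0" "\<And>x. x \<in> J \<Longrightarrow> of_int m * x \<in> R" using J by (auto simp: fideal_def)
  obtain x y where xy: "x \<in> I" "x \<noteq> 0" "y \<in> J" "y \<noteq> 0" using fideal_nonzero I J by metis
  show ?thesis
  proof (rule fidealI[OF Rmod_mul[OF fideal_Rmod[OF I] fideal_Rmod[OF J]] mulI[OF xy(1,3)]])
    show "x * y \<noteq> 0" "n * m > 0" using xy n m by auto
    show "of_int (n * m) * z \<in> R" if "z \<in> mul I J" for z using that
    proof (induction rule: mul_induct)
      case (prod x y)
      have "(of_int n * x) * (of_int m * y) \<in> R" using prod n m by blast
      then show ?case by (simp add: algebra_simps)
    next
      case (sum a b) then show ?case using R_add by (simp add: distrib_left)
    qed
  qed
qed

lemma K_to_R: "a \<in> K \<Longrightarrow> \<exists>n :: int. n > 0 \<and> of_int n * a \<in> R"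
proof -
  assume "a \<in> K"
  then obtain n where n: "n > 0" "of_int n * a \<in> Zs" using K_denominator by blast
  then obtain u v :: int where "of_int n * a = of_int u + of_int v * s" unfolding Zs_def by blast
  then have "of_int n * a \<in> R" by (simp add: R_add R_mult)
  then show ?thesis using n by blast
qed

lemma fideal_sm: "fideal I \<Longrightarrow> a \<in> K \<Longrightarrow> a \<noteq> 0 \<Longrightarrow> fideal (sm a I)"
proof -
  assume I: "fideal I" and a: "a \<in> K" "a \<noteq> 0"
  obtain n where n: "n > 0" "\<And>x. x \<in> I \<Longrightarrow> of_int n * x \<in> R" using I by (auto simp: fideal_def)
  obtain m where m: "m > 0" "of_int m * a \<in> R" using K_to_R[OF a(1)] by blast
  obtain x where x: "x \<in> I" "x \<noteq> 0" using fideal_nonzero I by metis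
  show ?thesis
  proof (rule fidealI[OF Rmod_sm[OF fideal_Rmod[OF I]]])
    show "a * x \<in> sm a I" "a * x \<noteq> 0" "m * n > 0" using x a n m by (auto simp: sm_iff)
    fix y assume "y \<in> sm a I"
    then obtain z where z: "z \<in> I" "y = a * z" by (auto simp: sm_iff)
    have "(of_int m * a) * (of_int n * z) \<in> R" using m n z by blast
    then show "of_int (m * n) * y \<in> R" using z by (simp add: algebra_simps)
  qed
qed

lemma fideal_cj: "fideal I \<Longrightarrow> fideal (cj I)"
proof -
  assume I: "fideal I"
  obtain n where n: "n > 0" "\<And>x. x \<in> I \<Longrightarrow> of_int n * x \<in> R" using I by (auto simp: fideal_def)
  obtain x where x: "x \<in> I" "x \<noteq> 0" using fideal_nonzero I by metis
  show ?thesis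
  proof (rule fidealI[OF Rmod_cj[OF fideal_Rmod[OF I]] _ _ n(1)])
    show "cnj x \<in> cj I" "cnj x \<noteq> 0" using x by (auto simp: cj_iff)
    fix y assume "y \<in> cj I"
    then have "of_int n * cnj y \<in> R" using n by (simp add: cj_iff)
    then show "of_int n * y \<in> R" using R_cnj[of "of_int n * cnj y"] by simp
  qed
qed

text \<open>The quotient of \<open>x\<close> times the conjugate of \<open>y\<close> by \<open>g\<close> has integral trace and norm.\<close>
lemma quotient_in_R:
  assumes "x \<in> K" "y \<in> K" "g \<noteq> 0" "g \<in> \<rat>"
    "x * cnj x = of_int a * of_real g" "y * cnj y = of_int b * of_real g" "x * cnj y + y * cnj x = of_int c * of_real g"
  shows "x * cnj y \<in> sm (of_real g) R"
proof -
  have "x * cnj y / of_real g \<in> R"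
    unfolding R_iff
  proof (intro conjI)
    show "x * cnj y / of_real g \<in> K" using assms K_rat by (intro K_divide K_mult K_cnj)
    have "x * cnj y / of_real g + cnj (x * cnj y / of_real g) = (x * cnj y + y * cnj x) / of_real g"
      by (simp add: add_divide_distrib mult.commute)
    also have "\<dots> = of_int c" using assms by simp
    finally show "x * cnj y / of_real g + cnj (x * cnj y / of_real g) \<in> \<int>" by simp
    have "(x * cnj y / of_real g) * cnj (x * cnj y / of_real g) = (x * cnj x) * (y * cnj y) / (of_real g * of_real g)"
      by (simp add: mult_ac)
    also have "\<dots> = of_int (a * b)" unfolding assms using assms(3) by simp
    finally show "(x * cnj y / of_real g) * cnj (x * cnj y / of_real g) \<in> \<int>" by simp
  qed
  then show ?thesis using assms(3) by (simp add: sm_iff')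
qed

text \<open>Let \<open>g\<close> generate the rational integers in \<open>I\<close> times its conjugate. This product contains the norms of \<open>x\<close>
  and \<open>y\<close> and the trace of \<open>x\<close> times the conjugate of \<open>y\<close>, so \<open>g\<close> divides them and \<open>quotient_in_R\<close> shows
  that \<open>g\<close> generates the product (an argument due to Hurwitz).\<close>
lemma norm_exists_integral:
  assumes I: "fideal I" "I \<subseteq> R"
  shows "\<exists>g :: int. g > 0 \<and> mul I (cj I) = sm (of_int g) R"
proof -
  define G where "G n \<longleftrightarrow> (of_int n :: complex) \<in> mul I (cj I)" for n :: int
  note M = Rmod_mul[OF fideal_Rmod[OF I(1)] Rmod_cj[OF fideal_Rmod[OF I(1)]]]
  have Gadd: "G (m + n)" if "G m" "G n" for m n using Rmod_add[OF M] that by (simp add: G_def)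
  have Gmul: "G (k * n)" if "G n" for k n using Rmod_mult[OF M R_int] that by (simp add: G_def)
  have GN: "G n" if "x \<in> I" "x * cnj x = of_int n" for x n
    using that mulI[of x I "cnj x" "cj I"] by (simp add: G_def cj_iff)
  obtain x where x: "x \<in> I" "x \<noteq> 0" using fideal_nonzero I by metis
  obtain n where n: "x * cnj x = of_int n" using R_norm x I by blast
  have "complex_of_real ((cmod x)\<^sup>2) = of_real (of_int n)" unfolding complex_norm_square using n by simp
  then have "(cmod x)\<^sup>2 = of_int n" using of_real_eq_iff by blast
  then have n0: "n > 0" using x(2) by (metis norm_eq_zero of_int_0_less_iff zero_less_power2)
  have "\<exists>m. m > 0 \<and> G (int m)" using GN[OF x(1) n] n0 by (intro exI[of _ "nat n"]) simp
  define g0 where "g0 = (LEAST m. m > 0 \<and> G (int m))"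
  have g0: "g0 > 0" "G (int g0)" using LeastI_ex[OF \<open>\<exists>m. m > 0 \<and> G (int m)\<close>] by (auto simp: g0_def)
  define g where "g = int g0"
  have g: "g > 0" "G g" using g0 by (auto simp: g_def)
  have gdvd: "g dvd n" if "G n" for n
  proof (rule ccontr)
    assume nd: "\<not> g dvd n"
    have "G (n + (- (n div g)) * g)" by (intro Gadd Gmul that g)
    then have "G (n mod g)" by (simp add: minus_div_mult_eq_mod[symmetric])
    moreover have "n mod g \<noteq> 0" using nd by (simp add: dvd_eq_mod_eq_0)
    moreover have "0 \<le> n mod g" "n mod g < g" using g(1) by auto
    ultimately have "nat (n mod g) > 0 \<and> G (int (nat (n mod g)))" by simp
    then have "g0 \<le> nat (n mod g)" unfolding g0_def by (rule Least_le)
    then have "int g0 \<le> n mod g" using \<open>0 \<le> n mod g\<close> by (simp add: le_nat_iff)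
    then show False using \<open>n mod g < g\<close> by (simp add: g_def)
  qed
  have "mul I (cj I) \<subseteq> sm (of_int g) R"
  proof (rule mul_sub)
    fix x y' assume x: "x \<in> I" and y': "y' \<in> cj I"
    define y where "y = cnj y'"
    have y: "y \<in> I" "y' = cnj y" using y' by (auto simp: y_def cj_iff)
    obtain a where a: "x * cnj x = of_int a" using R_norm x I by blast
    obtain b where b: "y * cnj y = of_int b" using R_norm y I by blast
    have "x * cnj y + y * cnj x \<in> \<real>" by (simp add: complex_is_Real_iff algebra_simps)
    moreover have "x * cnj y + y * cnj x \<in> R" using x y I R_cnj by (intro R_add R_mult) auto
    ultimately obtain c where c: "x * cnj y + y * cnj x = of_int c" using R_real by blast
    have "G c" using Rmod_add[OF M mulI[of x I "cnj y" "cj I"] mulI[of y I "cnj x" "cj I"]] x y c by (simp add: G_def cj_iff)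
    then obtain a' b' c' where "a = g * a'" "b = g * b'" "c = g * c'"
      using gdvd GN[OF x a] GN[OF y(1) b] by (meson dvdE)
    then have "x * cnj y \<in> sm (of_real (of_int g)) R"
      using a b c g(1) x y I R_K by (intro quotient_in_R[of _ _ _ a' b' c']) auto
    then show "x * y' \<in> sm (of_int g) R" using y by simp
  qed (rule Rmod_add[OF Rmod_sm[OF Rmod_R]])
  moreover have "sm (of_int g) R \<subseteq> mul I (cj I)"
    using Rmod_mult[OF M] g(2) by (auto simp: sm_iff G_def mult.commute)
  ultimately show ?thesis using g(1) by blast
qed

lemma norm_exists:
  assumes I: "fideal I"
  shows "\<exists>g :: real. g > 0 \<and> g \<in> \<rat> \<and> mul I (cj I) = sm (of_real g) R"
proof -
  obtain n where n: "n > 0" "\<And>x. x \<in> I \<Longrightarrow> of_int n * x \<in> R" using I by (auto simp: fideal_def)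
  have f: "fideal (sm (of_int n) I)" using I n(1) by (intro fideal_sm) auto
  moreover have "sm (of_int n) I \<subseteq> R" using n(2) by (auto simp: sm_iff)
  ultimately obtain g where g: "g > 0" "mul (sm (of_int n) I) (cj (sm (of_int n) I)) = sm (of_int g) R"
    using norm_exists_integral by blast
  then have "sm (of_int n * of_int n) (mul I (cj I)) = sm (of_int g) R" by (simp add: cj_sm mul_sm mul_sm2)
  then have "sm (inverse (of_int n * of_int n)) (sm (of_int n * of_int n) (mul I (cj I))) = sm (inverse (of_int n * of_int n)) (sm (of_int g) R)" by simp
  then have "mul I (cj I) = sm (of_real (of_int g / (of_int n * of_int n))) R" using n(1) by (simp add: field_simps)
  moreover have "of_int g / (of_int n * of_int n) > (0::real)" using g n by simp
  ultimately show ?thesis by (intro exI[of _ "of_int g / (of_int n * of_int n)"]) auto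
qed

lemma norm_unique:
  assumes "g > 0" "h > 0" "sm (complex_of_real g) R = sm (of_real h) R"
  shows "g = h"
proof -
  have le: "\<exists>n :: int. g = h * of_int n" if gh: "g > 0" "h > 0" "sm (complex_of_real g) R = sm (of_real h) R" for g h
  proof -
    have "complex_of_real g \<in> sm (of_real g) R" using R_1 by (force simp: sm_iff)
    then obtain r where r: "r \<in> R" "complex_of_real g = of_real h * r" using gh by (auto simp: sm_iff)
    then have "r = of_real (g / h)" using gh by (simp add: field_simps)
    then have "r \<in> \<real>" by simp
    then obtain n where n: "r = of_int n" using R_real r by blast
    have "complex_of_real g = of_real (h * of_int n)" using r n by simp
    then show ?thesis using of_real_eq_iff by blast
  qed
  obtain n where n: "g = h * of_int n" using le assms by blast
  obtain m where m: "h = g * of_int m" using le[OF assms(2,1) assms(3)[symmetric]] by blast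
  have "g * (of_int m * of_int n) = g * 1" using n m by (metis mult.assoc mult.right_neutral)
  then have "of_int (m * n) = (1::real)" using assms(1) by simp
  then have "m * n = 1" by linarith
  moreover have "n > 0" using n assms zero_less_mult_pos by (metis of_int_0_less_iff)
  ultimately have "n = 1" by (simp add: zmult_eq_1_iff)
  then show ?thesis using n by simp
qed

text \<open>The ideal norm, as the positive generator of the product of \<open>I\<close> with its conjugate.\<close>
definition "nrm I = (THE g. g > 0 \<and> mul I (cj I) = sm (complex_of_real g) R)"

lemma nrm_eqI: "g > 0 \<Longrightarrow> mul I (cj I) = sm (of_real g) R \<Longrightarrow> nrm I = g"
  unfolding nrm_def by (rule the_equality) (auto intro: norm_unique)

lemma nrm: assumes "fideal I" shows "nrm I > 0" "nrm I \<in> \<rat>" "mul I (cj I) = sm (of_real (nrm I)) R"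
proof -
  obtain g where g: "g > 0" "g \<in> \<rat>" "mul I (cj I) = sm (of_real g) R" using norm_exists[OF assms] by blast
  then have "nrm I = g" by (intro nrm_eqI)
  then show "nrm I > 0" "nrm I \<in> \<rat>" "mul I (cj I) = sm (of_real (nrm I)) R" using g by auto
qed

lemma nrm_mul: assumes "fideal I" "fideal J" shows "nrm (mul I J) = nrm I * nrm J"
proof (rule nrm_eqI)
  show "nrm I * nrm J > 0" using nrm assms by simp
  have "mul (mul I J) (cj (mul I J)) = mul (mul I (cj I)) (mul J (cj J))"
    by (simp add: cj_mul) (metis mul_assoc mul_commute)
  also have "\<dots> = sm (of_real (nrm I * nrm J)) R"
    by (simp add: nrm(3)[OF assms(1)] nrm(3)[OF assms(2)] mul_sm mul_sm2 mul_R[OF Rmod_R] mult.commute)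
  finally show "mul (mul I J) (cj (mul I J)) = sm (of_real (nrm I * nrm J)) R" .
qed

lemma nrm_sm: assumes "fideal I" "a \<noteq> 0" shows "nrm (sm a I) = (cmod a)\<^sup>2 * nrm I"
proof (rule nrm_eqI)
  show "(cmod a)\<^sup>2 * nrm I > 0" using nrm assms by simp
  have "mul (sm a I) (cj (sm a I)) = sm (a * cnj a) (mul I (cj I))" by (simp add: cj_sm mul_sm mul_sm2 mult.commute)
  then show "mul (sm a I) (cj (sm a I)) = sm (of_real ((cmod a)\<^sup>2 * nrm I)) R"
    by (simp add: nrm(3)[OF assms(1)] complex_norm_square[symmetric])
qed

lemma nrm_R [simp]: "nrm R = 1"
  by (rule nrm_eqI) (simp_all add: mul_R[OF Rmod_R])

definition "invi I = sm (of_real (inverse (nrm I))) (cj I)"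

lemma fideal_invi: "fideal I \<Longrightarrow> fideal (invi I)"
  unfolding invi_def using nrm[of I] by (intro fideal_sm fideal_cj K_rat) auto

lemma mul_invi: "fideal I \<Longrightarrow> mul I (invi I) = R"
  unfolding invi_def using nrm[of I] by (simp add: mul_sm2 del: of_real_inverse flip: of_real_mult)

lemma nrm_invi: "fideal I \<Longrightarrow> nrm (invi I) = inverse (nrm I)"
  using nrm_mul[OF _ fideal_invi, of I I] nrm(1)[of I] by (simp add: mul_invi field_simps)

end

section \<open>Representatives of ideal classes\<close>
context imaginary_quadratic
begin

lemma norm_ratio_integer:
  assumes I: "fideal I" and z: "z \<in> mul I (cj I)" "z \<in> \<real>"
  shows "\<exists>m :: int. z = of_int m * of_real (nrm I)"
proof -
  obtain r where r: "r \<in> R" "z = of_real (nrm I) * r" using z(1) nrm(3)[OF I] by (auto simp: sm_iff)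
  then have "r = z / of_real (nrm I)" using nrm(1)[OF I] by simp
  then have "r \<in> \<real>" using z(2) by simp
  then obtain m where "r = of_int m" using R_real r by blast
  then show ?thesis using r by (auto simp: mult.commute)
qed

lemma element_norm: "fideal I \<Longrightarrow> x \<in> I \<Longrightarrow> \<exists>m :: int. x * cnj x = of_int m * of_real (nrm I)"
  by (rule norm_ratio_integer) (auto intro!: mulI simp: cj_iff complex_is_Real_iff)

lemma element_trace: "fideal I \<Longrightarrow> x \<in> I \<Longrightarrow> y \<in> I \<Longrightarrow> \<exists>m :: int. x * cnj y + y * cnj x = of_int m * of_real (nrm I)"
  by (rule norm_ratio_integer) (auto intro!: mulI mul_add simp: cj_iff complex_is_Real_iff)

lemma nrm_integral: "fideal I \<Longrightarrow> I \<subseteq> R \<Longrightarrow> \<exists>n :: nat. n > 0 \<and> nrm I = real n"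
proof -
  assume I: "fideal I" "I \<subseteq> R"
  obtain g where g: "g > 0" "mul I (cj I) = sm (of_int g) R" using norm_exists_integral[OF I] by blast
  then have "nrm I = of_int g" by (intro nrm_eqI) auto
  then show ?thesis using g by (intro exI[of _ "nat g"]) auto
qed

lemma nrm_mem: "fideal I \<Longrightarrow> I \<subseteq> R \<Longrightarrow> of_real (nrm I) \<in> I"
proof -
  assume I: "fideal I" "I \<subseteq> R"
  have "of_real (nrm I) \<in> mul I (cj I)" using nrm(3)[OF I(1)] R_1 by (force simp: sm_iff)
  moreover have "cj I \<subseteq> R" using I(2) R_cnj by (auto simp: cj_iff) (metis complex_cnj_cnj subsetD)
  ultimately have "of_real (nrm I) \<in> mul I R" using mul_mono[of I I "cj I" R] by blast
  then show ?thesis using mul_R[OF fideal_Rmod[OF I(1)]] by (simp add: mul_commute)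
qed

text \<open>If \<open>l\<close> divided all values \<open>N(x)/N(I)\<close>, then by polarisation the product of \<open>I\<close> with its conjugate would lie
  in \<open>l N(I) R\<close>.\<close>
lemma element_norm_not_divisible:
  assumes I: "fideal I" and l: "l > 1"
  shows "\<exists>x\<in>I. \<exists>m :: int. x * cnj x = of_int m * of_real (nrm I) \<and> \<not> l dvd m"
proof (rule ccontr)
  assume "\<not> ?thesis"
  then have no: "l dvd m" if "x \<in> I" "x * cnj x = of_int m * of_real (nrm I)" for x m using that by blast
  note n = nrm[OF I]
  have elt: "\<exists>m'. x * cnj x = of_int m' * of_real (of_int l * nrm I)" if x: "x \<in> I" for x
  proof -
    obtain m where m: "x * cnj x = of_int m * of_real (nrm I)" using element_norm[OF I x] by blast
    then obtain m' where "m = l * m'" using no x by blast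
    then show ?thesis using m by (intro exI[of _ m']) simp
  qed
  have "mul I (cj I) \<subseteq> sm (of_real (of_int l * nrm I)) R"
  proof (rule mul_sub)
    fix x y' assume x: "x \<in> I" and y': "y' \<in> cj I"
    define y where "y = cnj y'"
    have y: "y \<in> I" "y' = cnj y" using y' by (auto simp: y_def cj_iff)
    have xy: "x + y \<in> I" using x y Rmod_add[OF fideal_Rmod[OF I]] by blast
    obtain a where a: "x * cnj x = of_int a * of_real (of_int l * nrm I)" using elt[OF x] by blast
    obtain b where b: "y * cnj y = of_int b * of_real (of_int l * nrm I)" using elt[OF y(1)] by blast
    obtain c where c: "(x + y) * cnj (x + y) = of_int c * of_real (of_int l * nrm I)" using elt[OF xy] by blast
    have "x * cnj y + y * cnj x = (x + y) * cnj (x + y) - x * cnj x - y * cnj y" by (simp add: algebra_simps)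
    also have "\<dots> = of_int (c - a - b) * of_real (of_int l * nrm I)" unfolding a b c by (simp add: algebra_simps)
    finally have "x * cnj y \<in> sm (of_real (of_int l * nrm I)) R"
      using a b n l fideal_K[OF I] x y by (intro quotient_in_R[of _ _ _ a b "c - a - b"]) auto
    then show "x * y' \<in> sm (of_real (of_int l * nrm I)) R" using y by simp
  qed (rule Rmod_add[OF Rmod_sm[OF Rmod_R]])
  moreover have "of_real (nrm I) \<in> mul I (cj I)" using n(3) R_1 by (force simp: sm_iff)
  ultimately have "of_real (nrm I) \<in> sm (of_real (of_int l * nrm I)) R" by blast
  then obtain r where r: "r \<in> R" "complex_of_real (nrm I) = of_real (of_int l * nrm I) * r" unfolding sm_iff by blast
  have "complex_of_real (nrm I) * (of_int l * r) = of_real (nrm I) * 1"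
    by (subst (2) r(2)) (simp add: mult_ac)
  then have r1: "of_int l * r = 1" using n(1) by (simp only: mult_cancel_left) auto
  then have "r = of_real (1 / of_int l)" using l by (simp add: field_simps)
  then have "r \<in> \<real>" by simp
  then obtain k where "r = of_int k" using R_real r by blast
  then have "of_int (l * k) = (1::complex)" using r1 by simp
  then have "l * k = 1" by (metis of_int_eq_1_iff)
  then show False using l by (simp add: zmult_eq_1_iff)
qed

text \<open>Add the primes one by one: \<open>z = l x + M y\<close> has norm prime to \<open>l\<close> because of \<open>y\<close> and prime to the factors of \<open>M\<close>
  because of \<open>x\<close>.\<close>
lemma element_norm_coprime:
  assumes I: "fideal I" and S: "finite S" "\<And>l. l \<in> S \<Longrightarrow> prime (l :: nat)"
  shows "\<exists>x\<in>I. x \<noteq> 0 \<and> (\<exists>m :: int. x * cnj x = of_int m * of_real (nrm I) \<and> (\<forall>l\<in>S. \<not> int l dvd m))"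
  using S
proof (induction S rule: finite_induct)
  case empty
  obtain x where "x \<in> I" "x \<noteq> 0" using fideal_nonzero[OF I] by blast
  then show ?case using element_norm[OF I] by blast
next
  case (insert l S)
  obtain x m where x: "x \<in> I" "x * cnj x = of_int m * of_real (nrm I)" "\<forall>l\<in>S. \<not> int l dvd m"
    using insert by blast
  have l: "prime l" using insert by blast
  obtain y k where y: "y \<in> I" "y * cnj y = of_int k * of_real (nrm I)" "\<not> int l dvd k"
    using element_norm_not_divisible[OF I, of "int l"] prime_gt_1_nat[OF l] by auto
  obtain t where t: "x * cnj y + y * cnj x = of_int t * of_real (nrm I)" using element_trace[OF I x(1) y(1)] by blast
  define M where "M = (\<Prod>q\<in>S. int q)"
  define z where "z = of_int (int l) * x + of_int M * y"
  have z: "z \<in> I" unfolding z_def using Rmod_add[OF fideal_Rmod[OF I]] Rmod_mult[OF fideal_Rmod[OF I] R_int] x y by blast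
  define k' where "k' = int l * int l * m + int l * M * t + M * M * k"
  have "z * cnj z = of_int (int l * int l) * (x * cnj x) + of_int (int l * M) * (x * cnj y + y * cnj x) + of_int (M * M) * (y * cnj y)"
    by (simp add: z_def algebra_simps)
  also have "\<dots> = of_int k' * of_real (nrm I)" unfolding x t y k'_def by (simp add: algebra_simps)
  finally have zk: "z * cnj z = of_int k' * of_real (nrm I)" .
  have pl: "prime (int l)" using l by simp
  have "\<not> int l dvd M"
  proof
    assume "int l dvd M"
    then obtain q where "q \<in> S" "int l dvd int q" unfolding M_def using prime_dvd_prod_iff[OF insert(1) pl, of int] by blast
    then have "l = q" using primes_dvd_imp_eq[of l q] l insert.prems by simp
    then show False using \<open>q \<in> S\<close> insert by blast
  qed
  then have ndl: "\<not> int l dvd k'"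
  proof -
    have "\<not> int l dvd M * M * k" using \<open>\<not> int l dvd M\<close> y(3) pl by (simp add: prime_dvd_mult_iff)
    moreover have e: "k' = int l * (int l * m + M * t) + M * M * k" by (simp add: k'_def algebra_simps)
    ultimately show ?thesis unfolding e using dvd_add_right_iff[of "int l" "int l * (int l * m + M * t)"] by simp
  qed
  have ndS: "\<not> int q dvd k'" if q: "q \<in> S" for q
  proof -
    have pq: "prime (int q)" using insert.prems q by simp
    have "l \<noteq> q" using q insert by blast
    then have "\<not> int q dvd int l" using primes_dvd_imp_eq[of q l] l insert.prems q by auto
    then have "\<not> int q dvd int l * int l * m" using x(3) q pq by (simp add: prime_dvd_mult_iff)
    moreover have "int q dvd M" unfolding M_def using insert(1) q by (simp add: dvd_prodI)
    then have "int q dvd int l * M * t + M * M * k" by simp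
    moreover have "k' = int l * int l * m + (int l * M * t + M * M * k)" by (simp add: k'_def)
    ultimately show ?thesis using dvd_add_left_iff by metis
  qed
  have "k' \<noteq> 0" using ndl by auto
  then have "z \<noteq> 0" using zk nrm(1)[OF I] by auto
  then show ?case using z zk ndl ndS by blast
qed

text \<open>Primitive ideals: not divisible by a rational prime.\<close>
definition "prim J \<longleftrightarrow> (\<forall>l :: nat. prime l \<longrightarrow> \<not> J \<subseteq> sm (of_nat l) R)"

text \<open>Dividing by a rational prime lowers the norm.\<close>
lemma primitive_part:
  assumes "fideal I" "I \<subseteq> R" "nrm I = real n"
  shows "\<exists>(m :: nat) J. m > 0 \<and> I = sm (of_nat m) J \<and> fideal J \<and> J \<subseteq> R \<and> prim J"
  using assms
proof (induction n arbitrary: I rule: less_induct)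
  case (less n)
  show ?case
  proof (cases "prim I")
    case True
    then show ?thesis using less.prems by (intro exI[of _ 1] exI[of _ I]) simp
  next
    case False
    then obtain l :: nat where l: "prime l" "I \<subseteq> sm (of_nat l) R" by (auto simp: prim_def)
    have l0: "(of_nat l :: complex) \<noteq> 0" "of_nat l \<in> K" using l K_of_int[of "int l"] by (auto simp: prime_gt_0_nat)
    define J where "J = sm (inverse (of_nat l)) I"
    have IJ: "I = sm (of_nat l) J" using l0 by (simp add: J_def)
    have J: "fideal J" unfolding J_def using less.prems l0 K_inverse by (intro fideal_sm) auto
    have JR: "J \<subseteq> R"
    proof
      fix x assume "x \<in> J"
      then have "of_nat l * x \<in> I" unfolding IJ sm_iff by blast
      then have "of_nat l * x \<in> sm (of_nat l) R" using l(2) by blast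
      then show "x \<in> R" using l0 by (auto simp: sm_iff)
    qed
    obtain n' where n': "n' > 0" "nrm J = real n'" using nrm_integral[OF J JR] by blast
    have "real n = (real l)\<^sup>2 * real n'" using nrm_sm[OF J l0(1)] IJ less.prems(3) n'(2) by simp
    then have "n = l\<^sup>2 * n'" by (metis of_nat_eq_iff of_nat_mult of_nat_power)
    moreover have "1 < l\<^sup>2" using prime_gt_1_nat[OF l(1)] power_strict_mono[of 1 l 2] by simp
    ultimately have "n' < n" using n'(1) n_less_m_mult_n[of n' "l\<^sup>2"] by simp
    then obtain m J' where "m > 0" "J = sm (of_nat m) J'" "fideal J'" "J' \<subseteq> R" "prim J'"
      using less.IH[OF _ J JR n'(2)] by blast
    then show ?thesis using IJ l(1) prime_gt_0_nat by (intro exI[of _ "l * m"] exI[of _ J']) simp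
  qed
qed

text \<open>Equality of ideal classes.\<close>
definition "eqv I J \<longleftrightarrow> (\<exists>a\<in>K. a \<noteq> 0 \<and> J = sm a I)"

lemma eqvI: "a \<in> K \<Longrightarrow> a \<noteq> 0 \<Longrightarrow> eqv I (sm a I)" by (auto simp: eqv_def)
lemma eqv_refl: "eqv I I" using eqvI[of 1 I] by simp
lemma eqv_sym: "eqv I J \<Longrightarrow> eqv J I"
proof -
  assume "eqv I J"
  then obtain a where a: "a \<in> K" "a \<noteq> 0" "J = sm a I" by (auto simp: eqv_def)
  then have "I = sm (inverse a) J" by simp
  then show ?thesis using eqvI[of "inverse a" J] a K_inverse by simp
qed
lemma eqv_trans: "eqv I J \<Longrightarrow> eqv J L \<Longrightarrow> eqv I L"
proof -
  assume "eqv I J" "eqv J L"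
  then obtain a b where "a \<in> K" "a \<noteq> 0" "J = sm a I" "b \<in> K" "b \<noteq> 0" "L = sm b J" by (auto simp: eqv_def)
  then show ?thesis using eqvI[of "b * a" I] K_mult by simp
qed
lemma eqv_mul: "eqv I J \<Longrightarrow> eqv I' J' \<Longrightarrow> eqv (mul I I') (mul J J')"
proof -
  assume "eqv I J" "eqv I' J'"
  then obtain a b where "a \<in> K" "a \<noteq> 0" "J = sm a I" "b \<in> K" "b \<noteq> 0" "J' = sm b I'" by (auto simp: eqv_def)
  then show ?thesis using eqvI[of "a * b" "mul I I'"] K_mult by (simp add: mul_sm mul_sm2 mult.commute)
qed
lemma eqv_fideal: "fideal I \<Longrightarrow> eqv I J \<Longrightarrow> fideal J"
  using fideal_sm by (auto simp: eqv_def)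

text \<open>Multiplying \<open>I\<close> by an element \<open>x\<close> of its inverse gives an integral ideal of norm \<open>N(x) N(I)\<close>, which is prime to
  \<open>S\<close> for suitable \<open>x\<close>. Removing the rational content makes it primitive.\<close>
lemma good_representative:
  assumes I: "fideal I" and S: "finite S" "\<And>l. l \<in> S \<Longrightarrow> prime (l :: nat)"
  obtains J n where "eqv I J" "fideal J" "J \<subseteq> R" "prim J" "nrm J = real n" "n > 0" "\<And>l. l \<in> S \<Longrightarrow> \<not> l dvd n"
proof -
  have I': "fideal (invi I)" by (rule fideal_invi[OF I])
  obtain x m where x: "x \<in> invi I" "x \<noteq> 0" "x * cnj x = of_int m * of_real (nrm (invi I))" "\<forall>l\<in>S. \<not> int l dvd m"
    using element_norm_coprime[OF I' S] by blast
  have xK: "x \<in> K" using fideal_K[OF I' x(1)] .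
  define I1 where "I1 = sm x I"
  have f1: "fideal I1" unfolding I1_def by (rule fideal_sm[OF I xK x(2)])
  have "I1 \<subseteq> mul (invi I) I" using x(1) by (auto simp: I1_def sm_iff intro: mulI)
  then have R1: "I1 \<subseteq> R" using mul_invi[OF I] by (simp add: mul_commute)
  obtain n1 where n1: "n1 > 0" "nrm I1 = real n1" using nrm_integral[OF f1 R1] by blast
  have "complex_of_real ((cmod x)\<^sup>2) = of_real (of_int m * inverse (nrm I))"
    using x(3) unfolding complex_norm_square nrm_invi[OF I] by simp
  then have "(cmod x)\<^sup>2 = of_int m * inverse (nrm I)" using of_real_eq_iff by blast
  then have "nrm I1 = of_int m" using nrm_sm[OF I x(2)] nrm(1)[OF I] by (simp add: I1_def)
  then have mn: "m = int n1" using n1 by linarith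
  obtain k J where J: "k > 0" "I1 = sm (of_nat k) J" "fideal J" "J \<subseteq> R" "prim J"
    using primitive_part[OF f1 R1 n1(2)] by blast
  have k: "(of_nat k :: complex) \<noteq> 0" "(of_nat k :: complex) \<in> K" using J(1) K_of_int[of "int k"] by auto
  obtain n where n: "n > 0" "nrm J = real n" using nrm_integral[OF J(3,4)] by blast
  have "real n1 = (real k)\<^sup>2 * real n" using nrm_sm[OF J(3) k(1)] J(2) n1(2) n(2) by simp
  then have "n1 = k\<^sup>2 * n" by (metis of_nat_eq_iff of_nat_mult of_nat_power)
  then have "n dvd n1" by simp
  then have "\<not> l dvd n" if "l \<in> S" for l using x(4) that mn by (metis dvd_trans int_dvd_int_iff)
  moreover have "eqv I J"
  proof -
    have "eqv I I1" unfolding I1_def by (rule eqvI[OF xK x(2)])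
    moreover have "eqv J I1" unfolding J(2) by (rule eqvI[OF k(2,1)])
    ultimately show ?thesis using eqv_trans eqv_sym by blast
  qed
  ultimately show thesis using that J n by blast
qed

lemma coords_divisible:
  assumes l: "odd (l :: int)" and x: "even (u + v)" "x = (of_int u + of_int v * s) / 2" and d: "l dvd u" "l dvd v"
  shows "x \<in> sm (of_int l) R"
proof -
  obtain a b where ab: "u = l * a" "v = l * b" using d by (auto elim!: dvdE)
  have "even (l * (a + b))" using x(1) ab by (simp add: algebra_simps)
  then have "even (a + b)" using l by simp
  then have "(of_int a + of_int b * s) / 2 \<in> R" using R_coords by blast
  moreover have "x = of_int l * ((of_int a + of_int b * s) / 2)" using x(2) ab by (simp add: field_simps)
  ultimately show ?thesis unfolding sm_iff by blast
qed

lemma norm_coords: "x = (of_int u + of_int v * s) / 2 \<Longrightarrow> x * cnj x = of_int n \<Longrightarrow> u * u - d * (v * v) = 4 * n"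
proof -
  assume x: "x = (of_int u + of_int v * s) / 2" and n: "x * cnj x = of_int n"
  have x2: "2 * x = of_int u + of_int v * s" unfolding x by simp
  have "of_int (4 * n) = (2 * x) * cnj (2 * x)" using n by (simp add: algebra_simps)
  also have "\<dots> = of_int u * of_int u - of_int v * of_int v * (s * s)" unfolding x2 by (simp add: cnj_s algebra_simps)
  also have "\<dots> = of_int (u * u - d * (v * v))" by (simp add: s_sq algebra_simps)
  finally have "(of_int (4 * n) :: complex) = of_int (u * u - d * (v * v))" .
  then show ?thesis using of_int_eq_iff by metis
qed

lemma element_norm_int:
  assumes I: "fideal I" "nrm I = real n" and x: "x \<in> I"
  shows "\<exists>m :: int. x * cnj x = of_int (int n * m)"
  using element_norm[OF I(1) x] I(2) by (auto simp: mult.commute)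

text \<open>Take \<open>x = (u + vs)/2\<close> in \<open>J\<close> but not in \<open>l R\<close>. Its norm is divisible by \<open>l\<close>, so \<open>u\<^sup>2 \<equiv> d v\<^sup>2\<close>, and \<open>l\<close> does not
  divide \<open>v\<close> by the choice of \<open>x\<close>.\<close>
lemma primitive_split:
  assumes J: "fideal J" "J \<subseteq> R" "prim J" "nrm J = real n" and l: "prime (l :: nat)" "2 < l" "l dvd n" "\<not> int l dvd d"
  shows "Legendre d l = 1"
proof -
  interpret odd_prime l by standard fact+
  obtain x where x: "x \<in> J" "x \<notin> sm (of_nat l) R" using J(3) l(1) by (auto simp: prim_def)
  obtain u v where uv: "even (u + v)" "x = (of_int u + of_int v * s) / 2" using x J(2) R_coords by blast
  obtain m where m: "x * cnj x = of_int (int n * m)" using element_norm_int[OF J(1,4) x(1)] by blast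
  have e: "u * u - d * (v * v) = 4 * (int n * m)" by (rule norm_coords[OF uv(2) m])
  have "int l dvd u * u - d * (v * v)" unfolding e using l(3) by (simp add: dvd_mult2 dvd_mult)
  then have c: "[d * v\<^sup>2 = u\<^sup>2] (mod int l)" by (simp add: cong_iff_dvd_diff power2_eq_square dvd_diff_commute)
  have nv: "\<not> int l dvd v"
  proof
    assume lv: "int l dvd v"
    then have "int l dvd d * v\<^sup>2" by (simp add: power2_eq_square)
    then have "int l dvd u\<^sup>2" using c cong_dvd_iff by blast
    then have "int l dvd u" using pint prime_dvd_power by blast
    moreover have "odd (int l)" using prime_odd_nat[OF l(1,2)] by simp
    ultimately have "x \<in> sm (of_int (int l)) R" using coords_divisible[of "int l" u v] uv lv by blast
    then show False using x(2) by simp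
  qed
  have "\<not> int l dvd d * v\<^sup>2" using nv l(4) pint by (auto simp: prime_dvd_mult_iff prime_dvd_power_iff)
  then have "\<not> int l dvd u\<^sup>2" using c cong_dvd_iff by blast
  then have nu: "\<not> int l dvd u" by (auto simp: power2_eq_square)
  have "Legendre d l = Legendre (d * v\<^sup>2) l" by (simp add: Legendre_cancel_square[OF nv])
  also have "\<dots> = 1" using Legendre_cong[OF c] Legendre_square[OF nu] by simp
  finally show ?thesis .
qed

text \<open>The square of a primitive ideal is not divisible by an unramified prime \<open>l\<close>. For \<open>x\<close> in \<open>J\<close> with
  \<open>x\<^sup>2\<close> in \<open>l R\<close> both trace and norm would be divisible by \<open>l\<close>, and then so would \<open>x\<close>.\<close>
lemma primitive_square:
  assumes J: "fideal J" "J \<subseteq> R" "prim J" "nrm J = real n" and l: "prime (l :: nat)" "2 < l" "l dvd n" "\<not> int l dvd d"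
  shows "\<exists>x\<in>J. x * x \<notin> sm (of_nat l) R"
proof -
  have pint: "prime (int l)" and ol: "odd (int l)" using l prime_odd_nat[OF l(1,2)] by auto
  obtain x where x: "x \<in> J" "x \<notin> sm (of_nat l) R" using J(3) l(1) by (auto simp: prim_def)
  have "x * x \<notin> sm (of_nat l) R"
  proof
    assume "x * x \<in> sm (of_nat l) R"
    then obtain r where r: "r \<in> R" "x * x = of_nat l * r" by (auto simp: sm_iff)
    obtain u v where uv: "even (u + v)" "x = (of_int u + of_int v * s) / 2" using x J(2) R_coords by blast
    obtain m where m: "x * cnj x = of_int (int n * m)" using element_norm_int[OF J(1,4) x(1)] by blast
    have e: "u * u - d * (v * v) = 4 * (int n * m)" by (rule norm_coords[OF uv(2) m])
    obtain t where t: "r + cnj r = of_int t" using r(1) R_iff by (auto elim!: Ints_cases)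
    have tr: "x + cnj x = of_int u" unfolding uv(2) by (simp add: cnj_s field_simps)
    have "of_int (u * u) = (x + cnj x) * (x + cnj x)" unfolding tr by simp
    also have "\<dots> = of_nat l * (r + cnj r) + 2 * (x * cnj x)"
    proof -
      have "cnj (x * x) = cnj (of_nat l * r)" by (simp only: r(2))
      then have "cnj x * cnj x = of_nat l * cnj r" by simp
      moreover have "(x + cnj x) * (x + cnj x) = x * x + cnj x * cnj x + 2 * (x * cnj x)" by (simp add: algebra_simps)
      ultimately show ?thesis using r(2) by (simp add: distrib_left)
    qed
    also have "\<dots> = of_int (int l * t + 2 * (int n * m))" unfolding t m by simp
    finally have "u * u = int l * t + 2 * (int n * m)" using of_int_eq_iff by blast
    moreover have ln: "int l dvd int n * m" using l(3) by simp
    ultimately have "int l dvd u * u" by simp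
    then have lu: "int l dvd u" using pint prime_dvd_mult_iff by blast
    have "d * (v * v) = u * u - 4 * (int n * m)" using e by simp
    then have "int l dvd d * (v * v)" using lu ln by simp
    then have "int l dvd v" using pint l(4) by (simp add: prime_dvd_mult_iff)
    then have "x \<in> sm (of_int (int l)) R" using coords_divisible[OF ol uv lu] by blast
    then show False using x(2) by simp
  qed
  then show ?thesis using x by blast
qed

text \<open>Hilbert's Theorem 90 for ideals: with \<open>L = R + I\<close>, multiplying the conjugate of \<open>L\<close> by \<open>I\<close> gives \<open>I + R = L\<close>,
  because \<open>I\<close> times its conjugate is \<open>R\<close>. Multiplying by \<open>L\<close> gives \<open>N(L) I = L\<^sup>2\<close>.\<close>
lemma norm_one_is_square:
  assumes I: "fideal I" and n: "nrm I = 1"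
  obtains L where "fideal L" "eqv I (mul L L)"
proof -
  define L where "L = {x + y | x y. x \<in> R \<and> y \<in> I}"
  note M = fideal_Rmod[OF I]
  have LI: "x + y \<in> L" if "x \<in> R" "y \<in> I" for x y using that unfolding L_def by blast
  have RL: "R \<subseteq> L" using LI[OF _ Rmod_0[OF M]] by auto
  have IL: "I \<subseteq> L" using LI[OF R_0] by auto
  have modL: "Rmod L"
    unfolding Rmod_def
  proof (intro conjI ballI)
    show "0 \<in> L" using RL by auto
    fix a b assume "a \<in> L" "b \<in> L"
    then obtain x y x' y' where xy: "x \<in> R" "y \<in> I" "a = x + y" "x' \<in> R" "y' \<in> I" "b = x' + y'" unfolding L_def by blast
    then have "x + x' \<in> R" "y + y' \<in> I" "a + b = (x + x') + (y + y')" using Rmod_add[OF M] by auto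
    then show "a + b \<in> L" using LI by simp
  next
    fix r a assume r: "r \<in> R" and "a \<in> L"
    then obtain x y where xy: "x \<in> R" "y \<in> I" "a = x + y" unfolding L_def by blast
    then have "r * x \<in> R" "r * y \<in> I" "r * a = r * x + r * y" using Rmod_mult[OF M] r by (auto simp: distrib_left)
    then show "r * a \<in> L" using LI by simp
  qed
  have fL: "fideal L"
  proof -
    obtain k where k: "k > 0" "\<And>x. x \<in> I \<Longrightarrow> of_int k * x \<in> R" using I by (auto simp: fideal_def)
    show ?thesis
    proof (rule fidealI[OF modL])
      show "1 \<in> L" using RL R_1 by blast
      show "(1 :: complex) \<noteq> 0" by simp
      show "k > 0" by (rule k(1))
      fix a assume "a \<in> L"
      then obtain x y where xy: "x \<in> R" "y \<in> I" "a = x + y" unfolding L_def by blast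
      have "of_int k * x \<in> R" by (rule R_mult[OF R_int xy(1)])
      moreover have "of_int k * y \<in> R" by (rule k(2)[OF xy(2)])
      ultimately show "of_int k * a \<in> R" using R_add xy(3) by (simp add: distrib_left)
    qed
  qed
  have II: "mul I (cj I) = R" using nrm(3)[OF I] n by simp
  have "mul I (cj L) = L"
  proof
    show "mul I (cj L) \<subseteq> L"
    proof (rule mul_sub)
      fix x z assume x: "x \<in> I" and "z \<in> cj L"
      then obtain a b where ab: "a \<in> R" "b \<in> I" "cnj z = a + b" unfolding cj_iff L_def by blast
      then have "z = cnj a + cnj b" by (metis complex_cnj_add complex_cnj_cnj)
      then have "x * z = x * cnj b + cnj a * x" by (simp add: algebra_simps)
      moreover have "x * cnj b \<in> R" using mulI[of x I "cnj b" "cj I"] x ab II by (simp add: cj_iff)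
      moreover have "cnj a * x \<in> I" using Rmod_mult[OF M] R_cnj ab x by blast
      ultimately show "x * z \<in> L" using LI by simp
    qed (rule Rmod_add[OF modL])
    note MM = Rmod_mul[OF M Rmod_cj[OF modL]]
    show "L \<subseteq> mul I (cj L)"
    proof
      fix z assume "z \<in> L"
      then obtain a b where ab: "a \<in> R" "b \<in> I" "z = a + b" unfolding L_def by blast
      have "a \<in> mul I (cj I)" using II ab by simp
      moreover have "cj I \<subseteq> cj L" using IL by (auto simp: cj_iff)
      ultimately have "a \<in> mul I (cj L)" using mul_mono by blast
      moreover have "b * 1 \<in> mul I (cj L)" by (rule mulI[OF ab(2)]) (use RL in \<open>auto simp: cj_iff\<close>)
      ultimately show "z \<in> mul I (cj L)" using ab mul_add by simp
    qed
  qed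
  then have "mul I (mul (cj L) L) = mul L L" by (simp add: mul_assoc[symmetric])
  then have "sm (of_real (nrm L)) I = mul L L"
    using nrm(3)[OF fL] mul_R[OF M] by (simp add: mul_commute[of "cj L"] mul_sm2 mul_commute[of I])
  then have "eqv I (mul L L)" using eqvI[of "of_real (nrm L)" I] nrm[OF fL] K_rat by (metis less_irrefl of_real_eq_0_iff)
  then show thesis using that fL by blast
qed

end

section \<open>Finiteness of the class group and ramified ideals\<close>
context imaginary_quadratic
begin

lemma K_basis: "x \<in> K \<Longrightarrow> \<exists>a b :: real. x = of_real a + of_real b * w"
proof -
  assume "x \<in> K"
  then obtain a b where "x = of_real a + of_real b * s" unfolding K_iff by blast
  then have "x = of_real (a - b) + of_real (2 * b) * w" by (simp add: w_def field_simps)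
  then show ?thesis by blast
qed

text \<open>Pigeonhole principle for the multiples of \<open>x\<close> modulo \<open>R\<close> in a fundamental domain that is cut into \<open>M\<^sup>2\<close> boxes of
  diameter less than 1.\<close>
lemma dirichlet_approximation:
  obtains m :: nat where "\<And>x. x \<in> K \<Longrightarrow> \<exists>k\<in>{1..m}. \<exists>y\<in>R. cmod (of_nat k * x - y) < 1"
proof -
  obtain M :: nat where M: "real M > 1 + cmod w" using reals_Archimedean2 by blast
  then have M0: "real M > 0" using norm_ge_zero[of w] by linarith
  have "\<exists>k\<in>{1..M * M}. \<exists>y\<in>R. cmod (of_nat k * x - y) < 1" if x: "x \<in> K" for x
  proof -
    obtain a b :: real where ab: "x = of_real a + of_real b * w" using K_basis[OF x] by blast
    define fr where "fr t = t - of_int \<lfloor>t\<rfloor>" for t :: real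
    have fr: "0 \<le> fr t" "fr t < 1" for t by (auto simp: fr_def) linarith
    define g where "g k = (\<lfloor>real M * fr (real k * a)\<rfloor>, \<lfloor>real M * fr (real k * b)\<rfloor>)" for k :: nat
    have rng: "\<lfloor>real M * fr t\<rfloor> \<in> {0..<int M}" for t
    proof -
      have "0 \<le> real M * fr t" "real M * fr t < real M" using fr[of t] M0 by auto
      then show ?thesis by (simp add: floor_less_iff)
    qed
    have "g ` {0..M * M} \<subseteq> {0..<int M} \<times> {0..<int M}" using rng by (auto simp: g_def)
    then have "card (g ` {0..M * M}) \<le> card ({0..<int M} \<times> {0..<int M})" by (intro card_mono) auto
    then have "card (g ` {0..M * M}) < card {0..M * M}" by simp
    then have "\<not> inj_on g {0..M * M}" by (rule pigeonhole)
    then obtain i j where ij: "i \<in> {0..M * M}" "j \<in> {0..M * M}" "i \<noteq> j" "g i = g j" unfolding inj_on_def by blast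
    have "\<exists>i j. i < j \<and> j \<le> M * M \<and> g i = g j"
    proof (cases "i < j")
      case True then show ?thesis using ij by auto
    next
      case False then show ?thesis using ij by (intro exI[of _ j] exI[of _ i]) auto
    qed
    then obtain i j where ij: "i < j" "j \<le> M * M" "g i = g j" by blast
    define k where "k = j - i"
    have close: "\<bar>fr t - fr u\<bar> < 1 / real M" if "\<lfloor>real M * fr t\<rfloor> = \<lfloor>real M * fr u\<rfloor>" for t u
    proof -
      have "\<bar>real M * fr t - real M * fr u\<bar> < 1" using that by linarith
      then have "real M * \<bar>fr t - fr u\<bar> < 1" using M0 by (simp add: abs_mult right_diff_distrib[symmetric])
      then show ?thesis using M0 by (simp add: field_simps)
    qed
    define y where "y = of_int (\<lfloor>real j * a\<rfloor> - \<lfloor>real i * a\<rfloor>) + of_int (\<lfloor>real j * b\<rfloor> - \<lfloor>real i * b\<rfloor>) * w"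
    have yR: "y \<in> R" unfolding y_def R_basis by blast
    define A where "A = fr (real j * a) - fr (real i * a)"
    define B where "B = fr (real j * b) - fr (real i * b)"
    have AB: "\<bar>A\<bar> < 1 / real M" "\<bar>B\<bar> < 1 / real M"
      unfolding A_def B_def using ij(3) by (auto intro!: close simp: g_def)
    have kc: "complex_of_nat k = of_nat j - of_nat i" using ij(1) by (simp add: k_def of_nat_diff)
    have "of_nat k * x - y = of_real A + of_real B * w"
      unfolding ab y_def A_def B_def fr_def kc by (simp add: algebra_simps)
    then have "cmod (of_nat k * x - y) \<le> \<bar>A\<bar> + \<bar>B\<bar> * cmod w"
      using norm_triangle_ineq[of "of_real A" "of_real B * w"] by (simp add: norm_mult)
    also have "\<dots> \<le> 1 / real M + 1 / real M * cmod w"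
      using AB by (intro add_mono mult_right_mono) auto
    also have "\<dots> = (1 + cmod w) / real M" by (simp add: add_divide_distrib)
    also have "\<dots> < 1" using M M0 by simp
    finally have "cmod (of_nat k * x - y) < 1" .
    moreover have "k \<in> {1..M * M}" using ij by (auto simp: k_def)
    ultimately show ?thesis using yR by blast
  qed
  then show thesis using that by blast
qed

text \<open>Divide \<open>I\<close> by a nonzero element of least absolute value. In the resulting ideal \<open>J\<close> every nonzero element has
  absolute value at least 1, so the approximation of \<open>ky\<close> by an integer of the field is exact for every
  \<open>y\<close> in \<open>J\<close>.\<close>
lemma reduced_ideal_exists:
  obtains N :: nat where "N > 0"
    "\<And>I. fideal I \<Longrightarrow> \<exists>J. eqv I J \<and> Rmod J \<and> R \<subseteq> J \<and> (\<forall>x\<in>J. of_nat N * x \<in> R)"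
proof -
  obtain m :: nat where m: "\<And>x. x \<in> K \<Longrightarrow> \<exists>k\<in>{1..m}. \<exists>y\<in>R. cmod (of_nat k * x - y) < 1"
    using dirichlet_approximation by blast
  have "\<exists>J. eqv I J \<and> Rmod J \<and> R \<subseteq> J \<and> (\<forall>x\<in>J. of_nat (fact m) * x \<in> R)" if I: "fideal I" for I
  proof -
    \<comment> \<open>A least element exists since the norms are integral multiples of the norm of \<open>I\<close>.\<close>
    define Q where "Q k \<longleftrightarrow> (\<exists>x\<in>I. x \<noteq> 0 \<and> (cmod x)\<^sup>2 = real k * nrm I)" for k :: nat
    have mem: "\<exists>k. (cmod x)\<^sup>2 = real k * nrm I" if xI: "x \<in> I" for x
    proof -
      obtain a where "x * cnj x = of_int a * of_real (nrm I)" using element_norm[OF I xI] by blast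
      then have "complex_of_real ((cmod x)\<^sup>2) = of_real (of_int a * nrm I)" unfolding complex_norm_square by simp
      then have e: "(cmod x)\<^sup>2 = of_int a * nrm I" using of_real_eq_iff by blast
      have "0 \<le> of_int a * nrm I" unfolding e[symmetric] by simp
      then have "0 \<le> a" using nrm(1)[OF I] by (simp add: zero_le_mult_iff)
      then show ?thesis using e by (intro exI[of _ "nat a"]) simp
    qed
    obtain x0 where "x0 \<in> I" "x0 \<noteq> 0" using fideal_nonzero[OF I] by blast
    then have "\<exists>k. Q k" using mem[of x0] unfolding Q_def by blast
    define k where "k = (LEAST k. Q k)"
    have "Q k" unfolding k_def using \<open>\<exists>k. Q k\<close> by (rule LeastI_ex)
    then obtain x where x: "x \<in> I" "x \<noteq> 0" "(cmod x)\<^sup>2 = real k * nrm I" by (auto simp: Q_def)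
    have least: "cmod x \<le> cmod y" if y: "y \<in> I" "y \<noteq> 0" for y
    proof -
      obtain j where j: "(cmod y)\<^sup>2 = real j * nrm I" using mem y by blast
      then have "Q j" using y unfolding Q_def by blast
      then have "k \<le> j" unfolding k_def by (rule Least_le)
      then have "(cmod x)\<^sup>2 \<le> (cmod y)\<^sup>2" unfolding x j using nrm(1)[OF I] by simp
      then show ?thesis by (simp add: power2_le_iff_abs_le)
    qed
    define J where "J = sm (inverse x) I"
    have xK: "x \<in> K" using fideal_K[OF I x(1)] .
    have e: "eqv I J" unfolding J_def using xK x(2) K_inverse by (intro eqvI) auto
    have mJ: "Rmod J" unfolding J_def by (rule Rmod_sm[OF fideal_Rmod[OF I]])
    have J_iff: "y \<in> J \<longleftrightarrow> x * y \<in> I" for y using x(2) by (simp add: J_def sm_iff' field_simps)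
    have "1 \<in> J" using x by (simp add: J_iff)
    then have RJ: "R \<subseteq> J" using Rmod_mult[OF mJ _ \<open>1 \<in> J\<close>] by auto
    have "of_nat (fact m) * y \<in> R" if y: "y \<in> J" for y
    proof -
      have fJ: "fideal J" by (rule eqv_fideal[OF I e])
      obtain l z where l: "l \<in> {1..m}" "z \<in> R" "cmod (of_nat l * y - z) < 1" using m[OF fideal_K[OF fJ y]] by blast
      have "of_nat l * y + (- 1) * z \<in> J"
        using RJ l(2) y by (intro Rmod_add[OF mJ] Rmod_mult[OF mJ]) (use R_int[of "int l"] R_int[of "-1"] in auto)
      then have zJ: "x * (of_nat l * y - z) \<in> I" by (simp add: J_iff)
      have "of_nat l * y - z = 0"
      proof (rule ccontr)
        assume n: "of_nat l * y - z \<noteq> 0"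
        then have "cmod x \<le> cmod (x * (of_nat l * y - z))" using x(2) zJ by (intro least) auto
        then show False using l(3) x(2) by (simp add: norm_mult)
      qed
      then have z: "of_nat l * y = z" by simp
      have "l dvd fact m" using l(1) by (intro dvd_fact) auto
      then obtain q where "fact m = l * q" by blast
      then have "of_nat (fact m) * y = of_int (int q) * z" using z by (metis (no_types) mult.assoc mult.commute of_int_of_nat_eq of_nat_mult)
      then show ?thesis using R_mult[OF R_int[of "int q"] l(2)] by simp
    qed
    then show ?thesis using e mJ RJ by blast
  qed
  then show thesis using that[of "fact m"] by simp
qed

text \<open>Such \<open>J\<close> is determined by its finitely many residue classes in \<open>N\<^sup>-\<^sup>1 R\<close> modulo \<open>R\<close>.\<close>
lemma finite_reduced_ideals:
  assumes N: "N > 0" shows "finite {J. Rmod J \<and> R \<subseteq> J \<and> (\<forall>x\<in>J. of_nat N * x \<in> R)}" (is "finite ?S")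
proof -
  define pt where "pt i j = (of_int i + of_int j * w) / of_nat N" for i j :: int
  define f where "f J = {(i, j). i \<in> {0..<int N} \<and> j \<in> {0..<int N} \<and> pt i j \<in> J}" for J
  have N0: "(of_nat N :: complex) \<noteq> 0" using N by simp
  have red: "pt a b \<in> J \<longleftrightarrow> pt (a mod int N) (b mod int N) \<in> J" if J: "J \<in> ?S" for J a b
  proof -
    have mJ: "Rmod J" and RJ: "R \<subseteq> J" using J by auto
    have dec: "of_int t = of_int (t mod int N) + complex_of_nat N * of_int (t div int N)" for t
      by (metis mod_mult_div_eq of_int_add of_int_mult of_int_of_nat_eq)
    define q where "q = of_int (a div int N) + of_int (b div int N) * w"
    have q: "q \<in> J" using RJ R_basis unfolding q_def by blast
    have e: "pt a b = pt (a mod int N) (b mod int N) + q"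
      unfolding pt_def q_def dec[of a] dec[of b] using N0 by (simp add: field_simps)
    have "(-1) * q \<in> J" using Rmod_mult[OF mJ R_int[of "-1"] q] by simp
    then have "pt a b \<in> J \<Longrightarrow> pt (a mod int N) (b mod int N) \<in> J"
      using Rmod_add[OF mJ, of "pt a b" "(-1) * q"] e by simp
    then show ?thesis using Rmod_add[OF mJ _ q] e by metis
  qed
  have "inj_on f ?S"
  proof (rule inj_onI)
    have sub: "J \<subseteq> J'" if J: "J \<in> ?S" "J' \<in> ?S" "f J = f J'" for J J'
    proof
      fix x assume x: "x \<in> J"
      then have "of_nat N * x \<in> R" using J by blast
      then obtain a b :: int where "of_nat N * x = of_int a + of_int b * w" unfolding R_basis by blast
      then have xp: "x = pt a b" using N0 by (simp add: pt_def field_simps)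
      then have "pt (a mod int N) (b mod int N) \<in> J" using red[OF J(1)] x by blast
      then have "(a mod int N, b mod int N) \<in> f J" using N by (simp add: f_def)
      then have "(a mod int N, b mod int N) \<in> f J'" using J(3) by simp
      then have "pt (a mod int N) (b mod int N) \<in> J'" by (simp add: f_def)
      then show "x \<in> J'" using red[OF J(2)] xp by blast
    qed
    fix J J' assume "J \<in> ?S" "J' \<in> ?S" "f J = f J'"
    then show "J = J'" using sub by (intro equalityI) auto
  qed
  moreover have "f ` ?S \<subseteq> Pow ({0..<int N} \<times> {0..<int N})" by (auto simp: f_def)
  then have "finite (f ` ?S)" by (rule finite_subset) simp
  ultimately show ?thesis using finite_imageD by blast
qed

text \<open>The ideal generated by \<open>m\<close> and \<open>s\<close>. For \<open>m\<close> dividing \<open>d\<close> it is the product of the ramified primes over the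
  prime factors of \<open>m\<close>.\<close>
definition "ram m = {of_int m * x + s * y | x y. x \<in> R \<and> y \<in> R}"

lemma ramI: "x \<in> R \<Longrightarrow> y \<in> R \<Longrightarrow> of_int m * x + s * y \<in> ram m"
  unfolding ram_def by blast

lemma ram_R: "ram m \<subseteq> R"
  unfolding ram_def using R_int R_s by blast

lemma ram_mem: "of_int m \<in> ram m" "s \<in> ram m"
  using ramI[of 1 0 m] ramI[of 0 1 m] by auto

lemma Rmod_ram: "Rmod (ram m)"
  unfolding Rmod_def
proof (intro conjI ballI)
  show "0 \<in> ram m" using ramI[of 0 0 m] by simp
  fix a b assume "a \<in> ram m" "b \<in> ram m"
  then obtain x y x' y' where xy: "x \<in> R" "y \<in> R" "a = of_int m * x + s * y" "x' \<in> R" "y' \<in> R" "b = of_int m * x' + s * y'"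
    unfolding ram_def by blast
  have "a + b = of_int m * (x + x') + s * (y + y')" using xy by (simp add: algebra_simps)
  then show "a + b \<in> ram m" using ramI[OF R_add[OF xy(1,4)] R_add[OF xy(2,5)]] by simp
next
  fix r a assume r: "r \<in> R" and "a \<in> ram m"
  then obtain x y where xy: "x \<in> R" "y \<in> R" "a = of_int m * x + s * y" unfolding ram_def by blast
  have "r * a = of_int m * (r * x) + s * (r * y)" using xy by (simp add: algebra_simps)
  then show "r * a \<in> ram m" using ramI[OF R_mult[OF r xy(1)] R_mult[OF r xy(2)]] by simp
qed

lemma fideal_ram: "fideal (ram m)"
  by (rule fidealI[OF Rmod_ram ram_mem(2) s_neq_0, of 1]) (use ram_R in auto)

lemma ram_1: "ram 1 = R"
  using ram_R[of 1] Rmod_mult[OF Rmod_ram _ ram_mem(1)[of 1]] by auto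

lemma cj_ram: "cj (ram m) = ram m"
proof -
  have "cj (ram m) \<subseteq> ram m"
  proof
    fix z assume "z \<in> cj (ram m)"
    then obtain x y where xy: "x \<in> R" "y \<in> R" "cnj z = of_int m * x + s * y" unfolding ram_def cj_iff by blast
    have "z = cnj (cnj z)" by simp
    also have "\<dots> = of_int m * cnj x + s * (- cnj y)" unfolding xy(3) by (simp add: cnj_s)
    finally show "z \<in> ram m" using ramI[OF R_cnj[OF xy(1)] R_minus[OF R_cnj[OF xy(2)]]] by simp
  qed
  then show ?thesis by (metis cj_cj cj_iff subsetI subset_antisym subsetD complex_cnj_cnj)
qed

lemma mul_ram_coprime:
  assumes "coprime m k" shows "mul (ram m) (ram k) = ram (m * k)"
proof
  show "mul (ram m) (ram k) \<subseteq> ram (m * k)"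
  proof (rule mul_sub)
    fix a b assume "a \<in> ram m" "b \<in> ram k"
    then obtain x y x' y' where xy: "x \<in> R" "y \<in> R" "a = of_int m * x + s * y" "x' \<in> R" "y' \<in> R" "b = of_int k * x' + s * y'"
      unfolding ram_def by blast
    have "a * b = of_int (m * k) * (x * x') + s * (of_int m * x * y' + of_int k * x' * y + s * y * y')"
      using xy by (simp add: algebra_simps)
    moreover have r: "of_int m * x * y' + of_int k * x' * y + s * y * y' \<in> R" using xy by (intro R_add R_mult R_int R_s)
    ultimately show "a * b \<in> ram (m * k)" using ramI[OF R_mult[OF xy(1,4)] r, of "m * k"] by (simp only:)
  qed (rule Rmod_add[OF Rmod_ram])
  note M = Rmod_mul[OF Rmod_ram Rmod_ram, of m k]
  obtain p q where pq: "p * m + q * k = 1" using assms by (metis bezout_int coprime_iff_gcd_eq_1)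
  have 1: "of_int (m * k) \<in> mul (ram m) (ram k)" using mulI[OF ram_mem(1)[of m] ram_mem(1)[of k]] by simp
  have "of_int p * (of_int m * s) + of_int q * (s * of_int k) \<in> mul (ram m) (ram k)"
    by (rule Rmod_add[OF M Rmod_mult[OF M R_int mulI[OF ram_mem(1)[of m] ram_mem(2)[of k]]]
          Rmod_mult[OF M R_int mulI[OF ram_mem(2)[of m] ram_mem(1)[of k]]]])
  moreover have "of_int p * (of_int m * s) + of_int q * (s * of_int k) = of_int (p * m + q * k) * s" by (simp add: algebra_simps)
  ultimately have 2: "s \<in> mul (ram m) (ram k)" using pq by simp
  show "ram (m * k) \<subseteq> mul (ram m) (ram k)"
  proof
    fix z assume "z \<in> ram (m * k)"
    then obtain x y where xy: "x \<in> R" "y \<in> R" "z = of_int (m * k) * x + s * y" unfolding ram_def by blast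
    have "x * of_int (m * k) + y * s \<in> mul (ram m) (ram k)"
      by (intro Rmod_add[OF M] Rmod_mult[OF M] xy 1 2)
    then show "z \<in> mul (ram m) (ram k)" using xy(3) by (simp add: mult.commute)
  qed
qed

text \<open>The inclusion from right to left needs \<open>m\<close> in the square: \<open>m\<^sup>2\<close> and \<open>s\<^sup>2 = d\<close> have greatest common divisor \<open>m\<close>,
  as \<open>d\<close> is squarefree.\<close>
lemma mul_ram_self:
  assumes "m dvd d" shows "mul (ram m) (ram m) = sm (of_int m) R"
proof
  obtain e where e: "d = m * e" using assms by blast
  show "mul (ram m) (ram m) \<subseteq> sm (of_int m) R"
  proof (rule mul_sub)
    fix a b assume "a \<in> ram m" "b \<in> ram m"
    then obtain x y x' y' where xy: "x \<in> R" "y \<in> R" "a = of_int m * x + s * y" "x' \<in> R" "y' \<in> R" "b = of_int m * x' + s * y'"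
      unfolding ram_def by blast
    have "a * b = of_int m * (of_int m * x * x' + s * x * y' + s * x' * y) + s * s * (y * y')"
      using xy by (simp add: algebra_simps)
    also have "s * s * (y * y') = of_int m * (of_int e * y * y')"
    proof -
      have "(of_int d :: complex) = of_int m * of_int e" by (subst e) simp
      then show ?thesis by (simp add: s_sq)
    qed
    finally have "a * b = of_int m * (of_int m * x * x' + s * x * y' + s * x' * y + of_int e * y * y')" by (simp add: algebra_simps)
    moreover have "of_int m * x * x' + s * x * y' + s * x' * y + of_int e * y * y' \<in> R" using xy by (intro R_add R_mult R_int R_s)
    ultimately show "a * b \<in> sm (of_int m) R" unfolding sm_iff by blast
  qed (rule Rmod_add[OF Rmod_sm[OF Rmod_R]])
  note M = Rmod_mul[OF Rmod_ram Rmod_ram, of m m]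
  have "coprime m e"
  proof (rule coprimeI)
    fix c assume "c dvd m" "c dvd e"
    then have "c\<^sup>2 dvd d" unfolding e by (simp add: power2_eq_square mult_dvd_mono)
    then show "c dvd 1" using sqf squarefreeD by blast
  qed
  then obtain p q where pq: "p * m + q * e = 1" by (metis bezout_int coprime_iff_gcd_eq_1)
  have mm: "of_int m * of_int m \<in> mul (ram m) (ram m)" "s * s \<in> mul (ram m) (ram m)"
    using mulI[OF ram_mem(1)[of m] ram_mem(1)[of m]] mulI[OF ram_mem(2)[of m] ram_mem(2)[of m]] by auto
  have "of_int p * (of_int m * of_int m) + of_int q * (s * s) \<in> mul (ram m) (ram m)"
    by (intro Rmod_add[OF M] Rmod_mult[OF M] mm R_int)
  moreover have "of_int p * (of_int m * of_int m) + of_int q * (s * s) = (of_int m :: complex)"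
  proof -
    have "of_int p * (of_int m * of_int m) + of_int q * (s * s) = of_int (p * (m * m) + q * d)" by (simp add: s_sq)
    also have "p * (m * m) + q * d = m * (p * m + q * e)" by (subst e) (simp add: algebra_simps)
    finally show ?thesis using pq by simp
  qed
  ultimately have "of_int m \<in> mul (ram m) (ram m)" by simp
  then show "sm (of_int m) R \<subseteq> mul (ram m) (ram m)"
    using Rmod_mult[OF M] by (auto simp: sm_iff mult.commute)
qed

lemma nrm_ram: "m dvd d \<Longrightarrow> m > 0 \<Longrightarrow> nrm (ram m) = of_int m"
  by (rule nrm_eqI) (simp_all add: cj_ram mul_ram_self)

text \<open>If \<open>p\<close> divides the norm of \<open>x = (u + vs)/2\<close>, then it divides \<open>u\<close>, so \<open>2x\<close> lies in the ideal, and 2 is invertible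
  modulo \<open>p\<close>.\<close>
lemma ram_prime_mem:
  assumes p: "prime (p :: nat)" "2 < p" "int p dvd d" and x: "x \<in> R" and n: "x * cnj x = of_int n"
  shows "x \<in> ram (int p) \<longleftrightarrow> int p dvd n"
proof
  assume "x \<in> ram (int p)"
  then obtain m where "x * cnj x = of_int m * of_real (nrm (ram (int p)))" using element_norm[OF fideal_ram] by blast
  then have "complex_of_int n = of_int (m * int p)" using n nrm_ram[OF p(3)] p(2) by simp
  then have "n = m * int p" using of_int_eq_iff by blast
  then show "int p dvd n" by simp
next
  assume pn: "int p dvd n"
  obtain u v where uv: "even (u + v)" "x = (of_int u + of_int v * s) / 2" using x R_coords by blast
  have e: "u * u - d * (v * v) = 4 * n" by (rule norm_coords[OF uv(2) n])
  have "u * u = 4 * n + d * (v * v)" using e by simp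
  then have "int p dvd u * u" using pn p(3) by simp
  then have "int p dvd u" using p(1) prime_dvd_mult_iff[of "int p" u u] by simp
  then obtain u' where u': "u = int p * u'" by blast
  have "odd p" using prime_odd_nat[OF p(1,2)] .
  then obtain k where k: "p = 2 * k + 1" by (auto elim: oddE)
  have "2 * x = of_int (int p) * of_int u' + s * of_int v" using uv(2) u' by (simp add: mult.commute)
  then have "2 * x \<in> ram (int p)" using ramI[OF R_int R_int, of "int p" u' v] by (simp only:)
  then have "of_int (- int k) * (2 * x) + x * of_int (int p) \<in> ram (int p)"
    by (rule Rmod_add[OF Rmod_ram Rmod_mult[OF Rmod_ram R_int] Rmod_mult[OF Rmod_ram x ram_mem(1)]])
  moreover have "of_int (- int k) * (2 * x) + x * of_int (int p) = x" by (simp add: k algebra_simps)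
  ultimately show "x \<in> ram (int p)" by simp
qed

end

section \<open>Genus characters\<close>

text \<open>Here \<open>P\<close> consists of the prime factors congruent to 1 modulo 4 and \<open>r\<close> is the one congruent to 3. Then
  \<open>\<Delta> \<equiv> 1 (mod 4)\<close>, so that 2 is unramified.\<close>
locale genus_field =
  fixes P :: "nat set" and r :: nat
  assumes P: "finite P" "\<And>q. q \<in> P \<Longrightarrow> prime q" "\<And>q. q \<in> P \<Longrightarrow> [q = 1] (mod 4)"
    and r: "prime r" "[r = 3] (mod 4)"
begin

definition "n = \<Prod>P"
definition "\<Delta> = - (\<Prod>q\<in>insert r P. int q)"

lemma rP: "r \<notin> P" using P(3)[of r] r(2) by (auto simp: cong_def)
lemma r2: "2 < r"
proof -
  have "r \<noteq> 2" using r(2) by (auto simp: cong_def)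
  then show ?thesis using prime_ge_2_nat[OF r(1)] by simp
qed
lemma \<Delta>_eq: "\<Delta> = - (int r * int n)" using rP P(1) by (simp add: \<Delta>_def n_def)
lemma n_pos: "n > 0" unfolding n_def using P prime_gt_0_nat by (auto intro!: prod_pos)
lemma n_mod4: "[n = 1] (mod 4)" unfolding n_def using Legendre_two_prod(1)[of P] P by auto

lemma squarefree_prime_product:
  assumes "finite S" "\<And>q. q \<in> S \<Longrightarrow> prime (q :: nat)" shows "squarefree (\<Prod>S)"
proof -
  have "squarefree (\<Prod>q\<in>S. q)"
    by (rule squarefree_prod_coprime) (use assms in \<open>auto simp: primes_coprime squarefree_prime\<close>)
  then show ?thesis by simp
qed

lemma n_sqf: "squarefree n" unfolding n_def by (rule squarefree_prime_product) (use P in auto)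
lemma rn_sqf: "squarefree (r * n)"
proof -
  have "squarefree (\<Prod>(insert r P))" by (rule squarefree_prime_product) (use P r in auto)
  then show ?thesis using P(1) rP by (simp add: n_def)
qed

lemma squarefree_dvd_of_dvd_square:
  fixes m u :: int
  assumes "squarefree m" "m dvd u\<^sup>2" shows "m dvd u"
proof -
  have g0: "gcd m u \<noteq> 0" using assms(1) by auto
  obtain m' u' where mu: "m = m' * gcd m u" "u = u' * gcd m u" "coprime m' u'" using gcd_coprime_exists[OF g0] by blast
  define g where "g = gcd m u"
  have m: "m = m' * g" and u: "u = u' * g" using mu by (auto simp: g_def)
  have "m' * g dvd (u' * u' * g) * g" using assms(2) unfolding m u by (simp add: power2_eq_square mult_ac)
  then have "g = 0 \<or> m' dvd u' * u' * g" by (simp only: dvd_mult_cancel_right)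
  then have "m' dvd u' * u' * g" using g0 unfolding g_def by blast
  moreover have "coprime m' (u' * u')" using mu(3) by simp
  ultimately have "m' dvd g" using coprime_dvd_mult_right_iff by blast
  then have "m'\<^sup>2 dvd m" unfolding m by (simp add: power2_eq_square mult_dvd_mono)
  then have "m' dvd 1" using assms(1) squarefreeD by blast
  then have "m dvd g" unfolding m by auto
  then show ?thesis unfolding u by simp
qed

lemma squarefree_int_nat: "squarefree m \<Longrightarrow> squarefree (int m)"
proof (rule squarefreeI)
  fix x :: int assume m: "squarefree m" and x: "x\<^sup>2 dvd int m"
  have "int ((nat \<bar>x\<bar>)\<^sup>2) = x\<^sup>2" by simp
  then have "(nat \<bar>x\<bar>)\<^sup>2 dvd m" using x by (metis int_dvd_int_iff)
  then have "nat \<bar>x\<bar> dvd 1" using m squarefreeD by blast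
  then show "x dvd 1" by simp
qed

sublocale imaginary_quadratic \<Delta>
proof
  show "\<Delta> < 0" using r2 n_pos by (simp add: \<Delta>_eq)
  have "[int r * int n = 3 * 1] (mod 4)"
    using r(2) n_mod4 by (intro cong_mult) (simp_all add: cong_int_iff[of _ _ 4, simplified, symmetric])
  then have "(int r * int n) mod 4 = 3" by (simp add: cong_def)
  then show "[\<Delta> = 1] (mod 4)" unfolding \<Delta>_eq cong_def by presburger
  show "squarefree \<Delta>" using squarefree_int_nat[OF rn_sqf] by (simp add: \<Delta>_eq)
qed

lemma S_prime: "q \<in> insert r P \<Longrightarrow> odd_prime q"
  using P r r2 prime_1_mod_4_gt_2 by (auto simp: odd_prime_def)

lemma S_dvd: "q \<in> insert r P \<Longrightarrow> int q dvd \<Delta>"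
  unfolding \<Delta>_def using P(1) by (simp only: dvd_minus_iff) (rule dvd_prodI, auto)

lemma dvd_\<Delta>_S: "prime (l :: nat) \<Longrightarrow> int l dvd \<Delta> \<Longrightarrow> l \<in> insert r P"
proof -
  assume l: "prime l" "int l dvd \<Delta>"
  have "prime (int l)" using l by simp
  then obtain q where q: "q \<in> insert r P" "int l dvd int q"
    using l(2) P(1) prime_dvd_prod_iff[of "insert r P" "int l" int] unfolding \<Delta>_def dvd_minus_iff by blast
  then have "l = q" using l(1) P r primes_dvd_imp_eq[of l q] by auto
  then show ?thesis using q by simp
qed

text \<open>Let \<open>J' = aJ\<close>. The element \<open>a N(J)\<close> of \<open>J'\<close> is integral of norm \<open>n\<^sub>1 n\<^sub>2\<close>, and modulo \<open>q\<close> four times a norm is a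
  square.\<close>
lemma chi_welldefined:
  assumes q: "q \<in> insert r P" and J: "fideal J" "J \<subseteq> R" "nrm J = real n1" "\<not> q dvd n1"
    and J': "J' \<subseteq> R" "nrm J' = real n2" "\<not> q dvd n2" and e: "eqv J J'"
  shows "Legendre (int n1) q = Legendre (int n2) q"
proof -
  interpret odd_prime q by (rule S_prime[OF q])
  obtain a where a: "a \<in> K" "a \<noteq> 0" "J' = sm a J" using e by (auto simp: eqv_def)
  define x where "x = a * of_nat n1"
  have "of_real (nrm J) \<in> J" by (rule nrm_mem[OF J(1,2)])
  then have "x \<in> J'" using J(3) a by (auto simp: x_def sm_iff)
  then have xR: "x \<in> R" using J' by blast
  obtain u v where uv: "x = (of_int u + of_int v * s) / 2" using xR R_coords by blast
  have "real n2 = (cmod a)\<^sup>2 * real n1" using nrm_sm[OF J(1) a(2)] a(3) J J' by simp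
  then have "(cmod x)\<^sup>2 = real (n1 * n2)" by (simp add: x_def norm_mult power_mult_distrib power2_eq_square)
  then have "x * cnj x = of_int (int (n1 * n2))" using complex_norm_square[of x] by simp
  from norm_coords[OF uv this] have "u\<^sup>2 - 2\<^sup>2 * (int n1 * int n2) = \<Delta> * (v * v)" by (simp add: power2_eq_square)
  moreover have "int q dvd \<Delta> * (v * v)" using S_dvd[OF q] by simp
  ultimately have c: "[u\<^sup>2 = 2\<^sup>2 * (int n1 * int n2)] (mod int q)"
    by (simp only: cong_iff_dvd_diff)
  have "\<not> int q dvd 2" using p(2) zdvd_imp_le[of "int q" 2] by auto
  moreover have nn: "\<not> int q dvd int n1 * int n2" using J J' pint by (simp add: prime_dvd_mult_iff)
  moreover have "\<not> int q dvd 2\<^sup>2" using \<open>\<not> int q dvd 2\<close> pint prime_dvd_power by blast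
  ultimately have "\<not> int q dvd 2\<^sup>2 * (int n1 * int n2)" using pint prime_dvd_mult_iff by blast
  then have "\<not> int q dvd u\<^sup>2" using c cong_dvd_iff by blast
  then have nu: "\<not> int q dvd u" by (auto simp: power2_eq_square)
  have "Legendre (2\<^sup>2 * (int n1 * int n2)) q = 1" using Legendre_cong[OF c] Legendre_square[OF nu] by simp
  then have "Legendre (int n1) q * Legendre (int n2) q = 1"
    using Legendre_square[OF \<open>\<not> int q dvd 2\<close>] by (simp only: Legendre_mult mult_1_left)
  then show ?thesis using Legendre_values[of "int n1"] Legendre_values[of "int n2"] by auto
qed

text \<open>The genus character at \<open>q\<close>.\<close>
definition "chi q I = (SOME e. \<exists>J n1. eqv I J \<and> J \<subseteq> R \<and> nrm J = real n1 \<and> \<not> q dvd n1 \<and> e = Legendre (int n1) q)"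

lemma chi_eq:
  assumes q: "q \<in> insert r P" and I: "fideal I" and J: "eqv I J" "J \<subseteq> R" "nrm J = real n1" "\<not> q dvd n1"
  shows "chi q I = Legendre (int n1) q"
proof -
  have "\<exists>J n1. eqv I J \<and> J \<subseteq> R \<and> nrm J = real n1 \<and> \<not> q dvd n1 \<and> chi q I = Legendre (int n1) q"
    unfolding chi_def by (rule someI_ex) (use J in blast)
  then obtain J' n2 where J': "eqv I J'" "J' \<subseteq> R" "nrm J' = real n2" "\<not> q dvd n2" "chi q I = Legendre (int n2) q" by blast
  have "eqv J J'" using J(1) J'(1) eqv_sym eqv_trans by blast
  then show ?thesis
    using chi_welldefined[OF q eqv_fideal[OF I J(1)] J(2-4) J'(2-4)] J'(5) by simp
qed

lemma coprime_representative:
  assumes I: "fideal I"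
  obtains J n1 where "eqv I J" "fideal J" "J \<subseteq> R" "prim J" "nrm J = real n1" "n1 > 0"
    "\<And>q. q \<in> insert r P \<Longrightarrow> \<not> q dvd n1" "odd n1"
proof -
  have S: "finite (insert 2 (insert r P))" "\<And>l. l \<in> insert 2 (insert r P) \<Longrightarrow> prime l" using P r by auto
  obtain J n1 where J: "eqv I J" "fideal J" "J \<subseteq> R" "prim J" "nrm J = real n1" "n1 > 0"
    "\<And>q. q \<in> insert 2 (insert r P) \<Longrightarrow> \<not> q dvd n1" using good_representative[OF I S] by metis
  show thesis by (rule that[OF J(1-6)]) (use J(7) in auto)
qed

lemma chi_eqv: "q \<in> insert r P \<Longrightarrow> fideal I \<Longrightarrow> eqv I I' \<Longrightarrow> chi q I = chi q I'"
proof -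
  assume q: "q \<in> insert r P" and I: "fideal I" and e: "eqv I I'"
  obtain J n1 where J: "eqv I' J" "J \<subseteq> R" "nrm J = real n1" "\<not> q dvd n1"
    using coprime_representative[OF eqv_fideal[OF I e]] q by metis
  show ?thesis using chi_eq[OF q I eqv_trans[OF e J(1)] J(2-4)] chi_eq[OF q eqv_fideal[OF I e] J] by simp
qed

lemma chi_mul: "q \<in> insert r P \<Longrightarrow> fideal I \<Longrightarrow> fideal I' \<Longrightarrow> chi q (mul I I') = chi q I * chi q I'"
proof -
  assume q: "q \<in> insert r P" and I: "fideal I" "fideal I'"
  interpret odd_prime q by (rule S_prime[OF q])
  obtain J n1 where J: "eqv I J" "J \<subseteq> R" "nrm J = real n1" "\<not> q dvd n1" and fJ: "fideal J"
    using coprime_representative[OF I(1)] q by metis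
  obtain J' n2 where J': "eqv I' J'" "J' \<subseteq> R" "nrm J' = real n2" "\<not> q dvd n2" and fJ': "fideal J'"
    using coprime_representative[OF I(2)] q by metis
  have "mul J J' \<subseteq> R" using mul_mono[OF J(2) J'(2)] mul_R[OF Rmod_R] by simp
  moreover have "nrm (mul J J') = real (n1 * n2)" using nrm_mul[OF fJ fJ'] J(3) J'(3) by simp
  moreover have "\<not> q dvd n1 * n2" using J(4) J'(4) p(1) prime_dvd_mult_iff by blast
  ultimately have "chi q (mul I I') = Legendre (int (n1 * n2)) q"
    by (intro chi_eq[OF q fideal_mul[OF I] eqv_mul[OF J(1) J'(1)]])
  also have "\<dots> = Legendre (int n1) q * Legendre (int n2) q" by (simp add: Legendre_mult)
  finally show ?thesis using chi_eq[OF q I(1) J] chi_eq[OF q I(2) J'] by simp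
qed

lemma chi_R: "q \<in> insert r P \<Longrightarrow> chi q R = 1"
proof -
  assume q: "q \<in> insert r P"
  interpret odd_prime q by (rule S_prime[OF q])
  have "chi q R = Legendre (int 1) q" by (rule chi_eq[OF q fideal_R eqv_refl]) (use p in auto)
  then show ?thesis by simp
qed

lemma chi_values: "q \<in> insert r P \<Longrightarrow> fideal I \<Longrightarrow> chi q I = 1 \<or> chi q I = -1"
proof -
  assume q: "q \<in> insert r P" and I: "fideal I"
  interpret odd_prime q by (rule S_prime[OF q])
  obtain J n1 where J: "eqv I J" "J \<subseteq> R" "nrm J = real n1" "\<not> q dvd n1"
    using coprime_representative[OF I] q by metis
  have "\<not> int q dvd int n1" using J(4) by simp
  then show ?thesis using chi_eq[OF q I J] Legendre_unit_cases by metis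
qed

text \<open>Represent the class by a primitive ideal \<open>J\<close> of norm \<open>a\<close> prime to \<open>2\<Delta>\<close>. The prime factors of \<open>a\<close> split, so \<open>\<Delta>\<close> is
  a square modulo the squarefree part \<open>a\<^sub>0\<close> of \<open>a\<close>. The characters and the product formula make \<open>a\<^sub>0\<close> a square
  modulo \<open>\<Delta>\<close>. The pigeonhole lemma then exhibits \<open>a\<^sub>0\<close>, and with it \<open>a\<close>, as the norm of an element, and
  dividing \<open>J\<close> by that element leaves an ideal of norm 1.\<close>
theorem principal_genus:
  assumes I: "fideal I" and chi: "\<And>q. q \<in> P \<Longrightarrow> chi q I = 1"
  obtains L where "fideal L" "eqv I (mul L L)"
proof -
  obtain J a where J: "eqv I J" "fideal J" "J \<subseteq> R" "prim J" "nrm J = real a" "a > 0"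
    "\<And>q. q \<in> insert r P \<Longrightarrow> \<not> q dvd a" "odd a" using coprime_representative[OF I] by metis
  have al: "2 < l \<and> l \<notin> insert r P \<and> Legendre \<Delta> l = 1" if l: "prime l" "l dvd a" for l
  proof -
    have "l \<noteq> 2" using l J(8) by auto
    then have l2: "2 < l" using prime_ge_2_nat[OF l(1)] by simp
    moreover have nS: "l \<notin> insert r P" using J(7) l by blast
    moreover have "\<not> int l dvd \<Delta>" using dvd_\<Delta>_S[OF l(1)] nS by blast
    ultimately show ?thesis using primitive_split[OF J(2-5) l(1) l2 l(2)] by blast
  qed
  have Leg: "Legendre (int a) q = 1" if q: "q \<in> insert r P" for q
  proof (cases "q = r")
    case True
    have "jac (int a) P = 1" unfolding jac_def
      by (rule prod.neutral) (use chi chi_eq[OF _ I J(1,3,5) J(7)] in auto)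
    moreover have "jac (int a) P = Legendre (int a) r"
      by (rule genus_product_formula[OF P(1) _ r rP \<Delta>_def J(6) al]) (use P in auto)
    ultimately show ?thesis using True by simp
  next
    case False
    then show ?thesis using q chi[of q] chi_eq[OF q I J(1,3,5) J(7)[OF q]] by simp
  qed
  define a0 m where "a0 = squarefree_part a" and "m = square_part a"
  have am: "a = a0 * m\<^sup>2" unfolding a0_def m_def by (rule squarefree_decompose)
  have a0_sqf: "squarefree a0" unfolding a0_def by (rule squarefree_squarefree_part)
  have "a0 * m\<^sup>2 > 0" using J(6) am by (simp only:)
  then have "a0 > 0" "m > 0" by (auto intro: Nat.gr0I)
  note a0 = a0_sqf this
  define b where "b = r * n"
  have b\<Delta>: "int b = - \<Delta>" by (simp add: b_def \<Delta>_eq)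
  have "\<exists>c. [c\<^sup>2 = \<Delta>] (mod int a0)"
  proof (rule square_mod_squarefree[OF a0(1)])
    fix l assume l: "prime l" "l dvd a0"
    then have "l dvd a" using am by simp
    then interpret odd_prime l using al l by unfold_locales auto
    show "\<exists>c. [c\<^sup>2 = \<Delta>] (mod int l)" using al[OF l(1) \<open>l dvd a\<close>] Legendre_1_iff by blast
  qed
  then obtain c where c: "[c\<^sup>2 = - int b] (mod int a0)" using b\<Delta> by auto
  have bS: "l \<in> insert r P" if l: "prime l" "l dvd b" for l
  proof (rule dvd_\<Delta>_S[OF l(1)])
    have "int l dvd int b" using l(2) by simp
    then show "int l dvd \<Delta>" using b\<Delta> by (metis dvd_minus_iff)
  qed
  have "\<exists>e. [e\<^sup>2 = int a0] (mod int b)"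
  proof (rule square_mod_squarefree)
    show "squarefree b" unfolding b_def by (rule rn_sqf)
    fix l assume l: "prime l" "l dvd b"
    have lS: "l \<in> insert r P" by (rule bS[OF l])
    interpret odd_prime l by (rule S_prime[OF lS])
    have "\<not> l dvd a" using J(7)[OF lS] .
    then have "\<not> l dvd m" using am by (auto simp: power2_eq_square)
    then have "Legendre (int a0 * (int m)\<^sup>2) l = Legendre (int a0) l" by (intro Legendre_cancel_square) simp
    moreover have "int a = int a0 * (int m)\<^sup>2" by (subst am) simp
    ultimately have "Legendre (int a0) l = 1" using Leg[OF lS] by simp
    then show "\<exists>c. [c\<^sup>2 = int a0] (mod int l)" using Legendre_1_iff by blast
  qed
  then obtain e where e: "[e\<^sup>2 = int a0] (mod int b)" by blast
  have cop: "coprime a0 b"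
  proof (rule ccontr)
    assume "\<not> coprime a0 b"
    then obtain l where l: "prime l" "l dvd a0" "l dvd b" using coprime_iff_gcd_eq_1 prime_factor_nat by (metis gcd_greatest_iff)
    then have "l dvd a" using am by simp
    then show False using J(7)[OF bS[OF l(1,3)]] by blast
  qed
  have nsq: "z\<^sup>2 \<noteq> b" for z
  proof
    assume "z\<^sup>2 = b"
    then have "z dvd 1" using rn_sqf squarefreeD[of "r * n" z] by (simp add: b_def)
    then have "b = 1" using \<open>z\<^sup>2 = b\<close> by simp
    then show False using r2 by (simp add: b_def)
  qed
  have bp: "b > 0" using r2 n_pos by (simp add: b_def)
  obtain x y z where xyz: "(x, y, z) \<noteq> (0, 0, 0)"
    "x\<^sup>2 + int b * y\<^sup>2 = int a0 * z\<^sup>2 \<or> x\<^sup>2 + int b * y\<^sup>2 = int a0 * (z\<^sup>2 + int b)"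
    using norm_equation_pigeonhole[OF a0(2) bp cop nsq c e] by blast
  have cm: "(cmod (of_int x + of_int y * s))\<^sup>2 = of_int (x\<^sup>2 + int b * y\<^sup>2)" for x y
  proof -
    have "(of_int x + of_int y * s) * cnj (of_int x + of_int y * s) = of_int x * of_int x - of_int y * of_int y * (s * s)"
      by (simp add: cnj_s algebra_simps)
    also have "\<dots> = of_real (of_int (x\<^sup>2 + int b * y\<^sup>2))" by (simp add: s_sq b\<Delta> power2_eq_square)
    finally show ?thesis unfolding complex_norm_square[symmetric] of_real_eq_iff .
  qed
  have "\<exists>g\<in>K. (cmod g)\<^sup>2 = real a0"
    using xyz(2)
  proof
    assume h: "x\<^sup>2 + int b * y\<^sup>2 = int a0 * z\<^sup>2"
    have z0: "z \<noteq> 0"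
    proof
      assume z: "z = 0"
      then have "x\<^sup>2 + int b * y\<^sup>2 = 0" using h by simp
      moreover have "x\<^sup>2 \<ge> 0" "int b * y\<^sup>2 \<ge> 0" by auto
      ultimately have "x\<^sup>2 = 0" "int b * y\<^sup>2 = 0" by linarith+
      then show False using xyz(1) z bp by simp
    qed
    have "(cmod ((of_int x + of_int y * s) / of_int z))\<^sup>2 = real a0"
      unfolding norm_divide power_divide cm h using z0 by simp
    moreover have "(of_int x + of_int y * s) / of_int z \<in> K" by (intro K_divide K_add K_mult) auto
    ultimately show ?thesis by blast
  next
    assume h: "x\<^sup>2 + int b * y\<^sup>2 = int a0 * (z\<^sup>2 + int b)"
    have zb: "z\<^sup>2 + int b > 0" using bp by (simp add: add_nonneg_pos)
    have "(cmod (of_int z + of_int 1 * s))\<^sup>2 = of_int (z\<^sup>2 + int b)" using cm[of z 1] by simp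
    then have "(cmod ((of_int x + of_int y * s) / (of_int z + of_int 1 * s)))\<^sup>2 = of_int (int a0 * (z\<^sup>2 + int b)) / of_int (z\<^sup>2 + int b)"
      unfolding norm_divide power_divide cm h by simp
    also have "\<dots> = real a0"
    proof -
      have "real_of_int (z\<^sup>2 + int b) \<noteq> 0" using zb by (simp only: of_int_eq_0_iff)
      then show ?thesis unfolding of_int_mult of_int_of_nat_eq by (rule nonzero_mult_div_cancel_right)
    qed
    finally have "(cmod ((of_int x + of_int y * s) / (of_int z + of_int 1 * s)))\<^sup>2 = real a0" .
    moreover have "(of_int x + of_int y * s) / (of_int z + of_int 1 * s) \<in> K" by (intro K_divide K_add K_mult) auto
    ultimately show ?thesis by blast
  qed
  then obtain g where g: "g \<in> K" "(cmod g)\<^sup>2 = real a0" by blast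
  define h where "h = inverse (of_nat m * g)"
  have g0: "g \<noteq> 0" using g(2) a0 by auto
  have hK: "h \<in> K" "h \<noteq> 0" unfolding h_def using g g0 a0 K_of_int[of "int m"] by (auto intro!: K_inverse K_mult)
  have "(cmod h)\<^sup>2 = inverse (real a)" by (simp add: h_def norm_inverse norm_mult power_inverse power_mult_distrib g(2) am)
  then have "nrm (sm h J) = 1" using nrm_sm[OF J(2) hK(2)] J(5,6) by simp
  then obtain L where L: "fideal L" "eqv (sm h J) (mul L L)" using norm_one_is_square[OF fideal_sm[OF J(2) hK]] by blast
  have "eqv I (mul L L)" using eqv_trans[OF eqv_trans[OF J(1) eqvI[OF hK]] L(2)] .
  then show thesis using that L by blast
qed

lemma dvd_n_facts:
  assumes D: "D dvd n"
  shows "D > 0" "squarefree D" "int D dvd \<Delta>" "prime_factors D \<subseteq> P" "(\<Prod>q\<in>prime_factors D. int q) = int D" "[D = 1] (mod 4)"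
proof -
  show D0: "D > 0" using D n_pos by (auto intro: Nat.gr0I)
  show sq: "squarefree D" using D n_sqf squarefree_mono by blast
  show "int D dvd \<Delta>" using D by (simp add: \<Delta>_eq)
  have sub: "q \<in> P" if "q \<in> prime_factors D" for q
  proof -
    have q: "prime q" "q dvd n" using that D dvd_trans[of q D n] by auto
    then obtain p where "p \<in> P" "q dvd p" unfolding n_def using prime_dvd_prod_iff[OF P(1), of q "\<lambda>x. x"] by auto
    then show ?thesis using P(2) q(1) primes_dvd_imp_eq by blast
  qed
  then show "prime_factors D \<subseteq> P" by blast
  have "\<Prod>(prime_factors D) = D"
  proof -
    have "(\<Prod>q\<in>prime_factors D. q ^ multiplicity q D) = D" using prod_prime_factors[of D] D0 by simp
    moreover have "\<forall>q\<in>prime_factors D. multiplicity q D = 1" using squarefree_factorial_semiring'[of D] sq D0 by simp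
    ultimately show ?thesis by simp
  qed
  then show pr: "(\<Prod>q\<in>prime_factors D. int q) = int D" by (metis (mono_tags) int_prod prod.cong)
  have "[\<Prod>(prime_factors D) = 1] (mod 4)" by (rule Legendre_two_prod(1)) (use sub P in auto)
  then show "[D = 1] (mod 4)" using \<open>\<Prod>(prime_factors D) = D\<close> by simp
qed

text \<open>The norm of a generator \<open>(u + vs)/2\<close> gives \<open>D u'\<^sup>2 + e v\<^sup>2 = 4\<close> with \<open>u = D u'\<close> and \<open>D e = -\<Delta>\<close>. The prime \<open>r\<close> divides
  \<open>e\<close>, hence \<open>e \<ge> 3\<close>, and parity leaves \<open>D = 1\<close> only.\<close>
lemma ram_principal:
  assumes D: "D dvd n" and e: "eqv R (ram (int D))" shows "D = 1"
proof -
  note F = dvd_n_facts[OF D]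
  obtain a where a: "a \<in> K" "a \<noteq> 0" "ram (int D) = sm a R" using e by (auto simp: eqv_def)
  have "a \<in> ram (int D)" unfolding a(3) sm_iff by (rule bexI[of _ 1]) auto
  then have aR: "a \<in> R" using ram_R by blast
  obtain u v where uv: "a = (of_int u + of_int v * s) / 2" using aR R_coords by blast
  have "(cmod a)\<^sup>2 = real D" using nrm_sm[OF fideal_R a(2)] a(3) nrm_ram[OF F(3)] F(1) by simp
  then have "a * cnj a = of_int (int D)" using complex_norm_square[of a] by simp
  from norm_coords[OF uv this] have q: "u * u - \<Delta> * (v * v) = 4 * int D" .
  obtain k where k: "n = D * k" using D by blast
  define e where "e = int r * int k"
  have De: "\<Delta> = - (int D * e)" by (simp add: \<Delta>_eq k e_def)
  have k0: "k > 0" using n_pos k by (auto intro: Nat.gr0I)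
  have e3: "e \<ge> 3" unfolding e_def using r2 k0 mult_mono[of 3 "int r" 1 "int k"] by simp
  have "odd (r * n)"
  proof -
    have "odd r" using prime_odd_nat[OF r(1) r2] .
    moreover have "odd n" using n_mod4 unfolding cong_def by presburger
    ultimately show ?thesis by simp
  qed
  then have oe: "odd e" "odd D" unfolding e_def k by auto
  have "int D dvd u * u"
  proof -
    have "u * u = int D * (4 - e * (v * v))" using q De by (simp add: algebra_simps)
    then show ?thesis by simp
  qed
  then have "int D dvd u" using squarefree_int_nat[OF F(2)] by (metis power2_eq_square squarefree_dvd_of_dvd_square)
  then obtain u' where u': "u = int D * u'" by blast
  have "int D * (int D * (u' * u') + e * (v * v)) = int D * 4" using q De u' by (simp add: algebra_simps)
  then have eq: "int D * (u' * u') + e * (v * v) = 4" using F(1) by simp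
  have nn: "int D * (u' * u') \<ge> 0" "v * v \<ge> 0" "u' * u' \<ge> 0" by auto
  show "D = 1"
  proof (cases "v = 0")
    case True
    then have "int D * (u' * u') = 4" using eq by simp
    moreover have "coprime (int D) 4"
    proof -
      have "coprime (int D) 2" using oe(2) by simp
      then have "coprime (int D) (2 * 2)" by (simp only: coprime_mult_right_iff)
      then show ?thesis by simp
    qed
    ultimately have "is_unit (int D)" using coprime_common_divisor[of "int D" 4 "int D"] by (metis dvd_refl dvd_triv_left)
    then show ?thesis by simp
  next
    case False
    then have "v * v \<ge> 1" by (metis nn(2) mult_eq_0_iff int_one_le_iff_zero_less order_le_less)
    have "e * (v * v) \<le> 4" using eq nn by linarith
    moreover have "e * (v * v) \<ge> 3 * (v * v)" using e3 nn by (intro mult_right_mono) auto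
    ultimately have "v * v = 1" using \<open>v * v \<ge> 1\<close> by linarith
    then have "int D * (u' * u') + e = 4" using eq by simp
    then have "int D * (u' * u') \<le> 1" "odd (int D * (u' * u'))" using e3 oe(1) by (linarith, metis even_add even_numeral)
    then have "int D * (u' * u') = 1" using nn by (metis dvd_0_right order_antisym_conv int_one_le_iff_zero_less order_le_less)
    then show ?thesis by (simp add: zmult_eq_1_iff)
  qed
qed

text \<open>Quadratic reciprocity for primes congruent to 1 modulo 4.\<close>
lemma chi_ram_prime:
  assumes "p \<in> P" "q \<in> P" shows "chi q (ram (int p)) = chi p (ram (int q))"
proof (cases "p = q")
  case False
  have c: "chi q (ram (int p)) = Legendre (int p) q" if "p \<in> P" "q \<in> P" "p \<noteq> q" for p q
  proof (rule chi_eq[OF _ fideal_ram eqv_refl ram_R])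
    show "q \<in> insert r P" using that by simp
    show "nrm (ram (int p)) = real p" using nrm_ram[of "int p"] S_dvd[of p] that P(2) prime_gt_0_nat by simp
    show "\<not> q dvd p" using that P(2) primes_dvd_imp_eq by blast
  qed
  show ?thesis using c[OF assms False] c[OF assms(2,1)] False
      Legendre_reciprocity_1[of p q] assms P prime_1_mod_4_gt_2 by auto
qed simp

lemma chi_ram:
  assumes D: "D dvd n" and q: "q \<in> insert r P"
  shows "chi q (ram (int D)) = (\<Prod>p\<in>prime_factors D. chi q (ram (int p)))"
proof -
  have "chi q (ram (int (\<Prod>S))) = (\<Prod>p\<in>S. chi q (ram (int p)))" if "finite S" "S \<subseteq> P" for S
    using that
  proof (induction S rule: finite_induct)
    case empty then show ?case using chi_R[OF q] ram_1 by simp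
  next
    case (insert p S)
    have "coprime p x" if "x \<in> S" for x using primes_coprime[of p x] insert that P(2) by auto
    then have "coprime p (\<Prod>S)" by (intro prod_coprime_right) auto
    then have "coprime (int p) (int (\<Prod>S))" by (simp only: coprime_int_iff)
    then have "ram (int (\<Prod>(insert p S))) = mul (ram (int p)) (ram (int (\<Prod>S)))"
      using mul_ram_coprime insert(1,2) by simp
    then show ?case using insert chi_mul[OF q fideal_ram fideal_ram] by simp
  qed
  then have "chi q (ram (int (\<Prod>(prime_factors D)))) = (\<Prod>p\<in>prime_factors D. chi q (ram (int p)))"
    using dvd_n_facts(4)[OF D] by simp
  moreover have "int (\<Prod>(prime_factors D)) = int D" using dvd_n_facts(5)[OF D] by simp
  ultimately show ?thesis by simp
qed

text \<open>The value of the pairing, as a sign.\<close>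
definition "X D I = (\<Prod>q\<in>prime_factors D. chi q I)"

lemma X_symmetric: "D dvd n \<Longrightarrow> D' dvd n \<Longrightarrow> X D (ram (int D')) = X D' (ram (int D))"
proof -
  assume D: "D dvd n" "D' dvd n"
  note F = dvd_n_facts(4)[OF D(1)] dvd_n_facts(4)[OF D(2)]
  have "X D (ram (int D')) = (\<Prod>q\<in>prime_factors D. \<Prod>p\<in>prime_factors D'. chi q (ram (int p)))"
    unfolding X_def by (rule prod.cong[OF refl], rule chi_ram[OF D(2)]) (use F in auto)
  also have "\<dots> = (\<Prod>q\<in>prime_factors D. \<Prod>p\<in>prime_factors D'. chi p (ram (int q)))"
    by (intro prod.cong refl chi_ram_prime) (use F in auto)
  also have "\<dots> = (\<Prod>p\<in>prime_factors D'. \<Prod>q\<in>prime_factors D. chi p (ram (int q)))" by (rule prod.swap)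
  also have "\<dots> = X D' (ram (int D))"
    unfolding X_def by (rule prod.cong[OF refl], rule chi_ram[OF D(1), symmetric]) (use F in auto)
  finally show ?thesis .
qed

lemma X_mul: "D dvd n \<Longrightarrow> fideal I \<Longrightarrow> fideal J \<Longrightarrow> X D (mul I J) = X D I * X D J"
  unfolding X_def prod.distrib[symmetric] using dvd_n_facts(4)[of D] by (intro prod.cong refl chi_mul) auto
lemma X_eqv: "D dvd n \<Longrightarrow> fideal I \<Longrightarrow> eqv I J \<Longrightarrow> X D I = X D J"
  unfolding X_def using dvd_n_facts(4)[of D] by (intro prod.cong refl chi_eqv) auto
lemma X_values: "D dvd n \<Longrightarrow> fideal I \<Longrightarrow> X D I = 1 \<or> X D I = -1"
proof -
  assume D: "D dvd n" "fideal I"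
  have "(\<Prod>q\<in>A. chi q I) = 1 \<or> (\<Prod>q\<in>A. chi q I) = -1" if "finite A" "A \<subseteq> P" for A
    using that
  proof (induction A rule: finite_induct)
    case (insert x A)
    have "chi x I = 1 \<or> chi x I = -1" using chi_values[OF _ D(2), of x] insert.prems by auto
    moreover have "(\<Prod>q\<in>A. chi q I) = 1 \<or> (\<Prod>q\<in>A. chi q I) = -1" using insert by auto
    ultimately show ?case using insert(1,2) by auto
  qed simp
  then show ?thesis unfolding X_def using dvd_n_facts(4)[OF D(1)] by simp
qed

text \<open>The representative \<open>J\<close> is chosen in the inverse class of \<open>I\<close>, so that \<open>J\<^sup>2\<close> times the ramified ideal over \<open>D\<close> is
  principal. The norm \<open>a\<^sup>2 D\<close> of a generator gives the equation to which \<open>quartic_symbol_eq_jac\<close> applies.\<close>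
theorem X_half_quartic:
  assumes D: "D dvd n" and I: "fideal I" "eqv (mul I I) (ram (int D))"
  shows "X D I = quartic_symbol (\<Delta> div int D) D"
proof -
  note F = dvd_n_facts[OF D]
  obtain J a where J: "eqv (invi I) J" "fideal J" "J \<subseteq> R" "prim J" "nrm J = real a" "a > 0"
    "\<And>q. q \<in> insert r P \<Longrightarrow> \<not> q dvd a" "odd a" using coprime_representative[OF fideal_invi[OF I(1)]] by metis
  have fi: "fideal (invi I)" by (rule fideal_invi[OF I(1)])
  have XJ: "X D I = X D J"
  proof -
    have "X D I * X D (invi I) = X D R" using X_mul[OF D I(1) fi] mul_invi[OF I(1)] by simp
    also have "X D R = 1" unfolding X_def using chi_R F(4) by (intro prod.neutral) auto
    finally have "X D I = X D (invi I)" using X_values[OF D I(1)] X_values[OF D fi] by auto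
    then show ?thesis using X_eqv[OF D fi J(1)] by simp
  qed
  have "eqv (mul (mul (invi I) (invi I)) (mul I I)) (mul (mul J J) (ram (int D)))"
    by (intro eqv_mul J(1) I(2))
  moreover have "mul (mul (invi I) (invi I)) (mul I I) = R"
  proof -
    have "mul (mul (invi I) (invi I)) (mul I I) = mul (mul I (invi I)) (mul I (invi I))" by (metis mul_assoc mul_commute)
    then show ?thesis using mul_invi[OF I(1)] mul_R[OF Rmod_R] by simp
  qed
  ultimately obtain al where al: "al \<in> K" "al \<noteq> 0" "mul (mul J J) (ram (int D)) = sm al R" by (auto simp: eqv_def)
  have JJ: "mul J J \<subseteq> R" using mul_mono[OF J(3,3)] mul_R[OF Rmod_R] by simp
  have "mul (mul J J) (ram (int D)) \<subseteq> R" using mul_mono[OF JJ ram_R] mul_R[OF Rmod_R] by simp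
  moreover have "al \<in> sm al R" unfolding sm_iff by (rule bexI[of _ 1]) auto
  ultimately have alR: "al \<in> R" using al by blast
  obtain u v where uv: "even (u + v)" "al = (of_int u + of_int v * s) / 2" using alR R_coords by blast
  have "nrm (mul (mul J J) (ram (int D))) = real a * real a * real D"
    using nrm_mul[OF fideal_mul[OF J(2,2)] fideal_ram] nrm_mul[OF J(2,2)] nrm_ram[OF F(3)] F(1) J(5) by simp
  then have "(cmod al)\<^sup>2 = real (a * a * D)" using nrm_sm[OF fideal_R al(2)] al(3) by simp
  then have "al * cnj al = of_int (int (a * a * D))" using complex_norm_square[of al] by simp
  from norm_coords[OF uv(2) this] have q: "u * u - \<Delta> * (v * v) = 4 * (int a * int a * int D)" by simp
  obtain k where k: "n = D * k" using D by blast
  define e where "e = int r * int k"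
  have De: "\<Delta> = - (int D * e)" by (simp add: \<Delta>_eq k e_def)
  have "int D dvd u * u"
  proof -
    have "u * u = int D * (4 * (int a * int a) - e * (v * v))" using q De by (simp add: algebra_simps)
    then show ?thesis by simp
  qed
  then have "int D dvd u" using squarefree_int_nat[OF F(2)] by (metis power2_eq_square squarefree_dvd_of_dvd_square)
  then obtain u' where u': "u = int D * u'" by blast
  have "int D * (int D * (u' * u') + e * (v * v)) = int D * (4 * (int a * int a))" using q De u' by (simp add: algebra_simps)
  then have eq: "int D * u'\<^sup>2 + e * v\<^sup>2 = 4 * (int a)\<^sup>2" using F(1) by (simp add: power2_eq_square)
  interpret Q: primes_1_mod_4 "prime_factors D"
    by standard (use F(4) P in auto)
  have e4: "[e = 3] (mod 4)"
  proof -
    have "[int D * e = int D * 3] (mod 4)"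
    proof -
      have "[int D = 1] (mod 4)" using F(6) cong_int_iff[of D 1 4] by simp
      then have "[int D * 3 = 1 * 3] (mod 4)" by (intro cong_mult) auto
      moreover have "[int D * e = 3] (mod 4)"
      proof -
        have "int D * e = - \<Delta>" by (simp add: De)
        moreover have "[- \<Delta> = 3] (mod 4)" using mod4 unfolding cong_def by presburger
        ultimately show ?thesis by simp
      qed
      ultimately show ?thesis by (simp add: cong_def)
    qed
    moreover have "coprime (int D) 4"
    proof -
      have "odd (int D)" using F(6) unfolding cong_def by presburger
      then have "coprime (int D) 2" by simp
      then have "coprime (int D) (2 * 2)" by (simp only: coprime_mult_right_iff)
      then show ?thesis by simp
    qed
    ultimately show ?thesis using cong_mult_lcancel by blast
  qed
  \<comment> \<open>A common prime factor of \<open>a\<close> and \<open>v\<close> would divide the generator, hence \<open>J\<^sup>2\<close>, against \<open>primitive_square\<close>.\<close>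
  have av: "\<not> int l dvd int a" if l: "prime l" "2 < l" "int l dvd v" for l
  proof
    assume la: "int l dvd int a"
    have pl: "prime (int l)" and ol: "odd (int l)" using l prime_odd_nat[OF l(1,2)] by auto
    have "l \<notin> insert r P" using J(7) la by auto
    then have l\<Delta>: "\<not> int l dvd \<Delta>" using dvd_\<Delta>_S[OF l(1)] by blast
    then have lD: "\<not> int l dvd int D" using De by auto
    have "u * u = 4 * (int a * int a * int D) + \<Delta> * (v * v)" using q by simp
    then have "int l dvd u * u" using la l(3) by simp
    then have "int l dvd u" using pl prime_dvd_mult_iff by blast
    then have "al \<in> sm (of_int (int l)) R" using coords_divisible[OF ol uv _ l(3)] by blast
    then obtain z where z: "z \<in> R" "al = of_nat l * z" by (auto simp: sm_iff)
    obtain x where x: "x \<in> J" "x * x \<notin> sm (of_nat l) R"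
      using primitive_square[OF J(2-5) l(1,2) _ l\<Delta>] la by auto
    have "(x * x) * of_int (int D) \<in> sm al R" unfolding al(3)[symmetric] by (intro mulI x ram_mem)
    then obtain y where y: "y \<in> R" "(x * x) * of_int (int D) = of_nat l * (z * y)" using z by (auto simp: sm_iff mult.assoc)
    have "coprime (int l) (int D)" using pl lD prime_imp_coprime by blast
    then obtain g h where gh: "g * int l + h * int D = 1" by (metis bezout_int coprime_iff_gcd_eq_1)
    have "x * x = of_int (g * int l + h * int D) * (x * x)" unfolding gh by simp
    also have "\<dots> = of_nat l * (of_int g * (x * x)) + of_int h * ((x * x) * of_int (int D))" by (simp add: algebra_simps)
    also have "\<dots> = of_nat l * (of_int g * (x * x) + of_int h * (z * y))" unfolding y(2) by (simp add: algebra_simps)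
    finally have "x * x = of_nat l * (of_int g * (x * x) + of_int h * (z * y))" .
    moreover have "of_int g * (x * x) + of_int h * (z * y) \<in> R" using x(1) J(3) z y by (intro R_add R_mult R_int) auto
    ultimately show False using x(2) unfolding sm_iff by blast
  qed
  have "quartic_symbol (- e) D = jac (int a) (prime_factors D)"
  proof (rule Q.quartic_symbol_eq_jac[OF _ _ e4 av])
    show "(\<Prod>q\<in>prime_factors D. int q) * u'\<^sup>2 + e * v\<^sup>2 = 4 * (int a)\<^sup>2" using eq F(5) by simp
    show "odd (int a)" using J(8) by simp
    show "\<not> int q dvd int a" if "q \<in> prime_factors D" for q using J(7)[of q] F(4) that by auto
  qed auto
  moreover have "\<Delta> div int D = - e"
  proof -
    have "\<Delta> = int D * - e" by (simp add: De)
    then show ?thesis using F(1) by (metis nonzero_mult_div_cancel_left of_nat_0_less_iff less_irrefl)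
  qed
  moreover have "X D J = jac (int a) (prime_factors D)"
    unfolding X_def jac_def using F(4) by (intro prod.cong refl chi_eq[OF _ J(2) eqv_refl J(3,5)] J(7)) auto
  ultimately show ?thesis using XJ by simp
qed

end

section \<open>The pairing of Redei, abstractly\<close>

text \<open>The sign character, used to count solutions of additive equations by character sums.\<close>
definition sg :: "bit \<Rightarrow> int" where "sg b = (if b = 0 then 1 else -1)"

lemma sg_add: "sg (a + b) = sg a * sg b"
  by (cases a; cases b) (simp_all add: sg_def)

lemma sum_sg:
  fixes f :: "'a \<Rightarrow> bit" and G :: "('a, 'm) monoid_scheme"
  assumes G: "group G" "finite (carrier G)" and f: "\<And>x y. x \<in> carrier G \<Longrightarrow> y \<in> carrier G \<Longrightarrow> f (x \<otimes>\<^bsub>G\<^esub> y) = f x + f y"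
  shows "(\<Sum>x\<in>carrier G. sg (f x)) = (if \<forall>x\<in>carrier G. f x = 0 then int (card (carrier G)) else 0)"
proof (cases "\<forall>x\<in>carrier G. f x = 0")
  case True then show ?thesis by (simp add: sg_def)
next
  case False
  then obtain a where a: "a \<in> carrier G" "f a = 1" by auto
  have b: "bij_betw (\<lambda>x. a \<otimes>\<^bsub>G\<^esub> x) (carrier G) (carrier G)"
    using group.inj_on_cmult[OF G(1) a(1)] group.surj_const_mult[OF G(1) a(1)] by (simp add: bij_betw_def)
  have "(\<Sum>x\<in>carrier G. sg (f x)) = (\<Sum>x\<in>carrier G. sg (f (a \<otimes>\<^bsub>G\<^esub> x)))"
    using sum.reindex_bij_betw[OF b, of "\<lambda>x. sg (f x)"] by simp
  also have "\<dots> = (\<Sum>x\<in>carrier G. - sg (f x))"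
    by (rule sum.cong[OF refl]) (use f a in \<open>simp add: sg_add, simp add: sg_def\<close>)
  finally have "(\<Sum>x\<in>carrier G. sg (f x)) = 0" by (simp add: sum_negf)
  then show ?thesis by (simp only: if_not_P[OF False])
qed

text \<open>Sum the signs of the pairing over all pairs. Summing over one argument first leaves the kernel on the
  other side; doing this in both orders gives the two expressions.\<close>
lemma pairing_count:
  fixes f :: "'a \<Rightarrow> 'c \<Rightarrow> bit" and A :: "('a, 'm) monoid_scheme" and E :: "('c, 'n) monoid_scheme"
  assumes A: "group A" "finite (carrier A)" and E: "group E" "finite (carrier E)"
    and fl: "\<And>x y e. x \<in> carrier A \<Longrightarrow> y \<in> carrier A \<Longrightarrow> e \<in> carrier E \<Longrightarrow> f (x \<otimes>\<^bsub>A\<^esub> y) e = f x e + f y e"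
    and fr: "\<And>x e e'. x \<in> carrier A \<Longrightarrow> e \<in> carrier E \<Longrightarrow> e' \<in> carrier E \<Longrightarrow> f x (e \<otimes>\<^bsub>E\<^esub> e') = f x e + f x e'"
  shows "card (carrier A) * card {e\<in>carrier E. \<forall>x\<in>carrier A. f x e = 0}
       = card (carrier E) * card {x\<in>carrier A. \<forall>e\<in>carrier E. f x e = 0}"
proof -
  have "(\<Sum>x\<in>carrier A. \<Sum>e\<in>carrier E. sg (f x e)) = (\<Sum>x\<in>carrier A. if \<forall>e\<in>carrier E. f x e = 0 then int (card (carrier E)) else 0)"
    by (rule sum.cong[OF refl], rule sum_sg[OF E]) (use fr in auto)
  also have "\<dots> = int (card (carrier E) * card {x\<in>carrier A. \<forall>e\<in>carrier E. f x e = 0})"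
    using A(2) by (simp add: sum.If_cases Int_def)
  finally have 1: "(\<Sum>x\<in>carrier A. \<Sum>e\<in>carrier E. sg (f x e)) = \<dots>" .
  have "(\<Sum>e\<in>carrier E. \<Sum>x\<in>carrier A. sg (f x e)) = (\<Sum>e\<in>carrier E. if \<forall>x\<in>carrier A. f x e = 0 then int (card (carrier A)) else 0)"
    by (rule sum.cong[OF refl], rule sum_sg[OF A]) (use fl in auto)
  also have "\<dots> = int (card (carrier A) * card {e\<in>carrier E. \<forall>x\<in>carrier A. f x e = 0})"
    using E(2) by (simp add: sum.If_cases Int_def)
  finally have 2: "(\<Sum>e\<in>carrier E. \<Sum>x\<in>carrier A. sg (f x e)) = \<dots>" .
  show ?thesis using 1 2 sum.swap[of "\<lambda>x e. sg (f x e)" "carrier E" "carrier A"] by (simp only: of_nat_eq_iff)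
qed

text \<open>A counting form of the homomorphism theorem for a map whose fibres are the cosets of \<open>K\<close>.\<close>
lemma (in group) card_hom_image:
  assumes "finite (carrier G)" and H: "subgroup H G"
    and f: "\<And>x y. x \<in> H \<Longrightarrow> y \<in> H \<Longrightarrow> f x = f y \<longleftrightarrow> inv x \<otimes> y \<in> K" and K: "K \<subseteq> H"
  shows "card H = card (f ` H) * card K"
proof -
  have HG: "H \<subseteq> carrier G" using subgroup.subset[OF H] .
  have "finite H" using finite_subset[OF HG assms(1)] .
  then have "card H = (\<Sum>y\<in>f ` H. card {x\<in>H. f x = y})"
    using card_eq_sum sum.image_gen[of H "\<lambda>_. 1::nat" f] by auto
  also have "\<dots> = (\<Sum>y\<in>f ` H. card K)"
  proof (rule sum.cong[OF refl])
    fix y assume "y \<in> f ` H"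
    then obtain a where a: "a \<in> H" "y = f a" by auto
    have aG: "a \<in> carrier G" using a HG by auto
    have "bij_betw (\<lambda>x. a \<otimes> x) K {x\<in>H. f x = y}"
    proof (rule bij_betw_byWitness[where f' = "\<lambda>x. inv a \<otimes> x"])
      show "\<forall>x\<in>K. inv a \<otimes> (a \<otimes> x) = x" using aG K HG by (auto simp: m_assoc[symmetric])
      show "\<forall>x\<in>{x\<in>H. f x = y}. a \<otimes> (inv a \<otimes> x) = x" using aG HG by (auto simp: m_assoc[symmetric])
      show "(\<lambda>x. a \<otimes> x) ` K \<subseteq> {x\<in>H. f x = y}"
      proof (rule image_subsetI)
        fix x assume x: "x \<in> K"
        then have xH: "a \<otimes> x \<in> H" using subgroup.m_closed[OF H a(1)] K by auto
        have "inv a \<otimes> (a \<otimes> x) = x" using aG K HG x by (auto simp: m_assoc[symmetric])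
        then have "f a = f (a \<otimes> x)" using f[OF a(1) xH] x by simp
        then show "a \<otimes> x \<in> {x\<in>H. f x = y}" using xH a by simp
      qed
      show "(\<lambda>x. inv a \<otimes> x) ` {x\<in>H. f x = y} \<subseteq> K"
      proof (rule image_subsetI)
        fix x assume "x \<in> {x\<in>H. f x = y}"
        then show "inv a \<otimes> x \<in> K" using f[OF a(1), of x] a(2) by simp
      qed
    qed
    then show "card {x\<in>H. f x = y} = card K" by (rule bij_betw_same_card[symmetric])
  qed
  finally show ?thesis by simp
qed

context comm_group
begin

abbreviation sq where "sq x \<equiv> x \<otimes> x"

lemma sq_mult: "x \<in> carrier G \<Longrightarrow> y \<in> carrier G \<Longrightarrow> sq (x \<otimes> y) = sq x \<otimes> sq y"
  by (simp add: m_ac)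

lemma sq_eq_iff: "x \<in> carrier G \<Longrightarrow> y \<in> carrier G \<Longrightarrow> sq x = sq y \<longleftrightarrow> sq (inv x \<otimes> y) = \<one>"
proof -
  assume x: "x \<in> carrier G" "y \<in> carrier G"
  have "sq (inv x \<otimes> y) = inv (sq x) \<otimes> sq y" using sq_mult[of "inv x" y] x by (simp add: inv_mult)
  then show ?thesis using x by (metis inv_closed inv_equality inv_inv l_inv m_closed)
qed

lemma subgroup_sq: "subgroup H G \<Longrightarrow> subgroup (sq ` H) G"
proof (rule subgroupI)
  assume H: "subgroup H G"
  have HG: "H \<subseteq> carrier G" using subgroup.subset[OF H] .
  show "sq ` H \<subseteq> carrier G" using HG by auto
  show "sq ` H \<noteq> {}" using subgroup.one_closed[OF H] by auto
  show "inv a \<in> sq ` H" if a: "a \<in> sq ` H" for a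
  proof -
    obtain x where x: "x \<in> H" "a = sq x" using a by auto
    then have "inv a = sq (inv x)" using HG by (auto simp: inv_mult)
    then show ?thesis using subgroup.m_inv_closed[OF H x(1)] by blast
  qed
  show "a \<otimes> b \<in> sq ` H" if ab: "a \<in> sq ` H" "b \<in> sq ` H" for a b
  proof -
    obtain x y where x: "x \<in> H" "a = sq x" "y \<in> H" "b = sq y" using ab by auto
    then have "a \<otimes> b = sq (x \<otimes> y)" using sq_mult[of x y] subsetD[OF HG x(1)] subsetD[OF HG x(3)] by simp
    then show ?thesis using subgroup.m_closed[OF H x(1,3)] by blast
  qed
qed

lemma card_sq:
  assumes "finite (carrier G)" "subgroup H G"
  shows "card H = card (sq ` H) * card {x\<in>H. sq x = \<one>}"
proof (rule card_hom_image[OF assms])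
  have HG: "H \<subseteq> carrier G" using subgroup.subset[OF assms(2)] .
  show "sq x = sq y \<longleftrightarrow> inv x \<otimes> y \<in> {x\<in>H. sq x = \<one>}" if xy: "x \<in> H" "y \<in> H" for x y
  proof -
    have "inv x \<otimes> y \<in> H" using xy assms(2) by (simp add: subgroup.m_closed subgroup.m_inv_closed)
    then show ?thesis using sq_eq_iff[of x y] xy HG by auto
  qed
qed auto

lemma powers_0: "powers G 1 = carrier G"
  by (force simp: powers_def)
lemma powers_double: "powers G (2 * k) = sq ` powers G k"
proof -
  have "x [^] (2 * k) = sq (x [^] k)" if "x \<in> carrier G" for x
    using that by (simp add: mult_2 nat_pow_mult[symmetric])
  then show ?thesis unfolding powers_def by (simp add: image_image cong: image_cong)
qed
lemma powers_subgroup: "subgroup (powers G (2 ^ k)) G"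
proof (induction k)
  case 0 then show ?case using powers_0 subgroup_self by simp
next
  case (Suc k) then show ?case using subgroup_sq powers_double[of "2 ^ k"] by simp
qed

lemma F2_module_vectorspace: "(\<And>x. x \<in> carrier G \<Longrightarrow> sq x = \<one>) \<Longrightarrow> vectorspace F2 (F2_module G)"
  unfolding vectorspace_F2_iff F2_axioms_def F2_module_def by (auto simp: m_ac)

text \<open>The dimension is read off from the index of \<open>K\<close> in \<open>H\<close>.\<close>
lemma quotient_dim:
  assumes fin: "finite (carrier G)" and H: "subgroup H G" and K: "subgroup K G" "K \<subseteq> H" and sqK: "\<And>x. x \<in> H \<Longrightarrow> sq x \<in> K"
  shows "card H = 2 ^ vectorspace.dim F2 (F2_module ((G\<lparr>carrier := H\<rparr>) Mod K)) * card K"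
proof -
  let ?H = "G\<lparr>carrier := H\<rparr>"
  have HG: "H \<subseteq> carrier G" using subgroup.subset[OF H] .
  interpret H: comm_group ?H
  proof (rule group.group_comm_groupI[OF subgroup_imp_group[OF H]])
    show "x \<otimes>\<^bsub>?H\<^esub> y = y \<otimes>\<^bsub>?H\<^esub> x" if "x \<in> carrier ?H" "y \<in> carrier ?H" for x y
      using m_comm[of x y] that HG by auto
  qed
  have KH: "subgroup K ?H" by (rule subgroup_incl[OF K(1) H K(2)])
  have N: "normal K ?H" using H.normal_iff_subgroup KH by blast
  interpret Q: comm_group "?H Mod K" by (rule H.abelian_FactGroup[OF KH])
  have sqQ: "X \<otimes>\<^bsub>?H Mod K\<^esub> X = \<one>\<^bsub>?H Mod K\<^esub>" if X: "X \<in> carrier (?H Mod K)" for X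
  proof -
    obtain x where x: "x \<in> H" "X = K #>\<^bsub>?H\<^esub> x" using X by (auto simp: FactGroup_def RCOSETS_def)
    have "X \<otimes>\<^bsub>?H Mod K\<^esub> X = K #>\<^bsub>?H\<^esub> (x \<otimes>\<^bsub>?H\<^esub> x)"
      using normal.rcos_sum[OF N, of x x] x by (simp add: FactGroup_def)
    also have "\<dots> = K" using H.coset_join2[OF _ KH, of "x \<otimes> x"] x sqK K(2) by auto
    finally show ?thesis by (simp add: FactGroup_def)
  qed
  have vs: "vectorspace F2 (F2_module (?H Mod K))" by (rule Q.F2_module_vectorspace[OF sqQ])
  have finH: "finite H" using finite_subset[OF HG fin] .
  have car: "carrier (F2_module (?H Mod K)) = rcosets\<^bsub>?H\<^esub> K" by (simp add: F2_module_def FactGroup_def)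
  have "finite (rcosets\<^bsub>?H\<^esub> K)" using finH by (auto simp: RCOSETS_def)
  then have "card (rcosets\<^bsub>?H\<^esub> K) = 2 ^ vectorspace.dim F2 (F2_module (?H Mod K))"
    using F2_card_dim[OF vs] car by simp
  moreover have "card (rcosets\<^bsub>?H\<^esub> K) * card K = card H" using H.lagrange[OF KH] by (simp add: Coset.order_def)
  ultimately show ?thesis by simp
qed

lemma two_power_rank_card:
  assumes fin: "finite (carrier G)"
  shows "card (powers G (2 ^ k)) = 2 ^ two_power_rank G (Suc k) * card (powers G (2 ^ Suc k))"
proof -
  have e: "powers G (2 ^ Suc k) = sq ` powers G (2 ^ k)" using powers_double[of "2 ^ k"] by simp
  have s: "x \<otimes> x \<in> powers G (2 ^ k)" if "x \<in> powers G (2 ^ k)" for x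
    using subgroup.m_closed[OF powers_subgroup that that] .
  show ?thesis unfolding two_power_rank_def diff_Suc_1
    by (rule quotient_dim[OF fin powers_subgroup powers_subgroup]) (use e s in auto)
qed

end

text \<open>The group \<open>C\<close> plays the class group, \<open>E\<close> the space \<open>V'\<close> of divisors, \<open>iota\<close> the map to ramified classes and
  \<open>pr\<close> the pairing by genus characters. The essential hypotheses are that the elements of \<open>C\<close>
  orthogonal to \<open>E\<close> are squares and that \<open>pr\<close> is symmetric on \<open>E\<close> through \<open>iota\<close>.\<close>
locale redei_pairing = C: comm_group C + E: comm_group E
  for C :: "('a, 'm) monoid_scheme" (structure) and E :: "('b, 'n) monoid_scheme" +
  fixes iota :: "'b \<Rightarrow> 'a" and pr :: "'b \<Rightarrow> 'a \<Rightarrow> bit"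
  assumes finC: "finite (carrier C)" and finE: "finite (carrier E)"
    and sqE: "\<And>x. x \<in> carrier E \<Longrightarrow> x \<otimes>\<^bsub>E\<^esub> x = \<one>\<^bsub>E\<^esub>"
    and iota: "iota \<in> hom E C" "inj_on iota (carrier E)"
    and pr_l: "\<And>D D' c. D \<in> carrier E \<Longrightarrow> D' \<in> carrier E \<Longrightarrow> c \<in> carrier C \<Longrightarrow> pr (D \<otimes>\<^bsub>E\<^esub> D') c = pr D c + pr D' c"
    and pr_r: "\<And>D c c'. D \<in> carrier E \<Longrightarrow> c \<in> carrier C \<Longrightarrow> c' \<in> carrier C \<Longrightarrow> pr D (c \<otimes>\<^bsub>C\<^esub> c') = pr D c + pr D c'"
    and pr_kernel: "\<And>c. c \<in> carrier C \<Longrightarrow> (\<And>D. D \<in> carrier E \<Longrightarrow> pr D c = 0) \<Longrightarrow> c \<in> powers C 2"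
    and pr_symmetric: "\<And>D D'. D \<in> carrier E \<Longrightarrow> D' \<in> carrier E \<Longrightarrow> pr D (iota D') = pr D' (iota D)"
begin

definition "T = {x \<in> carrier C. x \<otimes>\<^bsub>C\<^esub> x = \<one>\<^bsub>C\<^esub>}"
definition "V0 = {D \<in> carrier E. iota D \<in> powers C 2}"

lemma iota_C [simp]: "D \<in> carrier E \<Longrightarrow> iota D \<in> carrier C" using iota(1) by (auto simp: hom_def)
lemma iota_mult: "D \<in> carrier E \<Longrightarrow> D' \<in> carrier E \<Longrightarrow> iota (D \<otimes>\<^bsub>E\<^esub> D') = iota D \<otimes>\<^bsub>C\<^esub> iota D'" using iota(1) by (auto simp: hom_def)
lemma iota_one: "iota \<one>\<^bsub>E\<^esub> = \<one>\<^bsub>C\<^esub>"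
  using hom_one[OF iota(1) E.group_axioms C.group_axioms] .
lemma iota_T: "D \<in> carrier E \<Longrightarrow> iota D \<in> T"
  using iota_mult[of D D] sqE[of D] iota_one by (simp add: T_def)

lemma powers_2: "powers C 2 = (\<lambda>x. x \<otimes>\<^bsub>C\<^esub> x) ` carrier C"
  using C.powers_double[of 1] C.powers_0 by simp
lemma powers_4: "powers C 4 = (\<lambda>x. x \<otimes>\<^bsub>C\<^esub> x) ` powers C 2"
  using C.powers_double[of 2] by simp
lemma powers_8: "powers C 8 = (\<lambda>x. x \<otimes>\<^bsub>C\<^esub> x) ` powers C 4"
  using C.powers_double[of 4] by simp
lemma sub: "subgroup (powers C 2) C" "subgroup (powers C 4) C"
  using C.powers_subgroup[of 1] C.powers_subgroup[of 2] by simp_all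
lemma sub_carrier: "powers C 2 \<subseteq> carrier C" "powers C 4 \<subseteq> powers C 2"
proof -
  show "powers C 2 \<subseteq> carrier C" using subgroup.subset[OF sub(1)] .
  then show "powers C 4 \<subseteq> powers C 2" unfolding powers_4 using powers_2 by auto
qed
lemma fins: "finite (powers C 2)" "finite (powers C 4)" "finite T" "finite V0"
  using finC finE sub_carrier by (auto simp: T_def V0_def intro: finite_subset)

lemma pr_square: "D \<in> carrier E \<Longrightarrow> c \<in> powers C 2 \<Longrightarrow> pr D c = 0"
  using powers_2 pr_r by auto

lemma kernel_eq: "{c \<in> carrier C. \<forall>D\<in>carrier E. pr D c = 0} = powers C 2"
  using pr_square pr_kernel sub_carrier by blast

text \<open>Counting with the pairing bounds \<open>|C| / |2C| = |C[2]|\<close> by \<open>|E|\<close>, and \<open>iota\<close> embeds \<open>E\<close> into \<open>C[2]\<close>.\<close>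
lemma card_T: "card T = card (carrier E)" and iota_onto: "iota ` carrier E = T"
proof -
  have "card (carrier C) * card {D\<in>carrier E. \<forall>c\<in>carrier C. pr D c = 0} = card (carrier E) * card {c\<in>carrier C. \<forall>D\<in>carrier E. pr D c = 0}"
    by (rule pairing_count[OF C.group_axioms finC E.group_axioms finE, of "\<lambda>c D. pr D c"]) (auto simp: pr_l pr_r)
  then have 1: "card (carrier C) * card {D\<in>carrier E. \<forall>c\<in>carrier C. pr D c = 0} = card (carrier E) * card (powers C 2)"
    unfolding kernel_eq .
  have "\<one>\<^bsub>E\<^esub> \<in> {D\<in>carrier E. \<forall>c\<in>carrier C. pr D c = 0}"
    using pr_l[OF E.one_closed E.one_closed] by auto
  then have "card {D\<in>carrier E. \<forall>c\<in>carrier C. pr D c = 0} \<ge> 1"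
    using finE by (metis (no_types, lifting) One_nat_def Suc_leI card_gt_0_iff empty_iff finite_subset mem_Collect_eq subsetI)
  from mult_le_mono2[OF this, of "card (carrier C)"]
  have "card (carrier C) \<le> card (carrier E) * card (powers C 2)" unfolding 1 by simp
  moreover have c: "card (carrier C) = card (powers C 2) * card T"
    using C.card_sq[OF finC C.subgroup_self] powers_2 by (simp add: T_def)
  moreover have "card (powers C 2) > 0" using fins subgroup.one_closed[OF sub(1)] card_gt_0_iff by blast
  ultimately have le: "card T \<le> card (carrier E)"
    by (simp only: mult.commute[of "card (carrier E)"] mult_le_cancel1)
  have ci: "card (iota ` carrier E) = card (carrier E)" by (rule card_image[OF iota(2)])
  have "iota ` carrier E \<subseteq> T" using iota_T by auto
  then show i: "iota ` carrier E = T" using card_seteq[OF fins(3)] le ci by simp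
  then show "card T = card (carrier E)" using ci by simp
qed

lemma card_V0: "card (powers C 2) = card (powers C 4) * card V0"
proof -
  have "{x\<in>powers C 2. x \<otimes>\<^bsub>C\<^esub> x = \<one>\<^bsub>C\<^esub>} = iota ` V0"
    using iota_onto sub_carrier by (auto simp: V0_def T_def)
  moreover have "card (iota ` V0) = card V0" by (rule card_image[OF inj_on_subset[OF iota(2)]]) (auto simp: V0_def)
  ultimately show ?thesis using C.card_sq[OF finC sub(1)] powers_4 by simp
qed

text \<open>An element \<open>y\<close> with \<open>2y = iota D\<close>; it is determined up to \<open>C[2]\<close>.\<close>
definition "half D = (SOME y. y \<in> carrier C \<and> y \<otimes>\<^bsub>C\<^esub> y = iota D)"
definition "B D D' = pr D' (half D)"

lemma half: "D \<in> V0 \<Longrightarrow> half D \<in> carrier C \<and> half D \<otimes>\<^bsub>C\<^esub> half D = iota D"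
  unfolding half_def by (rule someI_ex) (auto simp: V0_def powers_2)

text \<open>Elements of \<open>C[2]\<close> come from \<open>E\<close>, so by symmetry they may be exchanged with \<open>D'\<close>, which \<open>iota\<close> maps to a square.\<close>
lemma pr_T: "D' \<in> V0 \<Longrightarrow> c \<in> T \<Longrightarrow> pr D' c = 0"
proof -
  assume D': "D' \<in> V0" and "c \<in> T"
  then obtain D where D: "D \<in> carrier E" "c = iota D" using iota_onto by auto
  then have "pr D' c = pr D (iota D')" using pr_symmetric D' by (simp add: V0_def)
  then show ?thesis using pr_square D D' by (simp add: V0_def)
qed

lemma pr_sq_eq:
  assumes D': "D' \<in> V0" and y: "y \<in> carrier C" "z \<in> carrier C" "y \<otimes>\<^bsub>C\<^esub> y = z \<otimes>\<^bsub>C\<^esub> z"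
  shows "pr D' y = pr D' z"
proof -
  have DE: "D' \<in> carrier E" using D' by (simp add: V0_def)
  have t: "inv\<^bsub>C\<^esub> y \<otimes>\<^bsub>C\<^esub> z \<in> T" using C.sq_eq_iff[OF y(1,2)] y by (simp add: T_def)
  have "z = y \<otimes>\<^bsub>C\<^esub> (inv\<^bsub>C\<^esub> y \<otimes>\<^bsub>C\<^esub> z)" using y by (simp add: C.m_assoc[symmetric])
  then have "pr D' z = pr D' y + pr D' (inv\<^bsub>C\<^esub> y \<otimes>\<^bsub>C\<^esub> z)" using pr_r[OF DE y(1), of "inv\<^bsub>C\<^esub> y \<otimes>\<^bsub>C\<^esub> z"] y by simp
  then show ?thesis using pr_T[OF D' t] by simp
qed

lemma B_eq: "D \<in> V0 \<Longrightarrow> D' \<in> V0 \<Longrightarrow> y \<in> carrier C \<Longrightarrow> y \<otimes>\<^bsub>C\<^esub> y = iota D \<Longrightarrow> B D D' = pr D' y"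
  unfolding B_def using half[of D] by (intro pr_sq_eq) auto

lemma V0_mult: "D \<in> V0 \<Longrightarrow> D' \<in> V0 \<Longrightarrow> D \<otimes>\<^bsub>E\<^esub> D' \<in> V0"
  using subgroup.m_closed[OF sub(1)] by (simp add: V0_def iota_mult)
lemma V0_one: "\<one>\<^bsub>E\<^esub> \<in> V0"
  using subgroup.one_closed[OF sub(1)] by (simp add: V0_def iota_one)

lemma B_l: "D \<in> V0 \<Longrightarrow> D' \<in> V0 \<Longrightarrow> G \<in> V0 \<Longrightarrow> B (D \<otimes>\<^bsub>E\<^esub> D') G = B D G + B D' G"
proof -
  assume D: "D \<in> V0" "D' \<in> V0" "G \<in> V0"
  have "(half D \<otimes>\<^bsub>C\<^esub> half D') \<otimes>\<^bsub>C\<^esub> (half D \<otimes>\<^bsub>C\<^esub> half D') = iota (D \<otimes>\<^bsub>E\<^esub> D')"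
    using half[OF D(1)] half[OF D(2)] C.sq_mult[of "half D" "half D'"] iota_mult D by (simp add: V0_def)
  then have "B (D \<otimes>\<^bsub>E\<^esub> D') G = pr G (half D \<otimes>\<^bsub>C\<^esub> half D')"
    using half[OF D(1)] half[OF D(2)] by (intro B_eq[OF V0_mult[OF D(1,2)] D(3)]) auto
  then show ?thesis using pr_r[of G "half D" "half D'"] half[OF D(1)] half[OF D(2)] D(3) unfolding B_def V0_def by auto
qed
lemma B_r: "D \<in> V0 \<Longrightarrow> D' \<in> V0 \<Longrightarrow> G \<in> V0 \<Longrightarrow> B G (D \<otimes>\<^bsub>E\<^esub> D') = B G D + B G D'"
  unfolding B_def by (rule pr_l) (use half[of G] in \<open>auto simp: V0_def\<close>)

text \<open>The right hand side is contained in the left, since changing \<open>c\<close> by \<open>C[2]\<close> makes it a square. The reverse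
  inclusion follows by counting: \<open>V0\<close> annihilates the left hand side, which bounds its size by
  \<open>|E| |2C| / |V0|\<close>, and this is \<open>|C[2]| |4C|\<close>, the size of the right hand side.\<close>
lemma annihilator_V0: "{c \<in> carrier C. \<forall>D\<in>V0. pr D c = 0} = {c \<in> carrier C. c \<otimes>\<^bsub>C\<^esub> c \<in> powers C 4}" (is "?Y = ?H")
proof -
  have sY: "subgroup ?Y C"
  proof (rule C.subgroupI)
    have one: "pr D \<one>\<^bsub>C\<^esub> = 0" if "D \<in> V0" for D using pr_square subgroup.one_closed[OF sub(1)] that by (simp add: V0_def)
    then show "?Y \<noteq> {}" by auto
    show "inv\<^bsub>C\<^esub> a \<in> ?Y" if a: "a \<in> ?Y" for a
    proof -
      have "pr D (inv\<^bsub>C\<^esub> a) = 0" if D: "D \<in> V0" for D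
        using pr_r[of D a "inv\<^bsub>C\<^esub> a"] a D one[OF D] by (simp add: V0_def)
      then show ?thesis using a by simp
    qed
    show "a \<otimes>\<^bsub>C\<^esub> b \<in> ?Y" if "a \<in> ?Y" "b \<in> ?Y" for a b
      using that pr_r by (auto simp: V0_def)
  qed auto
  have sH: "subgroup ?H C"
  proof (rule C.subgroupI)
    show "?H \<noteq> {}" using subgroup.one_closed[OF sub(2)] by (auto intro!: exI[of _ "\<one>\<^bsub>C\<^esub>"])
    show "inv\<^bsub>C\<^esub> a \<in> ?H" if "a \<in> ?H" for a
      using that subgroup.m_inv_closed[OF sub(2), of "a \<otimes>\<^bsub>C\<^esub> a"] by (simp add: C.inv_mult)
    show "a \<otimes>\<^bsub>C\<^esub> b \<in> ?H" if "a \<in> ?H" "b \<in> ?H" for a b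
      using that subgroup.m_closed[OF sub(2), of "a \<otimes>\<^bsub>C\<^esub> a" "b \<otimes>\<^bsub>C\<^esub> b"] C.sq_mult[of a b] by simp
  qed auto
  have HY: "?H \<subseteq> ?Y"
  proof
    fix c assume c: "c \<in> ?H"
    then obtain e where e: "e \<in> powers C 2" "c \<otimes>\<^bsub>C\<^esub> c = e \<otimes>\<^bsub>C\<^esub> e" unfolding powers_4 by auto
    have "pr D c = pr D e" if "D \<in> V0" for D using pr_sq_eq[OF that _ _ e(2)] c e(1) sub_carrier by auto
    then show "c \<in> ?Y" using c pr_square[OF _ e(1)] by (auto simp: V0_def)
  qed
  have cH: "card ?H = card (powers C 4) * card T"
  proof -
    have "(\<lambda>x. x \<otimes>\<^bsub>C\<^esub> x) ` ?H = powers C 4"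
    proof
      show "powers C 4 \<subseteq> (\<lambda>x. x \<otimes>\<^bsub>C\<^esub> x) ` ?H"
      proof
        fix z assume z: "z \<in> powers C 4"
        then obtain x where "x \<in> powers C 2" "z = x \<otimes>\<^bsub>C\<^esub> x" unfolding powers_4 by auto
        then show "z \<in> (\<lambda>x. x \<otimes>\<^bsub>C\<^esub> x) ` ?H" using z sub_carrier by auto
      qed
    qed auto
    moreover have "{x\<in>?H. x \<otimes>\<^bsub>C\<^esub> x = \<one>\<^bsub>C\<^esub>} = T" using subgroup.one_closed[OF sub(2)] by (auto simp: T_def)
    ultimately show ?thesis using C.card_sq[OF finC sH] by simp
  qed
  have finY: "finite ?Y" using finC by simp
  have 1: "card ?Y * card {D\<in>carrier E. \<forall>c\<in>?Y. pr D c = 0} = card (carrier E) * card {c\<in>?Y. \<forall>D\<in>carrier E. pr D c = 0}"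
    using pairing_count[OF C.subgroup_imp_group[OF sY] _ E.group_axioms finE, of "\<lambda>c D. pr D c"] finY pr_l pr_r by simp
  have 2: "{c\<in>?Y. \<forall>D\<in>carrier E. pr D c = 0} = powers C 2"
    using kernel_eq by (auto simp: V0_def)
  have 3: "card V0 \<le> card {D\<in>carrier E. \<forall>c\<in>?Y. pr D c = 0}"
    using finE by (intro card_mono) (auto simp: V0_def)
  have "card ?Y * card V0 \<le> card (carrier E) * card (powers C 2)"
    using mult_le_mono2[OF 3, of "card ?Y"] unfolding 1 2 .
  also have "\<dots> = card ?H * card V0" using card_V0 cH card_T by (simp add: mult_ac)
  finally have "card ?Y * card V0 \<le> card ?H * card V0" .
  moreover have "card V0 > 0" using fins(4) V0_one card_gt_0_iff by blast
  ultimately have "card ?Y \<le> card ?H" by (simp only: mult_le_cancel2)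
  then show ?thesis using card_seteq[OF finY HY] by simp
qed

text \<open>The left kernel consists of the \<open>D\<close> whose class lies in \<open>4C\<close>, that is, of \<open>C[2] \<inter> 4C\<close>, which is the kernel of
  squaring from \<open>4C\<close> onto \<open>8C\<close>.\<close>
lemma card_left_kernel:
  "card (powers C 4) = card (powers C 8) * card {D\<in>V0. \<forall>D'\<in>V0. B D D' = 0}"
proof -
  have "(\<forall>D'\<in>V0. B D D' = 0) \<longleftrightarrow> iota D \<in> powers C 4" if D: "D \<in> V0" for D
  proof -
    have "half D \<in> {c \<in> carrier C. \<forall>D\<in>V0. pr D c = 0} \<longleftrightarrow> half D \<in> {c \<in> carrier C. c \<otimes>\<^bsub>C\<^esub> c \<in> powers C 4}"
      unfolding annihilator_V0 ..
    then show ?thesis using half[OF D] unfolding B_def by simp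
  qed
  then have "{D\<in>V0. \<forall>D'\<in>V0. B D D' = 0} = {D\<in>V0. iota D \<in> powers C 4}" by blast
  moreover have "{x\<in>powers C 4. x \<otimes>\<^bsub>C\<^esub> x = \<one>\<^bsub>C\<^esub>} = iota ` {D\<in>V0. iota D \<in> powers C 4}"
  proof -
    have "x \<in> iota ` {D\<in>V0. iota D \<in> powers C 4}" if x: "x \<in> powers C 4" "x \<otimes>\<^bsub>C\<^esub> x = \<one>\<^bsub>C\<^esub>" for x
    proof -
      have "x \<in> T" using x sub_carrier by (auto simp: T_def)
      then obtain D where "D \<in> carrier E" "x = iota D" using iota_onto by auto
      then show ?thesis using x sub_carrier by (auto simp: V0_def)
    qed
    then show ?thesis using iota_T by (auto simp: V0_def T_def)
  qed
  moreover have "card (iota ` {D\<in>V0. iota D \<in> powers C 4}) = card {D\<in>V0. iota D \<in> powers C 4}"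
    by (rule card_image[OF inj_on_subset[OF iota(2)]]) (auto simp: V0_def)
  ultimately show ?thesis using C.card_sq[OF finC sub(2)] powers_8 by simp
qed

end

section \<open>The class group\<close>
context imaginary_quadratic
begin

abbreviation "QF \<equiv> quadratic_field d"
abbreviation "RI \<equiv> ring_of_integers (quadratic_field d)"

lemma RI_ops [simp]: "carrier RI = R" "x \<otimes>\<^bsub>RI\<^esub> y = x * y" "x \<oplus>\<^bsub>RI\<^esub> y = x + y" "\<zero>\<^bsub>RI\<^esub> = 0" "\<one>\<^bsub>RI\<^esub> = 1"
  by (simp_all add: R_def) (simp_all add: ring_of_integers_def quadratic_field_def)

lemma cring_RI: "cring RI"
proof (rule cringI)
  show "abelian_group RI"
  proof (rule abelian_groupI)
    show "\<exists>y\<in>carrier RI. y \<oplus>\<^bsub>RI\<^esub> x = \<zero>\<^bsub>RI\<^esub>" if "x \<in> carrier RI" for x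
      by (rule bexI[of _ "- x"]) (use that R_minus in auto)
  qed (auto simp: algebra_simps)
  show "Group.comm_monoid RI" by (rule comm_monoidI) (auto simp: algebra_simps)
qed (auto simp: algebra_simps)

lemma ideal_RI_iff: "ideal J RI \<longleftrightarrow> J \<subseteq> R \<and> Rmod J"
proof
  assume J: "ideal J RI"
  have "J \<subseteq> R" using additive_subgroup.a_subset[OF ideal.axioms(1)[OF J]] by simp
  moreover have "0 \<in> J" using additive_subgroup.zero_closed[OF ideal.axioms(1)[OF J]] by simp
  moreover have "x + y \<in> J" if "x \<in> J" "y \<in> J" for x y using additive_subgroup.a_closed[OF ideal.axioms(1)[OF J], of x y] that by simp
  moreover have "r * x \<in> J" if "r \<in> R" "x \<in> J" for r x using ideal.I_l_closed[OF J, of x r] that by simp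
  ultimately show "J \<subseteq> R \<and> Rmod J" unfolding Rmod_def by blast
next
  assume J: "J \<subseteq> R \<and> Rmod J"
  then have JR: "J \<subseteq> R" and m: "Rmod J" by auto
  interpret cring RI by (rule cring_RI)
  show "ideal J RI"
  proof (rule idealI)
    show "ring RI" by (rule ring_axioms)
    show "subgroup J (add_monoid RI)"
    proof
      show "inv\<^bsub>add_monoid RI\<^esub> x \<in> J" if x: "x \<in> J" for x
      proof -
        have "\<ominus>\<^bsub>RI\<^esub> x = - x" by (rule minus_equality) (use x JR R_minus in auto)
        moreover have "(- 1) * x \<in> J" by (rule Rmod_mult[OF m _ x]) (use R_int[of "-1"] in simp)
        ultimately show ?thesis by (simp add: a_inv_def)
      qed
    qed (use JR Rmod_0[OF m] Rmod_add[OF m] in auto)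
    show "x \<otimes>\<^bsub>RI\<^esub> a \<in> J" if "a \<in> J" "x \<in> carrier RI" for a x using Rmod_mult[OF m, of x a] that by simp
    show "a \<otimes>\<^bsub>RI\<^esub> x \<in> J" if "a \<in> J" "x \<in> carrier RI" for a x using Rmod_mult[OF m, of x a] that by (simp add: mult.commute)
  qed
qed

lemma fractional_ideals_eq: "fractional_ideals QF = Collect fideal"
proof (intro equalityI subsetI)
  fix I assume "I \<in> fractional_ideals QF"
  then obtain J e where J: "I = (\<lambda>x. x / e) ` J" "ideal J RI" "J \<noteq> {0}" "e \<in> carrier RI" "e \<noteq> 0"
    unfolding fractional_ideals_def by blast
  have I: "I = sm (inverse e) J" unfolding sm_def J(1) by (simp add: divide_inverse mult.commute)
  have "fideal J" unfolding fideal_def using J(2,3) unfolding ideal_RI_iff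
    by (intro conjI exI[of _ 1]) auto
  then have "fideal I" unfolding I by (rule fideal_sm) (use J(4,5) R_K K_inverse in auto)
  then show "I \<in> Collect fideal" by simp
next
  fix I assume "I \<in> Collect fideal"
  then have I: "fideal I" by simp
  then obtain m :: int where m: "m > 0" "\<And>x. x \<in> I \<Longrightarrow> of_int m * x \<in> R" by (auto simp: fideal_def)
  let ?J = "sm (of_int m) I"
  have f: "fideal ?J" by (rule fideal_sm[OF I]) (use m in auto)
  have "?J \<subseteq> R" using m(2) by (auto simp: sm_iff)
  then have "ideal ?J RI" "?J \<noteq> {0}" using f unfolding ideal_RI_iff fideal_def by auto
  moreover have "I = (\<lambda>x. x / of_int m) ` ?J" using m(1) by (simp add: sm_def image_image)
  moreover have "(of_int m :: complex) \<in> carrier RI" "(of_int m :: complex) \<noteq> 0" using m(1) by auto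
  ultimately show "I \<in> fractional_ideals QF" unfolding fractional_ideals_def by blast
qed

lemma ideal_prod_RI: "ideal_prod RI I J = mul I J"
proof (intro equalityI subsetI)
  fix z assume "z \<in> ideal_prod RI I J"
  then show "z \<in> mul I J" by (induction rule: ideal_prod.induct) (auto intro: mulI mul_add)
next
  fix z assume "z \<in> mul I J"
  then show "z \<in> ideal_prod RI I J"
  proof (induction rule: mul_induct)
    case (prod x y) then show ?case using ideal_prod.prod[of x I y J RI] by simp
  next
    case (sum a b) then show ?case using ideal_prod.sum[of a RI I J b] by simp
  qed
qed

abbreviation "IG \<equiv> ideal_group (quadratic_field d)"
abbreviation "CG \<equiv> class_group (quadratic_field d)"
abbreviation "PI \<equiv> principal_ideals (quadratic_field d)"

lemma IG_simps [simp]: "carrier IG = Collect fideal" "I \<otimes>\<^bsub>IG\<^esub> J = mul I J" "\<one>\<^bsub>IG\<^esub> = R"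
  by (simp_all add: ideal_group_def fractional_ideals_eq)

lemma comm_group_IG: "comm_group IG"
proof (rule comm_groupI)
  show "\<exists>y\<in>carrier IG. y \<otimes>\<^bsub>IG\<^esub> x = \<one>\<^bsub>IG\<^esub>" if "x \<in> carrier IG" for x
    by (rule bexI[of _ "invi x"]) (use that mul_invi fideal_invi mul_commute in auto)
qed (use fideal_mul fideal_R mul_assoc mul_commute mul_R fideal_Rmod in auto)

lemma PI_eq: "PI = {sm a R | a. a \<in> K \<and> a \<noteq> 0}"
  by (simp add: principal_ideals_def sm_def K_def)

lemma subgroup_PI: "subgroup PI IG"
proof -
  interpret comm_group IG by (rule comm_group_IG)
  show ?thesis
  proof (rule subgroupI)
    show "PI \<subseteq> carrier IG" using fideal_sm[OF fideal_R] by (auto simp: PI_eq)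
    have "sm 1 R \<in> PI" unfolding PI_eq by (intro CollectI exI[of _ 1]) simp
    then show "PI \<noteq> {}" by blast
    show "inv\<^bsub>IG\<^esub> I \<in> PI" if I: "I \<in> PI" for I
    proof -
      obtain a where a: "I = sm a R" "a \<in> K" "a \<noteq> 0" using I by (auto simp: PI_eq)
      have "mul (sm (inverse a) R) (sm a R) = R" using a mul_R[OF Rmod_R] by (simp add: mul_sm mul_sm2)
      then have "inv\<^bsub>IG\<^esub> I = sm (inverse a) R"
        by (intro inv_equality) (use a fideal_sm[OF fideal_R] K_inverse in auto)
      then show ?thesis unfolding PI_eq using a K_inverse by (intro CollectI exI[of _ "inverse a"]) simp
    qed
    show "I \<otimes>\<^bsub>IG\<^esub> J \<in> PI" if IJ: "I \<in> PI" "J \<in> PI" for I J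
    proof -
      obtain a b where a: "I = sm a R" "a \<in> K" "a \<noteq> 0" "J = sm b R" "b \<in> K" "b \<noteq> 0" using IJ by (auto simp: PI_eq)
      then have "I \<otimes>\<^bsub>IG\<^esub> J = sm (a * b) R" using mul_R[OF Rmod_R] by (simp add: mul_sm mul_sm2 mult.commute)
      moreover have "a * b \<in> K" "a * b \<noteq> 0" using a by auto
      ultimately show ?thesis unfolding PI_eq by blast
    qed
  qed
qed

lemma comm_group_CG: "comm_group CG"
  unfolding class_group_def by (rule comm_group.abelian_FactGroup[OF comm_group_IG subgroup_PI])

abbreviation "cl \<equiv> ideal_class (quadratic_field d)"

text \<open>The coset of \<open>I\<close> is its class as a set of ideals.\<close>
lemma cl_eq: "fideal I \<Longrightarrow> cl I = {J. eqv I J}"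
proof -
  assume I: "fideal I"
  have "mul (sm a R) I = sm a I" for a using mul_R[OF fideal_Rmod[OF I]] by (simp add: mul_sm)
  then show ?thesis unfolding ideal_class_def r_coset_def PI_eq eqv_def by auto
qed

lemma cl_eq_iff: "fideal I \<Longrightarrow> fideal J \<Longrightarrow> cl I = cl J \<longleftrightarrow> eqv I J"
proof -
  assume I: "fideal I" "fideal J"
  show ?thesis unfolding cl_eq[OF I(1)] cl_eq[OF I(2)]
  proof
    assume "{L. eqv I L} = {L. eqv J L}"
    then show "eqv I J" using eqv_refl[of J] by blast
  next
    assume e: "eqv I J"
    show "{L. eqv I L} = {L. eqv J L}" using eqv_trans[OF e] eqv_trans[OF eqv_sym[OF e]] by blast
  qed
qed

lemma carrier_CG: "carrier CG = cl ` Collect fideal"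
  by (auto simp: class_group_def FactGroup_def RCOSETS_def ideal_class_def)

lemma cl_in [simp]: "fideal I \<Longrightarrow> cl I \<in> carrier CG" by (simp add: carrier_CG)

lemma cl_mul: "fideal I \<Longrightarrow> fideal J \<Longrightarrow> cl I \<otimes>\<^bsub>CG\<^esub> cl J = cl (mul I J)"
proof -
  assume I: "fideal I" "fideal J"
  interpret comm_group IG by (rule comm_group_IG)
  have N: "normal PI IG" using normal_iff_subgroup subgroup_PI by blast
  show ?thesis using normal.rcos_sum[OF N, of I J] I by (simp add: class_group_def FactGroup_def ideal_class_def)
qed

lemma finite_CG: "finite (carrier CG)"
proof -
  obtain N where N: "N > (0::nat)" "\<And>I. fideal I \<Longrightarrow> \<exists>J. eqv I J \<and> Rmod J \<and> R \<subseteq> J \<and> (\<forall>x\<in>J. of_nat N * x \<in> R)"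
    using reduced_ideal_exists by metis
  let ?S = "{J. Rmod J \<and> R \<subseteq> J \<and> (\<forall>x\<in>J. of_nat N * x \<in> R)}"
  have "carrier CG \<subseteq> cl ` ?S"
  proof
    fix c assume "c \<in> carrier CG"
    then obtain I where I: "fideal I" "c = cl I" by (auto simp: carrier_CG)
    then obtain J where J: "eqv I J" "J \<in> ?S" using N(2)[OF I(1)] by blast
    have "c = cl J" using cl_eq_iff[OF I(1) eqv_fideal[OF I(1) J(1)]] J(1) I(2) by simp
    then show "c \<in> cl ` ?S" using J(2) by blast
  qed
  then show ?thesis using finite_reduced_ideals[OF N(1)] finite_surj by blast
qed

text \<open>Membership in the ideal means that \<open>p\<close> divides the norm, so the ideal is prime. It is the only prime
  ideal with square \<open>pR\<close>, because prime ideals with equal squares contain each other.\<close>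
lemma ramified_prime_eq:
  assumes p: "prime (p :: nat)" "2 < p" "int p dvd d"
  shows "ramified_prime QF p = ram (int p)"
proof -
  have idr: "ideal (ram (int p)) RI" using Rmod_ram ram_R by (simp add: ideal_RI_iff)
  have pi: "PIdl\<^bsub>RI\<^esub> (of_nat p) = sm (of_int (int p)) R"
    by (auto simp: cgenideal_def sm_iff mult.commute)
  have sq: "mul (ram (int p)) (ram (int p)) = sm (of_int (int p)) R" by (rule mul_ram_self[OF p(3)])
  have prime: "x \<in> ram (int p) \<or> y \<in> ram (int p)" if xy: "x \<in> R" "y \<in> R" "x * y \<in> ram (int p)" for x y
  proof -
    obtain a b where ab: "x * cnj x = of_int a" "y * cnj y = of_int b" using R_norm xy by metis
    have "(x * y) * cnj (x * y) = of_int (a * b)" using ab by (simp add: mult_ac)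
    then have "int p dvd a * b" using ram_prime_mem[OF p, of "x * y" "a * b"] xy by auto
    then have "int p dvd a \<or> int p dvd b" using p(1) prime_dvd_mult_iff[of "int p"] by simp
    then show ?thesis using ram_prime_mem[OF p xy(1) ab(1)] ram_prime_mem[OF p xy(2) ab(2)] by simp
  qed
  have sub: "mul I I \<subseteq> I" if I: "ideal I RI" for I
  proof (rule mul_sub)
    have m: "I \<subseteq> R" "Rmod I" using I by (auto simp: ideal_RI_iff)
    show "x * y \<in> I" if "x \<in> I" "y \<in> I" for x y using Rmod_mult[OF m(2), of x y] that m(1) by blast
    show "a + b \<in> I" if "a \<in> I" "b \<in> I" for a b by (rule Rmod_add[OF m(2) that])
  qed
  have "1 \<notin> ram (int p)" using ram_prime_mem[OF p R_1, of 1] p(2) by simp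
  then have ne: "R \<noteq> ram (int p)" using R_1 by metis
  show ?thesis unfolding ramified_prime_def ideal_prod_RI pi
  proof (rule the_equality)
    have "primeideal (ram (int p)) RI"
      by (rule primeidealI[OF idr cring_RI]) (use ne prime in auto)
    then show "primeideal (ram (int p)) RI \<and> mul (ram (int p)) (ram (int p)) = sm (of_int (int p)) R" using sq by blast
    fix I assume I: "primeideal I RI \<and> mul I I = sm (of_int (int p)) R"
    then have idI: "ideal I RI" and e: "mul I I = mul (ram (int p)) (ram (int p))"
      using sq by (auto simp: primeideal_def)
    have IR: "I \<subseteq> R" using idI by (simp add: ideal_RI_iff)
    show "I = ram (int p)"
    proof (intro equalityI subsetI)
      fix x assume x: "x \<in> I"
      have "x * x \<in> ram (int p)" using mulI[OF x x] sub[OF idr] unfolding e by blast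
      then show "x \<in> ram (int p)" using prime x IR by blast
    next
      fix x assume x: "x \<in> ram (int p)"
      have "x * x \<in> I" using mulI[OF x x] sub[OF idI] unfolding e[symmetric] by blast
      then show "x \<in> I" using primeideal.I_prime[of I RI x x] I x ram_R by auto
    qed
  qed
qed

end

section \<open>The 4-rank and the 8-rank\<close>
context genus_field
begin

text \<open>The group of divisors of \<open>n\<close> is the group of subsets of \<open>P\<close> under symmetric difference.\<close>
definition "sd S T = (S - T) \<union> (T - S)" for S T :: "nat set"

lemma finite_sub: "S \<subseteq> P \<Longrightarrow> finite S" using P(1) finite_subset by blast
lemma prod_pos_sub: "S \<subseteq> P \<Longrightarrow> \<Prod>S > 0"
  using P(2) prime_gt_0_nat by (intro prod_pos) auto

lemma prime_factors_prod_sub: "S \<subseteq> P \<Longrightarrow> prime_factors (\<Prod>S) = S"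
proof -
  assume S: "S \<subseteq> P"
  have "q \<in> prime_factors (\<Prod>S) \<longleftrightarrow> q \<in> S" for q
  proof
    assume "q \<in> prime_factors (\<Prod>S)"
    then have q: "prime q" "q dvd \<Prod>S" by auto
    then obtain p where "p \<in> S" "q dvd p" using prime_dvd_prod_iff[OF finite_sub[OF S], of q "\<lambda>x. x"] by auto
    then show "q \<in> S" using P(2)[of p] S q(1) primes_dvd_imp_eq by blast
  next
    assume q: "q \<in> S"
    have "q dvd \<Prod>S" using dvd_prodI[OF finite_sub[OF S] q, of "\<lambda>x. x"] by simp
    then show "q \<in> prime_factors (\<Prod>S)" using prod_pos_sub[OF S] P(2)[of q] q S by (auto simp: in_prime_factors_iff)
  qed
  then show ?thesis by blast
qed

lemma prod_sub_dvd: "S \<subseteq> P \<Longrightarrow> \<Prod>S dvd n"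
  unfolding n_def by (rule prod_dvd_prod_subset[OF P(1)])

lemma prod_prime_factors_dvd: "D dvd n \<Longrightarrow> \<Prod>(prime_factors D) = D"
proof -
  assume D: "D dvd n"
  have "int (\<Prod>(prime_factors D)) = int D" using dvd_n_facts(5)[OF D] by simp
  then show ?thesis by (simp only: of_nat_eq_iff)
qed

lemma dvd_n_iff: "D dvd n \<longleftrightarrow> (\<exists>S. S \<subseteq> P \<and> D = \<Prod>S)"
proof
  assume D: "D dvd n"
  show "\<exists>S. S \<subseteq> P \<and> D = \<Prod>S"
    using dvd_n_facts(4)[OF D] prod_prime_factors_dvd[OF D] by (intro exI[of _ "prime_factors D"]) simp
qed (use prod_sub_dvd in blast)

lemma prod_disjoint: "S \<subseteq> P \<Longrightarrow> T \<subseteq> P \<Longrightarrow> S \<inter> T = {} \<Longrightarrow> \<Prod>(S \<union> T) = \<Prod>S * \<Prod>T"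
  using prod.union_disjoint[OF finite_sub finite_sub, of S T "\<lambda>x. x"] by simp

lemma coprime_disjoint: "S \<subseteq> P \<Longrightarrow> T \<subseteq> P \<Longrightarrow> S \<inter> T = {} \<Longrightarrow> coprime (\<Prod>S) (\<Prod>T)"
proof -
  assume S: "S \<subseteq> P" "T \<subseteq> P" "S \<inter> T = {}"
  have "coprime p q" if "p \<in> S" "q \<in> T" for p q
    using primes_coprime[of p q] P(2) S that by blast
  then have "coprime p (\<Prod>T)" if "p \<in> S" for p using that by (intro prod_coprime_right) auto
  then show ?thesis by (intro prod_coprime_left) auto
qed

abbreviation "E \<equiv> divisor_group n"

lemma E_simps [simp]: "carrier E = {D. D dvd n}" "\<one>\<^bsub>E\<^esub> = 1"
  by (simp_all add: divisor_group_def)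

lemma E_mult: "S \<subseteq> P \<Longrightarrow> T \<subseteq> P \<Longrightarrow> \<Prod>S \<otimes>\<^bsub>E\<^esub> \<Prod>T = \<Prod>(sd S T)"
proof -
  assume S: "S \<subseteq> P" "T \<subseteq> P"
  let ?A = "\<Prod>(S \<inter> T)" and ?B = "\<Prod>(S - T)" and ?C = "\<Prod>(T - S)"
  have s: "\<Prod>S = ?A * ?B" using prod_disjoint[of "S \<inter> T" "S - T"] S by (auto simp: Int_Diff_Un)
  have "(S \<inter> T) \<union> (T - S) = T" "(S \<inter> T) \<inter> (T - S) = {}" by auto
  then have t: "\<Prod>T = ?A * ?C" using prod_disjoint[of "S \<inter> T" "T - S"] S by auto
  have c: "coprime ?B ?C" by (rule coprime_disjoint) (use S in auto)
  have "a * b * (a * c) div (gcd (a * b) (a * c))\<^sup>2 = b * c" if "coprime b c" "a > 0" for a b c :: nat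
  proof -
    have "gcd (a * b) (a * c) = a" using gcd_mult_distrib_nat[of a b c] that(1) by simp
    moreover have "a * b * (a * c) = a\<^sup>2 * (b * c)" by (simp only: power2_eq_square mult_ac)
    moreover have "a\<^sup>2 * (b * c) div a\<^sup>2 = b * c" by (rule nonzero_mult_div_cancel_left) (use that(2) in simp)
    ultimately show ?thesis by (simp only:)
  qed
  from this[OF c] have "\<Prod>S \<otimes>\<^bsub>E\<^esub> \<Prod>T = ?B * ?C"
    using prod_pos_sub[of "S \<inter> T"] S unfolding s t by (simp add: divisor_group_def le_infI1)
  also have "\<dots> = \<Prod>(sd S T)" unfolding sd_def using S by (intro prod_disjoint[symmetric]) auto
  finally show ?thesis .
qed

lemma sd_sub: "S \<subseteq> P \<Longrightarrow> T \<subseteq> P \<Longrightarrow> sd S T \<subseteq> P" by (auto simp: sd_def)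

lemma E_cases: "D \<in> carrier E \<Longrightarrow> (\<And>S. S \<subseteq> P \<Longrightarrow> D = \<Prod>S \<Longrightarrow> thesis) \<Longrightarrow> thesis"
  using dvd_n_iff by auto

lemma E_sq: "D \<in> carrier E \<Longrightarrow> D \<otimes>\<^bsub>E\<^esub> D = \<one>\<^bsub>E\<^esub>"
proof (erule E_cases)
  fix S assume "S \<subseteq> P" "D = \<Prod>S"
  then show ?thesis using E_mult[of S S] by (simp add: sd_def)
qed

lemma comm_group_E: "comm_group E"
proof (rule comm_groupI)
  show cl: "x \<otimes>\<^bsub>E\<^esub> y \<in> carrier E" if xy: "x \<in> carrier E" "y \<in> carrier E" for x y
  proof -
    obtain S T where S: "S \<subseteq> P" "x = \<Prod>S" "T \<subseteq> P" "y = \<Prod>T" using E_cases[OF xy(1)] E_cases[OF xy(2)] by metis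
    then show ?thesis using E_mult[OF S(1,3)] prod_sub_dvd[OF sd_sub[OF S(1,3)]] by simp
  qed
  show "\<one>\<^bsub>E\<^esub> \<in> carrier E" by simp
  show "x \<otimes>\<^bsub>E\<^esub> y \<otimes>\<^bsub>E\<^esub> z = x \<otimes>\<^bsub>E\<^esub> (y \<otimes>\<^bsub>E\<^esub> z)" if xyz: "x \<in> carrier E" "y \<in> carrier E" "z \<in> carrier E" for x y z
  proof -
    obtain S T U where S: "S \<subseteq> P" "x = \<Prod>S" "T \<subseteq> P" "y = \<Prod>T" "U \<subseteq> P" "z = \<Prod>U"
      using E_cases[OF xyz(1)] E_cases[OF xyz(2)] E_cases[OF xyz(3)] by metis
    have "sd (sd S T) U = sd S (sd T U)" by (auto simp: sd_def)
    then show ?thesis unfolding S(2,4,6)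
      by (simp only: E_mult[OF S(1,3)] E_mult[OF S(3,5)] E_mult[OF sd_sub[OF S(1,3)] S(5)] E_mult[OF S(1) sd_sub[OF S(3,5)]])
  qed
  show "x \<otimes>\<^bsub>E\<^esub> y = y \<otimes>\<^bsub>E\<^esub> x" for x y by (simp add: divisor_group_def mult.commute gcd.commute)
  show "\<one>\<^bsub>E\<^esub> \<otimes>\<^bsub>E\<^esub> x = x" if "x \<in> carrier E" for x by (simp add: divisor_group_def)
  show "\<exists>y\<in>carrier E. y \<otimes>\<^bsub>E\<^esub> x = \<one>\<^bsub>E\<^esub>" if x: "x \<in> carrier E" for x by (rule bexI[of _ x]) (rule E_sq[OF x], rule x)
qed

lemma finite_E: "finite (carrier E)" using n_pos by simp

definition "iota D = cl (ram (int D))"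

lemma ram_prod: "S \<subseteq> P \<Longrightarrow> T \<subseteq> P \<Longrightarrow> S \<inter> T = {} \<Longrightarrow>
    mul (ram (int (\<Prod>S))) (ram (int (\<Prod>T))) = ram (int (\<Prod>(S \<union> T)))"
proof -
  assume S: "S \<subseteq> P" "T \<subseteq> P" "S \<inter> T = {}"
  have "coprime (int (\<Prod>S)) (int (\<Prod>T))" using coprime_disjoint[OF S] by (simp only: coprime_int_iff)
  from mul_ram_coprime[OF this] show ?thesis unfolding prod_disjoint[OF S] of_nat_mult .
qed

text \<open>The factors common to \<open>S\<close> and \<open>T\<close> occur twice, and the square of a ramified ideal is principal.\<close>
lemma eqv_ram_mul: "S \<subseteq> P \<Longrightarrow> T \<subseteq> P \<Longrightarrow>
    eqv (ram (int (\<Prod>(sd S T)))) (mul (ram (int (\<Prod>S))) (ram (int (\<Prod>T))))"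
proof -
  assume S: "S \<subseteq> P" "T \<subseteq> P"
  let ?r = "\<lambda>S. ram (int (\<Prod>S))"
  have st: "(S \<inter> T) \<union> (S - T) = S" "(S \<inter> T) \<union> (T - S) = T" by auto
  have s: "mul (?r (S \<inter> T)) (?r (S - T)) = ?r S" using ram_prod[of "S \<inter> T" "S - T"] S unfolding st by auto
  have t: "mul (?r (S \<inter> T)) (?r (T - S)) = ?r T" using ram_prod[of "S \<inter> T" "T - S"] S unfolding st by auto
  have u: "mul (?r (S - T)) (?r (T - S)) = ?r (sd S T)" unfolding sd_def by (rule ram_prod) (use S in auto)
  have D: "\<Prod>(S \<inter> T) dvd n" by (rule prod_sub_dvd) (use S in auto)
  have ac: "mul (mul a b) (mul a c) = mul (mul a a) (mul b c)" for a b c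
  proof -
    have "mul b (mul a c) = mul a (mul b c)"
      using mul_assoc[of b a c] mul_assoc[of a b c] mul_commute[of a b] by (simp only:)
    then show ?thesis unfolding mul_assoc by (simp only:)
  qed
  have "mul (?r S) (?r T) = mul (mul (?r (S \<inter> T)) (?r (S \<inter> T))) (mul (?r (S - T)) (?r (T - S)))"
    unfolding s[symmetric] t[symmetric] by (rule ac)
  also have "\<dots> = sm (of_int (int (\<Prod>(S \<inter> T)))) (?r (sd S T))"
    unfolding u mul_ram_self[OF dvd_n_facts(3)[OF D]] by (simp only: mul_sm mul_R[OF Rmod_ram])
  finally have e: "mul (?r S) (?r T) = sm (of_int (int (\<Prod>(S \<inter> T)))) (?r (sd S T))" .
  have "(of_int (int (\<Prod>(S \<inter> T))) :: complex) \<noteq> 0"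
    unfolding of_int_of_nat_eq using dvd_n_facts(1)[OF D] by (simp only: of_nat_eq_0_iff)
  then show ?thesis unfolding e by (rule eqvI[OF K_of_int])
qed

lemma iota_hom: "iota \<in> hom E CG"
proof (rule homI)
  show "iota x \<in> carrier CG" for x by (simp add: iota_def fideal_ram)
  show "iota (x \<otimes>\<^bsub>E\<^esub> y) = iota x \<otimes>\<^bsub>CG\<^esub> iota y" if xy: "x \<in> carrier E" "y \<in> carrier E" for x y
  proof -
    obtain S T where S: "S \<subseteq> P" "x = \<Prod>S" "T \<subseteq> P" "y = \<Prod>T" using E_cases[OF xy(1)] E_cases[OF xy(2)] by metis
    show ?thesis unfolding iota_def S(2,4) E_mult[OF S(1,3)] cl_mul[OF fideal_ram fideal_ram]
      using cl_eq_iff[OF fideal_ram fideal_mul[OF fideal_ram fideal_ram]] eqv_ram_mul[OF S(1,3)] by blast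
  qed
qed

lemma iota_inj: "inj_on iota (carrier E)"
proof (rule inj_onI)
  fix x y assume xy: "x \<in> carrier E" "y \<in> carrier E" and e: "iota x = iota y"
  obtain S T where S: "S \<subseteq> P" "x = \<Prod>S" "T \<subseteq> P" "y = \<Prod>T" using E_cases[OF xy(1)] E_cases[OF xy(2)] by metis
  have ST: "sd S T \<subseteq> P" by (rule sd_sub[OF S(1,3)])
  have "iota (x \<otimes>\<^bsub>E\<^esub> y) = iota (x \<otimes>\<^bsub>E\<^esub> x)" using iota_hom xy e by (simp add: hom_def)
  then have "iota (\<Prod>(sd S T)) = iota 1" using E_mult[OF S(1,3)] E_sq[OF xy(1)] S by simp
  then have "cl (ram (int (\<Prod>(sd S T)))) = cl R" unfolding iota_def using ram_1 by simp
  then have "eqv R (ram (int (\<Prod>(sd S T))))" using cl_eq_iff[OF fideal_ram fideal_R] eqv_sym by blast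
  then have "\<Prod>(sd S T) = 1" by (rule ram_principal[OF prod_sub_dvd[OF ST]])
  then have "sd S T = {}" using prime_factors_prod_sub[OF ST] by simp
  then show "x = y" using S by (auto simp: sd_def)
qed

lemma xi_mult: "a = 1 \<or> a = -1 \<Longrightarrow> b = 1 \<or> b = -1 \<Longrightarrow> xi (a * b) = xi a + xi b"
  by (auto simp: xi_def)

text \<open>The pairing on classes, additively; any representative may be used.\<close>
definition "pr D c = xi (X D (SOME I. fideal I \<and> cl I = c))"

lemma pr_class: "D dvd n \<Longrightarrow> fideal I \<Longrightarrow> pr D (cl I) = xi (X D I)"
proof -
  assume D: "D dvd n" and I: "fideal I"
  define J where "J = (SOME J. fideal J \<and> cl J = cl I)"
  have J: "fideal J \<and> cl J = cl I" unfolding J_def by (rule someI[of _ I]) (use I in simp)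
  then have "eqv J I" using cl_eq_iff[of J I] I by simp
  then show ?thesis using X_eqv[OF D _ \<open>eqv J I\<close>] J unfolding pr_def J_def[symmetric] by simp
qed

lemma X_disjoint: "S \<subseteq> P \<Longrightarrow> T \<subseteq> P \<Longrightarrow> S \<inter> T = {} \<Longrightarrow> X (\<Prod>(S \<union> T)) I = X (\<Prod>S) I * X (\<Prod>T) I"
  unfolding X_def using prime_factors_prod_sub[of S] prime_factors_prod_sub[of T] prime_factors_prod_sub[of "S \<union> T"]
    prod.union_disjoint[OF finite_sub finite_sub, of S T] by simp

text \<open>The factors common to \<open>S\<close> and \<open>T\<close> contribute squares of signs.\<close>
lemma X_E_mult: "S \<subseteq> P \<Longrightarrow> T \<subseteq> P \<Longrightarrow> fideal I \<Longrightarrow> X (\<Prod>(sd S T)) I = X (\<Prod>S) I * X (\<Prod>T) I"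
proof -
  assume S: "S \<subseteq> P" "T \<subseteq> P" and I: "fideal I"
  have st: "(S \<inter> T) \<union> (S - T) = S" "(S \<inter> T) \<union> (T - S) = T" by auto
  have s: "X (\<Prod>S) I = X (\<Prod>(S \<inter> T)) I * X (\<Prod>(S - T)) I" using X_disjoint[of "S \<inter> T" "S - T"] S unfolding st by auto
  have t: "X (\<Prod>T) I = X (\<Prod>(S \<inter> T)) I * X (\<Prod>(T - S)) I" using X_disjoint[of "S \<inter> T" "T - S"] S unfolding st by auto
  have u: "X (\<Prod>(sd S T)) I = X (\<Prod>(S - T)) I * X (\<Prod>(T - S)) I" unfolding sd_def by (rule X_disjoint) (use S in auto)
  have "X (\<Prod>(S \<inter> T)) I = 1 \<or> X (\<Prod>(S \<inter> T)) I = -1" by (rule X_values[OF prod_sub_dvd I]) (use S in auto)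
  then show ?thesis unfolding s t u by auto
qed

lemma redei: "redei_pairing CG E iota pr"
proof -
  interpret C: comm_group CG by (rule comm_group_CG)
  interpret E: comm_group E by (rule comm_group_E)
  show ?thesis
  proof
    show "finite (carrier CG)" by (rule finite_CG)
    show "finite (carrier E)" by (rule finite_E)
    show "x \<otimes>\<^bsub>E\<^esub> x = \<one>\<^bsub>E\<^esub>" if "x \<in> carrier E" for x by (rule E_sq[OF that])
    show "iota \<in> hom E CG" by (rule iota_hom)
    show "inj_on iota (carrier E)" by (rule iota_inj)
    show "pr (x \<otimes>\<^bsub>E\<^esub> y) c = pr x c + pr y c" if xy: "x \<in> carrier E" "y \<in> carrier E" "c \<in> carrier CG" for x y c
    proof -
      obtain S T where S: "S \<subseteq> P" "x = \<Prod>S" "T \<subseteq> P" "y = \<Prod>T" using E_cases[OF xy(1)] E_cases[OF xy(2)] by metis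
      obtain I where I: "fideal I" "c = cl I" using xy(3) by (auto simp: carrier_CG)
      have D: "x dvd n" "y dvd n" using xy by auto
      have "pr (x \<otimes>\<^bsub>E\<^esub> y) c = xi (X (\<Prod>(sd S T)) I)"
        unfolding S(2,4) E_mult[OF S(1,3)] I(2) by (rule pr_class[OF prod_sub_dvd[OF sd_sub[OF S(1,3)]] I(1)])
      also have "\<dots> = xi (X x I * X y I)" unfolding X_E_mult[OF S(1,3) I(1)] S(2,4) ..
      also have "\<dots> = pr x c + pr y c" unfolding I(2) pr_class[OF D(1) I(1)] pr_class[OF D(2) I(1)]
        by (rule xi_mult[OF X_values[OF D(1) I(1)] X_values[OF D(2) I(1)]])
      finally show ?thesis .
    qed
    show "pr x (c \<otimes>\<^bsub>CG\<^esub> e) = pr x c + pr x e" if xy: "x \<in> carrier E" "c \<in> carrier CG" "e \<in> carrier CG" for x c e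
    proof -
      obtain I J where I: "fideal I" "c = cl I" "fideal J" "e = cl J" using xy(2,3) by (auto simp: carrier_CG)
      have D: "x dvd n" using xy by auto
      show ?thesis unfolding I(2,4) cl_mul[OF I(1,3)] pr_class[OF D I(1)] pr_class[OF D I(3)] pr_class[OF D fideal_mul[OF I(1,3)]]
          X_mul[OF D I(1,3)] by (rule xi_mult[OF X_values[OF D I(1)] X_values[OF D I(3)]])
    qed
    show "c \<in> powers CG 2" if c: "c \<in> carrier CG" and z: "\<And>D. D \<in> carrier E \<Longrightarrow> pr D c = 0" for c
    proof -
      obtain I where I: "fideal I" "c = cl I" using c by (auto simp: carrier_CG)
      have "chi q I = 1" if q: "q \<in> P" for q
      proof -
        have qn: "q dvd n" using prod_sub_dvd[of "{q}"] q by simp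
        have "xi (X q I) = 0" using z[of q] pr_class[OF qn I(1)] I(2) qn by simp
        moreover have "X q I = chi q I" unfolding X_def using prime_factors_prod_sub[of "{q}"] q by simp
        moreover have "chi q I = 1 \<or> chi q I = -1" using chi_values[OF _ I(1)] q by simp
        ultimately show ?thesis by (auto simp: xi_def)
      qed
      then obtain L where L: "fideal L" "eqv I (mul L L)" using principal_genus[OF I(1)] by metis
      have "c = cl L \<otimes>\<^bsub>CG\<^esub> cl L"
        unfolding I(2) cl_mul[OF L(1,1)] using cl_eq_iff[OF I(1) fideal_mul[OF L(1,1)]] L(2) by simp
      moreover have "powers CG 2 = (\<lambda>x. x \<otimes>\<^bsub>CG\<^esub> x) ` carrier CG" using C.powers_double[of 1] C.powers_0 by simp
      ultimately show ?thesis using L(1) by simp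
    qed
    show "pr x (iota y) = pr y (iota x)" if xy: "x \<in> carrier E" "y \<in> carrier E" for x y
    proof -
      have D: "x dvd n" "y dvd n" using xy by auto
      show ?thesis unfolding iota_def pr_class[OF D(1) fideal_ram] pr_class[OF D(2) fideal_ram] X_symmetric[OF D] ..
    qed
  qed
qed

sublocale RP: redei_pairing CG E iota pr by (rule redei)

lemma finprod_ramified:
  assumes D: "D dvd n" shows "finprod IG (ramified_prime QF) (prime_factors D) = ram (int D)"
proof -
  interpret comm_group IG by (rule comm_group_IG)
  have "finprod IG (ramified_prime QF) S = ram (int (\<Prod>S))" if "finite S" "S \<subseteq> P" for S
    using that
  proof (induction S rule: finite_induct)
    case empty then show ?case using ram_1 by simp
  next
    case (insert q S)
    have r: "ramified_prime QF p = ram (int p)" if "p \<in> P" for p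
      using ramified_prime_eq[of p] P(2,3) prime_1_mod_4_gt_2 S_dvd[of p] that by auto
    have "finprod IG (ramified_prime QF) (insert q S) = ramified_prime QF q \<otimes>\<^bsub>IG\<^esub> finprod IG (ramified_prime QF) S"
      by (rule finprod_insert) (use insert r fideal_ram in auto)
    then show ?case using insert r[of q] ram_prod[of "{q}" S] by simp
  qed
  from this[OF _ dvd_n_facts(4)[OF D]] show ?thesis by (simp only: prod_prime_factors_dvd[OF D]) simp
qed

lemma V0_space_eq: "V0_space \<Delta> n = F2_module E\<lparr>carrier := RP.V0\<rparr>"
proof -
  have "{D \<in> carrier (F2_module E). cl (finprod IG (ramified_prime QF) (prime_factors D)) \<in> powers CG 2} = RP.V0"
    unfolding RP.V0_def iota_def using finprod_ramified by (auto simp: F2_module_def)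
  then show ?thesis by (simp add: V0_space_def Let_def)
qed

lemma V0_simps: "carrier (V0_space \<Delta> n) = RP.V0" "x \<oplus>\<^bsub>V0_space \<Delta> n\<^esub> y = x \<otimes>\<^bsub>E\<^esub> y" "\<zero>\<^bsub>V0_space \<Delta> n\<^esub> = \<one>\<^bsub>E\<^esub>"
  "b \<odot>\<^bsub>V0_space \<Delta> n\<^esub> x = (if b = 0 then \<one>\<^bsub>E\<^esub> else x)"
  unfolding V0_space_eq by (simp_all add: F2_module_def)

lemma V0_E: "x \<in> RP.V0 \<Longrightarrow> x \<in> carrier E" by (simp add: RP.V0_def)

lemma V0_vectorspace: "vectorspace F2 (V0_space \<Delta> n)"
  unfolding vectorspace_F2_iff F2_axioms_def V0_simps
proof (intro conjI ballI)
  show "\<one>\<^bsub>E\<^esub> \<in> RP.V0" by (rule RP.V0_one)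
  show "x \<otimes>\<^bsub>E\<^esub> y \<in> RP.V0" if "x \<in> RP.V0" "y \<in> RP.V0" for x y by (rule RP.V0_mult[OF that])
  show "x \<otimes>\<^bsub>E\<^esub> y = y \<otimes>\<^bsub>E\<^esub> x" if "x \<in> RP.V0" "y \<in> RP.V0" for x y
    by (rule RP.E.m_comm[OF V0_E V0_E, OF that])
  show "x \<otimes>\<^bsub>E\<^esub> y \<otimes>\<^bsub>E\<^esub> z = x \<otimes>\<^bsub>E\<^esub> (y \<otimes>\<^bsub>E\<^esub> z)" if "x \<in> RP.V0" "y \<in> RP.V0" "z \<in> RP.V0" for x y z
    by (rule RP.E.m_assoc[OF V0_E V0_E V0_E, OF that])
  show "x \<otimes>\<^bsub>E\<^esub> \<one>\<^bsub>E\<^esub> = x" if "x \<in> RP.V0" for x by (rule RP.E.r_one[OF V0_E[OF that]])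
  show "x \<otimes>\<^bsub>E\<^esub> x = \<one>\<^bsub>E\<^esub>" if "x \<in> RP.V0" for x by (rule E_sq[OF V0_E[OF that]])
qed simp_all

lemma B_bilinear: "bilinear_form F2 (V0_space \<Delta> n) RP.B"
proof -
  have z: "b = b + b \<Longrightarrow> b = 0" for b :: bit by (cases b) auto
  have "RP.B \<one>\<^bsub>E\<^esub> x = 0" "RP.B x \<one>\<^bsub>E\<^esub> = 0" if x: "x \<in> RP.V0" for x
    using z[OF RP.B_l[OF RP.V0_one RP.V0_one x, unfolded RP.E.r_one[OF RP.E.one_closed]]]
      z[OF RP.B_r[OF RP.V0_one RP.V0_one x, unfolded RP.E.r_one[OF RP.E.one_closed]]] .
  then show ?thesis unfolding bilinear_form_def V0_simps F2_simps using RP.B_l RP.B_r by (auto simp del: E_simps)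
qed

text \<open>For \<open>D = D'\<close> the pairing is the one evaluated by \<open>X_half_quartic\<close>.\<close>
lemma Q_form_eq: "D \<in> RP.V0 \<Longrightarrow> Q_form \<Delta> D = RP.B D D"
proof -
  assume D: "D \<in> RP.V0"
  then have Dn: "D dvd n" by (simp add: RP.V0_def)
  obtain y where y: "y \<in> carrier CG" "y \<otimes>\<^bsub>CG\<^esub> y = iota D" using RP.half[OF D] by blast
  then obtain I where I: "fideal I" "y = cl I" by (auto simp: carrier_CG)
  have "cl (mul I I) = cl (ram (int D))" using y(2) unfolding I(2) cl_mul[OF I(1,1)] iota_def .
  then have "eqv (mul I I) (ram (int D))" using cl_eq_iff[OF fideal_mul[OF I(1,1)] fideal_ram] by simp
  from X_half_quartic[OF Dn I(1) this] have "Q_form \<Delta> D = pr D y"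
    unfolding I(2) pr_class[OF Dn I(1)] Q_form_def by simp
  then show ?thesis using RP.B_eq[OF D D y] by simp
qed

lemma finite_V0: "finite RP.V0" by (rule RP.fins)

text \<open>Squaring maps \<open>2C\<close> onto \<open>4C\<close> with kernel \<open>C[2] \<inter> 2C\<close>, which is \<open>V0\<close>.\<close>
lemma four_rank: "two_power_rank CG 2 = vectorspace.dim F2 (V0_space \<Delta> n)"
proof -
  have "card (powers CG 2) = 2 ^ two_power_rank CG 2 * card (powers CG 4)"
  proof -
    have e: "Suc 1 = 2" "(2::nat) ^ 1 = 2" "(2::nat) ^ 2 = 4" by simp_all
    show ?thesis using RP.C.two_power_rank_card[OF finite_CG, of 1] by (simp only: e)
  qed
  then have "card (powers CG 4) * card RP.V0 = card (powers CG 4) * 2 ^ two_power_rank CG 2"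
    using RP.card_V0 by (simp add: mult.commute)
  moreover have "card (powers CG 4) > 0" using RP.fins(2) subgroup.one_closed[OF RP.sub(2)] card_gt_0_iff by blast
  ultimately have "card RP.V0 = 2 ^ two_power_rank CG 2" by simp
  then show ?thesis using F2_dim_eq[OF V0_vectorspace] finite_V0 by (simp add: V0_simps)
qed

text \<open>The form \<open>RP.B\<close> is the bilinear form of diagonal \<open>Q\<close> whose left kernel has dimension \<open>r\<^sub>8\<close>.\<close>
lemma eight_rank: "two_power_rank CG 3 \<in> form_nullities F2 (V0_space \<Delta> n) (Q_form \<Delta>)"
proof (rule nullity_in_form_nullities[OF V0_vectorspace _ B_bilinear])
  show "finite (carrier (V0_space \<Delta> n))" using finite_V0 by (simp add: V0_simps)
  show "Q_form \<Delta> x = RP.B x x" if "x \<in> carrier (V0_space \<Delta> n)" for x using Q_form_eq that by (simp add: V0_simps)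
  have "card (powers CG 4) = 2 ^ two_power_rank CG 3 * card (powers CG 8)"
  proof -
    have e: "Suc 2 = 3" "(2::nat) ^ 2 = 4" "(2::nat) ^ 3 = 8" by simp_all
    show ?thesis using RP.C.two_power_rank_card[OF finite_CG, of 2] by (simp only: e)
  qed
  then have "card (powers CG 8) * card {D\<in>RP.V0. \<forall>D'\<in>RP.V0. RP.B D D' = 0} = card (powers CG 8) * 2 ^ two_power_rank CG 3"
    using RP.card_left_kernel by (simp add: mult.commute)
  moreover have "card (powers CG 8) > 0"
  proof -
    have s: "subgroup (powers CG 8) CG" using RP.C.powers_subgroup[of 3] by simp
    have "finite (powers CG 8)" using finite_subset[OF subgroup.subset[OF s] finite_CG] .
    then show ?thesis using subgroup.one_closed[OF s] card_gt_0_iff by blast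
  qed
  ultimately show "card {x \<in> carrier (V0_space \<Delta> n). \<forall>y\<in>carrier (V0_space \<Delta> n). RP.B x y = 0} = 2 ^ two_power_rank CG 3"
    unfolding V0_simps by simp
qed

lemma Q_form_quadratic: "quadratic_form F2 (V0_space \<Delta> n) (Q_form \<Delta>)"
  unfolding quadratic_form_def using B_bilinear Q_form_eq by (intro exI[of _ RP.B]) (simp add: V0_simps)

lemma nullities_Q_form: "form_nullities F2 (V0_space \<Delta> n) (Q_form \<Delta>) =
    S_set (V0_space \<Delta> n) (Q_form \<Delta>) (isotropy_index F2 (V0_space \<Delta> n) (Q_form \<Delta>)) (two_power_rank CG 2)"
  unfolding four_rank
  by (rule nullities_of_quadratic_form[OF V0_vectorspace _ Q_form_quadratic]) (simp add: V0_simps finite_V0)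

end

theorem theorem4p2:
  shows
    "(\<forall>(t::nat) (p::nat \<Rightarrow> nat) (\<Delta>::int) (n::nat).
        1 \<le> t \<and> (\<forall>i\<in>{1..t}. prime (p i)) \<and> inj_on p {1..t} \<and>
        (\<forall>i\<in>{1..<t}. [p i = 1] (mod 4)) \<and> [p t = 3] (mod 4) \<and>
        \<Delta> = - (\<Prod>i\<in>{1..t}. int (p i)) \<and> n = (\<Prod>i\<in>{1..<t}. p i) \<longrightarrow>
        two_power_rank (class_group (quadratic_field \<Delta>)) 3
          \<in> form_nullities F2 (V0_space \<Delta> n) (Q_form \<Delta>) \<and>
        two_power_rank (class_group (quadratic_field \<Delta>)) 2
          = vectorspace.dim F2 (V0_space \<Delta> n) \<and>
        form_nullities F2 (V0_space \<Delta> n) (Q_form \<Delta>)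
          = S_set (V0_space \<Delta> n) (Q_form \<Delta>)
              (isotropy_index F2 (V0_space \<Delta> n) (Q_form \<Delta>))
              (two_power_rank (class_group (quadratic_field \<Delta>)) 2))
     \<and>
     (\<forall>(W::(bit, 'v) module) (Q::'v \<Rightarrow> bit) (r::nat) (\<rho>::nat).
        vectorspace F2 W \<and> vectorspace.fin_dim F2 W \<and> vectorspace.dim F2 W = r \<and>
        quadratic_form F2 W Q \<and> isotropy_index F2 W Q = \<rho> \<longrightarrow>
        form_nullities F2 W Q = S_set W Q \<rho> r)"
proof (intro conjI allI impI; (elim conjE)?)
  fix t :: nat and p :: "nat \<Rightarrow> nat" and \<Delta> :: int and n :: nat
  assume t: "1 \<le> t" and pr: "\<forall>i\<in>{1..t}. prime (p i)" and inj: "inj_on p {1..t}"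
    and p1: "\<forall>i\<in>{1..<t}. [p i = 1] (mod 4)" and p3: "[p t = 3] (mod 4)"
    and \<Delta>: "\<Delta> = - (\<Prod>i\<in>{1..t}. int (p i))" and n: "n = (\<Prod>i\<in>{1..<t}. p i)"
  have ins: "{1..t} = insert t {1..<t}" using t by auto
  interpret G: genus_field "p ` {1..<t}" "p t"
    by standard (use t pr p1 p3 in auto)
  have n': "G.n = n" unfolding G.n_def n
    by (subst prod.reindex) (auto intro: inj_on_subset[OF inj])
  have im: "insert (p t) (p ` {1..<t}) = p ` {1..t}" unfolding ins by simp
  have d: "G.\<Delta> = \<Delta>" unfolding G.\<Delta>_def \<Delta> im prod.reindex[OF inj] comp_def ..
  show "two_power_rank (class_group (quadratic_field \<Delta>)) 3 \<in> form_nullities F2 (V0_space \<Delta> n) (Q_form \<Delta>)"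
    using G.eight_rank unfolding n' d .
  show "two_power_rank (class_group (quadratic_field \<Delta>)) 2 = vectorspace.dim F2 (V0_space \<Delta> n)"
    using G.four_rank unfolding n' d .
  show "form_nullities F2 (V0_space \<Delta> n) (Q_form \<Delta>)
      = S_set (V0_space \<Delta> n) (Q_form \<Delta>) (isotropy_index F2 (V0_space \<Delta> n) (Q_form \<Delta>))
          (two_power_rank (class_group (quadratic_field \<Delta>)) 2)"
    using G.nullities_Q_form unfolding n' d .
next
  fix W :: "(bit, 'v) module" and Q :: "'v \<Rightarrow> bit" and r \<rho> :: nat
  assume W: "vectorspace F2 W" "vectorspace.fin_dim F2 W" and dim: "vectorspace.dim F2 W = r"
    and Q: "quadratic_form F2 W Q" and rho: "isotropy_index F2 W Q = \<rho>"
  have "finite (carrier W)" using F2_coordinates[OF W] by metis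
  from nullities_of_quadratic_form[OF W(1) this Q]
  show "form_nullities F2 W Q = S_set W Q \<rho> r" unfolding dim rho .
qed

end
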